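(* Let $m\ge0$ and let $\mathcal{Z}_1,\mathcal{Z}_2\in C^\infty_{c,m}$ satisfy $$\det\begin{pmatrix}(\Lambda Q,\mathcal{Z}_1)_r&(iQ,\mathcal{Z}_1)_r\\(\Lambda Q,\mathcal{Z}_2)_r&(iQ,\mathcal{Z}_2)_r\end{pmatrix}\ne0.$$ For any $M>0$, there exists $\eta>0$ such that the nonlinear coercivity $$E[Q+\epsilon]\sim_M\|\epsilon\|_{\dot{\mathcal{H}}^1_m}^2$$ holds for any $\epsilon\in H^1_m$ with $\|\epsilon\|_{L^2}\le M$ satisfying the orthogonality conditions $(\epsilon,\mathcal{Z}_1)_r=(\epsilon,\mathcal{Z}_2)_r=0$ and the smallness $\|\epsilon\|_{\dot{\mathcal{H}}^1_m}\le\eta$.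
   Context: Functions are radial parts $u=u(r)$, $r\in(0,\infty)$, of $m$-equivariant functions $u(r)e^{im\theta}$ on $\mathbb{R}^2$; $\int f=2\pi\int_0^\infty f(r)\,r\,dr$; $L^p$ norms are with respect to this measure; $(f,g)_r=\int\mathrm{Re}(\overline fg)$. $H^1_m,\dot H^1_m$ are the usual Sobolev spaces on $\mathbb{R}^2$ restricted to $m$-equivariant functions, so $\|f\|_{\dot H^1_m}^2=\|\partial_rf\|_{L^2}^2+m^2\|r^{-1}f\|_{L^2}^2$. $C^\infty_{c,m}$ denotes (radial parts of) smooth compactly supported $m$-equivariant functions. $\dot{\mathcal{H}}^1_m:=\dot H^1_m$ for $m\ge1$, and $\dot{\mathcal{H}}^1_0$ is defined by the norm $\|f\|_{\dot{\mathcal{H}}^1_0}=\|\partial_rf\|_{L^2}+\|\langle\log_-r\rangle^{-1}r^{-1}f\|_{L^2}$, where $\log_-r=\max\{-\log r,0\}$, $\langle x\rangle=(1+|x|^2)^{1/2}$. Energy: $E[u]=\int\frac12|\partial_ru|^2+\frac12\big(\frac{m+A_\theta[u]}{r}\big)^2|u|^2-\frac14|u|^4=\frac12\int|\mathbf{D}_uu|^2$, with $A_\theta[u](r)=-\frac12\int_0^r|u|^2r'dr'$ and $\mathbf{D}_uf=\partial_rf-\frac{m+A_\theta[u]}{r}f$. $Q(r)=\sqrt8(m+1)\frac{r^m}{1+r^{2m+2}}$, $\Lambda=r\partial_r+1$. $A\sim_MB$ means two-sided bounds with constants depending only on $M$ (dependence on $m$ and on the fixed profiles $\mathcal{Z}_1,\mathcal{Z}_2$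 allowed). *)

theory Defs
  imports "HOL-Analysis.Analysis"
begin

section \<open>Weak derivatives\<close>

primrec Ck :: "nat \<Rightarrow> ('a::real_normed_vector \<Rightarrow> 'b::real_normed_vector) \<Rightarrow> bool" where
  "Ck 0 f \<longleftrightarrow> continuous_on UNIV f"
| "Ck (Suc k) f \<longleftrightarrow> f differentiable_on UNIV \<and>
     (\<forall>v. Ck k (\<lambda>x. frechet_derivative f (at x) v))"

definition Cc_infinity :: "'a::real_normed_vector set \<Rightarrow> ('a \<Rightarrow> 'b::real_normed_vector) set" where
  "Cc_infinity S = {\<phi>. (\<forall>k. Ck k \<phi>) \<and>
     compact (closure {x. \<phi> x \<noteq> 0}) \<and> closure {x. \<phi> x \<noteq> 0} \<subseteq> S}"

definition locally_integrable ::
    "'a::euclidean_space set \<Rightarrow> ('a \<Rightarrow> 'b::euclidean_space) \<Rightarrow> bool" where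
  "locally_integrable S f \<longleftrightarrow> (\<forall>K. compact K \<and> K \<subseteq> S \<longrightarrow> set_integrable lborel K f)"

text \<open>\<open>g\<close> is the weak (distributional) derivative of \<open>f\<close> on the open set \<open>S\<close> in direction \<open>e\<close>.\<close>
definition has_weak_derivative ::
    "('a::euclidean_space \<Rightarrow> 'b::euclidean_space) \<Rightarrow> ('a \<Rightarrow> 'b) \<Rightarrow> 'a \<Rightarrow> 'a set \<Rightarrow> bool" where
  "has_weak_derivative f g e S \<longleftrightarrow>
     locally_integrable S f \<and> locally_integrable S g \<and>
     (\<forall>\<phi> \<in> (Cc_infinity S :: ('a \<Rightarrow> real) set).
        (LINT x:S|lborel. frechet_derivative \<phi> (at x) e *\<^sub>R f x) =
        - (LINT x:S|lborel. \<phi> x *\<^sub>R g x))"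

definition L2_space :: "('a::euclidean_space \<Rightarrow> 'b::euclidean_space) set" where
  "L2_space = {f. f \<in> borel_measurable lborel \<and> integrable lborel (\<lambda>x. (norm (f x))\<^sup>2)}"

definition H1_space :: "('a::euclidean_space \<Rightarrow> 'b::euclidean_space) set" where
  "H1_space = {f \<in> L2_space. \<forall>e\<in>Basis. \<exists>g\<in>L2_space. has_weak_derivative f g e UNIV}"

section \<open>Equivariant functions and their radial parts\<close>

text \<open>
  The plane is identified with \<^typ>\<open>complex\<close>, so that \<open>sgn z ^ m\<close> is \<open>e\<^sup>i\<^sup>m\<^sup>\<theta>\<close> for
  \<open>z = r e\<^sup>i\<^sup>\<theta>\<close>, \<open>r > 0\<close>. Radial parts are functions of type \<^typ>\<open>real \<Rightarrow> complex\<close> of which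
  only the values on \<open>(0,\<infinity>)\<close> matter.
\<close>
definition equivariant :: "nat \<Rightarrow> (real \<Rightarrow> complex) \<Rightarrow> complex \<Rightarrow> complex" where
  "equivariant m u z = u (cmod z) * sgn z ^ m"

definition H1m :: "nat \<Rightarrow> (real \<Rightarrow> complex) set" where
  "H1m m = {u. equivariant m u \<in> H1_space}"

text \<open>The value at the origin is not determined by the radial part on \<open>(0,\<infinity>)\<close>.\<close>
definition Cc_infinity_m :: "nat \<Rightarrow> (real \<Rightarrow> complex) set" where
  "Cc_infinity_m m = {Z. \<exists>F \<in> Cc_infinity UNIV. \<forall>z. z \<noteq> 0 \<longrightarrow> F z = equivariant m Z z}"

text \<open>
  The weak derivative in \<open>r\<close> on \<open>(0,\<infinity>)\<close>. It is unique up to null sets, and it is only used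
  under integrals; it exists for the radial part of every function in \<open>H\<^sup>1\<close> and agrees a.e. with
  the classical derivative for continuously differentiable functions.
\<close>
definition d_r :: "(real \<Rightarrow> complex) \<Rightarrow> real \<Rightarrow> complex" where
  "d_r u = (SOME v. has_weak_derivative u v 1 {0<..})"

text \<open>Integral of a radial function over the plane.\<close>
definition rint :: "(real \<Rightarrow> real) \<Rightarrow> real" where
  "rint f = 2 * pi * (LINT r:{0<..}|lborel. f r * r)"

definition inner_r :: "(real \<Rightarrow> complex) \<Rightarrow> (real \<Rightarrow> complex) \<Rightarrow> real" where
  "inner_r f g = rint (\<lambda>r. Re (cnj (f r) * g r))"

text \<open>This and the following norms are only used on \<^term>\<open>H1m m\<close>, where the integrals are finite.\<close>
definition L2_norm :: "(real \<Rightarrow> complex) \<Rightarrow> real" where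
  "L2_norm f = sqrt (rint (\<lambda>r. (cmod (f r))\<^sup>2))"

definition Hdot1m_norm :: "nat \<Rightarrow> (real \<Rightarrow> complex) \<Rightarrow> real" where
  "Hdot1m_norm m f =
     sqrt ((L2_norm (d_r f))\<^sup>2 + (real m)\<^sup>2 * (L2_norm (\<lambda>r. f r / of_real r))\<^sup>2)"

definition jbracket :: "real \<Rightarrow> real" where
  "jbracket x = sqrt (1 + \<bar>x\<bar>\<^sup>2)"

definition log_minus :: "real \<Rightarrow> real" where
  "log_minus r = max (- ln r) 0"

text \<open>The norm of the modified space (calligraphic H), which differs from the usual one if \<open>m = 0\<close>.\<close>
definition calHdot1m_norm :: "nat \<Rightarrow> (real \<Rightarrow> complex) \<Rightarrow> real" where
  "calHdot1m_norm m f =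
     (if m = 0
      then L2_norm (d_r f) + L2_norm (\<lambda>r. f r / of_real (jbracket (log_minus r) * r))
      else Hdot1m_norm m f)"

section \<open>Energy and soliton\<close>

definition A_theta :: "(real \<Rightarrow> complex) \<Rightarrow> real \<Rightarrow> real" where
  "A_theta u r = - (1/2) * (LINT s:{0<..<r}|lborel. (cmod (u s))\<^sup>2 * s)"

definition energy :: "nat \<Rightarrow> (real \<Rightarrow> complex) \<Rightarrow> real" where
  "energy m u = rint (\<lambda>r. 1/2 * (cmod (d_r u r))\<^sup>2
      + 1/2 * ((real m + A_theta u r) / r)\<^sup>2 * (cmod (u r))\<^sup>2
      - 1/4 * (cmod (u r)) ^ 4)"

definition Q :: "nat \<Rightarrow> real \<Rightarrow> complex" where
  "Q m r = of_real (sqrt 8 * (real m + 1) * (r ^ m / (1 + r ^ (2 * m + 2))))"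

definition Lambda :: "(real \<Rightarrow> complex) \<Rightarrow> real \<Rightarrow> complex" where
  "Lambda f r = of_real r * d_r f r + f r"

end

theory Submission
  imports Defs "HOL-Computational_Algebra.Polynomial"
begin

text \<open>
  Write \<open>u = Q + e\<close>. Integrating by parts, \<open>E[u]\<close> is half the square of the \<open>L^2\<close> norm of
  \<open>D_u u\<close> (Bogomolny), and \<open>D_Q Q = 0\<close>. Hence \<open>D_u u\<close> is a first-order expression in \<open>e\<close> with linear part
  \<open>e' - (k/r) e + (Q/r) y\<close>, where \<open>k = m + A_theta[Q]\<close> and \<open>y' = r Q Re e\<close>, \<open>y(0) = 0\<close>, whose kernel is
  spanned by \<open>Lambda Q\<close> and \<open>iQ\<close>.

  On a bounded interval, \<open>e\<close> is controlled by the linear part as soon as \<open>e\<close> vanishes at one small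
  radius: by Hardy's inequality towards the origin and by Gronwall's inequality away from it. The
  two orthogonality conditions replace the vanishing, and the quadratic remainder is absorbed by
  smallness. For large radii the nonlocal term is only bounded in terms of \<open>M\<close>, so one does not linearize;
  instead \<open>m + A_theta[u]\<close> is below \<open>-1\<close> there, and testing \<open>D_u u\<close> against \<open>e\<close> bounds the tail by
  \<open>D_u u\<close> and the boundary values.
\<close>

text \<open>The mass bound \<open>M\<close> is arbitrary, so beyond a large radius the quadratic
  part \<open>zf\<close> of the potential is no perturbation. It enters \<open>m + A_theta\<close>
  with a negative sign, however, which only helps there; just the cross term \<open>yf\<close> has
  to be small. Its increment beyond \<open>R\<close> is at most of order \<open>sqrt (M / R)\<close>
  by the decay of \<open>Q\<close>, and this dictates \<open>R\<close> in terms of \<open>M\<close>.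
  Its value at \<open>R\<close>, like the quadratic remainder inside, is made small by choosing
  \<open>\<eta>\<close> after \<open>R\<close>. Constants are constructed directly, without a
  compactness or spectral argument. For \<open>m = 0\<close> the plain Hardy inequality fails at the
  origin; only the logarithmic weight is available, and it suffices because \<open>m - k\<close> and
  the variation of \<open>A_theta\<close> vanish at \<open>0\<close>. Much of the development is
  regularity: \<open>H1m\<close> and \<open>d_r\<close> rest on weak derivatives, while boundary
  values and Gronwall need an absolutely continuous representative \<open>e\<close> with derivative
  \<open>v\<close>. The boundary terms of the Bogomolny identity are shown to vanish only along
  sequences tending to \<open>0\<close> and to infinity.\<close>

abbreviation si :: "real set \<Rightarrow> (real \<Rightarrow> 'a::{banach, second_countable_topology}) \<Rightarrow> bool" where
  "si \<equiv> set_integrable lborel"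

abbreviation nsq :: "complex \<Rightarrow> real" where
  "nsq z \<equiv> (cmod z)\<^sup>2"

abbreviation bm :: "('a::topological_space \<Rightarrow> 'b::topological_space) set" where
  "bm \<equiv> borel_measurable borel"

section \<open>Smooth functions\<close>

definition smooth :: "('a::real_normed_vector \<Rightarrow> 'b::real_normed_vector) \<Rightarrow> bool" where
  "smooth f \<longleftrightarrow> (\<forall>k. Ck k f)"

text \<open>Induction on the order of differentiation shows that a set of functions stable under
  directional derivatives consists of smooth functions. Each closure property below then reduces to
  exhibiting such a set, with a single differentiation to compute.\<close>

lemma smooth_coinduct:
  assumes "f \<in> S"
    and step: "\<And>g. g \<in> S \<Longrightarrow> \<exists>g'. (\<forall>x. (g has_derivative g' x) (at x)) \<and> (\<forall>v. (\<lambda>x. g' x v) \<in> S)"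
  shows "smooth f"
proof -
  have "Ck k f" if "f \<in> S" for k f
    using that
  proof (induction k arbitrary: f)
    case 0
    obtain g' where g': "\<And>x. (f has_derivative g' x) (at x)"
      using step[OF 0] by blast
    have "continuous_on UNIV f"
      using has_derivative_continuous[OF g'] by (simp add: continuous_on_eq_continuous_at)
    then show ?case by simp
  next
    case (Suc k)
    obtain g' where g': "\<And>x. (f has_derivative g' x) (at x)" "\<And>v. (\<lambda>x. g' x v) \<in> S"
      using step[OF Suc.prems] by blast
    have "frechet_derivative f (at x) = g' x" for x
      using frechet_derivative_at[OF g'(1)] by simp
    moreover have "f differentiable_on UNIV"
      unfolding differentiable_on_def differentiable_def using g'(1) by blast
    ultimately show ?case
      using Suc.IH[OF g'(2)] by simp
  qed
  with assms(1) show ?thesis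
    by (auto simp: smooth_def)
qed

lemma smooth_derivative:
  assumes "smooth f"
  obtains f' where "\<And>x. (f has_derivative f' x) (at x)" "\<And>v. smooth (\<lambda>x. f' x v)"
proof
  have "Ck (Suc k) f" for k
    using assms by (auto simp: smooth_def)
  then show "\<And>v. smooth (\<lambda>x. frechet_derivative f (at x) v)"
    by (auto simp: smooth_def)
  have "f differentiable (at x)" for x
    using \<open>Ck (Suc 0) f\<close> by (auto simp: differentiable_on_def)
  then show "\<And>x. (f has_derivative frechet_derivative f (at x)) (at x)"
    by (simp add: frechet_derivative_works)
qed

lemma smooth_frechet: "smooth f \<Longrightarrow> smooth (\<lambda>x. frechet_derivative f (at x) v)"
  unfolding smooth_def using Ck.simps(2) by blast

lemma smooth_real_derivative:
  fixes f :: "real \<Rightarrow> real"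
  assumes "smooth f"
  obtains f' where "\<And>x. (f has_real_derivative f' x) (at x)" "smooth f'"
    "\<And>x v. frechet_derivative f (at x) v = f' x * v"
proof -
  obtain f' where f': "\<And>x. (f has_derivative f' x) (at x)" "\<And>v. smooth (\<lambda>x. f' x v)"
    using smooth_derivative[OF assms] by blast
  have eq: "f' x = (\<lambda>v. f' x 1 * v)" for x
  proof
    have "linear (f' x)"
      using f'(1) has_derivative_linear by blast
    then show "f' x v = f' x 1 * v" for v
      using linear_cmul[of "f' x" v 1] by simp
  qed
  show ?thesis
  proof (rule that[of "\<lambda>x. f' x 1"])
    show "\<And>x. (f has_real_derivative f' x 1) (at x)"
      unfolding has_field_derivative_def eq[symmetric] by (rule f'(1))
    show "\<And>x v. frechet_derivative f (at x) v = f' x 1 * v"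
      using frechet_derivative_at[OF f'(1)] eq by metis
  qed (use f' in auto)
qed

lemma smooth_continuous: "smooth f \<Longrightarrow> continuous_on S f"
  using continuous_on_subset[of UNIV f S] Ck.simps(1)[of f] unfolding smooth_def by blast

lemma smooth_const [simp]: "smooth (\<lambda>x. c)"
  by (rule smooth_coinduct[where S = "range (\<lambda>c x. c)"]) (auto intro!: exI[of _ "\<lambda>_ _. 0"])

lemma smooth_bounded_linear: "bounded_linear h \<Longrightarrow> smooth h"
proof (rule smooth_coinduct[where S = "insert h (range (\<lambda>c x. c))"])
  fix g assume h: "bounded_linear h" and g: "g \<in> insert h (range (\<lambda>c x. c))"
  show "\<exists>g'. (\<forall>x. (g has_derivative g' x) (at x)) \<and> (\<forall>v. (\<lambda>x. g' x v) \<in> insert h (range (\<lambda>c x. c)))"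
  proof (cases "g = h")
    case True
    then show ?thesis
      using h by (intro exI[of _ "\<lambda>_. h"]) (auto intro: bounded_linear_imp_has_derivative)
  next
    case False
    then show ?thesis
      using g by (intro exI[of _ "\<lambda>_ _. 0"]) auto
  qed
qed simp

lemma smooth_bounded_linear_comp:
  fixes f :: "'a::real_normed_vector \<Rightarrow> 'b::real_normed_vector" and h :: "'b \<Rightarrow> 'c::real_normed_vector"
  assumes "bounded_linear h" "smooth f"
  shows "smooth (\<lambda>x. h (f x))"
proof (rule smooth_coinduct[where S = "{(\<lambda>x. h (f x)) |f. smooth f}"])
  fix g :: "'a \<Rightarrow> 'c" assume "g \<in> {(\<lambda>x. h (f x)) |f. smooth f}"
  then obtain f where f: "g = (\<lambda>x. h (f x))" "smooth f" by blast
  obtain f' where f': "\<And>x. (f has_derivative f' x) (at x)" "\<And>v. smooth (\<lambda>x. f' x v)"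
    using smooth_derivative[OF f(2)] by blast
  show "\<exists>g'. (\<forall>x. (g has_derivative g' x) (at x)) \<and> (\<forall>v. (\<lambda>x. g' x v) \<in> {(\<lambda>x. h (f x)) |f. smooth f})"
    unfolding f(1)
  proof (intro exI[of _ "\<lambda>x v. h (f' x v)"] conjI allI)
    show "(\<lambda>x. h (f' x v)) \<in> {(\<lambda>x. h (f x)) |f. smooth f}" for v
      by (intro CollectI exI[of _ "\<lambda>x. f' x v"] conjI refl f')
  qed (rule bounded_linear.has_derivative[OF assms(1) f'(1)])
qed (use assms in auto)

lemma smooth_add:
  fixes f g :: "'a::real_normed_vector \<Rightarrow> 'b::real_normed_vector"
  assumes "smooth f" "smooth g"
  shows "smooth (\<lambda>x. f x + g x)"
proof (rule smooth_coinduct[where S = "{(\<lambda>x. f x + g x) |f g. smooth f \<and> smooth g}"])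
  fix h :: "'a \<Rightarrow> 'b" assume "h \<in> {(\<lambda>x. f x + g x) |f g. smooth f \<and> smooth g}"
  then obtain f g where h: "h = (\<lambda>x. f x + g x)" "smooth f" "smooth g" by blast
  obtain f' where f': "\<And>x. (f has_derivative f' x) (at x)" "\<And>v. smooth (\<lambda>x. f' x v)"
    using smooth_derivative[OF h(2)] by blast
  obtain g' where g': "\<And>x. (g has_derivative g' x) (at x)" "\<And>v. smooth (\<lambda>x. g' x v)"
    using smooth_derivative[OF h(3)] by blast
  show "\<exists>g'. (\<forall>x. (h has_derivative g' x) (at x)) \<and> (\<forall>v. (\<lambda>x. g' x v) \<in> {(\<lambda>x. f x + g x) |f g. smooth f \<and> smooth g})"
    unfolding h(1)
  proof (intro exI[of _ "\<lambda>x v. f' x v + g' x v"] conjI allI)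
    show "((\<lambda>x. f x + g x) has_derivative (\<lambda>v. f' x v + g' x v)) (at x)" for x
      by (intro has_derivative_add f' g')
    show "(\<lambda>x. f' x v + g' x v) \<in> {(\<lambda>x. f x + g x) |f g. smooth f \<and> smooth g}" for v
      by (intro CollectI exI[of _ "\<lambda>x. f' x v"] exI[of _ "\<lambda>x. g' x v"] conjI refl f' g')
  qed
qed (use assms in auto)

text \<open>Differentiating a product gives a sum of two products, so products alone are not stable
  under differentiation; closing them under addition gives an invariant set for
  \<open>smooth_coinduct\<close>.\<close>

inductive_set product_sums :: "('a::real_normed_vector \<Rightarrow> 'b::real_normed_algebra) set" where
  prod: "smooth f \<Longrightarrow> smooth g \<Longrightarrow> (\<lambda>x. f x * g x) \<in> product_sums"
| add: "f \<in> product_sums \<Longrightarrow> g \<in> product_sums \<Longrightarrow> (\<lambda>x. f x + g x) \<in> product_sums"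

lemma smooth_mult:
  fixes f g :: "'a::real_normed_vector \<Rightarrow> 'b::real_normed_algebra"
  assumes "smooth f" "smooth g"
  shows "smooth (\<lambda>x. f x * g x)"
proof (rule smooth_coinduct[where S = product_sums])
  show "\<exists>g'. (\<forall>x. (h has_derivative g' x) (at x)) \<and> (\<forall>v. (\<lambda>x. g' x v) \<in> product_sums)"
    if "h \<in> product_sums" for h :: "'a \<Rightarrow> 'b"
    using that
  proof induction
    case (prod f g)
    obtain f' where f': "\<And>x. (f has_derivative f' x) (at x)" "\<And>v. smooth (\<lambda>x. f' x v)"
      using smooth_derivative[OF prod(1)] by blast
    obtain g' where g': "\<And>x. (g has_derivative g' x) (at x)" "\<And>v. smooth (\<lambda>x. g' x v)"
      using smooth_derivative[OF prod(2)] by blast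
    show ?case
      by (intro exI[of _ "\<lambda>x v. f x * g' x v + f' x v * g x"] conjI allI has_derivative_mult
          product_sums.intros f' g' prod)
  next
    case (add f g)
    obtain f' where f': "\<forall>x. (f has_derivative f' x) (at x)" "\<forall>v. (\<lambda>x. f' x v) \<in> product_sums"
      using add.IH(1) by (elim exE conjE)
    obtain g' where g': "\<forall>x. (g has_derivative g' x) (at x)" "\<forall>v. (\<lambda>x. g' x v) \<in> product_sums"
      using add.IH(2) by (elim exE conjE)
    show ?case
      by (intro exI[of _ "\<lambda>x v. f' x v + g' x v"] conjI allI has_derivative_add product_sums.add
          f'[rule_format] g'[rule_format])
  qed
qed (rule product_sums.prod[OF assms])

lemma smooth_power: "smooth f \<Longrightarrow> smooth (\<lambda>x. f x ^ n)"
  for f :: "'a::real_normed_vector \<Rightarrow> 'b::real_normed_algebra_1"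
  by (induction n) (auto intro: smooth_mult)

lemma smooth_affine:
  fixes f :: "real \<Rightarrow> real"
  assumes "smooth f"
  shows "smooth (\<lambda>x. f (c * x + d))"
\<comment> \<open>The scalar \<open>a\<close> absorbs the inner derivative \<open>c\<close> and the
  direction \<open>v\<close>, both of which appear on differentiating.\<close>
proof (rule smooth_coinduct[where S = "{h. \<exists>f a. smooth f \<and> (\<forall>x. h x = (a * f (c * x + d) :: real))}"])
  fix h :: "real \<Rightarrow> real" assume "h \<in> {h. \<exists>f a. smooth f \<and> (\<forall>x. h x = (a * f (c * x + d) :: real))}"
  then obtain f a where f: "smooth f" and "\<forall>x. h x = (a * f (c * x + d) :: real)"
    by blast
  then have h: "h = (\<lambda>x. a * f (c * x + d))" by (simp add: fun_eq_iff)
  obtain f' where f': "\<And>x. (f has_real_derivative f' x) (at x)" "smooth f'"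
    using smooth_real_derivative[OF f] by metis
  have *: "(h has_real_derivative a * (f' (c * x + d) * c)) (at x)" for x
  proof -
    have "((\<lambda>x. c * x + d) has_real_derivative c) (at x)"
      by (auto intro!: derivative_eq_intros)
    from DERIV_cmult[OF DERIV_chain2[OF f'(1) this]] show ?thesis
      unfolding h .
  qed
  have "(\<lambda>x. a * (f' (c * x + d) * c) * v) \<in> {h. \<exists>f a. smooth f \<and> (\<forall>x. h x = (a * f (c * x + d) :: real))}" for v
    by (intro CollectI exI[of _ f'] exI[of _ "a * c * v"]) (simp add: f'(2))
  with * show "\<exists>g'. (\<forall>x. (h has_derivative g' x) (at x)) \<and>
      (\<forall>v. (\<lambda>x. g' x v) \<in> {h. \<exists>f a. smooth f \<and> (\<forall>x. h x = (a * f (c * x + d) :: real))})"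
    unfolding has_field_derivative_def
    by (intro exI[of _ "\<lambda>x v. a * (f' (c * x + d) * c) * v"] conjI allI)
next
  show "(\<lambda>x. f (c * x + d)) \<in> {h. \<exists>f a. smooth f \<and> (\<forall>x. h x = (a * f (c * x + d) :: real))}"
    using assms by (intro CollectI exI[of _ f] exI[of _ 1]) simp
qed

section \<open>Functions that vanish to infinite order at the origin\<close>

definition flat_exp :: "real poly \<Rightarrow> real \<Rightarrow> real" where
  "flat_exp p x = (if x > 0 then poly p (1/x) * exp (- 1/x) else 0)"

lemma poly_div_exp_tendsto_0: "((\<lambda>t::real. poly p t / exp t) \<longlongrightarrow> 0) at_top"
  unfolding poly_altdef sum_divide_distrib
proof (intro tendsto_null_sum)
  fix i
  show "((\<lambda>t::real. coeff p i * t ^ i / exp t) \<longlongrightarrow> 0) at_top"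
    using tendsto_mult_right_zero[OF tendsto_power_div_exp_0[of i], of "coeff p i"] by simp
qed

text \<open>With \<open>t = 1/x\<close> the chain rule turns \<open>p(t) exp(-t)\<close> into
  \<open>t^2 (p(t) - p'(t)) exp(-t)\<close>, so the family is stable under differentiation. At the
  origin the difference quotient from the right is \<open>t p(t) exp(-t)\<close> with
  \<open>t\<close> tending to infinity.\<close>

lemma flat_exp_deriv:
  "(flat_exp p has_real_derivative flat_exp ([:0,0,1:] * (p - pderiv p)) x) (at x)"
proof -
  consider "x > 0" | "x < 0" | "x = 0" by linarith
  then show ?thesis
  proof cases
    case 1
    have "((\<lambda>x. poly p (1/x) * exp (- 1/x)) has_real_derivative
        (poly (pderiv p) (1/x) * (- 1 / x^2)) * exp (-1/x) + (exp (-1/x) * (1 / x^2)) * poly p (1/x)) (at x)"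
    proof (rule DERIV_mult)
      have d: "((\<lambda>x. 1/x) has_real_derivative - 1 / x^2) (at x)" "((\<lambda>x. - 1/x) has_real_derivative 1 / x^2) (at x)"
        using 1 by (auto intro!: derivative_eq_intros simp: power2_eq_square)
      show "((\<lambda>x. poly p (1/x)) has_real_derivative poly (pderiv p) (1/x) * (- 1 / x^2)) (at x)"
        by (rule DERIV_chain2[OF poly_DERIV d(1)])
      show "((\<lambda>x. exp (-1/x)) has_real_derivative exp (-1/x) * (1 / x^2)) (at x)"
        by (rule DERIV_chain2[OF DERIV_exp d(2)])
    qed
    also have "(poly (pderiv p) (1/x) * (- 1 / x^2)) * exp (-1/x) + (exp (-1/x) * (1 / x^2)) * poly p (1/x) =
        flat_exp ([:0,0,1:] * (p - pderiv p)) x"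
      using 1 by (simp add: flat_exp_def field_simps power2_eq_square)
    finally show ?thesis
      by (rule has_field_derivative_transform_within_open[where S = "{0<..}"])
        (use 1 in \<open>auto simp: flat_exp_def\<close>)
  next
    case 2
    have "((\<lambda>x. 0) has_real_derivative flat_exp ([:0,0,1:] * (p - pderiv p)) x) (at x)"
      using 2 by (auto simp: flat_exp_def)
    then show ?thesis
      by (rule has_field_derivative_transform_within_open[where S = "{..<0}"])
        (use 2 in \<open>auto simp: flat_exp_def\<close>)
  next
    case 3
    have "((\<lambda>h. flat_exp p h / h) \<longlongrightarrow> 0) (at 0)"
    proof (rule filterlim_split_at)
      show "((\<lambda>h. flat_exp p h / h) \<longlongrightarrow> 0) (at_left 0)"
        by (rule tendsto_eventually) (auto simp: flat_exp_def eventually_at_left_field intro: exI[of _ "-1"])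
      have "((\<lambda>h. poly ([:0,1:] * p) (inverse h) / exp (inverse h)) \<longlongrightarrow> 0) (at_right 0)"
        by (rule filterlim_compose[OF poly_div_exp_tendsto_0 filterlim_inverse_at_top_right])
      then show "((\<lambda>h. flat_exp p h / h) \<longlongrightarrow> 0) (at_right 0)"
        by (rule Lim_transform_eventually)
          (auto simp: flat_exp_def eventually_at_right_field exp_minus divide_simps intro!: exI[of _ 1])
    qed
    then show ?thesis
      using 3 by (simp add: DERIV_def flat_exp_def)
  qed
qed

lemma smooth_flat_exp: "smooth (flat_exp p)"
proof (rule smooth_coinduct[where S = "{h. \<exists>p c. \<forall>x. h x = c * flat_exp p x}"])
  fix g assume "g \<in> {h. \<exists>p c. \<forall>x. h x = c * flat_exp p x}"
  then obtain p c where "\<forall>x. g x = c * flat_exp p x" by blast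
  then have g: "g = (\<lambda>x. c * flat_exp p x)" by (simp add: fun_eq_iff)
  let ?p = "[:0,0,1:] * (p - pderiv p)"
  have "(g has_real_derivative c * flat_exp ?p x) (at x)" for x
    unfolding g using DERIV_cmult[OF flat_exp_deriv] .
  moreover have "(\<lambda>x. c * flat_exp ?p x * v) \<in> {h. \<exists>p c. \<forall>x. h x = c * flat_exp p x}" for v
    by (intro CollectI exI[of _ ?p] exI[of _ "c * v"]) (simp add: mult_ac)
  ultimately show "\<exists>g'. (\<forall>x. (g has_derivative g' x) (at x)) \<and>
      (\<forall>v. (\<lambda>x. g' x v) \<in> {h. \<exists>p c. \<forall>x. h x = c * flat_exp p x})"
    unfolding has_field_derivative_def
    by (intro exI[of _ "\<lambda>x v. c * flat_exp ?p x * v"] conjI allI)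
next
  show "flat_exp p \<in> {h. \<exists>p c. \<forall>x. h x = c * flat_exp p x}"
    by (intro CollectI exI[of _ p] exI[of _ 1]) simp
qed

lemma flat_exp_1: "flat_exp 1 x = (if x > 0 then exp (- 1/x) else 0)"
  by (simp add: flat_exp_def)

section \<open>Test functions on the half line\<close>

definition test_fun :: "(real \<Rightarrow> real) \<Rightarrow> bool" where
  "test_fun \<xi> \<longleftrightarrow> smooth \<xi> \<and> (\<exists>a b. 0 < a \<and> a < b \<and> (\<forall>x. x \<notin> {a..b} \<longrightarrow> \<xi> x = 0))"

lemma test_fun_Cc_infinity: "test_fun \<xi> \<longleftrightarrow> \<xi> \<in> Cc_infinity {0<..}"
proof
  assume "test_fun \<xi>"
  then obtain a b where ab: "smooth \<xi>" "0 < a" "a < b" "\<And>x. x \<notin> {a..b} \<Longrightarrow> \<xi> x = 0"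
    unfolding test_fun_def by blast
  have "closure {x. \<xi> x \<noteq> 0} \<subseteq> {a..b}"
    using ab(4) by (intro closure_minimal subsetI) (blast, simp)
  moreover from this have "compact (closure {x. \<xi> x \<noteq> 0})"
    using compact_Int_closed[OF compact_Icc closed_closure, of a b "{x. \<xi> x \<noteq> 0}"] by (simp add: Int_absorb1)
  ultimately show "\<xi> \<in> Cc_infinity {0<..}"
    using ab(1,2) unfolding Cc_infinity_def smooth_def by fastforce
next
  assume *: "\<xi> \<in> Cc_infinity {0<..}"
  let ?K = "closure {x. \<xi> x \<noteq> 0}"
  have K: "smooth \<xi>" "compact ?K" "?K \<subseteq> {0<..}"
    using * unfolding Cc_infinity_def smooth_def by auto
  have sub: "x \<in> ?K" if "\<xi> x \<noteq> 0" for x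
    using that closure_subset[of "{x. \<xi> x \<noteq> 0}"] by blast
  show "test_fun \<xi>"
  proof (cases "?K = {}")
    case True
    then have "\<xi> x = 0" for x using sub[of x] by blast
    with K(1) show ?thesis unfolding test_fun_def by (intro conjI exI[of _ 1] exI[of _ 2]) auto
  next
    case False
    obtain a where a: "a \<in> ?K" "\<And>x. x \<in> ?K \<Longrightarrow> a \<le> x"
      using compact_attains_inf[OF K(2) False] by blast
    obtain b where b: "b \<in> ?K" "\<And>x. x \<in> ?K \<Longrightarrow> x \<le> b"
      using compact_attains_sup[OF K(2) False] by blast
    have "\<xi> x = 0" if "x \<notin> {a..b+1}" for x
      using a(2)[of x] b(2)[of x] sub[of x] that by fastforce
    moreover have "0 < a" "a < b + 1"
      using K(3) a b(1) by fastforce+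
    ultimately show ?thesis
      unfolding test_fun_def using K(1) by (intro conjI exI[of _ a] exI[of _ "b+1"]) auto
  qed
qed

lemma test_funE:
  assumes "test_fun \<xi>"
  obtains a b where "smooth \<xi>" "0 < a" "a < b" "\<And>x. x \<notin> {a..b} \<Longrightarrow> \<xi> x = 0"
  using assms unfolding test_fun_def by blast

lemma test_fun_deriv:
  assumes "test_fun \<xi>"
  obtains \<xi>' where "\<And>x. (\<xi> has_real_derivative \<xi>' x) (at x)" "test_fun \<xi>'"
    "\<And>x v. frechet_derivative \<xi> (at x) v = \<xi>' x * v"
proof -
  obtain a b where ab: "smooth \<xi>" "0 < a" "a < b" "\<And>x. x \<notin> {a..b} \<Longrightarrow> \<xi> x = 0"
    using test_funE[OF assms] by metis
  obtain \<xi>' where d: "\<And>x. (\<xi> has_real_derivative \<xi>' x) (at x)" "smooth \<xi>'"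
    "\<And>x v. frechet_derivative \<xi> (at x) v = \<xi>' x * v"
    using smooth_real_derivative[OF ab(1)] by metis
  have "\<xi>' x = 0" if "x \<notin> {a..b}" for x
  proof -
    have "((\<lambda>x. 0) has_real_derivative \<xi>' x) (at x)"
      by (rule has_field_derivative_transform_within_open[OF d(1), of "- {a..b}"])
        (use that ab(4) in auto)
    then show ?thesis using DERIV_const[of 0 "at x"] DERIV_unique by blast
  qed
  then have "test_fun \<xi>'" unfolding test_fun_def using ab d by blast
  with d that show ?thesis by blast
qed

lemma test_fun_mult: "test_fun \<xi> \<Longrightarrow> smooth g \<Longrightarrow> test_fun (\<lambda>x. \<xi> x * g x)"
  unfolding test_fun_def using smooth_mult[of \<xi> g] by force

lemma test_fun_add:
  assumes "test_fun f" "test_fun g"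
  shows "test_fun (\<lambda>x. f x + g x)"
proof -
  obtain a b where ab: "smooth f" "0 < a" "a < b" "\<And>x. x \<notin> {a..b} \<Longrightarrow> f x = 0"
    using test_funE[OF assms(1)] by metis
  obtain c d where cd: "smooth g" "0 < c" "c < d" "\<And>x. x \<notin> {c..d} \<Longrightarrow> g x = 0"
    using test_funE[OF assms(2)] by metis
  have "f x + g x = 0" if "x \<notin> {min a c..max b d}" for x
  proof -
    have "x \<notin> {a..b}" "x \<notin> {c..d}" using that by auto
    with ab(4) cd(4) show ?thesis by simp
  qed
  moreover have "0 < min a c" "min a c < max b d"
    using ab(2,3) cd(2,3) by auto
  ultimately show ?thesis
    unfolding test_fun_def using smooth_add[OF ab(1) cd(1)] by blast
qed

text \<open>The value \<open>inverse 0\<close> does no harm, since the numerator vanishes near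
  \<open>0\<close>. The sums are needed because the quotient rule produces two terms, with exponents
  \<open>n\<close> and \<open>n + 1\<close>.\<close>

inductive_set test_quotients :: "(real \<Rightarrow> real) set" where
  quot: "test_fun \<xi> \<Longrightarrow> (\<lambda>r. \<xi> r * inverse r ^ n) \<in> test_quotients"
| add: "f \<in> test_quotients \<Longrightarrow> g \<in> test_quotients \<Longrightarrow> (\<lambda>x. f x + g x) \<in> test_quotients"

lemma test_quotients_deriv:
  assumes "f \<in> test_quotients"
  shows "\<exists>f'. f' \<in> test_quotients \<and> (\<forall>x. (f has_real_derivative f' x) (at x))"
  using assms
proof induction
  case (quot \<xi> n)
  obtain a b where ab: "smooth \<xi>" "0 < a" "a < b" "\<And>x. x \<notin> {a..b} \<Longrightarrow> \<xi> x = 0"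
    using test_funE[OF quot] by metis
  obtain \<xi>' where d: "\<And>x. (\<xi> has_real_derivative \<xi>' x) (at x)" "test_fun \<xi>'"
    using test_fun_deriv[OF quot] by metis
  define g where "g = (\<lambda>x. (\<xi>' x) * inverse x ^ n + (\<xi> x * (- real n)) * inverse x ^ Suc n)"
  have zero: "\<xi>' x = 0" if "x < a" for x
  proof -
    have "((\<lambda>x. 0) has_real_derivative \<xi>' x) (at x)"
      by (rule has_field_derivative_transform_within_open[OF d(1), of "{..<a}"])
        (use that ab(4) in auto)
    then show ?thesis using DERIV_const[of 0 "at x"] DERIV_unique by blast
  qed
  have "((\<lambda>r. \<xi> r * inverse r ^ n) has_real_derivative g x) (at x)" for x
  proof (cases "x < a")
    case True
    have "((\<lambda>r. 0) has_real_derivative g x) (at x)"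
      using True zero[OF True] ab(4)[of x] by (simp add: g_def)
    then show ?thesis
      by (rule has_field_derivative_transform_within_open[where S = "{..<a}"]) (use True ab(4) in auto)
  next
    case False
    then have "x \<noteq> 0" using ab by auto
    have "((\<lambda>r. inverse r ^ n) has_real_derivative (- real n) * inverse x ^ Suc n) (at x)"
    proof (cases n)
      case (Suc k)
      then show ?thesis using DERIV_power[OF DERIV_inverse[OF \<open>x \<noteq> 0\<close>], of n]
        by (simp add: algebra_simps)
    qed auto
    from DERIV_mult[OF d(1) this] show ?thesis
      by (simp add: g_def algebra_simps)
  qed
  moreover have "g \<in> test_quotients"
    unfolding g_def by (intro test_quotients.intros d(2) test_fun_mult quot) auto
  ultimately show ?case by blast
next
  case (add f g)
  obtain f' where f': "f' \<in> test_quotients" "\<forall>x. (f has_real_derivative f' x) (at x)"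
    using add.IH(1) by (elim exE conjE)
  obtain g' where g': "g' \<in> test_quotients" "\<forall>x. (g has_real_derivative g' x) (at x)"
    using add.IH(2) by (elim exE conjE)
  have "(\<lambda>x. f' x + g' x) \<in> test_quotients"
    using f'(1) g'(1) by (rule test_quotients.add)
  moreover have "\<forall>x. ((\<lambda>x. f x + g x) has_real_derivative f' x + g' x) (at x)"
    using f'(2) g'(2) DERIV_add by blast
  ultimately show ?case by (intro exI[of _ "\<lambda>x. f' x + g' x"] conjI)
qed

lemma test_quotients_cmult: "f \<in> test_quotients \<Longrightarrow> (\<lambda>x. f x * c) \<in> test_quotients"
proof (induction rule: test_quotients.induct)
  case (quot \<xi> n)
  have "test_fun (\<lambda>x. \<xi> x * c)" by (rule test_fun_mult[OF quot]) simp
  from test_quotients.quot[OF this, of n] show ?case by (simp add: mult_ac)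
next
  case (add f g)
  from test_quotients.add[OF add.IH] show ?case by (simp add: algebra_simps)
qed

text \<open>Polar coordinates multiply test functions by powers of \<open>r\<close>. This allows
  those powers to be divided out, so that a prescribed test function on the half line arises from
  one on the plane.\<close>

lemma test_fun_divide_power:
  assumes "test_fun \<xi>"
  shows "test_fun (\<lambda>r. \<xi> r / r ^ n)"
proof -
  have "smooth (\<lambda>r. \<xi> r * inverse r ^ n)"
  proof (rule smooth_coinduct[where S = test_quotients])
    fix g assume "g \<in> test_quotients"
    then obtain g' where g': "g' \<in> test_quotients" "\<forall>x. (g has_real_derivative g' x) (at x)"
      using test_quotients_deriv by metis
    then show "\<exists>g'. (\<forall>x. (g has_derivative g' x) (at x)) \<and> (\<forall>v. (\<lambda>x. g' x v) \<in> test_quotients)"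
      unfolding has_field_derivative_def
      by (intro exI[of _ "\<lambda>x v. g' x * v"] conjI allI test_quotients_cmult) auto
  qed (rule test_quotients.quot[OF assms])
  with assms show ?thesis
    unfolding test_fun_def by (auto simp: field_simps)
qed

text \<open>For \<open>n \<rightarrow> \<infinity>\<close> these test functions increase to the indicator function of \<open>{a<..<b}\<close>.\<close>
definition bump :: "real \<Rightarrow> real \<Rightarrow> nat \<Rightarrow> real \<Rightarrow> real" where
  "bump a b n x = flat_exp 1 (real (Suc n) * (x - a)) * flat_exp 1 (real (Suc n) * (b - x))"

lemma test_fun_bump:
  assumes "0 < a" "a < b"
  shows "test_fun (bump a b n)"
proof -
  have "smooth (\<lambda>x. flat_exp 1 (real (Suc n) * x + (- real (Suc n) * a)) *
      flat_exp 1 ((- real (Suc n)) * x + real (Suc n) * b))"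
    by (intro smooth_mult smooth_affine smooth_flat_exp)
  then have "smooth (bump a b n)"
    unfolding bump_def by (simp add: algebra_simps)
  moreover have "bump a b n x = 0" if "x \<notin> {a..b}" for x
    using that by (auto simp: bump_def flat_exp_1 zero_less_mult_iff)
  ultimately show ?thesis
    unfolding test_fun_def using assms by blast
qed

lemma bump_nonneg: "0 \<le> bump a b n x"
  and bump_le_1: "bump a b n x \<le> 1"
  by (auto simp: bump_def flat_exp_1 intro!: mult_le_one)

lemma bump_outside: "x \<notin> {a<..<b} \<Longrightarrow> bump a b n x = 0"
  by (auto simp: bump_def flat_exp_1 zero_less_mult_iff)

lemma bump_tendsto: "(\<lambda>n. bump a b n x) \<longlonglongrightarrow> indicat_real {a<..<b} x"
proof (cases "x \<in> {a<..<b}")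
  case True
  have *: "(\<lambda>n. flat_exp 1 (real (Suc n) * c)) \<longlonglongrightarrow> 1" if "c > 0" for c
  proof -
    have "(\<lambda>n. - (1 / c) * inverse (real (Suc n))) \<longlonglongrightarrow> - (1 / c) * 0"
      by (intro tendsto_mult tendsto_const LIMSEQ_inverse_real_of_nat)
    then have "(\<lambda>n. exp (- (1 / c) * inverse (real (Suc n)))) \<longlonglongrightarrow> exp 0"
      by (intro tendsto_exp) simp
    moreover have "flat_exp 1 (real (Suc n) * c) = exp (- (1 / c) * inverse (real (Suc n)))" for n
      using that by (simp add: flat_exp_1 divide_inverse)
    ultimately show ?thesis by simp
  qed
  have "(\<lambda>n. bump a b n x) \<longlonglongrightarrow> 1 * 1"
    unfolding bump_def using True by (intro tendsto_mult *) auto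
  with True show ?thesis by simp
next
  case False
  then show ?thesis by (simp add: bump_outside)
qed

section \<open>Local integrability on the half line\<close>

lemma set_integral_support:
  assumes "A \<subseteq> B" "\<And>x. x \<in> B \<Longrightarrow> x \<notin> A \<Longrightarrow> f x = 0"
  shows set_integrable_support: "set_integrable M B f \<longleftrightarrow> set_integrable M A f"
    and set_lebesgue_integral_support: "(LINT x:B|M. f x) = (LINT x:A|M. f x)"
proof -
  have "(\<lambda>x. indicat_real B x *\<^sub>R f x) = (\<lambda>x. indicat_real A x *\<^sub>R f x)"
    using assms by (auto simp: fun_eq_iff indicator_def)
  then show "set_integrable M B f \<longleftrightarrow> set_integrable M A f" "(LINT x:B|M. f x) = (LINT x:A|M. f x)"
    unfolding set_integrable_def set_lebesgue_integral_def by simp_all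
qed

definition locint :: "(real \<Rightarrow> 'a::euclidean_space) \<Rightarrow> bool" where
  "locint f \<longleftrightarrow> (\<forall>a b. 0 < a \<longrightarrow> a \<le> b \<longrightarrow> si {a..b} f)"

lemma locintD: "locint f \<Longrightarrow> 0 < a \<Longrightarrow> si {a..b} f"
  unfolding locint_def by (cases "a \<le> b") auto

lemma compact_half_line:
  assumes "compact K" "K \<subseteq> {0<..}"
  obtains a b :: real where "0 < a" "a \<le> b" "K \<subseteq> {a..b}"
proof (cases "K = {}")
  case True
  then show ?thesis using that[of 1 1] by simp
next
  case False
  obtain a where "a \<in> K" "\<And>x. x \<in> K \<Longrightarrow> a \<le> x"
    using compact_attains_inf[OF assms(1) False] by blast
  moreover obtain b where "b \<in> K" "\<And>x. x \<in> K \<Longrightarrow> x \<le> b"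
    using compact_attains_sup[OF assms(1) False] by blast
  ultimately show ?thesis using that[of a b] assms(2) by fastforce
qed

lemma locally_integrable_half_line: "locally_integrable {0<..} f \<longleftrightarrow> locint f"
proof
  assume "locally_integrable {0<..} f"
  then show "locint f"
    unfolding locally_integrable_def locint_def by (auto simp: subset_eq)
next
  assume f: "locint f"
  show "locally_integrable {0<..} f"
    unfolding locally_integrable_def
  proof (intro allI impI)
    fix K :: "real set" assume K: "compact K \<and> K \<subseteq> {0<..}"
    then obtain a b where ab: "0 < a" "a \<le> b" "K \<subseteq> {a..b}"
      using compact_half_line by metis
    show "si K f"
      using K by (intro set_integrable_subset[OF locintD[OF f ab(1)] _ ab(3)]) (auto intro: borel_compact)
  qed
qed

lemma locint_add: "locint f \<Longrightarrow> locint g \<Longrightarrow> locint (\<lambda>x. f x + g x)"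
  and locint_diff: "locint f \<Longrightarrow> locint g \<Longrightarrow> locint (\<lambda>x. f x - g x)"
  unfolding locint_def by auto

lemma set_integrable_bounded_linear:
  assumes "bounded_linear h" "set_integrable M A f"
  shows "set_integrable M A (\<lambda>x. h (f x))"
    and set_integral_bounded_linear: "(LINT x:A|M. h (f x)) = h (LINT x:A|M. f x)"
proof -
  interpret h: bounded_linear h by fact
  show "set_integrable M A (\<lambda>x. h (f x))" "(LINT x:A|M. h (f x)) = h (LINT x:A|M. f x)"
    using integrable_bounded_linear[OF assms(1) assms(2)[unfolded set_integrable_def]]
      integral_bounded_linear[OF assms(1) assms(2)[unfolded set_integrable_def]]
    by (simp_all add: set_integrable_def set_lebesgue_integral_def h.scaleR)
qed

lemma locint_bounded_linear: "bounded_linear h \<Longrightarrow> locint f \<Longrightarrow> locint (\<lambda>x. h (f x))"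
  unfolding locint_def using set_integrable_bounded_linear by blast

lemma locint_mult_continuous:
  fixes f :: "real \<Rightarrow> 'a::{euclidean_space, real_normed_algebra}"
  assumes "locint f" "continuous_on {0<..} g"
  shows "locint (\<lambda>x. g x * f x)"
  unfolding locint_def
proof (intro allI impI)
  fix a b :: real assume ab: "0 < a" "a \<le> b"
  have g: "continuous_on {a..b} g"
    by (rule continuous_on_subset[OF assms(2)]) (use ab in auto)
  have "bounded (g ` {a..b})"
    by (intro compact_imp_bounded compact_continuous_image g) auto
  then obtain B where "\<forall>y\<in>g ` {a..b}. norm y \<le> B"
    unfolding bounded_iff by blast
  then have B: "norm (g x) \<le> B" if "x \<in> {a..b}" for x
    using that by blast
  have int: "si {a..b} f" using locintD[OF assms(1) ab(1)] .
  have mf: "(\<lambda>x. indicator {a..b} x *\<^sub>R f x) \<in> bm"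
    using int unfolding set_integrable_def by (simp add: borel_measurable_integrable)
  have mg: "(\<lambda>x. indicator {a..b} x *\<^sub>R g x) \<in> bm"
    by (intro borel_measurable_continuous_on_indicator g) auto
  have "(\<lambda>x. (indicator {a..b} x *\<^sub>R g x) * (indicator {a..b} x *\<^sub>R f x)) \<in> bm"
    using mf mg by measurable
  also have "(\<lambda>x. (indicator {a..b} x *\<^sub>R g x) * (indicator {a..b} x *\<^sub>R f x)) =
      (\<lambda>x. indicator {a..b} x *\<^sub>R (g x * f x))"
    by (auto simp: fun_eq_iff indicator_def)
  finally have m: "set_borel_measurable lborel {a..b} (\<lambda>x. g x * f x)"
    unfolding set_borel_measurable_def by simp
  show "si {a..b} (\<lambda>x. g x * f x)"
  proof (rule set_integrable_bound[OF _ m])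
    show "si {a..b} (\<lambda>x. B *\<^sub>R f x)" using int by simp
    show "AE x in lborel. x \<in> {a..b} \<longrightarrow> norm (g x * f x) \<le> norm (B *\<^sub>R f x)"
    proof (intro AE_I2 impI)
      fix x assume "x \<in> {a..b}"
      then have "norm (g x) \<le> B" by (rule B)
      then have "norm (g x) * norm (f x) \<le> \<bar>B\<bar> * norm (f x)"
        by (intro mult_right_mono) auto
      then show "norm (g x * f x) \<le> norm (B *\<^sub>R f x)"
        using norm_mult_ineq[of "g x" "f x"] by simp
    qed
  qed
qed

lemma locint_continuous: "continuous_on {0<..} f \<Longrightarrow> locint f"
  unfolding locint_def
proof (intro allI impI)
  fix a b :: real assume f: "continuous_on {0<..} f" and "0 < a" "a \<le> b"
  then have "continuous_on {a..b} f" by (intro continuous_on_subset[OF f]) auto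
  then show "si {a..b} f" by (rule borel_integrable_atLeastAtMost')
qed

lemma test_fun_integrable:
  fixes f :: "real \<Rightarrow> 'a::{euclidean_space, real_normed_algebra_1}"
  assumes "test_fun \<xi>" "locint f"
  shows "si {0<..} (\<lambda>x. \<xi> x *\<^sub>R f x)"
proof -
  obtain a b where ab: "smooth \<xi>" "0 < a" "a < b" "\<And>x. x \<notin> {a..b} \<Longrightarrow> \<xi> x = 0"
    using test_funE[OF assms(1)] by metis
  have "locint (\<lambda>x. of_real (\<xi> x) * f x)"
    by (intro locint_mult_continuous assms continuous_on_of_real smooth_continuous ab)
  then have "si {a..b} (\<lambda>x. \<xi> x *\<^sub>R f x)"
    using locintD[OF _ ab(2)] by (simp add: scaleR_conv_of_real)
  then show ?thesis
    by (subst set_integrable_support[of "{a..b}"]) (use ab in auto)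
qed

lemma nn_integral_pos_eq_neg:
  fixes h :: "'a \<Rightarrow> real"
  assumes "integrable M h" "integral\<^sup>L M h = 0"
  shows "(\<integral>\<^sup>+x. ennreal (h x) \<partial>M) = (\<integral>\<^sup>+x. ennreal (- h x) \<partial>M)"
proof -
  have "(\<integral>\<^sup>+x. ennreal (h x) \<partial>M) \<noteq> \<infinity>" "(\<integral>\<^sup>+x. ennreal (- h x) \<partial>M) \<noteq> \<infinity>"
    using assms(1) unfolding real_integrable_def by blast+
  moreover have "enn2real (\<integral>\<^sup>+x. ennreal (h x) \<partial>M) = enn2real (\<integral>\<^sup>+x. ennreal (- h x) \<partial>M)"
    using real_lebesgue_integral_def[OF assms(1)] assms(2) by simp
  ultimately show ?thesis
    by (metis ennreal_enn2real_if infinity_ennreal_def)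
qed

text \<open>The positive and negative parts of \<open>f\<close> on an interval are densities of two
  finite measures. The hypothesis makes these agree on half lines, hence everywhere, and the density
  of a finite measure is unique almost everywhere. A countable exhaustion of the half line finishes
  the proof.\<close>

lemma AE_zero_if_interval_integrals_zero_real:
  fixes f :: "real \<Rightarrow> real"
  assumes "locint f" and zero: "\<And>a b. 0 < a \<Longrightarrow> a < b \<Longrightarrow> (LBINT x:{a<..<b}. f x) = 0"
  shows "AE x in lborel. x > 0 \<longrightarrow> f x = 0"
proof -
  have *: "AE x in lborel. x \<in> {a<..<b} \<longrightarrow> f x = 0" if ab: "0 < a" "a < b" for a b
  proof -
    define g where "g x = indicat_real {a<..<b} x * f x" for x
    have int: "integrable lborel g"
      using set_integrable_subset[OF locintD[OF assms(1) ab(1), of b], of "{a<..<b}"] 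
      unfolding set_integrable_def g_def by force
    then have mg[measurable]: "g \<in> bm" by (simp add: borel_measurable_integrable)
    let ?P = "\<lambda>x. ennreal (g x)" and ?N = "\<lambda>x. ennreal (- g x)"
    have fin: "(\<integral>\<^sup>+x. ?P x \<partial>lborel) < \<infinity>" "(\<integral>\<^sup>+x. ?N x \<partial>lborel) < \<infinity>"
      using int unfolding real_integrable_def by (auto simp: top.not_eq_extremum)
    have "density lborel ?P = density lborel ?N"
    proof (rule measure_eqI_lessThan)
      fix x :: real
      have ind: "ennreal (indicator {x<..} y * g y) = ?P y * indicator {x<..} y"
        "ennreal (- (indicator {x<..} y * g y)) = ?N y * indicator {x<..} y" for y
        by (auto simp: indicator_def)
      have "emeasure (density lborel ?P) {x<..} \<le> (\<integral>\<^sup>+x. ?P x \<partial>lborel)"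
        by (subst emeasure_density) (auto intro!: nn_integral_mono simp: indicator_def)
      then show "emeasure (density lborel ?P) {x<..} < \<infinity>"
        using fin(1) by (rule order_le_less_trans)
      have i: "integrable lborel (\<lambda>y. indicator {x<..} y * g y)"
        using integrable_mult_indicator[OF _ int, of "{x<..}"] by simp
      have z: "(LINT y|lborel. indicator {x<..} y * g y) = 0"
      proof -
        have "(LINT y|lborel. indicator {x<..} y * g y) = (LBINT y:{max a x<..<b}. f y)"
          unfolding set_lebesgue_integral_def g_def
          by (intro Bochner_Integration.integral_cong) (auto simp: indicator_def)
        also have "\<dots> = 0"
          using zero[of "max a x" b] ab by (cases "max a x < b") (auto simp: set_lebesgue_integral_def)
        finally show ?thesis .
      qed
      from nn_integral_pos_eq_neg[OF i z]
      show "emeasure (density lborel ?P) {x<..} = emeasure (density lborel ?N) {x<..}"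
        unfolding ind by (simp add: emeasure_density)
    qed auto
    then have "AE x in lborel. ?P x = ?N x"
      using fin(1) by (subst (asm) finite_density_unique) auto
    then show ?thesis
    proof eventually_elim
      case (elim x)
      then have "g x = 0" by (cases "g x \<ge> 0") (auto simp: ennreal_neg ennreal_eq_0_iff)
      then show ?case by (auto simp: g_def)
    qed
  qed
  have "AE x in lborel. \<forall>n. x \<in> {1 / real (Suc n)<..<real (Suc n) + 1} \<longrightarrow> f x = 0"
    unfolding AE_all_countable
  proof (intro allI *)
    fix n
    have "1 / real (Suc n) \<le> 1" by simp
    then show "1 / real (Suc n) < real (Suc n) + 1" by linarith
  qed simp
  then show ?thesis
  proof eventually_elim
    case (elim x)
    show ?case
    proof
      assume "x > 0"
      obtain n where "inverse (real (Suc n)) < x" using reals_Archimedean[OF \<open>x > 0\<close>] by blast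
      moreover obtain k where "x < real k" using reals_Archimedean2 by blast
      moreover have "1 / real (Suc (max n k)) \<le> 1 / real (Suc n)"
        by (intro divide_left_mono) auto
      ultimately have "x \<in> {1 / real (Suc (max n k))<..<real (Suc (max n k)) + 1}"
        by (auto simp: inverse_eq_divide)
      with elim show "f x = 0" by blast
    qed
  qed
qed

lemma AE_zero_if_interval_integrals_zero:
  fixes f :: "real \<Rightarrow> complex"
  assumes f: "locint f" and zero: "\<And>a b. 0 < a \<Longrightarrow> a < b \<Longrightarrow> (LBINT x:{a<..<b}. f x) = 0"
  shows "AE x in lborel. x > 0 \<longrightarrow> f x = 0"
proof -
  have int: "si {a<..<b} f" if "0 < a" "a < b" for a b
    by (rule set_integrable_subset[OF locintD[OF f that(1), of b]]) auto
  have "AE x in lborel. x > 0 \<longrightarrow> Re (f x) = 0"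
    by (rule AE_zero_if_interval_integrals_zero_real)
      (auto intro: locint_bounded_linear[OF bounded_linear_Re f]
        simp: set_integral_bounded_linear[OF bounded_linear_Re int] zero)
  moreover have "AE x in lborel. x > 0 \<longrightarrow> Im (f x) = 0"
    by (rule AE_zero_if_interval_integrals_zero_real)
      (auto intro: locint_bounded_linear[OF bounded_linear_Im f]
        simp: set_integral_bounded_linear[OF bounded_linear_Im int] zero)
  ultimately show ?thesis
    by eventually_elim (auto simp: complex_eq_iff)
qed

text \<open>The functions \<open>bump a b n\<close> lie between \<open>0\<close> and
  \<open>1\<close> and converge to the indicator of \<open>{a<..<b}\<close>, so dominated
  convergence carries the hypothesis from test functions to intervals.\<close>

lemma fundamental_lemma:
  fixes f :: "real \<Rightarrow> complex"
  assumes f: "locint f" and zero: "\<And>\<xi>. test_fun \<xi> \<Longrightarrow> (LBINT x:{0<..}. \<xi> x *\<^sub>R f x) = 0"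
  shows "AE x in lborel. x > 0 \<longrightarrow> f x = 0"
proof (rule AE_zero_if_interval_integrals_zero[OF f])
  fix a b :: real assume ab: "0 < a" "a < b"
  have int: "si {a<..<b} f"
    by (rule set_integrable_subset[OF locintD[OF f ab(1), of b]]) auto
  have meas: "(\<lambda>x. indicator {a<..<b} x *\<^sub>R f x) \<in> bm"
    using int unfolding set_integrable_def by (simp add: borel_measurable_integrable)
  have mb[measurable]: "bump a b n \<in> bm" for n
    using test_fun_bump[OF ab] unfolding test_fun_def by (auto intro: borel_measurable_continuous_onI smooth_continuous)
  have "(\<lambda>n. LINT x|lborel. bump a b n x *\<^sub>R (indicator {a<..<b} x *\<^sub>R f x))
      \<longlonglongrightarrow> (LINT x|lborel. indicat_real {a<..<b} x *\<^sub>R (indicator {a<..<b} x *\<^sub>R f x))"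
  proof (rule integral_dominated_convergence)
    show "integrable lborel (\<lambda>x. norm (indicator {a<..<b} x *\<^sub>R f x))"
      using int unfolding set_integrable_def by (rule integrable_norm)
    show "AE x in lborel. (\<lambda>n. bump a b n x *\<^sub>R (indicator {a<..<b} x *\<^sub>R f x))
        \<longlonglongrightarrow> indicat_real {a<..<b} x *\<^sub>R (indicator {a<..<b} x *\<^sub>R f x)"
      by (intro AE_I2 tendsto_scaleR bump_tendsto tendsto_const)
    show "AE x in lborel. norm (bump a b n x *\<^sub>R (indicator {a<..<b} x *\<^sub>R f x)) \<le> norm (indicator {a<..<b} x *\<^sub>R f x)" for n
      using bump_le_1[of a b n] bump_nonneg[of a b n]
      by (intro AE_I2) (auto simp: indicator_def mult_left_le_one_le)
  qed (use meas in measurable)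
  moreover have "(LINT x|lborel. bump a b n x *\<^sub>R (indicator {a<..<b} x *\<^sub>R f x)) = 0" for n
  proof -
    have "(LINT x|lborel. bump a b n x *\<^sub>R (indicator {a<..<b} x *\<^sub>R f x)) =
        (LBINT x:{0<..}. bump a b n x *\<^sub>R f x)"
      unfolding set_lebesgue_integral_def using ab
      using bump_outside[of _ a b n] by (intro Bochner_Integration.integral_cong) (fastforce simp: indicator_def)+
    also have "\<dots> = 0" by (rule zero[OF test_fun_bump[OF ab]])
    finally show ?thesis .
  qed
  ultimately have "(LINT x|lborel. indicat_real {a<..<b} x *\<^sub>R (indicator {a<..<b} x *\<^sub>R f x)) = 0"
    by (simp add: LIMSEQ_const_iff)
  also have "(\<lambda>x. indicat_real {a<..<b} x *\<^sub>R (indicator {a<..<b} x *\<^sub>R f x)) = (\<lambda>x. indicator {a<..<b} x *\<^sub>R f x)"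
    by (auto simp: indicator_def)
  finally show "(LBINT x:{a<..<b}. f x) = 0"
    unfolding set_lebesgue_integral_def .
qed

section \<open>Absolutely continuous functions on the half line\<close>

text \<open>Absolute continuity on compact subintervals, encoded by the fundamental theorem of
  calculus with the derivative as data. Nothing is required at \<open>0\<close>, where
  \<open>f\<close> may fail to be integrable, and \<open>f\<close> may be changed on null
  sets.\<close>

definition ac :: "(real \<Rightarrow> 'a::euclidean_space) \<Rightarrow> (real \<Rightarrow> 'a) \<Rightarrow> bool" where
  "ac F f \<longleftrightarrow> locint f \<and> (\<forall>a b. 0 < a \<longrightarrow> a \<le> b \<longrightarrow> F b - F a = (LBINT x:{a..b}. f x))"

lemma ac_locint: "ac F f \<Longrightarrow> locint f"
  unfolding ac_def by blast

lemma ac_diff_eq: "ac F f \<Longrightarrow> 0 < a \<Longrightarrow> a \<le> b \<Longrightarrow> F b - F a = (LBINT x:{a..b}. f x)"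
  unfolding ac_def by blast

lemma ac_integrable: "ac F f \<Longrightarrow> 0 < a \<Longrightarrow> si {a..b} f"
  using locintD[OF ac_locint] .

lemma ac_add:
  assumes "ac F f" "ac G g"
  shows "ac (\<lambda>x. F x + G x) (\<lambda>x. f x + g x)"
  unfolding ac_def
proof (intro conjI allI impI locint_add ac_locint[OF assms(1)] ac_locint[OF assms(2)])
  fix a b :: real assume "0 < a" "a \<le> b"
  then show "F b + G b - (F a + G a) = (LBINT x:{a..b}. f x + g x)"
    using ac_diff_eq[OF assms(1), of a b] ac_diff_eq[OF assms(2), of a b]
    by (simp add: set_integral_add(2)[OF ac_integrable[OF assms(1)] ac_integrable[OF assms(2)]] add_diff_add)
qed

lemma ac_bounded_linear:
  assumes "bounded_linear h" "ac F f"
  shows "ac (\<lambda>x. h (F x)) (\<lambda>x. h (f x))"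
  unfolding ac_def
proof (intro conjI allI impI)
  show "locint (\<lambda>x. h (f x))"
    by (rule locint_bounded_linear[OF assms(1) ac_locint[OF assms(2)]])
  fix a b :: real assume ab: "0 < a" "a \<le> b"
  interpret bounded_linear h by fact
  show "h (F b) - h (F a) = (LBINT x:{a..b}. h (f x))"
    using ac_diff_eq[OF assms(2) ab] set_integral_bounded_linear[OF assms(1) ac_integrable[OF assms(2) ab(1)], of b]
    by (simp add: diff[symmetric])
qed

lemma ac_diff:
  assumes "ac F f" "ac G g"
  shows "ac (\<lambda>x. F x - G x) (\<lambda>x. f x - g x)"
  using ac_add[OF assms(1) ac_bounded_linear[OF bounded_linear_minus[OF bounded_linear_ident] assms(2)]] by simp

lemma ac_const: "ac (\<lambda>x. c) (\<lambda>x. 0)"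
  unfolding ac_def locint_def by (auto simp: set_integrable_def)

lemma ac_continuous:
  assumes "ac F f"
  shows "continuous_on {0<..} F"
proof -
  have "isCont F x" if "0 < x" for x
  proof -
    have int: "si {x/2..2*x} f"
      using locintD[OF ac_locint[OF assms]] that by simp
    have f: "f integrable_on {x/2..2*x}"
      using set_borel_integral_eq_integral(1)[OF int] .
    have "continuous_on {x/2..2*x} (\<lambda>t. F (x/2) + integral {x/2..t} f)"
      by (intro continuous_on_add continuous_on_const indefinite_integral_continuous_1 f)
    moreover have "F (x/2) + integral {x/2..t} f = F t" if t: "t \<in> {x/2..2*x}" for t
    proof -
      have "si {x/2..t} f"
        using locintD[OF ac_locint[OF assms]] \<open>0 < x\<close> by simp
      from set_borel_integral_eq_integral(2)[OF this] show ?thesis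
        using ac_diff_eq[OF assms, of "x/2" t] t \<open>0 < x\<close> by (simp add: algebra_simps)
    qed
    ultimately have "continuous_on {x/2..2*x} F"
      by (rule continuous_on_eq)
    then have "continuous_on {x/2<..<2*x} F"
      by (rule continuous_on_subset) auto
    then show ?thesis
      using that by (auto simp: continuous_on_eq_continuous_at)
  qed
  then show ?thesis by (simp add: continuous_at_imp_continuous_on)
qed

lemma ac_C1:
  assumes "\<And>x. 0 < x \<Longrightarrow> (F has_vector_derivative f x) (at x)" "continuous_on {0<..} f"
  shows "ac F f"
  unfolding ac_def
proof (intro conjI allI impI locint_continuous assms)
  fix a b :: real assume ab: "0 < a" "a \<le> b"
  have "(LBINT x. indicator {a..b} x *\<^sub>R f x) = F b - F a"
  proof (rule integral_FTC_atLeastAtMost[OF ab(2)])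
    show "(F has_vector_derivative f x) (at x within {a..b})" if "a \<le> x" "x \<le> b" for x
      using assms(1)[of x] that ab has_vector_derivative_at_within by fastforce
    show "continuous_on {a..b} f"
      by (rule continuous_on_subset[OF assms(2)]) (use ab in auto)
  qed
  then show "F b - F a = (LBINT x:{a..b}. f x)"
    unfolding set_lebesgue_integral_def by simp
qed

text \<open>Exhausting the half line by compact intervals turns measurability on each of them into
  measurability on the union. Nothing is known about \<open>f\<close> on the rest of the line, hence
  the indicator.\<close>

lemma locint_measurable:
  assumes "locint f"
  shows "(\<lambda>x. indicator {0<..} x *\<^sub>R f x) \<in> bm"
proof (rule borel_measurable_LIMSEQ_metric)
  let ?I = "\<lambda>n. {1 / real (Suc n)..real (Suc n)}"
  show "(\<lambda>x. indicator (?I n) x *\<^sub>R f x) \<in> bm" for n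
    using locintD[OF assms, of "1 / real (Suc n)" "real (Suc n)"]
    unfolding set_integrable_def by (simp add: borel_measurable_integrable)
  show "(\<lambda>n. indicator (?I n) x *\<^sub>R f x) \<longlonglongrightarrow> indicator {0<..} x *\<^sub>R f x" for x
  proof (cases "x > 0")
    case True
    obtain n where n: "inverse (real (Suc n)) < x" using reals_Archimedean[OF True] by blast
    obtain k where k: "x < real k" using reals_Archimedean2 by blast
    have "x \<in> ?I j" if "j \<ge> max n k" for j
    proof -
      have "1 / real (Suc j) \<le> 1 / real (Suc n)"
        using that by (intro divide_left_mono) auto
      then have "1 / real (Suc j) \<le> x" using n by (simp add: inverse_eq_divide)
      moreover have "x \<le> real (Suc j)" using k that by simp
      ultimately show ?thesis by simp
    qed
    then have "eventually (\<lambda>j. indicator (?I j) x *\<^sub>R f x = indicator {0<..} x *\<^sub>R f x) sequentially"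
      using True by (intro eventually_sequentiallyI[of "max n k"]) (simp add: indicator_def)
    then show ?thesis by (rule tendsto_eventually)
  next
    case False
    then have "indicator (?I j) x *\<^sub>R f x = 0" for j
      using order_less_le_trans[of 0 "1 / real (Suc j)" x] by (auto simp: indicator_def)
    then have "(\<lambda>j. indicator (?I j) x *\<^sub>R f x) = (\<lambda>j. 0)" by (rule ext)
    with False show ?thesis by (simp only:) simp
  qed
qed

text \<open>Fubini: the product of the increments of \<open>F\<close> and \<open>G\<close> is the
  integral of \<open>f s * g t\<close> over a square. Splitting the square along its diagonal and
  integrating first in one variable gives the two integrals of the product rule.\<close>

lemma ac_mult:
  fixes F G :: "real \<Rightarrow> 'a::{euclidean_space, real_normed_field}"
  assumes "ac F f" "ac G g"
  shows "ac (\<lambda>x. F x * G x) (\<lambda>x. F x * g x + G x * f x)"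
  unfolding ac_def
proof (intro conjI allI impI)
  show "locint (\<lambda>x. F x * g x + G x * f x)"
    by (intro locint_add locint_mult_continuous ac_continuous[OF assms(1)] ac_continuous[OF assms(2)]
        ac_locint[OF assms(1)] ac_locint[OF assms(2)])
  fix a b :: real assume ab: "0 < a" "a \<le> b"
  define f1 where "f1 x = indicat_real {a..b} x *\<^sub>R f x" for x
  define g1 where "g1 x = indicat_real {a..b} x *\<^sub>R g x" for x
  have f1: "integrable lborel f1" and g1: "integrable lborel g1"
    using locintD[OF ac_locint[OF assms(1)] ab(1), of b] locintD[OF ac_locint[OF assms(2)] ab(1), of b]
    unfolding f1_def g1_def set_integrable_def by auto
  have m[measurable]: "f1 \<in> bm" "g1 \<in> bm"
    using f1 g1 by (simp_all add: borel_measurable_integrable)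
  have p: "integrable (lborel \<Otimes>\<^sub>M lborel) (\<lambda>(s,t). f1 s * g1 t)"
  proof (rule lborel_pair.Fubini_integrable)
    show "integrable lborel (\<lambda>s. LINT t|lborel. norm (case (s, t) of (s, t) \<Rightarrow> f1 s * g1 t))"
      using f1 by (auto simp: norm_mult)
    show "AE s in lborel. integrable lborel (\<lambda>t. case (s, t) of (s, t) \<Rightarrow> f1 s * g1 t)"
      using g1 by auto
  qed measurable
  have S1: "{x. fst x \<le> snd x} \<in> sets (lborel \<Otimes>\<^sub>M (lborel :: real measure))"
    and S2: "{x. snd x < fst x} \<in> sets (lborel \<Otimes>\<^sub>M (lborel :: real measure))"
  proof -
    have "{x \<in> space (borel \<Otimes>\<^sub>M borel). fst x \<le> snd x} \<in> sets (borel \<Otimes>\<^sub>M (borel :: real measure))"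
      "{x \<in> space (borel \<Otimes>\<^sub>M borel). snd x < fst x} \<in> sets (borel \<Otimes>\<^sub>M (borel :: real measure))"
      by measurable
    moreover have "sets (lborel \<Otimes>\<^sub>M lborel) = sets (borel \<Otimes>\<^sub>M (borel :: real measure))"
      by (intro sets_pair_measure_cong) auto
    ultimately show "{x. fst x \<le> snd x} \<in> sets (lborel \<Otimes>\<^sub>M (lborel :: real measure))"
      "{x. snd x < fst x} \<in> sets (lborel \<Otimes>\<^sub>M (lborel :: real measure))"
      by (simp_all add: space_pair_measure)
  qed
  have p1: "integrable (lborel \<Otimes>\<^sub>M lborel) (\<lambda>(s,t). indicat_real {x. fst x \<le> snd x} (s,t) *\<^sub>R (f1 s * g1 t))"
    using integrable_mult_indicator[OF S1 p] by (simp only: split_def prod.collapse)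
  have p2: "integrable (lborel \<Otimes>\<^sub>M lborel) (\<lambda>(s,t). indicat_real {x. snd x < fst x} (s,t) *\<^sub>R (f1 s * g1 t))"
    using integrable_mult_indicator[OF S2 p] by (simp only: split_def prod.collapse)
  have Fi: "(LINT s|lborel. f1 s) = F b - F a" and Gi: "(LINT s|lborel. g1 s) = G b - G a"
    using ac_diff_eq[OF assms(1) ab] ac_diff_eq[OF assms(2) ab]
    unfolding f1_def g1_def set_lebesgue_integral_def by auto
  have Ft: "(LINT s|lborel. indicat_real {x. fst x \<le> snd x} (s,t) *\<^sub>R f1 s) = F t - F a" if "t \<in> {a..b}" for t
  proof -
    have "(LINT s|lborel. indicat_real {x. fst x \<le> snd x} (s,t) *\<^sub>R f1 s) = (LBINT s:{a..t}. f s)"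
      unfolding set_lebesgue_integral_def f1_def using that
      by (intro Bochner_Integration.integral_cong) (auto simp: indicator_def)
    with ac_diff_eq[OF assms(1) ab(1), of t] that show ?thesis by simp
  qed
  have Gs: "(LINT t|lborel. indicat_real {x. snd x < fst x} (s,t) *\<^sub>R g1 t) = G s - G a" if "s \<in> {a..b}" for s
  proof -
    have "(LINT t|lborel. indicat_real {x. snd x < fst x} (s,t) *\<^sub>R g1 t) =
        (LINT t|lborel. indicat_real {a..s} t *\<^sub>R g1 t)"
    proof (rule integral_cong_AE)
      \<comment> \<open>The lower triangle is open along the diagonal while \<open>{a..s}\<close> is
        closed; the difference is one point.\<close>
      have "AE t in lborel. t \<noteq> s" by (rule AE_lborel_singleton)
      then show "AE t in lborel. indicat_real {x. snd x < fst x} (s,t) *\<^sub>R g1 t = indicat_real {a..s} t *\<^sub>R g1 t"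
        by eventually_elim (auto simp: indicator_def g1_def)
    qed (auto intro: borel_measurable_scaleR)
    also have "\<dots> = (LBINT t:{a..s}. g t)"
      unfolding set_lebesgue_integral_def g1_def using that
      by (intro Bochner_Integration.integral_cong) (auto simp: indicator_def)
    finally show ?thesis using ac_diff_eq[OF assms(2) ab(1), of s] that by simp
  qed
  have i1: "integrable lborel (\<lambda>t. (F t - F a) * g1 t)" and e1: "integral\<^sup>L (lborel \<Otimes>\<^sub>M lborel) (\<lambda>(s,t). indicat_real {x. fst x \<le> snd x} (s,t) *\<^sub>R (f1 s * g1 t)) = (LINT t|lborel. (F t - F a) * g1 t)"
  proof -
    have *: "(LINT s|lborel. indicat_real {x. fst x \<le> snd x} (s,t) *\<^sub>R (f1 s * g1 t)) = (F t - F a) * g1 t" for t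
    proof (cases "t \<in> {a..b}")
      case True
      have "(LINT s|lborel. indicat_real {x. fst x \<le> snd x} (s,t) *\<^sub>R (f1 s * g1 t)) =
        (LINT s|lborel. (indicat_real {x. fst x \<le> snd x} (s,t) *\<^sub>R f1 s) * g1 t)"
        by (simp add: scaleR_conv_of_real mult_ac)
      also have "\<dots> = (F t - F a) * g1 t"
        by (subst integral_mult_left_zero) (simp only: Ft[OF True])
      finally show ?thesis .
    qed (simp add: g1_def)
    show "integrable lborel (\<lambda>t. (F t - F a) * g1 t)"
      using lborel_pair.integrable_snd[OF p1] by (simp add: *)
    show "integral\<^sup>L (lborel \<Otimes>\<^sub>M lborel) (\<lambda>(s,t). indicat_real {x. fst x \<le> snd x} (s,t) *\<^sub>R (f1 s * g1 t))
        = (LINT t|lborel. (F t - F a) * g1 t)"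
      using lborel_pair.integral_snd[OF p1] by (simp only: * case_prod_conv)
  qed
  have i2: "integrable lborel (\<lambda>s. (G s - G a) * f1 s)" and e2: "integral\<^sup>L (lborel \<Otimes>\<^sub>M lborel) (\<lambda>(s,t). indicat_real {x. snd x < fst x} (s,t) *\<^sub>R (f1 s * g1 t)) = (LINT s|lborel. (G s - G a) * f1 s)"
  proof -
    have *: "(LINT t|lborel. indicat_real {x. snd x < fst x} (s,t) *\<^sub>R (f1 s * g1 t)) = (G s - G a) * f1 s" for s
    proof (cases "s \<in> {a..b}")
      case True
      have "(LINT t|lborel. indicat_real {x. snd x < fst x} (s,t) *\<^sub>R (f1 s * g1 t)) =
        (LINT t|lborel. (indicat_real {x. snd x < fst x} (s,t) *\<^sub>R g1 t) * f1 s)"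
        by (simp add: scaleR_conv_of_real mult_ac)
      also have "\<dots> = (G s - G a) * f1 s"
        by (subst integral_mult_left_zero) (simp only: Gs[OF True])
      finally show ?thesis .
    qed (simp add: f1_def)
    show "integrable lborel (\<lambda>s. (G s - G a) * f1 s)"
      using lborel_pair.integrable_fst[OF p2] by (simp add: *)
    show "integral\<^sup>L (lborel \<Otimes>\<^sub>M lborel) (\<lambda>(s,t). indicat_real {x. snd x < fst x} (s,t) *\<^sub>R (f1 s * g1 t))
        = (LINT s|lborel. (G s - G a) * f1 s)"
      using lborel_pair.integral_fst[OF p2] by (simp only: * case_prod_conv)
  qed
  have "(F b - F a) * (G b - G a) = integral\<^sup>L (lborel \<Otimes>\<^sub>M lborel) (\<lambda>(s,t). f1 s * g1 t)"
    using lborel_pair.integral_fst[OF p] by (simp add: Fi Gi)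
  also have "\<dots> = integral\<^sup>L (lborel \<Otimes>\<^sub>M lborel) (\<lambda>x. (\<lambda>(s,t). indicat_real {x. fst x \<le> snd x} (s,t) *\<^sub>R (f1 s * g1 t)) x
      + (\<lambda>(s,t). indicat_real {x. snd x < fst x} (s,t) *\<^sub>R (f1 s * g1 t)) x)"
    by (intro Bochner_Integration.integral_cong) (auto simp: indicator_def)
  also have "\<dots> = (LINT t|lborel. (F t - F a) * g1 t) + (LINT s|lborel. (G s - G a) * f1 s)"
    by (subst Bochner_Integration.integral_add[OF p1 p2]) (simp only: e1 e2)
  also have "\<dots> = (LINT t|lborel. (F t - F a) * g1 t + (G t - G a) * f1 t)"
    using i1 i2 by simp
  also have "\<dots> = (LINT t|lborel. indicat_real {a..b} t *\<^sub>R (F t * g t + G t * f t) - (F a * g1 t + G a * f1 t))"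
    by (intro Bochner_Integration.integral_cong) (auto simp: f1_def g1_def indicator_def algebra_simps)
  also have "\<dots> = (LBINT t:{a..b}. F t * g t + G t * f t) - (F a * (G b - G a) + G a * (F b - F a))"
    unfolding set_lebesgue_integral_def
    using locintD[OF \<open>locint (\<lambda>x. F x * g x + G x * f x)\<close> ab(1), of b] f1 g1
    by (subst Bochner_Integration.integral_diff) (auto simp: set_integrable_def Fi Gi)
  finally show "F b * G b - F a * G a = (LBINT t:{a..b}. F t * g t + G t * f t)"
    by (simp add: algebra_simps)
qed

section \<open>Weak derivatives on the half line\<close>

lemma test_fun_ac:
  assumes "test_fun \<xi>" "\<And>x. (\<xi> has_real_derivative \<xi>' x) (at x)" "test_fun \<xi>'"
  shows "ac (\<lambda>x. of_real (\<xi> x) :: complex) (\<lambda>x. of_real (\<xi>' x))"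
proof -
  have "ac \<xi> \<xi>'"
  proof (rule ac_C1)
    show "(\<xi> has_vector_derivative \<xi>' x) (at x)" for x
      using assms(2) by (simp add: has_real_derivative_iff_has_vector_derivative)
    show "continuous_on {0<..} \<xi>'"
      using assms(3) unfolding test_fun_def by (blast intro: smooth_continuous)
  qed
  from ac_bounded_linear[OF bounded_linear_of_real this] show ?thesis .
qed

lemma test_fun_integral_by_parts:
  fixes e v :: "real \<Rightarrow> complex"
  assumes "test_fun \<xi>" "\<And>x. (\<xi> has_real_derivative \<xi>' x) (at x)" "test_fun \<xi>'" "ac e v"
  shows "(LBINT x:{0<..}. \<xi>' x *\<^sub>R e x) = - (LBINT x:{0<..}. \<xi> x *\<^sub>R v x)"
proof -
  obtain a b where ab: "0 < a" "a < b" "\<And>x. x \<notin> {a..b} \<Longrightarrow> \<xi> x = 0"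
    using test_funE[OF assms(1)] by metis
  obtain c d where cd: "0 < c" "c < d" "\<And>x. x \<notin> {c..d} \<Longrightarrow> \<xi>' x = 0"
    using test_funE[OF assms(3)] by metis
  define l where "l = min a c / 2"
  define h where "h = max b d + 1"
  have lh: "0 < l" "l \<le> h" "l < a" "b < h" "l < c" "d < h"
    using ab cd by (auto simp: l_def h_def min_def max_def)
  have z: "\<xi> l = 0" "\<xi> h = 0"
    using lh by (auto intro: ab(3))
  have "locint e"
    using ac_continuous[OF assms(4)] by (rule locint_continuous)
  have i1: "si {0<..} (\<lambda>x. \<xi>' x *\<^sub>R e x)" and i2: "si {0<..} (\<lambda>x. \<xi> x *\<^sub>R v x)"
    using test_fun_integrable[OF assms(3) \<open>locint e\<close>] test_fun_integrable[OF assms(1) ac_locint[OF assms(4)]] by auto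
  have "0 = (LBINT x:{l..h}. of_real (\<xi> x) * v x + e x * of_real (\<xi>' x))"
    using ac_diff_eq[OF ac_mult[OF test_fun_ac[OF assms(1-3)] assms(4)] lh(1,2)] z by simp
  also have "\<dots> = (LBINT x:{0<..}. of_real (\<xi> x) * v x + e x * of_real (\<xi>' x))"
  proof (rule set_lebesgue_integral_support[symmetric])
    show "of_real (\<xi> x) * v x + e x * of_real (\<xi>' x) = 0" if "x \<notin> {l..h}" for x
      using that lh ab(3)[of x] cd(3)[of x] by auto
  qed (use lh in auto)
  also have "\<dots> = (LBINT x:{0<..}. \<xi> x *\<^sub>R v x + \<xi>' x *\<^sub>R e x)"
    by (simp add: scaleR_conv_of_real mult.commute)
  also have "\<dots> = (LBINT x:{0<..}. \<xi> x *\<^sub>R v x) + (LBINT x:{0<..}. \<xi>' x *\<^sub>R e x)"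
    by (rule set_integral_add(2)[OF i2 i1])
  finally show ?thesis by (simp add: eq_neg_iff_add_eq_0 add.commute)
qed

lemma has_weak_derivative_half_line:
  fixes u v :: "real \<Rightarrow> complex"
  shows "has_weak_derivative u v 1 {0<..} \<longleftrightarrow> locint u \<and> locint v \<and>
    (\<forall>\<xi> \<xi>'. test_fun \<xi> \<longrightarrow> test_fun \<xi>' \<longrightarrow> (\<forall>x. (\<xi> has_real_derivative \<xi>' x) (at x)) \<longrightarrow>
      (LBINT x:{0<..}. \<xi>' x *\<^sub>R u x) = - (LBINT x:{0<..}. \<xi> x *\<^sub>R v x))"
proof -
  have eq: "frechet_derivative \<xi> (at x) 1 = \<xi>' x" if "(\<xi> has_real_derivative \<xi>' x) (at x)" for \<xi> \<xi>' :: "real \<Rightarrow> real" and x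
    using fun_cong[OF frechet_derivative_at[OF that[unfolded has_field_derivative_def]], of 1] by simp
  have "(\<forall>\<xi>\<in>Cc_infinity {0<..}. (LBINT x:{0<..}. frechet_derivative \<xi> (at x) 1 *\<^sub>R u x)
      = - (LBINT x:{0<..}. \<xi> x *\<^sub>R v x)) \<longleftrightarrow>
    (\<forall>\<xi> \<xi>'. test_fun \<xi> \<longrightarrow> test_fun \<xi>' \<longrightarrow> (\<forall>x. (\<xi> has_real_derivative \<xi>' x) (at x)) \<longrightarrow>
      (LBINT x:{0<..}. \<xi>' x *\<^sub>R u x) = - (LBINT x:{0<..}. \<xi> x *\<^sub>R v x))" (is "?L = ?R")
  proof
    assume ?L
    show ?R
    proof (intro allI impI)
      fix \<xi> \<xi>' :: "real \<Rightarrow> real" assume "test_fun \<xi>" and d: "\<forall>x. (\<xi> has_real_derivative \<xi>' x) (at x)"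
      then have "\<xi> \<in> Cc_infinity {0<..}" by (simp add: test_fun_Cc_infinity)
      with \<open>?L\<close> have "(LBINT x:{0<..}. frechet_derivative \<xi> (at x) 1 *\<^sub>R u x)
          = - (LBINT x:{0<..}. \<xi> x *\<^sub>R v x)" by (rule bspec)
      moreover have "frechet_derivative \<xi> (at x) 1 = \<xi>' x" for x
        by (rule eq) (use d in blast)
      ultimately show "(LBINT x:{0<..}. \<xi>' x *\<^sub>R u x) = - (LBINT x:{0<..}. \<xi> x *\<^sub>R v x)"
        by simp
    qed
  next
    assume R: ?R
    show ?L
    proof
      fix \<xi> :: "real \<Rightarrow> real" assume "\<xi> \<in> Cc_infinity {0<..}"
      then have t: "test_fun \<xi>" by (simp add: test_fun_Cc_infinity)
      obtain \<xi>' where d: "\<And>x. (\<xi> has_real_derivative \<xi>' x) (at x)" "test_fun \<xi>'"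
        using test_fun_deriv[OF t] by metis
      have "(LBINT x:{0<..}. \<xi>' x *\<^sub>R u x) = - (LBINT x:{0<..}. \<xi> x *\<^sub>R v x)"
        using R t d by blast
      then show "(LBINT x:{0<..}. frechet_derivative \<xi> (at x) 1 *\<^sub>R u x)
          = - (LBINT x:{0<..}. \<xi> x *\<^sub>R v x)"
      proof -
        have "frechet_derivative \<xi> (at x) 1 = \<xi>' x" for x
          by (rule eq) (rule d(1))
        with \<open>(LBINT x:{0<..}. \<xi>' x *\<^sub>R u x) = - (LBINT x:{0<..}. \<xi> x *\<^sub>R v x)\<close>
        show ?thesis by simp
      qed
    qed
  qed
  then show ?thesis
    unfolding has_weak_derivative_def locally_integrable_half_line by blast
qed

lemma weak_derivative_test:
  fixes u v :: "real \<Rightarrow> complex"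
  assumes "has_weak_derivative u v 1 {0<..}"
    and "test_fun \<xi>" "test_fun \<xi>'" "\<And>x. (\<xi> has_real_derivative \<xi>' x) (at x)"
  shows "(LBINT x:{0<..}. \<xi>' x *\<^sub>R u x) = - (LBINT x:{0<..}. \<xi> x *\<^sub>R v x)"
  using assms(1)[unfolded has_weak_derivative_half_line] assms(2-4) by blast

lemma has_weak_derivative_ac:
  fixes e u v :: "real \<Rightarrow> complex"
  assumes "ac e v" "AE x in lborel. 0 < x \<longrightarrow> u x = e x" "u \<in> bm" "e \<in> bm"
  shows "has_weak_derivative u v 1 {0<..}"
proof -
  have le: "locint e"
    using ac_continuous[OF assms(1)] by (rule locint_continuous)
  have lu: "locint u"
    unfolding locint_def
  proof (intro allI impI)
    fix a b :: real assume "0 < a" "a \<le> b"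
    then have "AE x in lborel. indicator {a..b} x *\<^sub>R e x = indicator {a..b} x *\<^sub>R u x"
      using assms(2) by (auto simp: indicator_def)
    then show "si {a..b} u"
      using locintD[OF le \<open>0 < a\<close>, of b] assms(3,4) unfolding set_integrable_def
      by (subst integrable_cong_AE[symmetric]) (auto intro: borel_measurable_scaleR)
  qed
  have "(LBINT x:{0<..}. \<xi>' x *\<^sub>R u x) = - (LBINT x:{0<..}. \<xi> x *\<^sub>R v x)"
    if t: "test_fun \<xi>" "test_fun \<xi>'" "\<forall>x. (\<xi> has_real_derivative \<xi>' x) (at x)" for \<xi> \<xi>'
  proof -
    have "\<xi>' \<in> bm"
      using t(2) unfolding test_fun_def by (auto intro: borel_measurable_continuous_onI smooth_continuous)
    then have "(LBINT x:{0<..}. \<xi>' x *\<^sub>R u x) = (LBINT x:{0<..}. \<xi>' x *\<^sub>R e x)"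
      unfolding set_lebesgue_integral_def using assms(2-4)
      by (intro integral_cong_AE) (auto simp: indicator_def intro!: borel_measurable_scaleR)
    with test_fun_integral_by_parts[OF t(1) t(3)[rule_format] t(2) assms(1)] show ?thesis by simp
  qed
  with lu ac_locint[OF assms(1)] show ?thesis
    unfolding has_weak_derivative_half_line by blast
qed

text \<open>The fundamental lemma applied to the difference. It makes \<open>d_r\<close>, which is
  defined by a choice, independent of that choice up to null sets, which is all that integrals
  see.\<close>

lemma has_weak_derivative_unique:
  fixes u v w :: "real \<Rightarrow> complex"
  assumes "has_weak_derivative u v 1 {0<..}" "has_weak_derivative u w 1 {0<..}"
  shows "AE x in lborel. 0 < x \<longrightarrow> v x = w x"
proof -
  have l: "locint v" "locint w"
    using assms unfolding has_weak_derivative_half_line by auto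
  have "AE x in lborel. 0 < x \<longrightarrow> v x - w x = 0"
  proof (rule fundamental_lemma[OF locint_diff[OF l]])
    fix \<xi> assume t: "test_fun \<xi>"
    obtain \<xi>' where d: "\<And>x. (\<xi> has_real_derivative \<xi>' x) (at x)" "test_fun \<xi>'"
      using test_fun_deriv[OF t] by metis
    have "(LBINT x:{0<..}. \<xi> x *\<^sub>R v x) = (LBINT x:{0<..}. \<xi> x *\<^sub>R w x)"
      using weak_derivative_test[OF assms(1) t d(2,1)] weak_derivative_test[OF assms(2) t d(2,1)] by simp
    then show "(LBINT x:{0<..}. \<xi> x *\<^sub>R (v x - w x)) = 0"
      using set_integral_diff(2)[OF test_fun_integrable[OF t l(1)] test_fun_integrable[OF t l(2)]]
      by (simp add: scaleR_diff_right)
  qed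
  then show ?thesis by simp
qed

lemma smooth_antiderivative:
  fixes F :: "real \<Rightarrow> real"
  assumes "\<And>x. (F has_real_derivative f x) (at x)" "smooth f"
  shows "smooth F"
proof (rule smooth_coinduct[where S = "insert F {g. smooth g}"])
  fix g :: "real \<Rightarrow> real" assume "g \<in> insert F {g. smooth g}"
  then consider "g = F" | "smooth g" by blast
  then show "\<exists>g'. (\<forall>x. (g has_derivative g' x) (at x)) \<and> (\<forall>v. (\<lambda>x. g' x v) \<in> insert F {g. smooth g})"
  proof cases
    case 1
    have "smooth (\<lambda>x. f x * v)" for v
      by (rule smooth_mult[OF assms(2)]) simp
    then show ?thesis
      unfolding 1 by (intro exI[of _ "\<lambda>x v. f x * v"] conjI allI insertI2 CollectI
          assms(1)[unfolded has_field_derivative_def])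
  next
    case 2
    obtain g' where "\<And>x. (g has_derivative g' x) (at x)" "\<And>v. smooth (\<lambda>x. g' x v)"
      using smooth_derivative[OF 2] by metis
    then show ?thesis
      by (intro exI[of _ g'] conjI allI insertI2 CollectI)
  qed
qed simp

text \<open>The primitive starting at \<open>0\<close> vanishes to the left of the support for free;
  to the right of it the primitive equals the total integral, which is why that integral has to be
  zero.\<close>

lemma test_fun_antiderivative:
  assumes t: "test_fun \<psi>" and zero: "(LBINT x:{0<..}. \<psi> x) = 0"
  obtains \<Psi> where "test_fun \<Psi>" "\<And>x. (\<Psi> has_real_derivative \<psi> x) (at x)"
proof -
  obtain a b where ab: "smooth \<psi>" "0 < a" "a < b" "\<And>x. x \<notin> {a..b} \<Longrightarrow> \<psi> x = 0"
    using test_funE[OF t] by metis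
  define \<Psi> where "\<Psi> x = integral {0..x} \<psi>" for x
  have cont: "continuous_on S \<psi>" for S by (rule smooth_continuous[OF ab(1)])
  have int: "\<psi> integrable_on {c..d}" for c d
    by (rule integrable_continuous_real[OF cont])
  have small: "\<Psi> x = 0" if "x < a" for x
    unfolding \<Psi>_def using that ab(4) by (intro integral_unique has_integral_is_0) auto
  have d: "(\<Psi> has_real_derivative \<psi> x) (at x)" for x
  proof (cases "x < a")
    case True
    have "((\<lambda>x. 0) has_real_derivative \<psi> x) (at x)"
      using ab(4)[of x] True by simp
    then show ?thesis
      by (rule has_field_derivative_transform_within_open[where S = "{..<a}"]) (use True small in auto)
  next
    case False
    then have "x \<in> {0<..<x+1}" using ab by auto
    have "(\<Psi> has_real_derivative \<psi> x) (at x within {0..x+1})"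
      unfolding \<Psi>_def by (rule integral_has_real_derivative[OF cont]) (use False ab in auto)
    then have "(\<Psi> has_real_derivative \<psi> x) (at x within {0<..<x+1})"
      by (rule DERIV_subset) auto
    then show ?thesis
      using at_within_open[OF \<open>x \<in> {0<..<x+1}\<close>] by simp
  qed
  have "integral {0..b} \<psi> = 0"
  proof -
    have "(LBINT x:{0<..}. \<psi> x) = (LBINT x:{a..b}. \<psi> x)"
      using ab by (intro set_lebesgue_integral_support) auto
    also have "\<dots> = (LBINT x:{0..b}. \<psi> x)"
      using ab by (intro set_lebesgue_integral_support[symmetric]) auto
    also have "\<dots> = integral {0..b} \<psi>"
      by (intro set_borel_integral_eq_integral(2) borel_integrable_atLeastAtMost' cont)
    finally show ?thesis using zero by simp
  qed
  then have large: "\<Psi> x = 0" if "b < x" for x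
  proof -
    have "integral {0..x} \<psi> = integral {0..b} \<psi> + integral {b..x} \<psi>"
      using that ab by (intro Henstock_Kurzweil_Integration.integral_combine[symmetric] int) auto
    moreover have "integral {b..x} \<psi> = 0"
    proof (rule integral_unique, rule has_integral_spike_finite[of "{b}"])
      show "((\<lambda>x. 0) has_integral (0::real)) {b..x}" by (rule has_integral_is_0) simp
    qed (use ab in auto)
    ultimately show ?thesis using \<open>integral {0..b} \<psi> = 0\<close> by (simp add: \<Psi>_def)
  qed
  have "\<Psi> x = 0" if "x \<notin> {a..b}" for x
    using that small[of x] large[of x] by auto
  then have "test_fun \<Psi>"
    unfolding test_fun_def using ab smooth_antiderivative[OF d ab(1)] by blast
  with d that show ?thesis by blast
qed

text \<open>Subtracting a multiple of one fixed bump from a test function makes its integral zero,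
  so that it becomes the derivative of a test function. The hypothesis then says that
  \<open>w - c\<close> is orthogonal to all test functions, where \<open>c\<close> is the mean of
  \<open>w\<close> weighted by the bump.\<close>

lemma du_Bois_Reymond:
  fixes w :: "real \<Rightarrow> complex"
  assumes w: "locint w"
    and zero: "\<And>\<xi> \<xi>'. test_fun \<xi> \<Longrightarrow> test_fun \<xi>' \<Longrightarrow> (\<And>x. (\<xi> has_real_derivative \<xi>' x) (at x)) \<Longrightarrow>
      (LBINT x:{0<..}. \<xi>' x *\<^sub>R w x) = 0"
  obtains c where "AE x in lborel. 0 < x \<longrightarrow> w x = c"
proof -
  let ?b = "bump 1 2 0"
  have tb: "test_fun ?b" by (rule test_fun_bump) auto
  have l1: "locint (\<lambda>x. 1 :: real)" and lc: "\<And>c::complex. locint (\<lambda>x. c)"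
    by (rule locint_continuous, rule continuous_on_const)+
  define c0 where "c0 = (LBINT x:{0<..}. ?b x)"
  have "c0 \<noteq> 0"
  proof
    assume "c0 = 0"
    have int: "si {0<..} ?b"
      using test_fun_integrable[OF tb l1] by simp
    have "AE x in lborel. indicator {0<..} x *\<^sub>R ?b x = 0"
      using \<open>c0 = 0\<close> int bump_nonneg[of 1 2 0] unfolding c0_def set_lebesgue_integral_def set_integrable_def
      by (subst (asm) integral_nonneg_eq_0_iff_AE) auto
    moreover have "indicator {0<..} x *\<^sub>R ?b x \<noteq> 0" if "x \<in> {1<..<2}" for x
      using that by (auto simp: bump_def flat_exp_1)
    ultimately have "AE x in lborel. x \<notin> {1<..<2::real}"
      by (auto elim!: eventually_mono)
    then have "{1<..<2::real} \<in> null_sets lborel"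
      by (subst (asm) AE_iff_null_sets[symmetric]) auto
    then show False by (simp add: null_sets_def)
  qed
  define c where "c = (LBINT x:{0<..}. ?b x *\<^sub>R w x) /\<^sub>R c0"
  have "AE x in lborel. 0 < x \<longrightarrow> w x - c = 0"
  proof (rule fundamental_lemma[OF locint_diff[OF w lc]])
    fix \<phi> assume t: "test_fun \<phi>"
    have i\<phi>: "si {0<..} \<phi>" and ib: "si {0<..} ?b"
      using test_fun_integrable[OF t l1] test_fun_integrable[OF tb l1] by simp_all
    define q where "q = (LBINT x:{0<..}. \<phi> x) / c0"
    define \<psi> where "\<psi> x = \<phi> x + ?b x * (- q)" for x
    have t\<psi>: "test_fun \<psi>"
      unfolding \<psi>_def by (intro test_fun_add t test_fun_mult tb) simp
    have "(LBINT x:{0<..}. \<psi> x) = (LBINT x:{0<..}. \<phi> x) + c0 * (- q)"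
      unfolding \<psi>_def c0_def set_integral_mult_left[symmetric]
      by (rule set_integral_add(2)[OF i\<phi> set_integrable_mult_left[OF ib]])
    also have "\<dots> = 0" using \<open>c0 \<noteq> 0\<close> by (simp add: q_def)
    finally obtain \<Psi> where "test_fun \<Psi>" "\<And>x. (\<Psi> has_real_derivative \<psi> x) (at x)"
      using test_fun_antiderivative[OF t\<psi>] by metis
    then have "(LBINT x:{0<..}. \<psi> x *\<^sub>R w x) = 0" by (intro zero[OF _ t\<psi>])
    moreover have "(LBINT x:{0<..}. \<psi> x *\<^sub>R w x) =
        (LBINT x:{0<..}. \<phi> x *\<^sub>R w x) - q *\<^sub>R (LBINT x:{0<..}. ?b x *\<^sub>R w x)"
    proof -
      have eq: "(\<lambda>x. \<psi> x *\<^sub>R w x) = (\<lambda>x. \<phi> x *\<^sub>R w x - q *\<^sub>R (?b x *\<^sub>R w x))"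
        by (simp add: fun_eq_iff \<psi>_def algebra_simps)
      show ?thesis
        unfolding eq set_integral_scaleR_right[symmetric]
        by (rule set_integral_diff(2)[OF test_fun_integrable[OF t w] set_integrable_scaleR_right[OF test_fun_integrable[OF tb w]]])
    qed
    moreover have "q *\<^sub>R (LBINT x:{0<..}. ?b x *\<^sub>R w x) = (LBINT x:{0<..}. \<phi> x) *\<^sub>R c"
      unfolding q_def c_def by (simp add: divide_inverse mult.commute)
    moreover have "(LBINT x:{0<..}. \<phi> x) *\<^sub>R c = (LBINT x:{0<..}. \<phi> x *\<^sub>R c)"
      using i\<phi> unfolding set_lebesgue_integral_def set_integrable_def by simp
    ultimately show "(LBINT x:{0<..}. \<phi> x *\<^sub>R (w x - c)) = 0"
      using set_integral_diff(2)[OF test_fun_integrable[OF t w] test_fun_integrable[OF t lc[of c]]]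
      by (simp add: scaleR_diff_right)
  qed
  then show ?thesis using that[of c] by simp
qed

lemma locint_antiderivative:
  fixes v :: "real \<Rightarrow> complex"
  assumes "locint v"
  obtains e where "ac e v"
proof
  define e where "e x = (if 1 \<le> x then LBINT t:{1..x}. v t else - (LBINT t:{x..1}. v t))" for x
  have split: "(LBINT t:{a..c}. v t) = (LBINT t:{a..b}. v t) + (LBINT t:{b..c}. v t)"
    if "0 < a" "a \<le> b" "b \<le> c" for a b c
  proof -
    have "{a..c} = {a..b} \<union> {b..c}" using that by auto
    moreover have "AE x in lborel. \<not> (x \<in> {a..b} \<and> x \<in> {b..c})"
      using AE_lborel_singleton[of b] by eventually_elim auto
    ultimately show ?thesis
      using set_integral_Un_AE[where M = lborel and A = "{a..b}" and B = "{b..c}" and f = v] locintD[OF assms, of a b] locintD[OF assms, of b c] that by simp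
  qed
  show "ac e v"
    unfolding ac_def
  proof (intro conjI allI impI assms)
    fix a b :: real assume ab: "0 < a" "a \<le> b"
    consider "1 \<le> a" | "a < 1" "1 \<le> b" | "b < 1" by linarith
    then show "e b - e a = (LBINT x:{a..b}. v x)"
    proof cases
      case 1
      then show ?thesis using split[of 1 a b] ab by (simp add: e_def)
    next
      case 2
      then show ?thesis using split[of a 1 b] ab by (simp add: e_def)
    next
      case 3
      then show ?thesis using split[of a b 1] ab by (simp add: e_def)
    qed
  qed
qed

text \<open>The representative is extended by \<open>0\<close> to \<open>r \<le> 0\<close> to make it Borel measurable.\<close>
lemma weak_derivative_representative:
  fixes u v :: "real \<Rightarrow> complex"
  assumes "has_weak_derivative u v 1 {0<..}"
  obtains e where "ac e v" "AE x in lborel. 0 < x \<longrightarrow> u x = e x" "e \<in> bm"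
proof -
  have l: "locint u" "locint v" using assms unfolding has_weak_derivative_half_line by auto
  obtain e0 where e0: "ac e0 v" using locint_antiderivative[OF l(2)] by metis
  have le0: "locint e0" using ac_continuous[OF e0] by (rule locint_continuous)
  obtain c where c: "AE x in lborel. 0 < x \<longrightarrow> u x - e0 x = c"
  proof (rule du_Bois_Reymond[OF locint_diff[OF l(1) le0]])
    fix \<xi> \<xi>' :: "real \<Rightarrow> real" assume t: "test_fun \<xi>" "test_fun \<xi>'" "\<And>x. (\<xi> has_real_derivative \<xi>' x) (at x)"
    have "(LBINT x:{0<..}. \<xi>' x *\<^sub>R u x) = (LBINT x:{0<..}. \<xi>' x *\<^sub>R e0 x)"
      using test_fun_integral_by_parts[OF t(1,3,2) e0] weak_derivative_test[OF assms t] by simp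
    then show "(LBINT x:{0<..}. \<xi>' x *\<^sub>R (u x - e0 x)) = 0"
      using set_integral_diff(2)[OF test_fun_integrable[OF t(2) l(1)] test_fun_integrable[OF t(2) le0]]
      by (simp add: scaleR_diff_right)
  qed blast
  define e where "e x = indicat_real {0<..} x *\<^sub>R (e0 x + c)" for x
  have eq: "e x = e0 x + c" if "0 < x" for x using that by (simp add: e_def)
  have "ac (\<lambda>x. e0 x + c) (\<lambda>x. v x + 0)" by (rule ac_add[OF e0 ac_const])
  then have "ac e v" unfolding ac_def using eq by auto
  moreover have "AE x in lborel. 0 < x \<longrightarrow> u x = e x"
    using c by eventually_elim (auto simp: eq algebra_simps)
  moreover have "e \<in> bm"
    unfolding e_def by (intro borel_measurable_continuous_on_indicator continuous_on_add ac_continuous[OF e0] continuous_on_const) auto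
  ultimately show ?thesis using that by blast
qed

section \<open>Integration of radial functions\<close>

definition radial_density :: "real \<Rightarrow> real" where
  "radial_density r = 2 * pi * r * indicat_real {0<..} r"

lemma radial_density_measurable [measurable]: "radial_density \<in> bm"
  unfolding radial_density_def by measurable

lemma radial_density_nonneg: "0 \<le> radial_density r"
  by (simp add: radial_density_def indicator_def)

text \<open>The half lines \<open>{..x}\<close> generate the Borel sets, and there the identity says
  that the area \<open>pi * x^2\<close> of a disc is a primitive of
  \<open>2 * pi * r\<close>.\<close>

lemma distr_cmod: "distr lborel borel cmod = density lborel (\<lambda>r. ennreal (radial_density r))"
proof (rule measure_eqI_generator_eq[where E = "range atMost" and \<Omega> = UNIV and A = "\<lambda>n. {..real n}"])
  show "Int_stable (range (atMost :: real \<Rightarrow> _))"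
    by (auto simp: Int_stable_def)
  show "sets (distr lborel borel cmod) = sigma_sets UNIV (range atMost)"
    "sets (density lborel (\<lambda>r. ennreal (radial_density r))) = sigma_sets UNIV (range atMost)"
    by (simp_all add: borel_eq_atMost sets_measure_of)
  have e1: "emeasure (distr lborel borel cmod) {..x} = ennreal (pi * (max 0 x)^2)" for x
  proof -
    have "emeasure (distr lborel borel cmod) {..x} = emeasure lborel (cmod -` {..x} \<inter> space lborel)"
      by (rule emeasure_distr) auto
    also have "cmod -` {..x} \<inter> space lborel = cball 0 x"
      by auto
    also have "emeasure lborel (cball (0::complex) x) = ennreal (pi * (max 0 x)^2)"
    proof (cases "0 \<le> x")
      case True
      then show ?thesis
        by (simp add: emeasure_cball unit_ball_vol_numeral)
    next
      case False
      then show ?thesis by simp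
    qed
    finally show ?thesis .
  qed
  have e2: "emeasure (density lborel (\<lambda>r. ennreal (radial_density r))) {..x} = ennreal (pi * (max 0 x)^2)" for x
  proof -
    have "emeasure (density lborel (\<lambda>r. ennreal (radial_density r))) {..x} =
        (\<integral>\<^sup>+r. ennreal (2 * pi * r) * indicator {0..max 0 x} r \<partial>lborel)"
      by (subst emeasure_density)
        (auto intro!: nn_integral_cong simp: radial_density_def indicator_def max_def)
    also have "\<dots> = pi * (max 0 x)^2 - pi * 0^2"
      by (rule nn_integral_FTC_Icc[where F = "\<lambda>r. pi * r^2"])
        (auto intro!: derivative_eq_intros simp: power2_eq_square)
    finally show ?thesis by simp
  qed
  show "emeasure (distr lborel borel cmod) X = emeasure (density lborel (\<lambda>r. ennreal (radial_density r))) X"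
    if "X \<in> range atMost" for X
    using that e1 e2 by auto
  show "emeasure (distr lborel borel cmod) {..real n} \<noteq> \<infinity>" for n
    by (simp add: e1)
  show "(\<Union>n. {..real n}) = UNIV"
    using real_arch_simple by auto
qed auto

lemma
  fixes f :: "real \<Rightarrow> 'b::{banach, second_countable_topology}"
  assumes [measurable]: "f \<in> bm"
  shows integrable_cmod: "integrable lborel (\<lambda>z::complex. f (cmod z)) \<longleftrightarrow> si {0<..} (\<lambda>r. (2 * pi * r) *\<^sub>R f r)"
    and integral_cmod: "(LINT z|lborel. f (cmod z)) = (LBINT r:{0<..}. (2 * pi * r) *\<^sub>R f r)"
proof -
  have eq: "radial_density r *\<^sub>R f r = indicat_real {0<..} r *\<^sub>R ((2 * pi * r) *\<^sub>R f r)" for r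
    by (auto simp: radial_density_def indicator_def)
  have "integrable lborel (\<lambda>z::complex. f (cmod z)) \<longleftrightarrow> integrable (distr lborel borel cmod) f"
    by (rule integrable_distr_eq[symmetric]) auto
  also have "\<dots> \<longleftrightarrow> si {0<..} (\<lambda>r. (2 * pi * r) *\<^sub>R f r)"
    unfolding distr_cmod set_integrable_def eq[symmetric]
    by (rule integrable_density) (auto simp: radial_density_nonneg)
  finally show "integrable lborel (\<lambda>z::complex. f (cmod z)) \<longleftrightarrow> si {0<..} (\<lambda>r. (2 * pi * r) *\<^sub>R f r)" .
  have "(LINT z|lborel. f (cmod z)) = (LINT r|distr lborel borel cmod. f r)"
    by (rule integral_distr[symmetric]) auto
  also have "\<dots> = (LBINT r:{0<..}. (2 * pi * r) *\<^sub>R f r)"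
    unfolding distr_cmod set_lebesgue_integral_def eq[symmetric]
    by (rule integral_density) (auto simp: radial_density_nonneg)
  finally show "(LINT z|lborel. f (cmod z)) = (LBINT r:{0<..}. (2 * pi * r) *\<^sub>R f r)" .
qed

section \<open>Square integrable functions\<close>

lemma integrable_mult_L2:
  fixes f g :: "'a \<Rightarrow> 'b::{real_normed_algebra, banach, second_countable_topology}"
  assumes "f \<in> borel_measurable M" "g \<in> borel_measurable M"
    and "integrable M (\<lambda>x. (norm (f x))^2)" "integrable M (\<lambda>x. (norm (g x))^2)"
  shows "integrable M (\<lambda>x. f x * g x)"
proof (rule Bochner_Integration.integrable_bound[where f = "\<lambda>x. (norm (f x))^2 + (norm (g x))^2"])
  have "norm (f x * g x) \<le> (norm (f x))^2 + (norm (g x))^2" for x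
  proof -
    have "norm (f x * g x) \<le> norm (f x) * norm (g x)" by (rule norm_mult_ineq)
    also have "\<dots> \<le> (norm (f x))^2 + (norm (g x))^2"
    proof -
      have "2 * (norm (f x) * norm (g x)) \<le> (norm (f x))^2 + (norm (g x))^2"
        using sum_squares_bound[of "norm (f x)" "norm (g x)"] by (simp add: mult.assoc)
      moreover have "0 \<le> norm (f x) * norm (g x)" by simp
      ultimately show ?thesis by linarith
    qed
    finally show ?thesis .
  qed
  then show "AE x in M. norm (f x * g x) \<le> norm ((norm (f x))^2 + (norm (g x))^2)"
    by (intro AE_I2) (metis abs_of_nonneg add_nonneg_nonneg real_norm_def zero_le_power2)
qed (use assms in auto)

text \<open>
  Angular averages, as Radon-Nikodym derivatives of the image of \<open>g dz\<close> under \<open>cmod\<close>.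
\<close>
lemma angular_average_nonneg:
  fixes g :: "complex \<Rightarrow> real"
  assumes [measurable]: "g \<in> bm" and nn: "\<And>z. 0 \<le> g z"
    and int: "integrable lborel (\<lambda>z. (g z)^2)"
  obtains f :: "real \<Rightarrow> real" where "f \<in> bm" "\<And>r. 0 \<le> f r"
    "si {0<..} (\<lambda>r. (f r)^2 * r)"
    "\<forall>\<psi> \<in> bm. integrable lborel (\<lambda>z. \<psi> (cmod z) * g z) \<longleftrightarrow>
        si {0<..} (\<lambda>r. 2 * pi * r * (\<psi> r * f r))"
    "\<forall>\<psi> \<in> bm. (LINT z|lborel. \<psi> (cmod z) * g z) =
        (LBINT r:{0<..}. 2 * pi * r * (\<psi> r * f r))"
proof -
  define \<rho> where "\<rho> = distr lborel borel cmod"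
  define \<nu> where "\<nu> = distr (density lborel (\<lambda>z. ennreal (g z))) borel cmod"
  have \<rho>: "\<rho> = density lborel (\<lambda>r. ennreal (radial_density r))" by (simp add: \<rho>_def distr_cmod)
  have sets[simp, measurable_cong]: "sets \<rho> = sets borel" "sets \<nu> = sets borel" by (simp_all add: \<rho>_def \<nu>_def)
  have fin: "(\<integral>\<^sup>+z. ennreal ((g z)^2) \<partial>lborel) < \<infinity>"
    using int unfolding integrable_iff_bounded by simp
  have vimage: "cmod -` A \<in> sets borel" if "A \<in> sets borel" for A
  proof -
    have "cmod \<in> bm" by measurable
    from measurable_sets[OF this that] show ?thesis by simp
  qed
  have em\<nu>: "emeasure \<nu> A = (\<integral>\<^sup>+z. ennreal (g z) * indicator A (cmod z) \<partial>lborel)" if [measurable]: "A \<in> sets borel" for A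
  proof -
    have "emeasure \<nu> A = emeasure (density lborel (\<lambda>z. ennreal (g z))) (cmod -` A \<inter> space lborel)"
      unfolding \<nu>_def by (subst emeasure_distr) auto
    also have "\<dots> = (\<integral>\<^sup>+z. ennreal (g z) * indicator (cmod -` A \<inter> space lborel) z \<partial>lborel)"
      by (rule emeasure_density) (auto intro: vimage)
    finally show ?thesis by (simp add: indicator_def)
  qed
  have "sigma_finite_measure \<rho>"
    unfolding \<rho> by (subst sigma_finite_measure.sigma_finite_iff_density_finite[OF sigma_finite_lborel]) auto
  then interpret \<rho>: sigma_finite_measure \<rho> .
  have "absolutely_continuous \<rho> \<nu>"
    unfolding absolutely_continuous_def
  proof
    fix A assume A: "A \<in> null_sets \<rho>"
    then have [measurable]: "A \<in> sets borel" by auto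
    have "emeasure lborel (cmod -` A \<inter> space lborel) = 0"
      using A unfolding \<rho>_def by (auto simp: null_sets_def emeasure_distr)
    then have "cmod -` A \<inter> space lborel \<in> null_sets lborel"
      by (auto simp: null_sets_def intro: vimage)
    then have "AE z in lborel. z \<notin> cmod -` A \<inter> space lborel" by (rule AE_not_in)
    then have "(\<integral>\<^sup>+z. ennreal (g z) * indicator A (cmod z) \<partial>lborel) = (\<integral>\<^sup>+(z::complex). 0 \<partial>lborel)"
      by (intro nn_integral_cong_AE) (auto elim!: eventually_mono simp: indicator_def)
    then show "A \<in> null_sets \<nu>" by (simp add: null_sets_def em\<nu>)
  qed
  then obtain f where f[measurable]: "f \<in> borel_measurable \<rho>" and d: "density \<rho> f = \<nu>"
    using \<rho>.Radon_Nikodym[of \<nu>] by auto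
  have fb[measurable]: "f \<in> bm"
    using f unfolding measurable_cong_sets[OF sets(1) refl] .
  have key: "(\<integral>\<^sup>+r. f r * h r \<partial>\<rho>) = (\<integral>\<^sup>+z. ennreal (g z) * h (cmod z) \<partial>lborel)"
    if [measurable]: "h \<in> bm" for h
  proof -
    have "(\<integral>\<^sup>+r. f r * h r \<partial>\<rho>) = (\<integral>\<^sup>+r. h r \<partial>\<nu>)"
      unfolding d[symmetric] by (rule nn_integral_density[symmetric]) auto
    also have "\<dots> = (\<integral>\<^sup>+z. h (cmod z) \<partial>density lborel (\<lambda>z. ennreal (g z)))"
      unfolding \<nu>_def by (rule nn_integral_distr) auto
    also have "\<dots> = (\<integral>\<^sup>+z. ennreal (g z) * h (cmod z) \<partial>lborel)"
      by (rule nn_integral_density) auto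
    finally show ?thesis .
  qed
  have fin\<rho>: "emeasure \<rho> A < \<infinity>" if "A \<in> sets borel" "A \<subseteq> {..real n}" for A n
  proof -
    have "emeasure \<rho> A \<le> emeasure \<rho> {..real n}"
      using that by (intro emeasure_mono) auto
    also have "\<dots> = emeasure lborel (cmod -` {..real n} \<inter> space lborel)"
      unfolding \<rho>_def by (rule emeasure_distr) auto
    also have "cmod -` {..real n} \<inter> space lborel = cball 0 (real n)" by auto
    also have "emeasure lborel (cball (0::complex) (real n)) < \<infinity>"
      by (simp add: emeasure_cball)
    finally show ?thesis .
  qed
  define A where "A n = {r. f r \<le> of_nat n \<and> r \<le> real n}" for n
  have A[measurable]: "A n \<in> sets borel" for n unfolding A_def by measurable
  \<comment> \<open>Testing the average against \<open>f\<close> itself and using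
    \<open>2 * g * f \<le> f^2 + g^2\<close> bounds the norm of \<open>f\<close> by that of
    \<open>g\<close>. The truncation to \<open>A n\<close> makes the term \<open>?a\<close> finite,
    so that it can be cancelled.\<close>
  have bound: "(\<integral>\<^sup>+r. (f r)^2 * indicator (A n) r \<partial>\<rho>) \<le> (\<integral>\<^sup>+z. ennreal ((g z)^2) \<partial>lborel)" (is "?a \<le> ?b") for n
  proof -
    have "?a \<le> (\<integral>\<^sup>+r. ennreal ((real n)^2) * indicator (A n) r \<partial>\<rho>)"
    proof (intro nn_integral_mono)
      fix r
      show "(f r)^2 * indicator (A n) r \<le> ennreal ((real n)^2) * indicator (A n) r"
      proof (cases "r \<in> A n")
        case True
        then have "f r * f r \<le> of_nat n * of_nat n"
          unfolding A_def by (intro mult_mono) auto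
        with True show ?thesis
          by (simp add: power2_eq_square ennreal_of_nat_eq_real_of_nat ennreal_mult)
      qed simp
    qed
    also have "\<dots> = ennreal ((real n)^2) * emeasure \<rho> (A n)"
      by (rule nn_integral_cmult_indicator) simp
    also have "\<dots> < \<infinity>"
      using fin\<rho>[of "A n" n] by (auto simp: A_def ennreal_mult_less_top)
    finally have a_fin: "?a < \<infinity>" .
    have "2 * ?a = (\<integral>\<^sup>+r. 2 * ((f r)^2 * indicator (A n) r) \<partial>\<rho>)"
      by (rule nn_integral_cmult[symmetric]) simp
    also have "\<dots> = (\<integral>\<^sup>+r. f r * (2 * (f r * indicator (A n) r)) \<partial>\<rho>)"
      by (simp add: power2_eq_square mult_ac)
    also have "\<dots> = (\<integral>\<^sup>+z. ennreal (g z) * (2 * (f (cmod z) * indicator (A n) (cmod z))) \<partial>lborel)"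
      by (rule key) measurable
    also have "\<dots> \<le> (\<integral>\<^sup>+z. (f (cmod z))^2 * indicator (A n) (cmod z) + ennreal ((g z)^2) \<partial>lborel)"
    proof (intro nn_integral_mono)
      fix z :: complex
      show "ennreal (g z) * (2 * (f (cmod z) * indicator (A n) (cmod z))) \<le> (f (cmod z))^2 * indicator (A n) (cmod z) + ennreal ((g z)^2)"
      proof (cases "cmod z \<in> A n")
        case True
        then have "f (cmod z) < top"
          unfolding A_def by (auto intro: le_less_trans simp: of_nat_less_top)
        then obtain x where x: "f (cmod z) = ennreal x" "0 \<le> x"
          by (cases "f (cmod z)") auto
        have "g z * (2 * x) \<le> x^2 + (g z)^2"
          using sum_squares_bound[of x "g z"] by (simp add: mult_ac)
        then have "ennreal (g z * (2 * x)) \<le> ennreal (x^2 + (g z)^2)"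
          by (rule ennreal_leI)
        with True x show ?thesis
          by (simp add: ennreal_mult nn ennreal_power)
      qed simp
    qed
    also have "\<dots> = (\<integral>\<^sup>+z. (f (cmod z))^2 * indicator (A n) (cmod z) \<partial>lborel) + ?b"
      by (rule nn_integral_add) auto
    also have "(\<integral>\<^sup>+z. (f (cmod z))^2 * indicator (A n) (cmod z) \<partial>lborel) = ?a"
      unfolding \<rho>_def by (rule nn_integral_distr[symmetric]) auto
    finally have "?a + ?a \<le> ?a + ?b" by (simp add: mult_2)
    with a_fin show ?thesis by (auto simp: ennreal_add_left_cancel_le)
  qed
  \<comment> \<open>The sets \<open>A n\<close> leave out the points where \<open>f\<close> is
    infinite, so the previous bound says nothing about them. They form a null set because
    \<open>g \<le> g^2 + 1\<close> makes \<open>g\<close> integrable on discs.\<close>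
  have ftop: "AE r in \<rho>. f r < \<infinity>"
  proof -
    have "AE r in \<rho>. r \<le> real n \<longrightarrow> f r < \<infinity>" for n
    proof -
      let ?I = "indicator {..real n} :: real \<Rightarrow> ennreal"
      have "(\<integral>\<^sup>+r. f r * ?I r \<partial>\<rho>) = (\<integral>\<^sup>+z. ennreal (g z) * ?I (cmod z) \<partial>lborel)"
        by (rule key) measurable
      also have "\<dots> \<le> (\<integral>\<^sup>+z. ennreal ((g z)^2) + ?I (cmod z) \<partial>lborel)"
      proof (intro nn_integral_mono)
        fix z :: complex
        have "g z \<le> (g z)^2 + 1" using zero_le_power2[of "g z - 1"] nn[of z]
          by (simp add: power2_eq_square algebra_simps)
        then have "ennreal (g z) \<le> ennreal ((g z)^2 + 1)"
          by (rule ennreal_leI)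
        also have "\<dots> = ennreal ((g z)^2) + 1"
          using ennreal_plus[of "(g z)^2" 1] by simp
        finally have "ennreal (g z) \<le> ennreal ((g z)^2) + 1" .
        then show "ennreal (g z) * ?I (cmod z) \<le> ennreal ((g z)^2) + ?I (cmod z)"
          by (auto simp: indicator_def)
      qed
      also have "\<dots> = (\<integral>\<^sup>+z. ennreal ((g z)^2) \<partial>lborel) + (\<integral>\<^sup>+z. ?I (cmod z) \<partial>(lborel :: complex measure))"
        by (rule nn_integral_add) auto
      also have "(\<integral>\<^sup>+z. ?I (cmod z) \<partial>(lborel :: complex measure)) = emeasure \<rho> {..real n}"
      proof -
        have "(\<integral>\<^sup>+z. ?I (cmod z) \<partial>(lborel :: complex measure)) = (\<integral>\<^sup>+r. ?I r \<partial>\<rho>)"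
          unfolding \<rho>_def by (rule nn_integral_distr[symmetric]) auto
        then show ?thesis by simp
      qed
      also have "(\<integral>\<^sup>+z. ennreal ((g z)^2) \<partial>lborel) + emeasure \<rho> {..real n} < \<infinity>"
        using fin fin\<rho>[of "{..real n}" n] by simp
      finally have "AE r in \<rho>. f r * ?I r \<noteq> \<infinity>"
        by (intro nn_integral_PInf_AE) auto
      then show ?thesis
        by eventually_elim (auto simp: indicator_def less_top)
    qed
    then have "AE r in \<rho>. \<forall>n. r \<le> real n \<longrightarrow> f r < \<infinity>"
      unfolding AE_all_countable by blast
    then show ?thesis
      by eventually_elim (meson real_arch_simple)
  qed
  have L2: "(\<integral>\<^sup>+r. (f r)^2 \<partial>\<rho>) \<le> (\<integral>\<^sup>+z. ennreal ((g z)^2) \<partial>lborel)"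
  proof -
    have inc: "incseq (\<lambda>n r. (f r)^2 * indicator (A n) r)"
    proof (rule incseq_SucI, rule le_funI)
      fix n r
      have "A n \<subseteq> A (Suc n)"
        unfolding A_def by (auto intro: order_trans[of _ "of_nat n :: ennreal"])
      then show "(f r)^2 * indicator (A n) r \<le> (f r)^2 * indicator (A (Suc n)) r"
        by (intro mult_left_mono) (auto simp: indicator_def)
    qed
    have "(\<integral>\<^sup>+r. (f r)^2 \<partial>\<rho>) = (\<integral>\<^sup>+r. (SUP n. (f r)^2 * indicator (A n) r) \<partial>\<rho>)"
    proof (rule nn_integral_cong_AE)
      show "AE r in \<rho>. (f r)^2 = (SUP n. (f r)^2 * indicator (A n) r)"
        using ftop
      proof eventually_elim
        case (elim r)
        obtain n1 where n1: "f r \<le> of_nat n1"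
          using elim ennreal_Ex_less_of_nat[of "f r"] less_imp_le by (metis infinity_ennreal_def)
        obtain n2 where n2: "r \<le> real n2" using real_arch_simple by blast
        have "r \<in> A (max n1 n2)"
          unfolding A_def using n1 n2 by (auto intro: order_trans[of _ "of_nat n1 :: ennreal"])
        then have "(f r)^2 \<le> (SUP n. (f r)^2 * indicator (A n) r)"
          by (intro SUP_upper2[of "max n1 n2"]) auto
        moreover have "(SUP n. (f r)^2 * indicator (A n) r) \<le> (f r)^2"
          by (intro SUP_least) (auto simp: indicator_def)
        ultimately show ?case by (rule antisym)
      qed
    qed
    also have "\<dots> = (SUP n. \<integral>\<^sup>+r. (f r)^2 * indicator (A n) r \<partial>\<rho>)"
      by (rule nn_integral_monotone_convergence_SUP[OF inc]) measurable
    also have "\<dots> \<le> (\<integral>\<^sup>+z. ennreal ((g z)^2) \<partial>lborel)"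
      by (intro SUP_least bound)
    finally show ?thesis .
  qed
  define F where "F r = enn2real (f r)" for r
  have F[measurable]: "F \<in> bm" unfolding F_def by measurable
  have Fnn: "0 \<le> F r" for r by (simp add: F_def)
  have Ff: "AE r in \<rho>. ennreal (F r) = f r"
    using ftop by eventually_elim (simp add: F_def ennreal_enn2real_if)
  have dF: "density \<rho> (\<lambda>r. ennreal (F r)) = \<nu>"
    unfolding d[symmetric] by (rule density_cong) (use Ff in auto)
  have "(\<integral>\<^sup>+r. ennreal ((F r)^2) \<partial>\<rho>) = (\<integral>\<^sup>+r. (f r)^2 \<partial>\<rho>)"
    by (rule nn_integral_cong_AE, use Ff in eventually_elim) (metis Fnn ennreal_power)
  also have "\<dots> < \<infinity>" using L2 fin by (rule le_less_trans)
  finally have "integrable \<rho> (\<lambda>r. (F r)^2)"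
    by (intro integrableI_nonneg) (auto simp: \<rho>_def)
  then have "integrable lborel (\<lambda>r. radial_density r *\<^sub>R (F r)^2)"
    unfolding \<rho> by (subst (asm) integrable_density) (auto simp: radial_density_nonneg)
  then have "integrable lborel (\<lambda>r. inverse (2 * pi) * (radial_density r *\<^sub>R (F r)^2))"
    by (intro integrable_mult_right impI)
  also have "(\<lambda>r. inverse (2 * pi) * (radial_density r *\<^sub>R (F r)^2)) = (\<lambda>r. indicator {0<..} r *\<^sub>R ((F r)^2 * r))"
    by (auto simp: radial_density_def indicator_def)
  finally have int2: "si {0<..} (\<lambda>r. (F r)^2 * r)"
    unfolding set_integrable_def .
  have eq: "radial_density r *\<^sub>R (F r *\<^sub>R \<psi> r) = indicat_real {0<..} r *\<^sub>R (2 * pi * r * (\<psi> r * F r))" for r and \<psi> :: "real \<Rightarrow> real"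
    by (auto simp: radial_density_def indicator_def)
  have "integrable lborel (\<lambda>z. \<psi> (cmod z) * g z) \<longleftrightarrow> si {0<..} (\<lambda>r. 2 * pi * r * (\<psi> r * F r))"
    if [measurable]: "\<psi> \<in> bm" for \<psi> :: "real \<Rightarrow> real"
  proof -
    have "integrable lborel (\<lambda>z. \<psi> (cmod z) * g z) \<longleftrightarrow> integrable lborel (\<lambda>z. g z *\<^sub>R \<psi> (cmod z))"
      by (simp add: mult.commute)
    also have "\<dots> \<longleftrightarrow> integrable (density lborel (\<lambda>z. ennreal (g z))) (\<lambda>z. \<psi> (cmod z))"
      by (rule integrable_density[symmetric]) (auto simp: nn)
    also have "\<dots> \<longleftrightarrow> integrable \<nu> \<psi>"
      unfolding \<nu>_def by (rule integrable_distr_eq[symmetric]) auto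
    also have "\<dots> \<longleftrightarrow> integrable \<rho> (\<lambda>r. F r *\<^sub>R \<psi> r)"
      unfolding dF[symmetric] by (rule integrable_density) (auto simp: Fnn \<rho>_def)
    also have "\<dots> \<longleftrightarrow> integrable lborel (\<lambda>r. radial_density r *\<^sub>R (F r *\<^sub>R \<psi> r))"
      unfolding \<rho> by (rule integrable_density) (auto simp: radial_density_nonneg)
    finally show ?thesis by (simp only: eq set_integrable_def)
  qed
  moreover have "(LINT z|lborel. \<psi> (cmod z) * g z) = (LBINT r:{0<..}. 2 * pi * r * (\<psi> r * F r))"
    if [measurable]: "\<psi> \<in> bm" for \<psi> :: "real \<Rightarrow> real"
  proof -
    have "(LINT z|lborel. \<psi> (cmod z) * g z) = (LINT z|lborel. g z *\<^sub>R \<psi> (cmod z))"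
      by (simp add: mult.commute)
    also have "\<dots> = (LINT z|density lborel (\<lambda>z. ennreal (g z)). \<psi> (cmod z))"
      by (rule integral_density[symmetric]) (auto simp: nn)
    also have "\<dots> = integral\<^sup>L \<nu> \<psi>"
      unfolding \<nu>_def by (rule integral_distr[symmetric]) auto
    also have "\<dots> = (LINT r|\<rho>. F r *\<^sub>R \<psi> r)"
      unfolding dF[symmetric] by (rule integral_density) (auto simp: Fnn \<rho>_def)
    also have "\<dots> = (LINT r|lborel. radial_density r *\<^sub>R (F r *\<^sub>R \<psi> r))"
      unfolding \<rho> by (rule integral_density) (auto simp: radial_density_nonneg)
    finally show ?thesis by (simp only: eq set_lebesgue_integral_def)
  qed
  ultimately show ?thesis using that F Fnn int2 by blast
qed

text \<open>A class of radial weights that are square integrable over the plane, hence can be paired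
  with any \<open>L^2\<close> function. It contains the products of test functions and powers of
  \<open>r\<close> that occur below.\<close>

definition bounded_support :: "(real \<Rightarrow> real) \<Rightarrow> bool" where
  "bounded_support \<psi> \<longleftrightarrow> \<psi> \<in> bm \<and> (\<exists>B. \<forall>r. \<bar>\<psi> r\<bar> \<le> B) \<and> (\<exists>R. \<forall>r>R. \<psi> r = 0)"

lemma bounded_support_square_integrable:
  assumes "bounded_support \<psi>"
  shows "integrable lborel (\<lambda>z::complex. (\<psi> (cmod z))^2)"
proof -
  obtain B R where [measurable]: "\<psi> \<in> bm" and B: "\<And>r. \<bar>\<psi> r\<bar> \<le> B" and R: "\<And>r. r > R \<Longrightarrow> \<psi> r = 0"
    using assms unfolding bounded_support_def by blast
  show ?thesis
  proof (rule Bochner_Integration.integrable_bound)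
    show "integrable lborel (\<lambda>z::complex. indicator (cball 0 R) z *\<^sub>R B^2)"
      using emeasure_bounded_finite[OF bounded_cball, of "0::complex" R]
      by (intro integrable_scaleR_left impI) (auto simp: integrable_indicator_iff)
    show "AE z in lborel. norm ((\<psi> (cmod z))^2) \<le> norm (indicator (cball 0 R) z *\<^sub>R B^2)"
    proof (intro AE_I2)
      fix z :: complex
      have "(\<psi> (cmod z))^2 \<le> B^2" using B[of "cmod z"] by (simp add: abs_le_square_iff[symmetric])
      then show "norm ((\<psi> (cmod z))^2) \<le> norm (indicator (cball 0 R) z *\<^sub>R B^2)"
        using R[of "cmod z"] by (auto simp: indicator_def)
    qed
  qed measurable
qed

lemma angular_average_real:
  fixes g :: "complex \<Rightarrow> real"
  assumes [measurable]: "g \<in> bm" and int: "integrable lborel (\<lambda>z. (g z)^2)"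
  obtains f :: "real \<Rightarrow> real" where "f \<in> bm"
    "si {0<..} (\<lambda>r. (f r)^2 * r)"
    "\<forall>\<psi>. bounded_support \<psi> \<longrightarrow> integrable lborel (\<lambda>z. \<psi> (cmod z) * g z)"
    "\<forall>\<psi>. bounded_support \<psi> \<longrightarrow> si {0<..} (\<lambda>r. 2 * pi * r * (\<psi> r * f r))"
    "\<forall>\<psi>. bounded_support \<psi> \<longrightarrow> (LINT z|lborel. \<psi> (cmod z) * g z) =
        (LBINT r:{0<..}. 2 * pi * r * (\<psi> r * f r))"
proof -
  define gp where "gp z = max (g z) 0" for z
  define gn where "gn z = max (- g z) 0" for z
  have [measurable]: "gp \<in> bm" "gn \<in> bm"
    unfolding gp_def gn_def by measurable
  have g: "g z = gp z - gn z" for z by (simp add: gp_def gn_def)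
  have nn: "0 \<le> gp z" "0 \<le> gn z" for z by (simp_all add: gp_def gn_def)
  have i: "integrable lborel (\<lambda>z. (gp z)^2)" "integrable lborel (\<lambda>z. (gn z)^2)"
  proof -
    have *: "(gp z)^2 \<le> (g z)^2" "(gn z)^2 \<le> (g z)^2" for z
      by (auto simp: gp_def gn_def max_def)
    show "integrable lborel (\<lambda>z. (gp z)^2)" "integrable lborel (\<lambda>z. (gn z)^2)"
      by (rule Bochner_Integration.integrable_bound[OF int]; simp add: *)+
  qed
  obtain p where p: "p \<in> bm" "\<And>r. 0 \<le> p r" "si {0<..} (\<lambda>r. (p r)^2 * r)"
    "\<forall>\<psi> \<in> bm. integrable lborel (\<lambda>z. \<psi> (cmod z) * gp z) \<longleftrightarrow>
        si {0<..} (\<lambda>r. 2 * pi * r * (\<psi> r * p r))"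
    "\<forall>\<psi> \<in> bm. (LINT z|lborel. \<psi> (cmod z) * gp z) =
        (LBINT r:{0<..}. 2 * pi * r * (\<psi> r * p r))"
    by (rule angular_average_nonneg[OF \<open>gp \<in> _\<close> nn(1) i(1)]) (rule that)
  obtain n where n: "n \<in> bm" "\<And>r. 0 \<le> n r" "si {0<..} (\<lambda>r. (n r)^2 * r)"
    "\<forall>\<psi> \<in> bm. integrable lborel (\<lambda>z. \<psi> (cmod z) * gn z) \<longleftrightarrow>
        si {0<..} (\<lambda>r. 2 * pi * r * (\<psi> r * n r))"
    "\<forall>\<psi> \<in> bm. (LINT z|lborel. \<psi> (cmod z) * gn z) =
        (LBINT r:{0<..}. 2 * pi * r * (\<psi> r * n r))"
    by (rule angular_average_nonneg[OF \<open>gn \<in> _\<close> nn(2) i(2)]) (rule that)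
  note [measurable] = p(1) n(1)
  define f where "f r = p r - n r" for r
  have [measurable]: "f \<in> bm" unfolding f_def by measurable
  moreover have "si {0<..} (\<lambda>r. (f r)^2 * r)"
  proof (rule set_integrable_bound)
    show "si {0<..} (\<lambda>r. (p r)^2 * r + (n r)^2 * r)"
      using p(3) n(3) by (rule set_integral_add(1))
    show "AE r in lborel. r \<in> {0<..} \<longrightarrow> norm ((f r)^2 * r) \<le> norm ((p r)^2 * r + (n r)^2 * r)"
    proof (intro AE_I2 impI)
      fix r :: real assume "r \<in> {0<..}"
      have "(f r)^2 \<le> (p r)^2 + (n r)^2"
        using mult_nonneg_nonneg[OF n(2) p(2), of r r] by (simp add: f_def power2_diff)
      then have "(f r)^2 * r \<le> ((p r)^2 + (n r)^2) * r"
        using \<open>r \<in> {0<..}\<close> by (intro mult_right_mono) auto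
      with \<open>r \<in> {0<..}\<close> show "norm ((f r)^2 * r) \<le> norm ((p r)^2 * r + (n r)^2 * r)"
        by (simp add: algebra_simps)
    qed
  qed (auto simp: set_borel_measurable_def)
  moreover have
    "integrable lborel (\<lambda>z. \<psi> (cmod z) * g z) \<and> si {0<..} (\<lambda>r. 2 * pi * r * (\<psi> r * f r))
      \<and> (LINT z|lborel. \<psi> (cmod z) * g z) = (LBINT r:{0<..}. 2 * pi * r * (\<psi> r * f r))"
    if \<psi>: "bounded_support \<psi>" for \<psi>
  proof -
    have [measurable]: "\<psi> \<in> bm" using \<psi> by (simp add: bounded_support_def)
    have i1: "integrable lborel (\<lambda>z. \<psi> (cmod z) * gp z)"
      by (rule integrable_mult_L2) (use i bounded_support_square_integrable[OF \<psi>] in auto)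
    have i2: "integrable lborel (\<lambda>z. \<psi> (cmod z) * gn z)"
      by (rule integrable_mult_L2) (use i bounded_support_square_integrable[OF \<psi>] in auto)
    have j1: "si {0<..} (\<lambda>r. 2 * pi * r * (\<psi> r * p r))"
      using i1 bspec[OF p(4), of \<psi>] by simp
    have j2: "si {0<..} (\<lambda>r. 2 * pi * r * (\<psi> r * n r))"
      using i2 bspec[OF n(4), of \<psi>] by simp
    have e1: "\<psi> (cmod z) * g z = \<psi> (cmod z) * gp z - \<psi> (cmod z) * gn z" for z
      by (simp add: g algebra_simps)
    have e2: "2 * pi * r * (\<psi> r * f r) = 2 * pi * r * (\<psi> r * p r) - 2 * pi * r * (\<psi> r * n r)" for r
      by (simp add: f_def algebra_simps)
    show ?thesis
      unfolding e1 e2 set_integral_diff(2)[OF j1 j2] Bochner_Integration.integral_diff[OF i1 i2]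
      using i1 i2 bspec[OF p(5), of \<psi>] bspec[OF n(5), of \<psi>] set_integral_diff(1)[OF j1 j2] by simp
  qed
  ultimately show ?thesis using that by blast
qed

lemma angular_average:
  fixes g :: "complex \<Rightarrow> complex"
  assumes [measurable]: "g \<in> bm" and int: "integrable lborel (\<lambda>z. nsq (g z))"
  obtains f :: "real \<Rightarrow> complex" where "f \<in> bm"
    "si {0<..} (\<lambda>r. nsq (f r) * r)"
    "\<forall>\<psi>. bounded_support \<psi> \<longrightarrow> si {0<..} (\<lambda>r. (2 * pi * r * \<psi> r) *\<^sub>R f r)"
    "\<forall>\<psi>. bounded_support \<psi> \<longrightarrow> (LINT z|lborel. \<psi> (cmod z) *\<^sub>R g z) =
        (LBINT r:{0<..}. (2 * pi * r * \<psi> r) *\<^sub>R f r)"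
proof -
  have i: "integrable lborel (\<lambda>z. (Re (g z))^2)" "integrable lborel (\<lambda>z. (Im (g z))^2)"
    by (rule Bochner_Integration.integrable_bound[OF int]; simp add: cmod_power2)+
  obtain a where a: "a \<in> bm"
    "si {0<..} (\<lambda>r. (a r)^2 * r)"
    "\<forall>\<psi>. bounded_support \<psi> \<longrightarrow> integrable lborel (\<lambda>z. \<psi> (cmod z) * Re (g z))"
    "\<forall>\<psi>. bounded_support \<psi> \<longrightarrow> si {0<..} (\<lambda>r. 2 * pi * r * (\<psi> r * a r))"
    "\<forall>\<psi>. bounded_support \<psi> \<longrightarrow> (LINT z|lborel. \<psi> (cmod z) * Re (g z)) =
        (LBINT r:{0<..}. 2 * pi * r * (\<psi> r * a r))"
    by (rule angular_average_real[OF measurable_compose[OF assms(1) borel_measurable_Re] i(1)]) (rule that)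
  obtain b where b: "b \<in> bm"
    "si {0<..} (\<lambda>r. (b r)^2 * r)"
    "\<forall>\<psi>. bounded_support \<psi> \<longrightarrow> integrable lborel (\<lambda>z. \<psi> (cmod z) * Im (g z))"
    "\<forall>\<psi>. bounded_support \<psi> \<longrightarrow> si {0<..} (\<lambda>r. 2 * pi * r * (\<psi> r * b r))"
    "\<forall>\<psi>. bounded_support \<psi> \<longrightarrow> (LINT z|lborel. \<psi> (cmod z) * Im (g z)) =
        (LBINT r:{0<..}. 2 * pi * r * (\<psi> r * b r))"
    by (rule angular_average_real[OF measurable_compose[OF assms(1) borel_measurable_Im] i(2)]) (rule that)
  note [measurable] = a(1) b(1)
  define f where "f r = Complex (a r) (b r)" for r
  have f: "f r = of_real (a r) + \<i> * of_real (b r)" for r by (simp add: f_def Complex_eq)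
  have "f \<in> bm" unfolding f by measurable
  moreover have "si {0<..} (\<lambda>r. nsq (f r) * r)"
    using set_integral_add(1)[OF a(2) b(2)] by (simp add: f_def cmod_power2 algebra_simps)
  moreover have "si {0<..} (\<lambda>r. (2 * pi * r * \<psi> r) *\<^sub>R f r)
      \<and> (LINT z|lborel. \<psi> (cmod z) *\<^sub>R g z) = (LBINT r:{0<..}. (2 * pi * r * \<psi> r) *\<^sub>R f r)"
    if \<psi>: "bounded_support \<psi>" for \<psi>
  proof -
    have e1: "\<psi> (cmod z) *\<^sub>R g z = of_real (\<psi> (cmod z) * Re (g z)) + \<i> * of_real (\<psi> (cmod z) * Im (g z))" for z
      by (simp add: complex_eq_iff)
    have e2: "(2 * pi * r * \<psi> r) *\<^sub>R f r =
        of_real (2 * pi * r * (\<psi> r * a r)) + \<i> * of_real (2 * pi * r * (\<psi> r * b r))" for r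
      by (simp add: f_def complex_eq_iff)
    have ir: "integrable lborel (\<lambda>z. complex_of_real (\<psi> (cmod z) * Re (g z)))"
      "integrable lborel (\<lambda>z. \<i> * complex_of_real (\<psi> (cmod z) * Im (g z)))"
      using a(3)[rule_format, OF \<psi>] b(3)[rule_format, OF \<psi>] by (auto intro!: integrable_of_real integrable_mult_right simp del: of_real_mult)
    have sr: "si {0<..} (\<lambda>r. complex_of_real (2 * pi * r * (\<psi> r * a r)))"
      "si {0<..} (\<lambda>r. complex_of_real (2 * pi * r * (\<psi> r * b r)))"
      by (rule set_integrable_bounded_linear[OF bounded_linear_of_real a(4)[rule_format, OF \<psi>]],
          rule set_integrable_bounded_linear[OF bounded_linear_of_real b(4)[rule_format, OF \<psi>]])
    have si: "si {0<..} (\<lambda>r. \<i> * complex_of_real (2 * pi * r * (\<psi> r * b r)))"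
      by (rule set_integrable_mult_right) (rule sr(2))
    have "(LBINT r:{0<..}. (2 * pi * r * \<psi> r) *\<^sub>R f r) =
        (LBINT r:{0<..}. complex_of_real (2 * pi * r * (\<psi> r * a r))) +
        \<i> * (LBINT r:{0<..}. complex_of_real (2 * pi * r * (\<psi> r * b r)))"
      unfolding e2 set_integral_mult_right[symmetric] by (rule set_integral_add(2)[OF sr(1) si])
    also have "\<dots> = of_real (LINT z|lborel. \<psi> (cmod z) * Re (g z)) + \<i> * of_real (LINT z|lborel. \<psi> (cmod z) * Im (g z))"
      unfolding a(5)[rule_format, OF \<psi>] b(5)[rule_format, OF \<psi>]
        set_integral_bounded_linear[OF bounded_linear_of_real a(4)[rule_format, OF \<psi>]]
        set_integral_bounded_linear[OF bounded_linear_of_real b(4)[rule_format, OF \<psi>]] ..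
    also have "\<dots> = (LINT z|lborel. \<psi> (cmod z) *\<^sub>R g z)"
      unfolding e1 Bochner_Integration.integral_add[OF ir] integral_mult_right_zero integral_complex_of_real ..
    finally show ?thesis
      unfolding e2 using set_integral_add(1)[OF sr(1) si] by simp
  qed
  ultimately show ?thesis using that by blast
qed

section \<open>Equivariant Sobolev functions\<close>

text \<open>The modulus is not differentiable at the origin, but \<open>\<xi>\<close> vanishes near
  it, and the formula gives the correct value there. The exponent \<open>1\<close> is written out to
  match \<open>test_fun_divide_power\<close>, which shows that the radial factor of the derivative
  is again a test function.\<close>

lemma radial_has_derivative:
  fixes z :: complex and g :: "complex \<Rightarrow> complex"
  assumes "test_fun \<xi>" "\<And>x. (\<xi> has_real_derivative \<xi>' x) (at x)" "test_fun \<xi>'"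
    and g: "(g has_derivative g') (at z)"
  shows "((\<lambda>z. of_real (\<xi> (cmod z)) * g z) has_derivative
    (\<lambda>v. of_real (\<xi> (cmod z)) * g' v + of_real (\<xi>' (cmod z) / cmod z ^ 1 * (z \<bullet> v)) * g z)) (at z)"
proof (rule has_derivative_mult)
  obtain a b where ab: "0 < a" "a < b" "\<And>x. x \<notin> {a..b} \<Longrightarrow> \<xi> x = 0"
    using test_funE[OF assms(1)] by metis
  have "((\<lambda>z. \<xi> (cmod z)) has_derivative (\<lambda>v. \<xi>' (cmod z) / cmod z ^ 1 * (z \<bullet> v))) (at z)"
  proof (cases "z = 0")
    case True
    have "((\<lambda>z. 0) has_derivative (\<lambda>v. \<xi>' (cmod z) / cmod z ^ 1 * (z \<bullet> v))) (at z)"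
      using True by simp
    then show ?thesis
      by (rule has_derivative_transform_within_open[where s = "ball 0 a"])
        (use True ab in auto)
  next
    case False
    have n: "(cmod has_derivative (\<lambda>v. v \<bullet> sgn z)) (at z)"
      by (rule has_derivative_norm[OF False])
    have "((\<lambda>z. \<xi> (cmod z)) has_derivative (\<lambda>v. \<xi>' (cmod z) * (v \<bullet> sgn z))) (at z)"
      by (rule has_derivative_compose[OF n assms(2)[unfolded has_field_derivative_def]])
    then show ?thesis
      by (simp add: sgn_div_norm inner_commute divide_inverse mult.assoc)
  qed
  then show "((\<lambda>z. complex_of_real (\<xi> (cmod z))) has_derivative
      (\<lambda>v. of_real (\<xi>' (cmod z) / cmod z ^ 1 * (z \<bullet> v)))) (at z)"
    by (rule has_derivative_of_real)
qed (rule g)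

inductive_set radial_sums :: "(complex \<Rightarrow> complex) set" where
  base: "test_fun \<xi> \<Longrightarrow> smooth g \<Longrightarrow> (\<lambda>z. of_real (\<xi> (cmod z)) * g z) \<in> radial_sums"
| add: "f \<in> radial_sums \<Longrightarrow> g \<in> radial_sums \<Longrightarrow> (\<lambda>z. f z + g z) \<in> radial_sums"

lemma radial_sums_derivative:
  assumes "h \<in> radial_sums"
  shows "\<exists>h'. (\<forall>x. (h has_derivative h' x) (at x)) \<and> (\<forall>v. (\<lambda>x. h' x v) \<in> radial_sums)"
  using assms
proof induction
  case (base \<xi> g)
  obtain \<xi>' where d: "\<And>x. (\<xi> has_real_derivative \<xi>' x) (at x)" "test_fun \<xi>'"
    using test_fun_deriv[OF base(1)] by metis
  obtain g' where g': "\<And>x. (g has_derivative g' x) (at x)" "\<And>v. smooth (\<lambda>x. g' x v)"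
    using smooth_derivative[OF base(2)] by metis
  define h' where "h' z v = of_real (\<xi> (cmod z)) * g' z v
    + of_real (\<xi>' (cmod z) / cmod z ^ 1) * (of_real (z \<bullet> v) * g z)" for z v
  have "((\<lambda>z. of_real (\<xi> (cmod z)) * g z) has_derivative h' z) (at z)" for z
    using radial_has_derivative[OF base(1) d g'(1), of z] by (simp add: h'_def[abs_def] mult.assoc)
  moreover have "(\<lambda>z. h' z v) \<in> radial_sums" for v
    unfolding h'_def
  proof (intro radial_sums.add radial_sums.base base(1) g'(2))
    show "test_fun (\<lambda>r. \<xi>' r / r ^ 1)" by (rule test_fun_divide_power[OF d(2)])
    show "smooth (\<lambda>z. complex_of_real (z \<bullet> v) * g z)"
      by (intro smooth_mult base(2) smooth_bounded_linear bounded_linear_compose[OF bounded_linear_of_real] bounded_linear_inner_left)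
  qed
  ultimately show ?case by (intro exI[of _ h'] conjI allI)
next
  case (add f g)
  obtain f' where f': "\<forall>x. (f has_derivative f' x) (at x)" "\<forall>v. (\<lambda>x. f' x v) \<in> radial_sums"
    using add.IH(1) by (elim exE conjE)
  obtain g' where g': "\<forall>x. (g has_derivative g' x) (at x)" "\<forall>v. (\<lambda>x. g' x v) \<in> radial_sums"
    using add.IH(2) by (elim exE conjE)
  show ?case
    by (intro exI[of _ "\<lambda>x v. f' x v + g' x v"] conjI allI has_derivative_add radial_sums.add
        f'[rule_format] g'[rule_format])
qed

lemma smooth_radial:
  assumes "test_fun \<xi>" "smooth g"
  shows "smooth (\<lambda>z. complex_of_real (\<xi> (cmod z)) * g z)"
  by (rule smooth_coinduct[where S = radial_sums]) (rule radial_sums.base[OF assms], rule radial_sums_derivative)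

lemma smooth_Cc_infinity:
  fixes f :: "complex \<Rightarrow> real"
  assumes "smooth f" "\<And>z. b < cmod z \<Longrightarrow> f z = 0"
  shows "f \<in> Cc_infinity UNIV"
proof -
  have "{x. f x \<noteq> 0} \<subseteq> cball 0 b"
    using assms(2) by (auto simp: not_less[symmetric])
  then have "closure {x. f x \<noteq> 0} \<subseteq> cball 0 b"
    by (rule closure_minimal) simp
  then have "compact (closure {x. f x \<noteq> 0})"
    using bounded_subset[OF bounded_cball] by (auto simp: compact_eq_bounded_closed)
  with assms(1) show ?thesis
    unfolding Cc_infinity_def smooth_def by simp
qed

lemma compact_support_square_integrable:
  fixes f :: "complex \<Rightarrow> complex"
  assumes "continuous_on UNIV f" "\<And>z. b < cmod z \<Longrightarrow> f z = 0"
  shows "integrable lborel (\<lambda>z. nsq (f z))"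
proof -
  have c: "continuous_on (cball 0 b) (\<lambda>z. nsq (f z))"
    by (intro continuous_on_power continuous_on_norm continuous_on_subset[OF assms(1)]) auto
  have "integrable lborel (\<lambda>z. indicator (cball 0 b) z *\<^sub>R nsq (f z))"
    by (rule borel_integrable_compact[OF compact_cball c])
  also have "(\<lambda>z. indicator (cball 0 b) z *\<^sub>R nsq (f z)) = (\<lambda>z. nsq (f z))"
    using assms(2) by (auto simp: fun_eq_iff indicator_def)
  finally show ?thesis .
qed

text \<open>Weak derivatives are defined by real test functions, whereas the phase
  \<open>exp(i m \<theta>)\<close> has to be cancelled by a complex one. Splitting into real and
  imaginary parts extends the class; since \<open>F\<close> and \<open>g\<close> are in
  \<open>L^2\<close>, all the integrals converge.\<close>

lemma weak_derivative_complex_test: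
  fixes F g \<Phi> :: "complex \<Rightarrow> complex"
  assumes w: "has_weak_derivative F g e UNIV" and F: "F \<in> L2_space" and g: "g \<in> L2_space"
    and \<Phi>: "smooth \<Phi>" and supp: "\<And>z. b < cmod z \<Longrightarrow> \<Phi> z = 0"
    and d: "\<And>z. (\<Phi> has_derivative \<Phi>' z) (at z)"
  shows "integrable lborel (\<lambda>z. \<Phi>' z e * F z)" "integrable lborel (\<lambda>z. \<Phi> z * g z)"
    "(LINT z|lborel. \<Phi>' z e * F z) = - (LINT z|lborel. \<Phi> z * g z)"
proof -
  have fd: "frechet_derivative \<Phi> (at z) = \<Phi>' z" for z
    using frechet_derivative_at[OF d] by simp
  have s': "smooth (\<lambda>z. \<Phi>' z e)"
    using smooth_frechet[OF \<Phi>, of e] by (simp add: fd)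
  have supp': "\<Phi>' z e = 0" if "b < cmod z" for z
  proof -
    have "((\<lambda>z. 0) has_derivative \<Phi>' z) (at z)"
    proof (rule has_derivative_transform_within_open[OF d, of "- cball 0 b"])
      show "open (- cball (0::complex) b)" by (simp add: open_Compl)
    qed (use that supp in auto)
    then have "\<Phi>' z = (\<lambda>v. 0)"
      using has_derivative_unique has_derivative_const by blast
    then show ?thesis by simp
  qed
  have m: "F \<in> borel_measurable lborel" "g \<in> borel_measurable lborel"
    "\<Phi> \<in> borel_measurable lborel" "(\<lambda>z. \<Phi>' z e) \<in> borel_measurable lborel"
    using F g smooth_continuous[OF \<Phi>] smooth_continuous[OF s'] unfolding L2_space_def
    by (auto intro: borel_measurable_continuous_onI)
  show i1: "integrable lborel (\<lambda>z. \<Phi>' z e * F z)"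
    by (rule integrable_mult_L2[OF m(4,1) compact_support_square_integrable[OF smooth_continuous[OF s'] supp']])
      (use F in \<open>auto simp: L2_space_def\<close>)
  show i2: "integrable lborel (\<lambda>z. \<Phi> z * g z)"
    by (rule integrable_mult_L2[OF m(3,2) compact_support_square_integrable[OF smooth_continuous[OF \<Phi>] supp]])
      (use g in \<open>auto simp: L2_space_def\<close>)
  have part: "(LINT z|lborel. h (\<Phi>' z e) *\<^sub>R F z) = - (LINT z|lborel. h (\<Phi> z) *\<^sub>R g z)"
    "integrable lborel (\<lambda>z. h (\<Phi>' z e) *\<^sub>R F z)" "integrable lborel (\<lambda>z. h (\<Phi> z) *\<^sub>R g z)"
    if h: "bounded_linear h" and hn: "\<And>z. \<bar>h z\<bar> \<le> cmod z" for h :: "complex \<Rightarrow> real"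
  proof -
    have "(\<lambda>z. h (\<Phi> z)) \<in> Cc_infinity UNIV"
      by (rule smooth_Cc_infinity[of _ b])
        (use smooth_bounded_linear_comp[OF h \<Phi>] supp linear_0[OF bounded_linear.linear[OF h]] in auto)
    then have "(LBINT x:UNIV. frechet_derivative (\<lambda>z. h (\<Phi> z)) (at x) e *\<^sub>R F x) =
        - (LBINT x:UNIV. h (\<Phi> x) *\<^sub>R g x)"
      using w unfolding has_weak_derivative_def by blast
    moreover have "frechet_derivative (\<lambda>z. h (\<Phi> z)) (at x) e = h (\<Phi>' x e)" for x
      using fun_cong[OF frechet_derivative_at[OF bounded_linear.has_derivative[OF h d[of x]]], of e] by simp
    ultimately show "(LINT z|lborel. h (\<Phi>' z e) *\<^sub>R F z) = - (LINT z|lborel. h (\<Phi> z) *\<^sub>R g z)"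
      by (simp add: set_lebesgue_integral_def)
    have hm: "h \<in> bm"
      by (intro borel_measurable_continuous_onI linear_continuous_on h)
    show "integrable lborel (\<lambda>z. h (\<Phi>' z e) *\<^sub>R F z)"
    proof (rule Bochner_Integration.integrable_bound[OF i1])
      show "(\<lambda>z. h (\<Phi>' z e) *\<^sub>R F z) \<in> borel_measurable lborel"
        by (intro borel_measurable_scaleR measurable_compose[OF m(4)] hm m(1))
      show "AE x in lborel. norm (h (\<Phi>' x e) *\<^sub>R F x) \<le> norm (\<Phi>' x e * F x)"
        using hn by (auto simp: norm_mult intro!: mult_right_mono)
    qed
    show "integrable lborel (\<lambda>z. h (\<Phi> z) *\<^sub>R g z)"
    proof (rule Bochner_Integration.integrable_bound[OF i2])
      show "(\<lambda>z. h (\<Phi> z) *\<^sub>R g z) \<in> borel_measurable lborel"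
        by (intro borel_measurable_scaleR measurable_compose[OF m(3)] hm m(2))
      show "AE x in lborel. norm (h (\<Phi> x) *\<^sub>R g x) \<le> norm (\<Phi> x * g x)"
        using hn by (auto simp: norm_mult intro!: mult_right_mono)
    qed
  qed
  note re = part[OF bounded_linear_Re abs_Re_le_cmod] and im = part[OF bounded_linear_Im abs_Im_le_cmod]
  have split: "x * y = Re x *\<^sub>R y + \<i> * (Im x *\<^sub>R y)" for x y :: complex
    by (simp add: complex_eq_iff)
  have "(LINT z|lborel. \<Phi>' z e * F z) = (LINT z|lborel. Re (\<Phi>' z e) *\<^sub>R F z) + \<i> * (LINT z|lborel. Im (\<Phi>' z e) *\<^sub>R F z)"
    by (subst split, subst Bochner_Integration.integral_add[OF re(2) integrable_mult_right[OF im(2)]]) (simp only: integral_mult_right_zero)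
  also have "\<dots> = - ((LINT z|lborel. Re (\<Phi> z) *\<^sub>R g z) + \<i> * (LINT z|lborel. Im (\<Phi> z) *\<^sub>R g z))"
    by (simp add: re(1) im(1))
  also have "(LINT z|lborel. Re (\<Phi> z) *\<^sub>R g z) + \<i> * (LINT z|lborel. Im (\<Phi> z) *\<^sub>R g z) = (LINT z|lborel. \<Phi> z * g z)"
    by (subst (2) split, subst Bochner_Integration.integral_add[OF re(3) integrable_mult_right[OF im(3)]]) (simp only: integral_mult_right_zero)
  finally show "(LINT z|lborel. \<Phi>' z e * F z) = - (LINT z|lborel. \<Phi> z * g z)" .
qed

text \<open>The divergence theorem for the vector field \<open>z \<mapsto> P z * (c * z)\<close>, tested against \<open>F\<close>.\<close>
lemma weak_divergence:
  fixes F g1 g2 P :: "complex \<Rightarrow> complex"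
  assumes w: "has_weak_derivative F g1 1 UNIV" "has_weak_derivative F g2 \<i> UNIV"
    and L2: "F \<in> L2_space" "g1 \<in> L2_space" "g2 \<in> L2_space"
    and P: "smooth P" and supp: "\<And>z. b < cmod z \<Longrightarrow> P z = 0"
    and d: "\<And>z. (P has_derivative P' z) (at z)"
  shows "(LINT z|lborel. (P' z (c * z) + of_real (2 * Re c) * P z) * F z) =
    - (LINT z|lborel. P z * (of_real (Re (c * z)) * g1 z + of_real (Im (c * z)) * g2 z))"
proof -
  have lin: "bounded_linear (\<lambda>z. complex_of_real (Re (c * z)))" "bounded_linear (\<lambda>z. complex_of_real (Im (c * z)))"
    by (intro bounded_linear_compose[OF bounded_linear_of_real] bounded_linear_compose[OF bounded_linear_Re]
        bounded_linear_compose[OF bounded_linear_Im] bounded_linear_mult_right)+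
  have dd: "((\<lambda>z. P z * complex_of_real (Re (c * z))) has_derivative
      (\<lambda>v. P z * of_real (Re (c * v)) + P' z v * of_real (Re (c * z)))) (at z)"
    "((\<lambda>z. P z * complex_of_real (Im (c * z))) has_derivative
      (\<lambda>v. P z * of_real (Im (c * v)) + P' z v * of_real (Im (c * z)))) (at z)" for z
    by (rule has_derivative_mult[OF d bounded_linear_imp_has_derivative[OF lin(1)]],
        rule has_derivative_mult[OF d bounded_linear_imp_has_derivative[OF lin(2)]])
  have W1: "integrable lborel (\<lambda>z. (P z * of_real (Re (c * 1)) + P' z 1 * of_real (Re (c * z))) * F z)"
    "integrable lborel (\<lambda>z. P z * of_real (Re (c * z)) * g1 z)"
    "(LINT z|lborel. (P z * of_real (Re (c * 1)) + P' z 1 * of_real (Re (c * z))) * F z) =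
      - (LINT z|lborel. P z * of_real (Re (c * z)) * g1 z)"
    by (rule weak_derivative_complex_test[OF w(1) L2(1,2) smooth_mult[OF P smooth_bounded_linear[OF lin(1)]] _ dd(1), of b],
        simp add: supp)+
  have W2: "integrable lborel (\<lambda>z. (P z * of_real (Im (c * \<i>)) + P' z \<i> * of_real (Im (c * z))) * F z)"
    "integrable lborel (\<lambda>z. P z * of_real (Im (c * z)) * g2 z)"
    "(LINT z|lborel. (P z * of_real (Im (c * \<i>)) + P' z \<i> * of_real (Im (c * z))) * F z) =
      - (LINT z|lborel. P z * of_real (Im (c * z)) * g2 z)"
    by (rule weak_derivative_complex_test[OF w(2) L2(1,3) smooth_mult[OF P smooth_bounded_linear[OF lin(2)]] _ dd(2), of b],
        simp add: supp)+
  have P': "P' z (c * z) = of_real (Re (c * z)) * P' z 1 + of_real (Im (c * z)) * P' z \<i>" for z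
  proof -
    have "linear (P' z)" using d by (rule has_derivative_linear)
    moreover have "c * z = Re (c * z) *\<^sub>R 1 + Im (c * z) *\<^sub>R \<i>" by (simp add: complex_eq_iff)
    ultimately have "P' z (c * z) = Re (c * z) *\<^sub>R P' z 1 + Im (c * z) *\<^sub>R P' z \<i>"
      by (metis linear_add linear_cmul)
    then show ?thesis by (simp add: scaleR_conv_of_real)
  qed
  have eq: "(P' z (c * z) + of_real (2 * Re c) * P z) * F z =
      (P z * of_real (Re (c * 1)) + P' z 1 * of_real (Re (c * z))) * F z +
      (P z * of_real (Im (c * \<i>)) + P' z \<i> * of_real (Im (c * z))) * F z" for z
    unfolding P' by (simp add: algebra_simps)
  have eq2: "P z * (of_real (Re (c * z)) * g1 z + of_real (Im (c * z)) * g2 z) =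
      P z * of_real (Re (c * z)) * g1 z + P z * of_real (Im (c * z)) * g2 z" for z
    by (simp add: algebra_simps)
  show ?thesis
    unfolding eq eq2 Bochner_Integration.integral_add[OF W1(1) W2(1)] Bochner_Integration.integral_add[OF W1(2) W2(2)]
      W1(3) W2(3) minus_add_distrib ..
qed

lemma H1_spaceE:
  fixes F :: "complex \<Rightarrow> complex"
  assumes "F \<in> H1_space"
  obtains g1 g2 where "F \<in> L2_space" "g1 \<in> L2_space" "g2 \<in> L2_space"
    "has_weak_derivative F g1 1 UNIV" "has_weak_derivative F g2 \<i> UNIV"
  using assms unfolding H1_space_def Basis_complex_def by blast

lemma bounded_support_test_fun:
  assumes "test_fun \<xi>"
  shows "bounded_support (\<lambda>r. \<xi> r * r ^ n)"
proof -
  obtain a b where ab: "smooth \<xi>" "0 < a" "a < b" "\<And>x. x \<notin> {a..b} \<Longrightarrow> \<xi> x = 0"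
    using test_funE[OF assms] by metis
  have c: "continuous_on UNIV (\<lambda>r. \<xi> r * r ^ n)"
    by (intro continuous_on_mult smooth_continuous[OF ab(1)] continuous_on_power continuous_on_id)
  have "compact ((\<lambda>r. \<xi> r * r ^ n) ` {a..b})"
    by (intro compact_continuous_image continuous_on_subset[OF c]) auto
  then obtain B where B: "\<forall>y\<in>(\<lambda>r. \<xi> r * r ^ n) ` {a..b}. norm y \<le> B"
    using compact_imp_bounded bounded_iff by blast
  have "\<bar>\<xi> r * r ^ n\<bar> \<le> max B 0" for r
  proof (cases "r \<in> {a..b}")
    case True
    then have "norm (\<xi> r * r ^ n) \<le> B" using B by blast
    then show ?thesis by simp
  next
    case False
    then show ?thesis using ab(4) by simp
  qed
  moreover have "\<xi> r * r ^ n = 0" if "b < r" for r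
    using ab(4)[of r] that by simp
  ultimately show ?thesis
    unfolding bounded_support_def using borel_measurable_continuous_onI[OF c] by blast
qed

lemma equivariant_of_real: "0 < r \<Longrightarrow> equivariant m u (of_real r) = u r"
  by (simp add: equivariant_def sgn_eq)

lemma locint_if_square_integrable:
  fixes u :: "real \<Rightarrow> complex"
  assumes m: "(\<lambda>r. indicator {0<..} r *\<^sub>R u r) \<in> bm"
    and i: "si {0<..} (\<lambda>r. nsq (u r) * r)"
  shows "locint u"
proof -
  define u0 where "u0 r = indicat_real {0<..} r *\<^sub>R u r" for r
  have [measurable]: "u0 \<in> bm" using m by (simp add: u0_def[abs_def])
  show ?thesis
    unfolding locint_def
  proof (intro allI impI)
    fix a b :: real assume ab: "0 < a" "a \<le> b"
    show "si {a..b} u"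
    proof (rule set_integrable_bound)
      have "si {a..b} (\<lambda>r. nsq (u r) * r)"
        by (rule set_integrable_subset[OF i]) (use ab in auto)
      then show "si {a..b} (\<lambda>r. 1 + inverse a * (nsq (u r) * r))"
        by (intro set_integral_add(1)[OF borel_integrable_atLeastAtMost'[OF continuous_on_const]] set_integrable_mult_right impI)
      have "(\<lambda>r. indicat_real {a..b} r *\<^sub>R u0 r) \<in> bm" by measurable
      also have "(\<lambda>r. indicat_real {a..b} r *\<^sub>R u0 r) = (\<lambda>r. indicat_real {a..b} r *\<^sub>R u r)"
        using ab by (auto simp: u0_def fun_eq_iff indicator_def)
      finally show "set_borel_measurable lborel {a..b} u" unfolding set_borel_measurable_def by simp
      show "AE r in lborel. r \<in> {a..b} \<longrightarrow> norm (u r) \<le> norm (1 + inverse a * (nsq (u r) * r))"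
      proof (intro AE_I2 impI)
        fix r assume r: "r \<in> {a..b}"
        have "cmod (u r) \<le> 1 + nsq (u r)"
        proof -
          have "2 * cmod (u r) \<le> nsq (u r) + 1"
            using zero_le_power2[of "cmod (u r) - 1"] by (simp add: power2_diff)
          then show ?thesis using norm_ge_zero[of "u r"] by linarith
        qed
        moreover have "nsq (u r) * 1 \<le> nsq (u r) * (inverse a * r)"
          using r ab by (intro mult_left_mono) (auto simp: field_simps)
        ultimately show "norm (u r) \<le> norm (1 + inverse a * (nsq (u r) * r))"
          by (simp add: mult_ac)
      qed
    qed
  qed
qed

text \<open>On the positive real axis the phase equals \<open>1\<close>, so \<open>u\<close> is the
  restriction of the planar function to that axis; this gives measurability. Integrability follows
  from polar coordinates because the phase has modulus \<open>1\<close> off the origin.\<close>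

lemma equivariant_L2:
  assumes "equivariant m u \<in> L2_space"
  shows "(\<lambda>r. indicator {0<..} r *\<^sub>R u r) \<in> bm"
    "si {0<..} (\<lambda>r. nsq (u r) * r)" "locint u"
proof -
  define u0 where "u0 r = indicat_real {0<..} r *\<^sub>R u r" for r
  have Fm: "equivariant m u \<in> bm" and Fi: "integrable lborel (\<lambda>z. nsq (equivariant m u z))"
    using assms unfolding L2_space_def by auto
  have "u0 = (\<lambda>r. indicat_real {0<..} r *\<^sub>R equivariant m u (of_real r))"
    by (auto simp: u0_def fun_eq_iff indicator_def equivariant_of_real)
  moreover have "(\<lambda>r. equivariant m u (complex_of_real r)) \<in> bm"
    by (rule measurable_compose[OF _ Fm]) measurable
  then have "(\<lambda>r. indicat_real {0<..} r *\<^sub>R equivariant m u (of_real r)) \<in> bm"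
    by measurable
  ultimately have m[measurable]: "u0 \<in> bm" by simp
  then show "(\<lambda>r. indicator {0<..} r *\<^sub>R u r) \<in> bm"
    by (simp add: u0_def[abs_def])
  have "AE z in lborel. nsq (equivariant m u z) = nsq (u0 (cmod z))"
    using AE_lborel_singleton[of "0::complex"]
  proof eventually_elim
    case (elim z)
    then show ?case by (simp add: equivariant_def u0_def norm_mult norm_power norm_sgn)
  qed
  then have "integrable lborel (\<lambda>z. nsq (u0 (cmod z)))"
    using Fi Fm by (subst integrable_cong_AE[symmetric]) auto
  then have "si {0<..} (\<lambda>r. (2 * pi * r) *\<^sub>R nsq (u0 r))"
    by (subst integrable_cmod[symmetric]) auto
  then have "si {0<..} (\<lambda>r. inverse (2 * pi) * ((2 * pi * r) *\<^sub>R nsq (u0 r)))"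
    by (intro set_integrable_mult_right impI)
  also have "?this \<longleftrightarrow> si {0<..} (\<lambda>r. nsq (u r) * r)"
    by (intro set_integrable_cong) (auto simp: u0_def)
  finally show i: "si {0<..} (\<lambda>r. nsq (u r) * r)" .
  show "locint u"
    using \<open>(\<lambda>r. indicator {0<..} r *\<^sub>R u r) \<in> bm\<close> i by (rule locint_if_square_integrable)
qed

lemma cnj_sgn_power_mult: "z \<noteq> 0 \<Longrightarrow> cnj (sgn z) ^ m * sgn z ^ m = 1"
  by (simp add: power_mult_distrib[symmetric] complex_norm_square[symmetric] mult.commute norm_sgn)

lemma cnj_eq_norm_sgn: "cnj z = of_real (cmod z) * cnj (sgn z)"
  by (cases "z = 0") (simp_all add: sgn_eq)

text \<open>Testing with \<open>\<xi>(|z|) * cnj z ^ m\<close> along the linear vector field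
  \<open>z \<mapsto> c * z\<close> cancels the phase. The value \<open>c = 1\<close> gives the
  radial field and \<open>c = \<i>\<close> the rotation field; \<open>v\<close> is the angular
  average of the derivative along \<open>c * z / |z|\<close>, freed of its phase.\<close>

lemma weak_divergence_radial:
  fixes c :: complex
  assumes w: "has_weak_derivative (equivariant m u) g1 1 UNIV" "has_weak_derivative (equivariant m u) g2 \<i> UNIV"
    and L2: "equivariant m u \<in> L2_space" "g1 \<in> L2_space" "g2 \<in> L2_space"
    and c: "cmod c = 1"
  obtains v where "v \<in> bm" "si {0<..} (\<lambda>r. nsq (v r) * r)"
    "\<forall>\<xi> \<xi>'. test_fun \<xi> \<longrightarrow> test_fun \<xi>' \<longrightarrow> (\<forall>x. (\<xi> has_real_derivative \<xi>' x) (at x)) \<longrightarrow>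
      (LBINT r:{0<..}. (of_real (\<xi>' r * Re c * r ^ (m + 2)) +
          of_real (\<xi> r * r ^ (m + 1)) * (of_nat m * cnj c + of_real (2 * Re c))) * u r) =
        - (LBINT r:{0<..}. (\<xi> r * r ^ (m + 2)) *\<^sub>R v r)"
proof -
  define F where "F = equivariant m u"
  define G where "G z = cnj (sgn z) ^ m * (of_real (Re (c * z) / cmod z) * g1 z + of_real (Im (c * z) / cmod z) * g2 z)" for z
  have [measurable]: "g1 \<in> bm" "g2 \<in> bm"
    using L2 unfolding L2_space_def by auto
  have gi: "integrable lborel (\<lambda>z. nsq (g1 z))" "integrable lborel (\<lambda>z. nsq (g2 z))"
    using L2 unfolding L2_space_def by auto
  have [measurable]: "(cnj :: complex \<Rightarrow> complex) \<in> bm" "(sgn :: complex \<Rightarrow> complex) \<in> bm"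
    unfolding sgn_div_norm[abs_def] by (intro borel_measurable_continuous_onI continuous_intros, measurable)
  have Gm: "G \<in> bm"
    unfolding G_def by measurable
  have "integrable lborel (\<lambda>z. nsq (G z))"
  proof (rule Bochner_Integration.integrable_bound)
    show "integrable lborel (\<lambda>z. 2 * nsq (g1 z) + 2 * nsq (g2 z))"
      using gi by auto
    show "AE z in lborel. norm (nsq (G z)) \<le> norm (2 * nsq (g1 z) + 2 * nsq (g2 z))"
    proof (intro AE_I2)
      fix z
      have le1: "\<bar>Re (c * z)\<bar> / cmod z \<le> 1" "\<bar>Im (c * z)\<bar> / cmod z \<le> 1"
        using abs_Re_le_cmod[of "c * z"] abs_Im_le_cmod[of "c * z"] c by (auto simp: norm_mult divide_le_eq_1)
      let ?X = "of_real (Re (c * z) / cmod z) * g1 z" and ?Y = "of_real (Im (c * z) / cmod z) * g2 z"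
      have "cmod (G z) = cmod (sgn z) ^ m * cmod (?X + ?Y)"
        by (simp only: G_def norm_mult norm_power complex_mod_cnj)
      also have "\<dots> \<le> 1 * cmod (?X + ?Y)"
        by (intro mult_right_mono power_le_one) (auto simp: norm_sgn)
      also have "\<dots> \<le> cmod ?X + cmod ?Y"
        using norm_triangle_ineq[of ?X ?Y] by simp
      also have "\<dots> = \<bar>Re (c * z)\<bar> / cmod z * cmod (g1 z) + \<bar>Im (c * z)\<bar> / cmod z * cmod (g2 z)"
        by (simp only: norm_mult norm_of_real abs_divide abs_norm_cancel)
      also have "\<dots> \<le> 1 * cmod (g1 z) + 1 * cmod (g2 z)"
        by (intro add_mono mult_right_mono le1) auto
      finally have "nsq (G z) \<le> (cmod (g1 z) + cmod (g2 z))^2"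
        by (intro power_mono) auto
      also have "\<dots> \<le> 2 * nsq (g1 z) + 2 * nsq (g2 z)"
        using sum_squares_bound[of "cmod (g1 z)" "cmod (g2 z)"] by (simp add: power2_sum)
      finally show "norm (nsq (G z)) \<le> norm (2 * nsq (g1 z) + 2 * nsq (g2 z))"
        by simp
    qed
  qed (use Gm in measurable)
  from Gm this obtain v where v: "v \<in> bm" "si {0<..} (\<lambda>r. nsq (v r) * r)"
    "\<forall>\<psi>. bounded_support \<psi> \<longrightarrow> si {0<..} (\<lambda>r. (2 * pi * r * \<psi> r) *\<^sub>R v r)"
    "\<forall>\<psi>. bounded_support \<psi> \<longrightarrow> (LINT z|lborel. \<psi> (cmod z) *\<^sub>R G z) = (LBINT r:{0<..}. (2 * pi * r * \<psi> r) *\<^sub>R v r)"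
    by (rule angular_average) (rule that)
  have "(LBINT r:{0<..}. (of_real (\<xi>' r * Re c * r ^ (m + 2)) +
          of_real (\<xi> r * r ^ (m + 1)) * (of_nat m * cnj c + of_real (2 * Re c))) * u r) =
        - (LBINT r:{0<..}. (\<xi> r * r ^ (m + 2)) *\<^sub>R v r)" (is "?L = - ?R")
    if t: "test_fun \<xi>" "test_fun \<xi>'" "\<forall>x. (\<xi> has_real_derivative \<xi>' x) (at x)" for \<xi> \<xi>'
  proof -
    obtain a b where ab: "smooth \<xi>" "0 < a" "a < b" "\<And>x. x \<notin> {a..b} \<Longrightarrow> \<xi> x = 0"
      using test_funE[OF t(1)] by metis
    define P where "P z = of_real (\<xi> (cmod z)) * cnj z ^ m" for z
    define P' where "P' z h = of_real (\<xi> (cmod z)) * (of_nat m * (cnj h * cnj z ^ (m - 1)))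
        + of_real (\<xi>' (cmod z) / cmod z ^ 1 * (z \<bullet> h)) * cnj z ^ m" for z h
    have "smooth P"
      unfolding P_def by (intro smooth_radial t(1) smooth_power smooth_bounded_linear bounded_linear_cnj)
    moreover have "P z = 0" if "b < cmod z" for z
      using that ab(4) by (simp add: P_def)
    moreover have "(P has_derivative P' z) (at z)" for z
    proof -
      have "((\<lambda>z. cnj z ^ m) has_derivative (\<lambda>h. of_nat m * (cnj h * cnj z ^ (m - 1)))) (at z)"
        using has_derivative_power[OF bounded_linear_imp_has_derivative[OF bounded_linear_cnj], of m z UNIV]
        by (simp add: mult.assoc)
      from radial_has_derivative[OF t(1) t(3)[rule_format] t(2) this]
      show ?thesis unfolding P_def P'_def by simp
    qed
    ultimately have PP: "smooth P" "\<And>z. b < cmod z \<Longrightarrow> P z = 0" "\<And>z. (P has_derivative P' z) (at z)"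
      by simp_all
    have div: "(LINT z|lborel. (P' z (c * z) + of_real (2 * Re c) * P z) * F z) =
        - (LINT z|lborel. P z * (of_real (Re (c * z)) * g1 z + of_real (Im (c * z)) * g2 z))"
      unfolding F_def by (rule weak_divergence[OF w L2 PP(1) _ PP(3)]) (rule PP(2))
    define u0 where "u0 r = indicat_real {0<..} r *\<^sub>R u r" for r
    have u0m[measurable]: "u0 \<in> bm"
      using equivariant_L2(1)[OF L2(1)] by (simp add: u0_def[abs_def])
    define H where "H r = (of_real (\<xi>' r * Re c * r ^ (m + 1)) +
          of_real (\<xi> r * r ^ m) * (of_nat m * cnj c + of_real (2 * Re c))) * u0 r" for r
    have [measurable]: "\<xi> \<in> bm" "\<xi>' \<in> bm"
      using t(1,2) unfolding test_fun_def by (auto intro!: borel_measurable_continuous_onI smooth_continuous)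
    have Hm: "H \<in> bm" unfolding H_def by measurable
    have "AE z in lborel. (P' z (c * z) + of_real (2 * Re c) * P z) * F z = H (cmod z)"
      using AE_lborel_singleton[of "0::complex"]
    proof eventually_elim
      case (elim z)
      define r where "r = cmod z"
      have r: "0 < r" using elim by (simp add: r_def)
      have inn: "z \<bullet> (c * z) = Re c * r^2"
        unfolding r_def cmod_power2 by (simp add: inner_complex_def algebra_simps power2_eq_square)
      \<comment> \<open>For \<open>m = 0\<close> the truncated exponent \<open>m - 1\<close> is
        harmless, since both sides carry the factor \<open>m\<close>.\<close>
      have pw: "of_nat m * (cnj (c * z) * cnj z ^ (m - 1)) = of_nat m * cnj c * cnj z ^ m"
        by (cases m) (simp_all add: mult_ac)
      have A: "P' z (c * z) + of_real (2 * Re c) * P z =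
          (of_real (\<xi>' r * Re c * r) + of_real (\<xi> r) * (of_nat m * cnj c + of_real (2 * Re c))) * cnj z ^ m"
        unfolding P'_def P_def pw inn r_def[symmetric] using r
        by (simp add: power2_eq_square algebra_simps)
      have B: "cnj z ^ m * F z = of_real (r ^ m) * u0 r"
        unfolding cnj_eq_norm_sgn[of z] F_def equivariant_def r_def[symmetric] power_mult_distrib
        using cnj_sgn_power_mult[OF elim, of m] r by (simp add: u0_def mult_ac)
      show ?case
        unfolding A mult.assoc B r_def[symmetric] H_def by (simp add: algebra_simps)
    qed
    then have "(LINT z|lborel. (P' z (c * z) + of_real (2 * Re c) * P z) * F z) = (LINT z|lborel. H (cmod z))"
    proof (rule integral_cong_AE[rotated 2])
      have "(\<lambda>z. P' z (c * z)) \<in> bm"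
        unfolding P'_def by measurable
      moreover have "P \<in> bm" unfolding P_def by measurable
      moreover have "F \<in> bm" using L2(1) by (auto simp: L2_space_def F_def)
      ultimately show "(\<lambda>z. (P' z (c * z) + of_real (2 * Re c) * P z) * F z) \<in> borel_measurable lborel"
        by measurable
    qed (use Hm in measurable)
    also have "\<dots> = (LBINT r:{0<..}. (2 * pi * r) *\<^sub>R H r)"
      by (rule integral_cmod[OF Hm])
    also have "\<dots> = (LBINT r:{0<..}. of_real (2 * pi) * ((of_real (\<xi>' r * Re c * r ^ (m + 2)) +
          of_real (\<xi> r * r ^ (m + 1)) * (of_nat m * cnj c + of_real (2 * Re c))) * u r))"
      by (intro set_lebesgue_integral_cong) (auto simp: H_def u0_def scaleR_conv_of_real algebra_simps)
    also have "\<dots> = of_real (2 * pi) * ?L" by (rule set_integral_mult_right)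
    finally have L: "(LINT z|lborel. (P' z (c * z) + of_real (2 * Re c) * P z) * F z) = of_real (2 * pi) * ?L" .
    have "P z * (of_real (Re (c * z)) * g1 z + of_real (Im (c * z)) * g2 z) = (\<xi> (cmod z) * cmod z ^ (m + 1)) *\<^sub>R G z" for z
    proof (cases "z = 0")
      case True
      then show ?thesis by simp
    next
      case False
      have *: "of_real x * p + of_real y * q = of_real n * (of_real (x / n) * p + of_real (y / n) * q)"
        if "n \<noteq> 0" for x y n :: real and p q :: complex
        using that by (simp add: distrib_left)
      have "of_real (Re (c * z)) * g1 z + of_real (Im (c * z)) * g2 z =
          of_real (cmod z) * (of_real (Re (c * z) / cmod z) * g1 z + of_real (Im (c * z) / cmod z) * g2 z)"
        by (rule *) (use False in simp)
      then show ?thesis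
        unfolding P_def G_def cnj_eq_norm_sgn[of z] power_mult_distrib
        by (simp add: scaleR_conv_of_real mult_ac)
    qed
    then have "(LINT z|lborel. P z * (of_real (Re (c * z)) * g1 z + of_real (Im (c * z)) * g2 z)) =
        (LINT z|lborel. (\<xi> (cmod z) * cmod z ^ (m + 1)) *\<^sub>R G z)" by simp
    also have "\<dots> = (LBINT r:{0<..}. (2 * pi * r * (\<xi> r * r ^ (m + 1))) *\<^sub>R v r)"
      using v(4)[rule_format, OF bounded_support_test_fun[OF t(1), of "m + 1"]] by simp
    also have "\<dots> = (LBINT r:{0<..}. of_real (2 * pi) * ((\<xi> r * r ^ (m + 2)) *\<^sub>R v r))"
      by (intro set_lebesgue_integral_cong) (auto simp: scaleR_conv_of_real algebra_simps)
    also have "\<dots> = of_real (2 * pi) * ?R" by (rule set_integral_mult_right)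
    finally have "of_real (2 * pi) * ?L = - (of_real (2 * pi) * ?R)"
      using div L by simp
    then have "complex_of_real (2 * pi) * ?L = of_real (2 * pi) * (- ?R)" by simp
    then show "?L = - ?R"
      by (subst (asm) mult_cancel_left) simp
  qed
  then show ?thesis using that v(1,2) by blast
qed

text \<open>The choice \<open>c = 1\<close> in the radial divergence identity shows that
  \<open>v\<close> is the weak derivative in \<open>r\<close>. The choice \<open>c = \<i>\<close>
  gives \<open>i m \<epsilon> = r t\<close> almost everywhere with \<open>t\<close> square
  integrable against \<open>r dr\<close>, and this is the integrability of
  \<open>m^2 |e|^2 / r\<close>.\<close>

lemma H1m_radial:
  assumes "\<epsilon> \<in> H1m m"
  obtains e v where "ac e v" "e \<in> bm" "v \<in> bm"
    "AE r in lborel. 0 < r \<longrightarrow> \<epsilon> r = e r" "has_weak_derivative \<epsilon> v 1 {0<..}"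
    "si {0<..} (\<lambda>r. nsq (v r) * r)"
    "si {0<..} (\<lambda>r. nsq (e r) * r)"
    "si {0<..} (\<lambda>r. (real m)^2 * nsq (e r) / r)"
proof -
  obtain g1 g2 where F: "equivariant m \<epsilon> \<in> L2_space" and g: "g1 \<in> L2_space" "g2 \<in> L2_space"
    and w: "has_weak_derivative (equivariant m \<epsilon>) g1 1 UNIV" "has_weak_derivative (equivariant m \<epsilon>) g2 \<i> UNIV"
    using H1_spaceE[of "equivariant m \<epsilon>"] assms unfolding H1m_def by blast
  note \<epsilon> = equivariant_L2[OF F]
  obtain v where v: "v \<in> bm" "si {0<..} (\<lambda>r. nsq (v r) * r)"
    and vt: "\<forall>\<xi> \<xi>'. test_fun \<xi> \<longrightarrow> test_fun \<xi>' \<longrightarrow> (\<forall>x. (\<xi> has_real_derivative \<xi>' x) (at x)) \<longrightarrow>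
      (LBINT r:{0<..}. (of_real (\<xi>' r * Re 1 * r ^ (m + 2)) +
          of_real (\<xi> r * r ^ (m + 1)) * (of_nat m * cnj 1 + of_real (2 * Re 1))) * \<epsilon> r) =
        - (LBINT r:{0<..}. (\<xi> r * r ^ (m + 2)) *\<^sub>R v r)"
    by (rule weak_divergence_radial[OF w F g norm_one]) (rule that)
  obtain t where t: "t \<in> bm" "si {0<..} (\<lambda>r. nsq (t r) * r)"
    and tt: "\<forall>\<xi> \<xi>'. test_fun \<xi> \<longrightarrow> test_fun \<xi>' \<longrightarrow> (\<forall>x. (\<xi> has_real_derivative \<xi>' x) (at x)) \<longrightarrow>
      (LBINT r:{0<..}. (of_real (\<xi>' r * Re \<i> * r ^ (m + 2)) +
          of_real (\<xi> r * r ^ (m + 1)) * (of_nat m * cnj \<i> + of_real (2 * Re \<i>))) * \<epsilon> r) =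
        - (LBINT r:{0<..}. (\<xi> r * r ^ (m + 2)) *\<^sub>R t r)"
    by (rule weak_divergence_radial[OF w F g norm_ii]) (rule that)
  have lv: "locint v" and lt: "locint t"
    using v t by (auto intro!: locint_if_square_integrable borel_measurable_scaleR)
  have W: "has_weak_derivative \<epsilon> v 1 {0<..}"
    unfolding has_weak_derivative_half_line
  proof (intro conjI \<epsilon>(3) lv allI impI)
    fix \<zeta> \<zeta>' :: "real \<Rightarrow> real"
    assume z: "test_fun \<zeta>" "test_fun \<zeta>'" "\<forall>x. (\<zeta> has_real_derivative \<zeta>' x) (at x)"
    \<comment> \<open>The power is the one on the right-hand side of \<open>vt\<close>;
      differentiating \<open>\<xi> r * r ^ (m + 2) = \<zeta> r\<close> then reproduces the integrand
      on the left, because the divergence of the radial field contributes the \<open>2\<close> in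
      \<open>m + 2\<close>.\<close>
    define \<xi> where "\<xi> r = \<zeta> r / r ^ (m + 2)" for r
    have x: "test_fun \<xi>" unfolding \<xi>_def[abs_def] by (rule test_fun_divide_power[OF z(1)])
    obtain \<xi>' where x': "\<And>r. (\<xi> has_real_derivative \<xi>' r) (at r)" "test_fun \<xi>'"
      using test_fun_deriv[OF x] by metis
    have e1: "\<xi> r * r ^ (m + 2) = \<zeta> r" if "0 < r" for r using that by (simp add: \<xi>_def)
    have e2: "\<xi>' r * r ^ (m + 2) + \<xi> r * r ^ (m + 1) * (real m + 2) = \<zeta>' r" if r: "0 < r" for r
    proof -
      have "((\<lambda>r. \<xi> r * r ^ (m + 2)) has_real_derivative \<xi>' r * r ^ (m + 2) + real (m + 2) * (1 * r ^ (m + 2 - Suc 0)) * \<xi> r) (at r)"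
        by (rule DERIV_mult[OF x'(1) DERIV_power[OF DERIV_ident]])
      moreover have "((\<lambda>r. \<xi> r * r ^ (m + 2)) has_real_derivative \<zeta>' r) (at r)"
        by (rule has_field_derivative_transform_within_open[where S = "{0<..}", OF z(3)[rule_format]])
          (use r e1 in auto)
      ultimately have "\<xi>' r * r ^ (m + 2) + real (m + 2) * (1 * r ^ (m + 2 - Suc 0)) * \<xi> r = \<zeta>' r"
        by (rule DERIV_unique)
      then show ?thesis by (simp add: algebra_simps)
    qed
    have "(LBINT r:{0<..}. \<zeta>' r *\<^sub>R \<epsilon> r) = (LBINT r:{0<..}. (of_real (\<xi>' r * Re 1 * r ^ (m + 2)) +
          of_real (\<xi> r * r ^ (m + 1)) * (of_nat m * cnj 1 + of_real (2 * Re 1))) * \<epsilon> r)"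
    proof (intro set_lebesgue_integral_cong allI impI)
      fix r :: real assume "r \<in> {0<..}"
      then have "complex_of_real (\<zeta>' r) = of_real (\<xi>' r * r ^ (m + 2) + \<xi> r * r ^ (m + 1) * (real m + 2))"
        using e2[of r] by simp
      then show "\<zeta>' r *\<^sub>R \<epsilon> r = (of_real (\<xi>' r * Re 1 * r ^ (m + 2)) +
          of_real (\<xi> r * r ^ (m + 1)) * (of_nat m * cnj 1 + of_real (2 * Re 1))) * \<epsilon> r"
        by (simp add: scaleR_conv_of_real)
    qed simp
    also have "\<dots> = - (LBINT r:{0<..}. (\<xi> r * r ^ (m + 2)) *\<^sub>R v r)"
      using vt x x' by blast
    also have "(LBINT r:{0<..}. (\<xi> r * r ^ (m + 2)) *\<^sub>R v r) = (LBINT r:{0<..}. \<zeta> r *\<^sub>R v r)"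
      by (intro set_lebesgue_integral_cong) (use e1 in auto)
    finally show "(LBINT r:{0<..}. \<zeta>' r *\<^sub>R \<epsilon> r) = - (LBINT r:{0<..}. \<zeta> r *\<^sub>R v r)" .
  qed
  have l1: "locint (\<lambda>r. \<i> * of_nat m * \<epsilon> r)" and l2: "locint (\<lambda>r. of_real r * t r)"
    by (intro locint_mult_continuous \<epsilon>(3) lt continuous_intros)+
  have "AE r in lborel. 0 < r \<longrightarrow> \<i> * of_nat m * \<epsilon> r - of_real r * t r = 0"
  proof (rule fundamental_lemma[OF locint_diff[OF l1 l2]])
    fix \<phi> assume p: "test_fun \<phi>"
    \<comment> \<open>For the rotation field \<open>Re \<i> = 0\<close> removes the term with
      \<open>\<xi>'\<close>. The identity becomes algebraic, so one power of \<open>r\<close> less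
      is divided out.\<close>
    define \<xi> where "\<xi> r = \<phi> r / r ^ (m + 1)" for r
    have x: "test_fun \<xi>" unfolding \<xi>_def[abs_def] by (rule test_fun_divide_power[OF p])
    obtain \<xi>' where x': "\<And>r. (\<xi> has_real_derivative \<xi>' r) (at r)" "test_fun \<xi>'"
      using test_fun_deriv[OF x] by metis
    have e1: "\<xi> r * r ^ (m + 1) = \<phi> r" if "0 < r" for r using that by (simp add: \<xi>_def)
    have e2: "\<xi> r * r ^ (m + 2) = \<phi> r * r" if "0 < r" for r
    proof -
      have "\<xi> r * r ^ (m + 2) = (\<xi> r * r ^ (m + 1)) * r" by simp
      then show ?thesis by (simp only: e1[OF that])
    qed
    have "(LBINT r:{0<..}. \<phi> r *\<^sub>R (\<i> * of_nat m * \<epsilon> r)) =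
        (LBINT r:{0<..}. (- 1) * ((of_real (\<xi>' r * Re \<i> * r ^ (m + 2)) +
          of_real (\<xi> r * r ^ (m + 1)) * (of_nat m * cnj \<i> + of_real (2 * Re \<i>))) * \<epsilon> r))"
    proof (intro set_lebesgue_integral_cong allI impI)
      fix r :: real assume "r \<in> {0<..}"
      then have "\<xi> r * r ^ (m + 1) = \<phi> r" using e1 by simp
      then show "\<phi> r *\<^sub>R (\<i> * of_nat m * \<epsilon> r) = (- 1) * ((of_real (\<xi>' r * Re \<i> * r ^ (m + 2)) +
          of_real (\<xi> r * r ^ (m + 1)) * (of_nat m * cnj \<i> + of_real (2 * Re \<i>))) * \<epsilon> r)"
        by (simp only:) (simp add: scaleR_conv_of_real)
    qed simp
    also have "\<dots> = (- 1) * (- (LBINT r:{0<..}. (\<xi> r * r ^ (m + 2)) *\<^sub>R t r))"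
      unfolding set_integral_mult_right tt[rule_format, OF x x'(2,1)] ..
    also have "\<dots> = (LBINT r:{0<..}. (\<xi> r * r ^ (m + 2)) *\<^sub>R t r)" by simp
    also have "\<dots> = (LBINT r:{0<..}. \<phi> r *\<^sub>R (of_real r * t r))"
    proof (intro set_lebesgue_integral_cong allI impI)
      fix r :: real assume "r \<in> {0<..}"
      then have "\<xi> r * r ^ (m + 2) = \<phi> r * r" using e2 by simp
      then show "(\<xi> r * r ^ (m + 2)) *\<^sub>R t r = \<phi> r *\<^sub>R (of_real r * t r)"
        by (simp only:) (simp add: scaleR_conv_of_real)
    qed simp
    finally show "(LBINT r:{0<..}. \<phi> r *\<^sub>R (\<i> * of_nat m * \<epsilon> r - of_real r * t r)) = 0"
      using set_integral_diff(2)[OF test_fun_integrable[OF p l1] test_fun_integrable[OF p l2]]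
      by (simp add: scaleR_diff_right)
  qed
  moreover obtain e where e: "ac e v" "AE r in lborel. 0 < r \<longrightarrow> \<epsilon> r = e r" "e \<in> bm"
    using weak_derivative_representative[OF W] by metis
  ultimately have ae: "AE r in lborel. 0 < r \<longrightarrow> \<i> * of_nat m * e r = of_real r * t r"
    by (auto elim: eventually_elim2)
  note [measurable] = e(3) v(1) t(1)
  have "si {0<..} (\<lambda>r. (real m)^2 * nsq (e r) / r)"
  proof (rule set_integrable_bound[OF t(2)])
    show "AE r in lborel. r \<in> {0<..} \<longrightarrow> norm ((real m)^2 * nsq (e r) / r) \<le> norm (nsq (t r) * r)"
      using ae
    proof eventually_elim
      case (elim r)
      show ?case
      proof
        assume r: "r \<in> {0<..}"
        then have "cmod (\<i> * of_nat m * e r) = cmod (of_real r * t r)" using elim by simp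
        then have "real m * cmod (e r) = r * cmod (t r)" using r by (simp add: norm_mult)
        then have "(real m)^2 * nsq (e r) = r^2 * nsq (t r)"
          by (metis power_mult_distrib)
        then show "norm ((real m)^2 * nsq (e r) / r) \<le> norm (nsq (t r) * r)"
          using r by (simp add: power2_eq_square)
      qed
    qed
  qed (auto simp: set_borel_measurable_def)
  moreover have "si {0<..} (\<lambda>r. nsq (e r) * r)"
  proof (rule set_integrable_bound[OF \<epsilon>(2)])
    show "AE r in lborel. r \<in> {0<..} \<longrightarrow> norm (nsq (e r) * r) \<le> norm (nsq (\<epsilon> r) * r)"
      using e(2) by eventually_elim auto
  qed (auto simp: set_borel_measurable_def)
  ultimately show ?thesis using that e v W by blast
qed

section \<open>Set integrals of real functions\<close>

lemma si_bound:
  fixes f g :: "real \<Rightarrow> real"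
  assumes "si S f" "g \<in> bm" "S \<in> sets borel"
    "\<And>x. x \<in> S \<Longrightarrow> \<bar>g x\<bar> \<le> f x"
  shows "si S g"
proof (rule set_integrable_bound[OF assms(1)])
  show "set_borel_measurable lborel S g"
    using assms(2,3) unfolding set_borel_measurable_def by simp
  show "AE x in lborel. x \<in> S \<longrightarrow> norm (g x) \<le> norm (f x)"
    using assms(4) by (intro AE_I2) fastforce
qed

lemma li_nonneg:
  fixes f :: "real \<Rightarrow> real"
  assumes "\<And>x. x \<in> S \<Longrightarrow> 0 \<le> f x"
  shows "0 \<le> (LBINT x:S. f x)"
  unfolding set_lebesgue_integral_def
  by (rule integral_nonneg_AE) (use assms in \<open>auto simp: indicator_def\<close>)

lemma li_mono_set:
  fixes f :: "real \<Rightarrow> real"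
  assumes "si B f" "A \<subseteq> B" "A \<in> sets borel" "\<And>x. x \<in> B \<Longrightarrow> 0 \<le> f x"
  shows "(LBINT x:A. f x) \<le> (LBINT x:B. f x)"
proof -
  have "si A f"
    by (rule set_integrable_subset[OF assms(1)]) (use assms in auto)
  then show ?thesis
    using assms unfolding set_lebesgue_integral_def set_integrable_def
    by (intro integral_mono) (auto simp: indicator_def)
qed

lemma li_split:
  fixes f :: "real \<Rightarrow> 'a::euclidean_space"
  assumes "si (A \<union> B) f" "A \<inter> B = {}" "A \<in> sets borel" "B \<in> sets borel"
  shows "(LBINT x:A \<union> B. f x) = (LBINT x:A. f x) + (LBINT x:B. f x)"
  by (rule set_integral_Un[OF assms(2)])
    (auto intro: set_integrable_subset[OF assms(1)] simp: assms(3,4))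

lemma si_bounded_interval:
  fixes f :: "real \<Rightarrow> real"
  assumes "f \<in> bm" "\<And>x. x \<in> {a<..<b} \<Longrightarrow> \<bar>f x\<bar> \<le> B"
  shows "si {a<..<b} f"
proof (rule si_bound[of _ "\<lambda>x. B"])
  show "si {a<..<b} (\<lambda>x. B)"
    by (rule set_integrable_subset[OF borel_integrable_atLeastAtMost'[OF continuous_on_const, of a b]]) auto
qed (use assms in auto)

lemma li_bounded_interval:
  fixes f :: "real \<Rightarrow> real"
  assumes "f \<in> bm" "\<And>x. x \<in> {a<..<b} \<Longrightarrow> \<bar>f x\<bar> \<le> B" "a \<le> b"
  shows "(LBINT x:{a<..<b}. f x) \<le> B * (b - a)"
proof -
  have "(LBINT x:{a<..<b}. f x) \<le> (LBINT x:{a<..<b}. B)"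
    by (rule set_integral_mono[OF si_bounded_interval[OF assms(1,2)] si_bounded_interval[of "\<lambda>x. B" a b "\<bar>B\<bar>"]])
      (use assms(2) in \<open>auto simp: abs_le_iff\<close>)
  also have "\<dots> = B * (b - a)"
    using assms(3) by (simp add: set_lebesgue_integral_def)
  finally show ?thesis .
qed

lemma quadratic_nonneg_imp_discriminant:
  fixes A B C :: real
  assumes "\<And>t. 0 \<le> A + 2 * t * B + t^2 * C"
  shows "B^2 \<le> A * C"
proof (cases "C = 0")
  case True
  have "B = 0"
  proof (rule ccontr)
    assume "B \<noteq> 0"
    have "2 * (- (A + 1) / (2 * B)) * B = - (A + 1)" using \<open>B \<noteq> 0\<close> by simp
    then have "A + 2 * (- (A + 1) / (2 * B)) * B + (- (A + 1) / (2 * B))^2 * C = - 1"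
      unfolding True by linarith
    with assms[of "- (A + 1) / (2 * B)"] show False by linarith
  qed
  with True show ?thesis by simp
next
  case False
  have "0 \<le> A + 2 * (C * 0) * B + (C * 0)^2 * C" using assms[of 0] by simp
  have "C > 0"
  proof (rule ccontr)
    assume "\<not> C > 0"
    then have "C < 0" using False by simp
    define t where "t = (\<bar>A\<bar> + 2 * \<bar>B\<bar> + 1) / (- C) + 1"
    have "0 \<le> (\<bar>A\<bar> + 2 * \<bar>B\<bar> + 1) / (- C)" using \<open>C < 0\<close> by (intro divide_nonneg_pos) auto
    then have t1: "t \<ge> 1" by (simp only: t_def)
    have "t * (- C) = \<bar>A\<bar> + 2 * \<bar>B\<bar> + 1 + (- C)" unfolding t_def distrib_right using False by simp
    then have tc: "t * C \<le> - (\<bar>A\<bar> + 2 * \<bar>B\<bar> + 1)" using \<open>C < 0\<close> by simp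
    have "A + 2 * t * B + t^2 * C = A + t * (2 * B + t * C)" by (simp add: power2_eq_square algebra_simps)
    also have "\<dots> \<le> A + t * (- \<bar>A\<bar> - 1)"
      using tc t1 by (intro add_left_mono mult_left_mono) auto
    also have "\<dots> \<le> A + 1 * (- \<bar>A\<bar> - 1)"
      using t1 by (intro add_left_mono mult_right_mono_neg) auto
    also have "\<dots> < 0" by simp
    finally show False using assms[of t] by simp
  qed
  have "0 \<le> A + 2 * (- B / C) * B + (- B / C)^2 * C" by (rule assms)
  also have "\<dots> = A - B^2 / C" using False by (simp add: field_simps power2_eq_square)
  finally show ?thesis using \<open>C > 0\<close> by (simp add: field_simps)
qed

lemma
  fixes f g :: "real \<Rightarrow> real"
  assumes [measurable]: "f \<in> bm" "g \<in> bm" and S: "S \<in> sets borel"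
    and f: "si S (\<lambda>x. (f x)^2)" and g: "si S (\<lambda>x. (g x)^2)"
  shows si_mult: "si S (\<lambda>x. f x * g x)"
    and li_Cauchy_Schwarz: "(LBINT x:S. f x * g x)^2 \<le> (LBINT x:S. (f x)^2) * (LBINT x:S. (g x)^2)"
proof -
  show i: "si S (\<lambda>x. f x * g x)"
  proof (rule si_bound[OF set_integral_add(1)[OF f g] _ S])
    show "\<bar>f x * g x\<bar> \<le> (f x)^2 + (g x)^2" for x
    proof -
      have "2 * (\<bar>f x\<bar> * \<bar>g x\<bar>) \<le> (f x)^2 + (g x)^2"
        using sum_squares_bound[of "\<bar>f x\<bar>" "\<bar>g x\<bar>"] by (simp add: mult.assoc)
      moreover have "0 \<le> \<bar>f x\<bar> * \<bar>g x\<bar>" by simp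
      ultimately show ?thesis unfolding abs_mult by linarith
    qed
  qed measurable
  show "(LBINT x:S. f x * g x)^2 \<le> (LBINT x:S. (f x)^2) * (LBINT x:S. (g x)^2)"
  proof (rule quadratic_nonneg_imp_discriminant)
    fix t
    have "0 \<le> (LBINT x:S. (f x + t * g x)^2)" by (rule li_nonneg) simp
    also have "\<dots> = (LBINT x:S. ((f x)^2 + 2 * t * (f x * g x)) + t^2 * (g x)^2)"
      by (simp add: power2_sum power_mult_distrib mult_ac add_ac)
    also have "\<dots> = (LBINT x:S. (f x)^2 + 2 * t * (f x * g x)) + (LBINT x:S. t^2 * (g x)^2)"
      by (rule set_integral_add(2)[OF set_integral_add(1)[OF f set_integrable_mult_right[OF i]] set_integrable_mult_right[OF g]])
    also have "(LBINT x:S. (f x)^2 + 2 * t * (f x * g x)) = (LBINT x:S. (f x)^2) + (LBINT x:S. 2 * t * (f x * g x))"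
      by (rule set_integral_add(2)[OF f set_integrable_mult_right[OF i]])
    finally show "0 \<le> (LBINT x:S. (f x)^2) + 2 * t * (LBINT x:S. f x * g x) + t^2 * (LBINT x:S. (g x)^2)"
      unfolding set_integral_mult_right .
  qed
qed

lemma li_abs_le:
  fixes f g :: "real \<Rightarrow> real"
  assumes "si S g" "f \<in> bm" "S \<in> sets borel" "\<And>x. x \<in> S \<Longrightarrow> \<bar>f x\<bar> \<le> g x"
  shows "\<bar>LBINT x:S. f x\<bar> \<le> (LBINT x:S. g x)"
proof -
  have i: "si S f" using assms by (rule si_bound)
  have n: "si S (\<lambda>x. - f x)"
    by (rule si_bound[OF assms(1)]) (use assms in auto)
  have "(LBINT x:S. f x) \<le> (LBINT x:S. g x)"
    by (rule set_integral_mono[OF i assms(1)]) (use assms(4) in \<open>fastforce simp: abs_le_iff\<close>)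
  moreover have "(LBINT x:S. - f x) \<le> (LBINT x:S. g x)"
    by (rule set_integral_mono[OF n assms(1)]) (use assms(4) in \<open>fastforce simp: abs_le_iff\<close>)
  ultimately show ?thesis using set_integral_uminus[OF i] by linarith
qed

text \<open>Monotone convergence in a form that yields integrability together with the bound. It
  serves at the ends \<open>0\<close> and infinity, where only estimates uniform in a cut-off are at
  hand.\<close>

lemma
  fixes f :: "real \<Rightarrow> real"
  assumes [measurable]: "f \<in> bm" "\<And>n. A n \<in> sets borel" and inc: "incseq A" and S: "(\<Union>n. A n) = S"
    and nn: "\<And>x. x \<in> S \<Longrightarrow> 0 \<le> f x" and i: "\<And>n. si (A n) f"
    and b: "\<And>n. (LBINT x:A n. f x) \<le> K"
  shows si_incseq: "si S f" and li_incseq: "(LBINT x:S. f x) \<le> K"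
proof -
  have K: "0 \<le> K"
  proof -
    have "0 \<le> (LBINT x:A 0. f x)" by (rule li_nonneg) (use S nn in auto)
    then show ?thesis using b[of 0] by linarith
  qed
  have [measurable]: "S \<in> sets borel" unfolding S[symmetric] by measurable
  have nnA: "0 \<le> indicator (A n) x * f x" for n x
    using nn S by (auto simp: indicator_def)
  have "(\<integral>\<^sup>+x. ennreal (indicator S x * f x) \<partial>lborel) = (\<integral>\<^sup>+x. (SUP n. ennreal (indicator (A n) x * f x)) \<partial>lborel)"
  proof (rule nn_integral_cong)
    fix x
    show "ennreal (indicator S x * f x) = (SUP n. ennreal (indicator (A n) x * f x))"
    proof (cases "x \<in> S")
      case True
      then obtain n where "x \<in> A n" using S by blast
      have "(SUP n. ennreal (indicator (A n) x * f x)) = ennreal (f x)"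
      proof (rule antisym)
        show "(SUP n. ennreal (indicator (A n) x * f x)) \<le> ennreal (f x)"
          by (rule SUP_least) (auto simp: indicator_def)
        show "ennreal (f x) \<le> (SUP n. ennreal (indicator (A n) x * f x))"
          by (rule SUP_upper2[of n]) (use \<open>x \<in> A n\<close> in auto)
      qed
      with True show ?thesis by simp
    next
      case False
      then have "x \<notin> A n" for n using S by blast
      with False show ?thesis by simp
    qed
  qed
  also have "\<dots> = (SUP n. \<integral>\<^sup>+x. ennreal (indicator (A n) x * f x) \<partial>lborel)"
  proof (rule nn_integral_monotone_convergence_SUP)
    show "incseq (\<lambda>n x. ennreal (indicator (A n) x * f x))"
    proof (rule incseq_SucI, rule le_funI, rule ennreal_leI)
      fix n x
      have "A n \<subseteq> A (Suc n)" using inc by (simp add: incseq_SucD)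
      then show "indicator (A n) x * f x \<le> indicator (A (Suc n)) x * f x"
        using nnA[of "Suc n" x] by (auto simp: indicator_def)
    qed
  qed measurable
  also have "\<dots> \<le> ennreal K"
  proof (rule SUP_least)
    fix n
    have "(\<integral>\<^sup>+x. ennreal (indicator (A n) x * f x) \<partial>lborel) = ennreal (LINT x|lborel. indicator (A n) x * f x)"
      using i[of n] nnA by (intro nn_integral_eq_integral) (auto simp: set_integrable_def)
    also have "\<dots> \<le> ennreal K"
      using b[of n] by (intro ennreal_leI) (simp add: set_lebesgue_integral_def)
    finally show "(\<integral>\<^sup>+x. ennreal (indicator (A n) x * f x) \<partial>lborel) \<le> ennreal K" .
  qed
  finally have fin: "(\<integral>\<^sup>+x. ennreal (indicator S x * f x) \<partial>lborel) \<le> ennreal K" .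
  have nnS: "0 \<le> indicator S x * f x" for x using nn by (auto simp: indicator_def)
  have int: "integrable lborel (\<lambda>x. indicator S x * f x)"
    by (rule integrableI_nonneg) (use le_less_trans[OF fin ennreal_less_top] nnS in auto)
  then show "si S f" by (simp add: set_integrable_def)
  have "ennreal (LINT x|lborel. indicator S x * f x) \<le> ennreal K"
    using fin nn_integral_eq_integral[OF int] nnS by simp
  then show "(LBINT x:S. f x) \<le> K"
    using K by (simp add: set_lebesgue_integral_def)
qed

lemma incseq_open_at_0: "incseq (\<lambda>n. {1 / real (Suc n)..<R})"
proof (rule incseq_SucI)
  fix n
  have "1 / real (Suc (Suc n)) \<le> 1 / real (Suc n)" by (intro divide_left_mono) auto
  then show "{1 / real (Suc n)..<R} \<subseteq> {1 / real (Suc (Suc n))..<R}" by auto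
qed

lemma Union_open_at_0: "(\<Union>n. {1 / real (Suc n)..<R}) = {0<..<R}"
proof (rule set_eqI, rule iffI)
  fix x assume "x \<in> (\<Union>n. {1 / real (Suc n)..<R})"
  then obtain n where "1 / real (Suc n) \<le> x" "x < R" by auto
  moreover from this have "0 < x"
    by (intro less_le_trans[of 0 "1 / real (Suc n)" x]) auto
  ultimately show "x \<in> {0<..<R}" by simp
next
  fix x assume x: "x \<in> {0<..<R}"
  then obtain n where "inverse (real (Suc n)) < x" using reals_Archimedean by auto
  with x show "x \<in> (\<Union>n. {1 / real (Suc n)..<R})" by (auto simp: inverse_eq_divide intro!: exI[of _ n])
qed

lemma
  fixes f :: "real \<Rightarrow> real"
  assumes "f \<in> bm" "\<And>x. 0 < x \<Longrightarrow> x < R \<Longrightarrow> 0 \<le> f x"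
    "\<And>d. 0 < d \<Longrightarrow> d < R \<Longrightarrow> si {d..<R} f \<and> (LBINT x:{d..<R}. f x) \<le> K" "0 \<le> K"
  shows si_at_0: "si {0<..<R} f" and li_at_0: "(LBINT x:{0<..<R}. f x) \<le> K"
proof -
  have *: "si {1 / real (Suc n)..<R} f \<and> (LBINT x:{1 / real (Suc n)..<R}. f x) \<le> K" for n
  proof (cases "1 / real (Suc n) < R")
    case True
    then show ?thesis by (intro assms(3)) auto
  next
    case False
    then have "{1 / real (Suc n)..<R} = {}" by auto
    with assms(4) show ?thesis by (simp add: set_lebesgue_integral_def)
  qed
  show "si {0<..<R} f"
    by (rule si_incseq[OF assms(1) _ incseq_open_at_0 Union_open_at_0]) (use assms(2) * in auto)
  show "(LBINT x:{0<..<R}. f x) \<le> K"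
    by (rule li_incseq[OF assms(1) _ incseq_open_at_0 Union_open_at_0]) (use assms(2) * in auto)
qed

lemma
  fixes f :: "real \<Rightarrow> real"
  assumes "f \<in> bm" "\<And>x. R \<le> x \<Longrightarrow> 0 \<le> f x"
    "\<And>b. R \<le> b \<Longrightarrow> si {R..b} f \<and> (LBINT x:{R..b}. f x) \<le> K"
  shows si_at_infinity: "si {R..} f" and li_at_infinity: "(LBINT x:{R..}. f x) \<le> K"
proof -
  have inc: "incseq (\<lambda>n. {R..R + real n})" by (rule incseq_SucI) auto
  have un: "(\<Union>n. {R..R + real n}) = {R..}"
  proof (rule set_eqI, rule iffI)
    fix x assume "x \<in> {R..}"
    obtain n where "x - R \<le> real n" using real_arch_simple by blast
    then have "x \<in> {R..R + real n}" using \<open>x \<in> {R..}\<close> by simp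
    then show "x \<in> (\<Union>n. {R..R + real n})" by blast
  qed auto
  show "si {R..} f"
    by (rule si_incseq[OF assms(1) _ inc un, where K = K]) (use assms(2,3) in auto)
  show "(LBINT x:{R..}. f x) \<le> K"
    by (rule li_incseq[OF assms(1) _ inc un]) (use assms(2,3) in auto)
qed

text \<open>The function \<open>(A + C * \<Psi> t) * exp (- (C * (t - a)))\<close>, with
  \<open>\<Psi>\<close> the primitive of \<open>\<phi>\<close>, has nonpositive derivative and the
  value \<open>A\<close> at \<open>a\<close>.\<close>

lemma gronwall:
  fixes \<phi> :: "real \<Rightarrow> real"
  assumes c: "continuous_on {a..b} \<phi>" and C: "0 \<le> C"
    and le: "\<And>r. r \<in> {a..b} \<Longrightarrow> \<phi> r \<le> A + C * (LBINT s:{a..r}. \<phi> s)" and r: "r \<in> {a..b}"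
  shows "\<phi> r \<le> A * exp (C * (r - a))"
proof -
  define \<Psi> where "\<Psi> t = integral {a..t} \<phi>" for t
  have \<Psi>: "(LBINT s:{a..t}. \<phi> s) = \<Psi> t" if "t \<in> {a..b}" for t
    unfolding \<Psi>_def
    by (intro set_borel_integral_eq_integral(2) borel_integrable_atLeastAtMost' continuous_on_subset[OF c]) (use that in auto)
  define G where "G t = (A + C * \<Psi> t) * exp (- (C * (t - a)))" for t
  have "G r \<le> G a"
  proof (rule DERIV_nonpos_imp_decreasing_open[of a r G])
    show "a \<le> r" using r by simp
    have d\<Psi>: "(\<Psi> has_real_derivative \<phi> t) (at t within {a..b})" if "t \<in> {a..b}" for t
      unfolding \<Psi>_def by (rule integral_has_real_derivative[OF c that])
    show "\<exists>y. (G has_real_derivative y) (at t) \<and> y \<le> 0" if t: "a < t" "t < r" for t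
    proof -
      have tab: "t \<in> {a<..<b}" "t \<in> {a..b}" using t r by auto
      have "(\<Psi> has_real_derivative \<phi> t) (at t within {a<..<b})"
        by (rule DERIV_subset[OF d\<Psi>[OF tab(2)]]) auto
      then have d: "(\<Psi> has_real_derivative \<phi> t) (at t)"
        using at_within_open[OF tab(1)] by simp
      have "(G has_real_derivative C * (\<phi> t - (A + C * \<Psi> t)) * exp (- (C * (t - a)))) (at t)"
        unfolding G_def by (auto intro!: derivative_eq_intros d simp: algebra_simps)
      moreover have "C * (\<phi> t - (A + C * \<Psi> t)) * exp (- (C * (t - a))) \<le> 0"
        using le[OF tab(2)] \<Psi>[OF tab(2)] C
        by (intro mult_nonpos_nonneg mult_nonneg_nonpos) auto
      ultimately show ?thesis by blast
    qed
    show "continuous_on {a..r} G"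
      unfolding G_def \<Psi>_def
      by (intro continuous_intros indefinite_integral_continuous_1 integrable_continuous_real continuous_on_subset[OF c])
        (use r in auto)
  qed
  moreover have "G a = A" by (simp add: G_def \<Psi>_def)
  ultimately have "G r \<le> A" by simp
  then have "(A + C * \<Psi> r) * exp (- (C * (r - a))) \<le> A" by (simp only: G_def)
  then have "(A + C * \<Psi> r) * exp (- (C * (r - a))) * exp (C * (r - a)) \<le> A * exp (C * (r - a))"
    by (intro mult_right_mono) auto
  then have "A + C * \<Psi> r \<le> A * exp (C * (r - a))"
    by (simp add: mult.assoc exp_add[symmetric])
  with le[OF r] \<Psi>[OF r] show ?thesis by simp
qed

section \<open>The soliton\<close>

definition q :: "nat \<Rightarrow> real \<Rightarrow> real" where
  "q m r = sqrt 8 * (real m + 1) * (r ^ m / (1 + r ^ (2 * m + 2)))"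

text \<open>The profile \<open>m + A_theta (Q m)\<close>, in closed form.\<close>
definition kq :: "nat \<Rightarrow> real \<Rightarrow> real" where
  "kq m r = real m - 2 * (real m + 1) * (r ^ (2 * m + 2) / (1 + r ^ (2 * m + 2)))"

definition qmax :: "nat \<Rightarrow> real" where
  "qmax m = sqrt 8 * (real m + 1)"

text \<open>The density of the potential part of the squared norm, with respect to \<open>dr\<close>.\<close>
definition wt :: "nat \<Rightarrow> real \<Rightarrow> real" where
  "wt m r = (real m)^2 / r + 1 / (r * (1 + (log_minus r)^2))"

lemma Q_eq_q: "Q m r = of_real (q m r)"
  by (simp add: Q_def q_def)

lemma qmax_pos: "0 < qmax m"
  by (simp add: qmax_def)

lemma one_plus_pow_pos: "0 < 1 + r ^ (2 * m + 2)" for r :: real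
proof -
  have "0 \<le> r ^ (2 * m + 2)" by (rule zero_le_even_power) simp
  then show ?thesis by linarith
qed

lemma [measurable]: "q m \<in> bm" "kq m \<in> bm" "wt m \<in> bm"
  unfolding q_def[abs_def] kq_def[abs_def] wt_def[abs_def] log_minus_def by measurable

lemma q_pos: "0 < r \<Longrightarrow> 0 < q m r"
  unfolding q_def using one_plus_pow_pos[of r m] by (intro mult_pos_pos divide_pos_pos) auto

lemma q_le_power: "0 < r \<Longrightarrow> q m r \<le> qmax m * r ^ m"
proof -
  assume "0 < r"
  then have "r ^ m / (1 + r ^ (2 * m + 2)) \<le> r ^ m / 1"
    using one_plus_pow_pos[of r m] by (intro divide_left_mono) auto
  then show ?thesis
    unfolding q_def qmax_def by (intro mult_left_mono) auto
qed

lemma q_le_qmax: "0 < r \<Longrightarrow> q m r \<le> qmax m"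
proof -
  assume r: "0 < r"
  have "r ^ m \<le> 1 + r ^ (2 * m + 2)"
  proof (cases "r \<le> 1")
    case True
    then have "r ^ m \<le> 1" using r by (intro power_le_one) auto
    then show ?thesis using r by (simp add: add_increasing2)
  next
    case False
    then have "r ^ m \<le> r ^ (2 * m + 2)" by (intro power_increasing) auto
    then show ?thesis by simp
  qed
  then have "r ^ m / (1 + r ^ (2 * m + 2)) \<le> 1"
    using one_plus_pow_pos[of r m] by simp
  then have "sqrt 8 * (real m + 1) * (r ^ m / (1 + r ^ (2 * m + 2))) \<le> sqrt 8 * (real m + 1) * 1"
    by (intro mult_left_mono) auto
  then show ?thesis by (simp add: q_def qmax_def)
qed

lemma q_decay: "1 \<le> r \<Longrightarrow> q m r \<le> qmax m / r^2"
proof -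
  assume r: "1 \<le> r"
  have "r ^ m * r^2 \<le> 1 + r ^ (2 * m + 2)"
  proof -
    have "r ^ m * r^2 = r ^ (m + 2)" by (simp only: power_add)
    also have "\<dots> \<le> r ^ (2 * m + 2)" using r by (intro power_increasing) auto
    finally show ?thesis by simp
  qed
  then have "r ^ m / (1 + r ^ (2 * m + 2)) \<le> 1 / r^2"
    using one_plus_pow_pos[of r m] r by (simp add: field_simps)
  then have "sqrt 8 * (real m + 1) * (r ^ m / (1 + r ^ (2 * m + 2))) \<le> sqrt 8 * (real m + 1) * (1 / r^2)"
    by (intro mult_left_mono) auto
  then show ?thesis by (simp add: q_def qmax_def)
qed

text \<open>This is the self-duality equation \<open>D_Q Q = 0\<close>, with \<open>kq\<close> in
  the role of \<open>m + A_theta Q\<close>.\<close>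

lemma q_deriv: "0 < r \<Longrightarrow> (q m has_real_derivative kq m r / r * q m r) (at r)"
proof -
  assume r: "0 < r"
  define p where "p = r ^ (2 * m + 2)"
  have p: "1 + p \<noteq> 0" "1 + p > 0" using one_plus_pow_pos[of r m] by (simp_all add: p_def)
  have 1: "((\<lambda>r. r ^ m) has_real_derivative real m * r ^ m / r) (at r)"
    using DERIV_pow[of m r] r by (cases m) auto
  have 2: "((\<lambda>r. 1 + r ^ (2 * m + 2)) has_real_derivative real (2 * m + 2) * p / r) (at r)"
    using DERIV_add[OF DERIV_const[of 1] DERIV_pow[of "2 * m + 2" r]] r by (simp add: p_def)
  have "((\<lambda>r. r ^ m / (1 + r ^ (2 * m + 2))) has_real_derivative
      (real m * r ^ m / r * (1 + p) - r ^ m * (real (2 * m + 2) * p / r)) / ((1 + p) * (1 + p))) (at r)"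
    using DERIV_divide[OF 1 2] p by (simp add: p_def)
  from DERIV_cmult[OF this, of "sqrt 8 * (real m + 1)"]
  have "(q m has_real_derivative sqrt 8 * (real m + 1) *
      ((real m * r ^ m / r * (1 + p) - r ^ m * (real (2 * m + 2) * p / r)) / ((1 + p) * (1 + p)))) (at r)"
    by (simp add: q_def[abs_def])
  also have "sqrt 8 * (real m + 1) *
      ((real m * r ^ m / r * (1 + p) - r ^ m * (real (2 * m + 2) * p / r)) / ((1 + p) * (1 + p))) = kq m r / r * q m r"
  proof -
    define i where "i = inverse (1 + p)"
    define j where "j = inverse r"
    define s where "s = sqrt 8 * (real m + 1)"
    have ip: "(1 + p) * i = 1" using p by (simp add: i_def)
    have "s * ((real m * r ^ m * j * (1 + p) - r ^ m * (real (2 * m + 2) * p * j)) * (i * i)) =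
        s * r ^ m * j * i * (real m * ((1 + p) * i) - 2 * (real m + 1) * (p * i))"
      by (simp add: algebra_simps)
    also have "\<dots> = (real m - 2 * (real m + 1) * (p * i)) * j * (s * (r ^ m * i))"
      unfolding ip by (simp add: algebra_simps)
    finally show ?thesis
      unfolding kq_def q_def p_def[symmetric] divide_inverse inverse_mult_distrib s_def i_def j_def .
  qed
  finally show ?thesis .
qed

text \<open>Together with the limit \<open>m\<close> at the origin this identifies the closed form
  \<open>kq\<close> with \<open>m + A_theta Q\<close>.\<close>

lemma kq_deriv: "0 < r \<Longrightarrow> (kq m has_real_derivative - ((q m r)^2 * r / 2)) (at r)"
proof -
  assume r: "0 < r"
  define p where "p = r ^ (2 * m + 2)"
  have p: "1 + p \<noteq> 0" "1 + p > 0" using one_plus_pow_pos[of r m] by (simp_all add: p_def)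
  have pr: "p = r ^ m * r ^ m * (r * r)" by (simp add: p_def power_add mult_2 power2_eq_square)
  have 1: "((\<lambda>r. r ^ (2 * m + 2)) has_real_derivative real (2 * m + 2) * p / r) (at r)"
    using DERIV_pow[of "2 * m + 2" r] r by (simp add: p_def)
  have 2: "((\<lambda>r. 1 + r ^ (2 * m + 2)) has_real_derivative real (2 * m + 2) * p / r) (at r)"
    using DERIV_add[OF DERIV_const[of 1] 1] by simp
  have "((\<lambda>r. r ^ (2 * m + 2) / (1 + r ^ (2 * m + 2))) has_real_derivative
      (real (2 * m + 2) * p / r * (1 + p) - p * (real (2 * m + 2) * p / r)) / ((1 + p) * (1 + p))) (at r)"
    using DERIV_divide[OF 1 2] p by (simp add: p_def)
  from DERIV_diff[OF DERIV_const[of "real m"] DERIV_cmult[OF this, of "2 * (real m + 1)"]]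
  have "(kq m has_real_derivative 0 - 2 * (real m + 1) *
      ((real (2 * m + 2) * p / r * (1 + p) - p * (real (2 * m + 2) * p / r)) / ((1 + p) * (1 + p)))) (at r)"
    by (simp add: kq_def[abs_def])
  also have "0 - 2 * (real m + 1) *
      ((real (2 * m + 2) * p / r * (1 + p) - p * (real (2 * m + 2) * p / r)) / ((1 + p) * (1 + p))) =
      - (4 * (real m + 1)^2 * (p / r) / ((1 + p) * (1 + p)))"
  proof -
    define i where "i = inverse (1 + p)"
    define j where "j = inverse r"
    have "0 - 2 * (real m + 1) * ((real (2 * m + 2) * p * j * (1 + p) - p * (real (2 * m + 2) * p * j)) * (i * i)) =
        - (4 * (real m + 1)^2 * (p * j) * (i * i))"
      by (simp add: algebra_simps power2_eq_square)
    then show ?thesis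
      unfolding divide_inverse inverse_mult_distrib i_def j_def .
  qed
  also have "p / r = r ^ m * r ^ m * r" using r by (simp add: pr)
  also have "- (4 * (real m + 1)^2 * (r ^ m * r ^ m * r) / ((1 + p) * (1 + p))) = - ((q m r)^2 * r / 2)"
  proof -
    have "(q m r)^2 = 8 * (real m + 1)^2 * ((r ^ m)^2 / (1 + p)^2)"
      unfolding q_def p_def[symmetric] power_mult_distrib power_divide by simp
    then show ?thesis by (simp add: power2_eq_square)
  qed
  finally show ?thesis .
qed

lemma kq_diff_nonneg: "0 < r \<Longrightarrow> 0 \<le> real m - kq m r"
  and kq_diff_le: "0 < r \<Longrightarrow> real m - kq m r \<le> 2 * (real m + 1)"
  and kq_diff_le_sq: "0 < r \<Longrightarrow> r \<le> 1 \<Longrightarrow> real m - kq m r \<le> 2 * (real m + 1) * r^2"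
proof -
  assume r: "0 < r"
  define p where "p = r ^ (2 * m + 2)"
  have p: "0 \<le> p" using r by (simp add: p_def)
  have k: "real m - kq m r = 2 * (real m + 1) * (p / (1 + p))" by (simp add: kq_def p_def)
  show "0 \<le> real m - kq m r" unfolding k using p by simp
  have "p / (1 + p) \<le> 1" using p by simp
  then have "2 * (real m + 1) * (p / (1 + p)) \<le> 2 * (real m + 1) * 1" by (intro mult_left_mono) auto
  then show "real m - kq m r \<le> 2 * (real m + 1)" unfolding k by simp
  assume r1: "r \<le> 1"
  have "p / (1 + p) \<le> p / 1" using p by (intro divide_left_mono) auto
  also have "p \<le> r^2" unfolding p_def using r r1 by (intro power_decreasing) auto
  finally have "2 * (real m + 1) * (p / (1 + p)) \<le> 2 * (real m + 1) * r^2" by (intro mult_left_mono) auto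
  then show "real m - kq m r \<le> 2 * (real m + 1) * r^2" unfolding k .
qed

text \<open>The limit at infinity is \<open>- (m + 2)\<close>. Stopping at \<open>- (3/2)\<close>
  leaves a margin of \<open>1/2\<close> above the target \<open>- 1\<close>, which the exterior
  estimate spends as two errors of \<open>1/4\<close> each.\<close>

lemma kq_tail: "4 * (real m + 1) \<le> r \<Longrightarrow> kq m r \<le> - (3/2)"
proof -
  assume r: "4 * (real m + 1) \<le> r"
  then have r1: "1 \<le> r" by simp
  define p where "p = r ^ (2 * m + 2)"
  have "r \<le> p" unfolding p_def using r1 by (intro self_le_power) auto
  then have p: "4 * (real m + 1) \<le> p" using r by linarith
  then have "2 * (real m + 1) / (1 + p) \<le> 1/2" by (simp add: field_simps)
  moreover have "kq m r = - (real m + 2) + 2 * (real m + 1) / (1 + p)"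
    unfolding kq_def p_def[symmetric] using p by (simp add: field_simps)
  ultimately show ?thesis by linarith
qed

section \<open>Bounds for the weight of the norm\<close>

lemma wt_nonneg: "0 < r \<Longrightarrow> 0 \<le> wt m r"
  unfolding wt_def by (intro add_nonneg_nonneg divide_nonneg_nonneg mult_nonneg_nonneg) auto

lemma wt_ge_m: "0 < r \<Longrightarrow> (real m)^2 / r \<le> wt m r"
  unfolding wt_def by simp

text \<open>The inequality \<open>- ln r \<le> 2 / sqrt r\<close> gives
  \<open>r * (1 + (log_minus r)^2) \<le> r + 4\<close>, which is at most \<open>5\<close> on the
  unit interval.\<close>

lemma wt_ge_1_5: "0 < r \<Longrightarrow> r \<le> 1 \<Longrightarrow> 1 / 5 \<le> wt m r"
proof -
  assume r: "0 < r" "r \<le> 1"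
  have "ln (1 / sqrt r) \<le> 1 / sqrt r - 1" using r by (intro ln_le_minus_one) auto
  moreover have "ln (1 / sqrt r) = - ln r / 2" using r by (simp add: ln_div ln_sqrt)
  ultimately have "- ln r \<le> 2 / sqrt r" by simp
  moreover have "0 \<le> - ln r" using r by simp
  ultimately have "(log_minus r)^2 \<le> (2 / sqrt r)^2"
    unfolding log_minus_def by (intro power_mono) auto
  also have "\<dots> = 4 / r" using r by (simp add: power_divide)
  finally have "r * (1 + (log_minus r)^2) \<le> r * (1 + 4 / r)"
    using r by (intro mult_left_mono) auto
  also have "\<dots> = r + 4" using r by (simp add: distrib_left)
  finally have "r * (1 + (log_minus r)^2) \<le> 5" using r by linarith
  moreover have "0 < r * (1 + (log_minus r)^2)" using r by (intro mult_pos_pos) (auto simp: add_pos_nonneg)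
  ultimately have "1 / 5 \<le> 1 / (r * (1 + (log_minus r)^2))" by (intro divide_left_mono) auto
  then show ?thesis unfolding wt_def using r by (simp add: add_increasing)
qed

lemma wt_ge_inverse: "1 \<le> r \<Longrightarrow> 1 / r \<le> wt m r"
  unfolding wt_def by (simp add: log_minus_def)

lemma wt_le: "0 < r \<Longrightarrow> wt m r \<le> ((real m)^2 + 1) / r"
proof -
  assume r: "0 < r"
  have "r * 1 \<le> r * (1 + (log_minus r)^2)" using r by (intro mult_left_mono) auto
  then have "1 / (r * (1 + (log_minus r)^2)) \<le> 1 / r" using r by (intro divide_left_mono) (auto simp: add_pos_nonneg)
  then show ?thesis by (simp add: wt_def add_divide_distrib)
qed

lemma wt_lower: "0 < r \<Longrightarrow> r \<le> R \<Longrightarrow> 1 \<le> R \<Longrightarrow> 1 \<le> 5 * R * wt m r"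
proof (cases "r \<le> 1")
  case True
  assume "0 < r" "1 \<le> R"
  then have "1 / 5 * 1 \<le> wt m r * R" using wt_ge_1_5[of r m] True by (intro mult_mono) auto
  then show ?thesis by (simp add: mult_ac)
next
  case False
  assume "r \<le> R" "1 \<le> R"
  have "1 = 1 / r * r" using False by simp
  also have "\<dots> \<le> wt m r * R" using False \<open>r \<le> R\<close> wt_ge_inverse[of r m] wt_nonneg[of r m] by (intro mult_mono) auto
  also have "\<dots> \<le> 5 * R * wt m r" using wt_nonneg[of r m] False \<open>1 \<le> R\<close> by simp
  finally show ?thesis .
qed

text \<open>Near the origin \<open>m - kq\<close> is of order \<open>r^2\<close>, so the singular
  factor \<open>1/r\<close> is compensated with room to spare; for \<open>r > 1\<close> the weight
  dominates \<open>1/r\<close> itself. Thus the deviation of the potential from \<open>m\<close> is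
  controlled by the norm even for \<open>m = 0\<close>.\<close>

lemma kq_diff_wt: "0 < r \<Longrightarrow> (real m - kq m r)^2 / r \<le> 20 * (real m + 1)^2 * wt m r"
proof (cases "r \<le> 1")
  case True
  assume r: "0 < r"
  have "(real m - kq m r)^2 \<le> (2 * (real m + 1) * r^2)^2"
    using kq_diff_nonneg[OF r] kq_diff_le_sq[OF r True] by (intro power_mono) auto
  also have "\<dots> = 4 * (real m + 1)^2 * (r ^ 3 * r)" by (simp add: power2_eq_square power3_eq_cube algebra_simps)
  finally have "(real m - kq m r)^2 / r \<le> 4 * (real m + 1)^2 * r ^ 3" using r by (simp add: divide_le_eq mult.assoc)
  also have "\<dots> \<le> 4 * (real m + 1)^2 * (5 * wt m r)"
  proof (intro mult_left_mono)
    have "r ^ 3 \<le> 1" using r True by (intro power_le_one) auto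
    then show "r ^ 3 \<le> 5 * wt m r" using wt_ge_1_5[OF r True, of m] by simp
  qed simp
  finally show ?thesis by simp
next
  case False
  assume r: "0 < r"
  have "(real m - kq m r)^2 \<le> (2 * (real m + 1))^2"
    using kq_diff_nonneg[OF r] kq_diff_le[OF r] by (intro power_mono) auto
  then have "(real m - kq m r)^2 / r \<le> (2 * (real m + 1))^2 * (1 / r)" using r by (simp add: divide_right_mono)
  also have "\<dots> \<le> (2 * (real m + 1))^2 * wt m r"
    using False wt_ge_inverse[of r m] by (intro mult_left_mono) auto
  also have "\<dots> \<le> 20 * (real m + 1)^2 * wt m r"
  proof (intro mult_right_mono wt_nonneg r)
    have "(2 * (real m + 1))^2 = 4 * (real m + 1)^2" by (simp only: power_mult_distrib) simp
    then show "(2 * (real m + 1))^2 \<le> 20 * (real m + 1)^2" by simp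
  qed
  finally show ?thesis .
qed

section \<open>The linearized operator near the origin\<close>

lemma ac_cmod_sq:
  assumes "ac e v"
  shows "ac (\<lambda>r. nsq (e r)) (\<lambda>r. 2 * Re (cnj (e r) * v r))"
proof -
  have "ac (\<lambda>r. cnj (e r) * e r) (\<lambda>r. cnj (e r) * v r + e r * cnj (v r))"
    by (rule ac_mult[OF ac_bounded_linear[OF bounded_linear_cnj assms] assms])
  from ac_bounded_linear[OF bounded_linear_Re this]
  show ?thesis by (simp add: cmod_power2 power2_eq_square[symmetric])
qed

text \<open>Pairs \<open>(e, v)\<close> with \<open>v = d_r e\<close>, locally of finite norm up to \<open>r = 0\<close>.\<close>
definition adml :: "nat \<Rightarrow> (real \<Rightarrow> complex) \<Rightarrow> (real \<Rightarrow> complex) \<Rightarrow> bool" where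
  "adml m e v \<longleftrightarrow> ac e v \<and> e \<in> bm \<and> v \<in> bm \<and>
    (\<forall>R. si {0<..<R} (\<lambda>r. nsq (v r) * r)) \<and>
    (\<forall>R. si {0<..<R} (\<lambda>r. wt m r * nsq (e r)))"

lemma adml_ac: "adml m e v \<Longrightarrow> ac e v"
  and adml_measurable: "adml m e v \<Longrightarrow> e \<in> bm" "adml m e v \<Longrightarrow> v \<in> bm"
  and adml_si: "adml m e v \<Longrightarrow> si {0<..<R} (\<lambda>r. nsq (v r) * r)"
    "adml m e v \<Longrightarrow> si {0<..<R} (\<lambda>r. wt m r * nsq (e r))"
  by (simp_all add: adml_def)

lemma locint_sq: "ac e v \<Longrightarrow> locint (\<lambda>r. nsq (e r))"
  by (intro locint_continuous continuous_on_power continuous_on_norm ac_continuous)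

section \<open>Hardy's inequality with a logarithmic weight\<close>

definition hardy_P :: "real \<Rightarrow> real" where "hardy_P r = 1 / (1 - ln r)"

lemma hardy_P_pos: "0 < r \<Longrightarrow> r \<le> 1 \<Longrightarrow> 0 < hardy_P r"
  using ln_le_zero_iff[of r] by (auto simp: hardy_P_def intro: le_less_trans[of _ 0])

lemma [measurable]: "hardy_P \<in> bm"
  unfolding hardy_P_def[abs_def] by measurable

lemma wt_le_hardy:
  assumes "0 < r" "r \<le> 1"
  shows "wt m r \<le> (real m)^2 / r + 2 * ((hardy_P r)^2 / r)"
proof -
  define L where "L = - ln r"
  have L: "0 \<le> L" "log_minus r = L" using assms by (auto simp: L_def log_minus_def)
  have "(1 + L)^2 \<le> 2 * (1 + L^2)" using zero_le_power2[of "1 - L"] by (simp add: power2_eq_square algebra_simps)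
  then have "1 / (1 + L^2) \<le> 2 / (1 + L)^2"
    using L by (simp add: field_simps add_pos_nonneg)
  then have "1 / (1 + L^2) / r \<le> 2 / (1 + L)^2 / r" using assms by (intro divide_right_mono) auto
  moreover have "hardy_P r = 1 / (1 + L)" by (simp add: hardy_P_def L_def)
  ultimately show ?thesis unfolding wt_def L by (simp add: power_divide mult.commute)
qed

text \<open>
  For \<open>r \<le> 1\<close> the derivative of \<open>hardy_P\<close> is \<open>(hardy_P r)^2 / r\<close>; integrate it by parts against \<open>|e|^2\<close>.
\<close>
lemma
  assumes e: "ac e v" "e \<in> bm" "v \<in> bm"
    and r0: "0 < r0" "r0 \<le> 1" and i: "si {0<..<r0} (\<lambda>r. nsq (v r) * r)"
  shows si_hardy: "si {0<..<r0} (\<lambda>r. (hardy_P r)^2 / r * nsq (e r))"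
    and li_hardy: "(LBINT r:{0<..<r0}. (hardy_P r)^2 / r * nsq (e r)) \<le>
      2 * (hardy_P r0 * nsq (e r0)) + 4 * (LBINT r:{0<..<r0}. nsq (v r) * r)"
proof -
  note [measurable] = e(2,3)
  let ?P = "hardy_P" and ?D = "LBINT r:{0<..<r0}. nsq (v r) * r"
  define K where "K = 2 * (?P r0 * nsq (e r0)) + 4 * ?D"
  let ?f = "\<lambda>r. (?P r)^2 / r * nsq (e r)"
  have D0: "0 \<le> ?D" by (rule li_nonneg) auto
  have K0: "0 \<le> K" unfolding K_def using D0 hardy_P_pos[OF r0] by simp
  have main: "si {d..<r0} ?f \<and> (LBINT r:{d..<r0}. ?f r) \<le> K" if d: "0 < d" "d < r0" for d
  proof -
    define PP where "PP r = (if r < 1 then ?P r else r)" for r :: real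
    have lnpos: "1 - ln r > 0" if "r \<in> {d..r0}" for r
    proof -
      have "0 < r" "r \<le> 1" using that d r0 by auto
      then have "ln r \<le> 0" by simp
      then show ?thesis by simp
    qed
    have cP: "continuous_on {d..r0} ?P"
      unfolding hardy_P_def using d lnpos by (intro continuous_intros) force+
    have PD: "(?P has_real_derivative (?P r)^2 / r) (at r)" if "r \<in> {d..r0}" for r
      unfolding hardy_P_def[abs_def] using lnpos[OF that] that d
      by (auto intro!: derivative_eq_intros simp: field_simps power2_eq_square)
    \<comment> \<open>Absolute continuity is a statement about the whole half line, but
      \<open>hardy_P\<close> has a pole at \<open>r = exp 1\<close>. The function is therefore
      frozen outside \<open>{d..r0}\<close>.\<close>
    define g where "g r = (if r \<in> {d..r0} then (?P r)^2 / r else 0)" for r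
    define G where "G r = (if r < d then ?P d else if r \<le> r0 then ?P r else ?P r0)" for r
    have gm[measurable]: "g \<in> bm" unfolding g_def by measurable
    have gi: "integrable lborel g"
    proof -
      have "si {d..r0} (\<lambda>r. (?P r)^2 / r)"
        using d by (intro borel_integrable_atLeastAtMost' continuous_intros cP) auto
      moreover have "(\<lambda>r. indicator {d..r0} r *\<^sub>R ((?P r)^2 / r)) = g" by (auto simp: g_def fun_eq_iff)
      ultimately show ?thesis by (simp add: set_integrable_def)
    qed
    have base: "(LBINT x:{a..b}. g x) = ?P b - ?P a" if "d \<le> a" "a \<le> b" "b \<le> r0" for a b
    proof -
      have "(LBINT x:{a..b}. g x) = (LBINT x:{a..b}. (?P x)^2 / x)"
        using that by (intro set_lebesgue_integral_cong) (auto simp: g_def)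
      also have "\<dots> = ?P b - ?P a"
        unfolding set_lebesgue_integral_def
      proof (rule integral_FTC_atLeastAtMost[OF that(2)])
        show "(?P has_vector_derivative (?P x)^2 / x) (at x within {a..b})" if "a \<le> x" "x \<le> b" for x
          using PD[of x] that \<open>d \<le> a\<close> \<open>b \<le> r0\<close>
          by (auto simp: has_real_derivative_iff_has_vector_derivative[symmetric] intro: has_field_derivative_at_within)
        show "continuous_on {a..b} (\<lambda>x. (?P x)^2 / x)"
          using d that by (intro continuous_intros continuous_on_subset[OF cP]) auto
      qed
      finally show ?thesis .
    qed
    have acG: "ac G g"
      unfolding ac_def locint_def
    proof (intro conjI allI impI)
      fix a b :: real assume ab: "0 < a" "a \<le> b"
      show "si {a..b} g"
        unfolding set_integrable_def by (rule integrable_mult_indicator[OF _ gi]) simp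
      show "G b - G a = (LBINT x:{a..b}. g x)"
      proof (cases "b < d \<or> r0 < a")
        case True
        then have "(LBINT x:{a..b}. g x) = (LBINT x:{a..b}. 0)"
          by (intro set_lebesgue_integral_cong) (auto simp: g_def)
        with True ab d show ?thesis by (auto simp: G_def)
      next
        case False
        have "(LBINT x:{a..b}. g x) = (LBINT x:{max a d..min b r0}. g x)"
          by (rule set_lebesgue_integral_support) (auto simp: g_def)
        also have "\<dots> = ?P (min b r0) - ?P (max a d)"
          by (rule base) (use False ab d in auto)
        also have "\<dots> = G b - G a" using False ab d by (auto simp: G_def min_def max_def)
        finally show ?thesis by simp
      qed
    qed
    have FI: "G r0 * nsq (e r0) - G d * nsq (e d) =
        (LBINT r:{d..r0}. G r * (2 * Re (cnj (e r) * v r)) + nsq (e r) * g r)"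
      and Fint: "si {d..r0} (\<lambda>r. G r * (2 * Re (cnj (e r) * v r)) + nsq (e r) * g r)"
      using ac_diff_eq[OF ac_mult[OF acG ac_cmod_sq[OF e(1)]], of d r0] d
        ac_integrable[OF ac_mult[OF acG ac_cmod_sq[OF e(1)]], of d r0] by auto
    have fi: "si {d..r0} ?f"
    proof -
      have "continuous_on {d..r0} ?f"
        using d by (intro continuous_intros cP continuous_on_subset[OF ac_continuous[OF e(1)]]) auto
      then show ?thesis by (rule borel_integrable_atLeastAtMost')
    qed
    have vi: "si {d..r0} (\<lambda>r. nsq (v r) * r)"
    proof -
      have "si ({d..<r0} \<union> {r0}) (\<lambda>r. nsq (v r) * r)"
        by (rule set_integrable_Un[OF set_integrable_subset[OF i]]) (use d in auto)
      moreover have "{d..<r0} \<union> {r0} = {d..r0}" using d by auto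
      ultimately show ?thesis by simp
    qed
    have Dd: "(LBINT r:{d..r0}. nsq (v r) * r) \<le> ?D"
    proof -
      have "(LBINT r:{d..r0}. nsq (v r) * r) = (LBINT r:{d..<r0}. nsq (v r) * r)"
        by (rule set_integral_cong_set)
          (use AE_lborel_singleton[of r0] in \<open>auto simp: set_borel_measurable_def elim!: eventually_mono\<close>)
      also have "\<dots> \<le> ?D" by (rule li_mono_set[OF i]) (use d in auto)
      finally show ?thesis .
    qed
    let ?S = "LBINT r:{d..r0}. ?f r"
    have "?S - ?S / 2 - 2 * (LBINT r:{d..r0}. nsq (v r) * r) =
        (LBINT r:{d..r0}. ?f r - (1/2) * ?f r - 2 * (nsq (v r) * r))"
      using set_integral_diff(2)[OF set_integral_diff(1)[OF fi set_integrable_mult_right[OF fi, of "1/2"]] set_integrable_mult_right[OF vi, of 2]]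
        set_integral_diff(2)[OF fi set_integrable_mult_right[OF fi, of "1/2"]] by simp
    also have "\<dots> \<le> (LBINT r:{d..r0}. G r * (2 * Re (cnj (e r) * v r)) + nsq (e r) * g r)"
    proof (rule set_integral_mono[OF _ Fint])
      show "si {d..r0} (\<lambda>r. ?f r - (1/2) * ?f r - 2 * (nsq (v r) * r))"
        by (intro set_integral_diff(1) fi vi set_integrable_mult_right)
      fix r assume r: "r \<in> {d..r0}"
      then have rp: "0 < r" using d by simp
      have GP: "G r = ?P r" "g r = (?P r)^2 / r" using r by (auto simp: G_def g_def)
      have Pp: "0 < ?P r" using r r0 rp by (intro hardy_P_pos) auto
      have "\<bar>Re (cnj (e r) * v r)\<bar> \<le> cmod (e r) * cmod (v r)"
        using abs_Re_le_cmod[of "cnj (e r) * v r"] by (simp add: norm_mult)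
      then have "?P r * \<bar>Re (cnj (e r) * v r)\<bar> \<le> ?P r * (cmod (e r) * cmod (v r))"
        using Pp by (intro mult_left_mono) auto
      \<comment> \<open>Young's inequality, weighted so that exactly half of the Hardy term is
        absorbed on the left; this produces the constants \<open>2\<close> and \<open>4\<close> of
        the claim.\<close>
      moreover have "2 * (?P r * (cmod (e r) * cmod (v r))) \<le> (1/2) * ?f r + 2 * (nsq (v r) * r)"
      proof -
        have "0 \<le> (?P r * cmod (e r) - 2 * r * cmod (v r))^2 / (2 * r)" using rp by simp
        also have "\<dots> = (1/2) * ?f r + 2 * (nsq (v r) * r) - 2 * (?P r * (cmod (e r) * cmod (v r)))"
          using rp by (simp add: field_simps power2_eq_square)
        finally show ?thesis by simp
      qed
      moreover have "- (?P r * \<bar>Re (cnj (e r) * v r)\<bar>) \<le> ?P r * Re (cnj (e r) * v r)"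
        using Pp mult_left_mono[of "- \<bar>Re (cnj (e r) * v r)\<bar>" "Re (cnj (e r) * v r)" "?P r"] by simp
      moreover have "nsq (e r) * g r = ?f r" by (simp add: GP)
      moreover have "G r * (2 * Re (cnj (e r) * v r)) = 2 * (?P r * Re (cnj (e r) * v r))" by (simp add: GP)
      ultimately show "?f r - (1/2) * ?f r - 2 * (nsq (v r) * r) \<le>
          G r * (2 * Re (cnj (e r) * v r)) + nsq (e r) * g r" by linarith
    qed
    also have "\<dots> = ?P r0 * nsq (e r0) - ?P d * nsq (e d)" using FI d by (simp add: G_def)
    also have "\<dots> \<le> ?P r0 * nsq (e r0)" using hardy_P_pos[of d] d r0 by simp
    finally have "?S \<le> K" unfolding K_def using Dd by linarith
    moreover have "(LBINT r:{d..<r0}. ?f r) \<le> ?S"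
      by (rule li_mono_set[OF fi]) (use d in auto)
    moreover have "si {d..<r0} ?f"
      by (rule set_integrable_subset[OF fi]) auto
    ultimately show ?thesis by simp
  qed
  have meas: "?f \<in> bm" by measurable
  show "si {0<..<r0} ?f"
    by (rule si_at_0[OF meas _ main K0]) auto
  show "(LBINT r:{0<..<r0}. ?f r) \<le> 2 * (hardy_P r0 * nsq (e r0)) + 4 * ?D"
    unfolding K_def[symmetric] by (rule li_at_0[OF meas _ main K0]) auto
qed

lemma si_wt:
  assumes e: "ac e v" "e \<in> bm" "v \<in> bm"
    and i: "si {0<..<1} (\<lambda>r. nsq (v r) * r)"
    and m: "si {0<..<1} (\<lambda>r. (real m)^2 / r * nsq (e r))"
  shows "si {0<..<R} (\<lambda>r. wt m r * nsq (e r))"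
proof -
  note [measurable] = e(2,3)
  have 1: "si {0<..<1} (\<lambda>r. wt m r * nsq (e r))"
  proof (rule si_bound[OF set_integral_add(1)[OF m set_integrable_mult_right[OF si_hardy[OF e _ _ i], of 2]]])
    fix r :: real assume r: "r \<in> {0<..<1}"
    have "wt m r * nsq (e r) \<le> ((real m)^2 / r + 2 * ((hardy_P r)^2 / r)) * nsq (e r)"
      by (intro mult_right_mono wt_le_hardy) (use r in auto)
    then show "\<bar>wt m r * nsq (e r)\<bar> \<le> (real m)^2 / r * nsq (e r) + 2 * ((hardy_P r)^2 / r * nsq (e r))"
      using wt_nonneg[of r m] r by (simp add: distrib_right)
  qed auto
  have 2: "si {1..R} (\<lambda>r. wt m r * nsq (e r))"
  proof (rule si_bound[OF set_integrable_mult_right[OF locintD[OF locint_sq[OF e(1)]], of "(real m)^2 + 1"]])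
    fix r assume r: "r \<in> {1..R}"
    have "wt m r \<le> ((real m)^2 + 1) / r" using r by (intro wt_le) auto
    also have "\<dots> \<le> ((real m)^2 + 1) / 1" using r by (intro divide_left_mono) auto
    finally have "wt m r * nsq (e r) \<le> ((real m)^2 + 1) * nsq (e r)" by (intro mult_right_mono) auto
    then show "\<bar>wt m r * nsq (e r)\<bar> \<le> ((real m)^2 + 1) * nsq (e r)"
      using wt_nonneg[of r m] r by simp
  qed auto
  have "si ({0<..<1} \<union> {1..R}) (\<lambda>r. wt m r * nsq (e r))"
    by (rule set_integrable_Un[OF 1 2]) auto
  then show ?thesis by (rule set_integrable_subset) auto
qed

lemma admlI:
  assumes "ac e v" "e \<in> bm" "v \<in> bm"
    and "\<And>R. si {0<..<R} (\<lambda>r. nsq (v r) * r)"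
    and "si {0<..<1} (\<lambda>r. (real m)^2 / r * nsq (e r))"
  shows "adml m e v"
  unfolding adml_def using assms si_wt[OF assms(1-3) assms(4) assms(5)] by blast

section \<open>Linear operations on admissible pairs\<close>

lemma cmod_add_sq_le: "nsq (a + b) \<le> 2 * nsq a + 2 * nsq b"
proof -
  have "nsq (a + b) \<le> (cmod a + cmod b)^2" by (intro power_mono norm_triangle_ineq) auto
  also have "\<dots> \<le> 2 * nsq a + 2 * nsq b"
    using sum_squares_bound[of "cmod a" "cmod b"] by (simp add: power2_sum)
  finally show ?thesis .
qed

lemma cmod_add3_sq_le: "nsq (a + b + c) \<le> 3 * nsq a + 3 * nsq b + 3 * nsq c"
proof -
  have "nsq (a + b + c) \<le> (cmod a + cmod b + cmod c)^2"
    by (intro power_mono norm_triangle_le add_right_mono norm_triangle_ineq) auto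
  also have "\<dots> \<le> 3 * nsq a + 3 * nsq b + 3 * nsq c"
    using sum_squares_bound[of "cmod a" "cmod b"] sum_squares_bound[of "cmod a" "cmod c"] sum_squares_bound[of "cmod b" "cmod c"]
    by (simp add: power2_sum power2_eq_square algebra_simps)
  finally show ?thesis .
qed

lemma adml_add:
  assumes "adml m e v" "adml m f w"
  shows "adml m (\<lambda>r. e r + f r) (\<lambda>r. v r + w r)"
  unfolding adml_def
proof (intro conjI allI)
  note [measurable] = adml_measurable[OF assms(1)] adml_measurable[OF assms(2)]
  show "ac (\<lambda>r. e r + f r) (\<lambda>r. v r + w r)" by (rule ac_add[OF adml_ac[OF assms(1)] adml_ac[OF assms(2)]])
  show "(\<lambda>r. e r + f r) \<in> bm" "(\<lambda>r. v r + w r) \<in> bm" by measurable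
  fix R
  show "si {0<..<R} (\<lambda>r. nsq (v r + w r) * r)"
  proof (rule si_bound[OF set_integral_add(1)[OF set_integrable_mult_right[OF adml_si(1)[OF assms(1)], where a = 2]
        set_integrable_mult_right[OF adml_si(1)[OF assms(2)], where a = 2]]])
    fix r :: real assume r: "r \<in> {0<..<R}"
    have "nsq (v r + w r) * r \<le> (2 * nsq (v r) + 2 * nsq (w r)) * r"
      using r by (intro mult_right_mono cmod_add_sq_le) auto
    then show "\<bar>nsq (v r + w r) * r\<bar> \<le> 2 * (nsq (v r) * r) + 2 * (nsq (w r) * r)"
      using r by (simp add: algebra_simps)
  qed auto
  show "si {0<..<R} (\<lambda>r. wt m r * nsq (e r + f r))"
  proof (rule si_bound[OF set_integral_add(1)[OF set_integrable_mult_right[OF adml_si(2)[OF assms(1)], where a = 2]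
        set_integrable_mult_right[OF adml_si(2)[OF assms(2)], where a = 2]]])
    fix r :: real assume r: "r \<in> {0<..<R}"
    have "wt m r * nsq (e r + f r) \<le> wt m r * (2 * nsq (e r) + 2 * nsq (f r))"
      using r wt_nonneg[of r m] by (intro mult_left_mono cmod_add_sq_le) auto
    then show "\<bar>wt m r * nsq (e r + f r)\<bar> \<le> 2 * (wt m r * nsq (e r)) + 2 * (wt m r * nsq (f r))"
      using r wt_nonneg[of r m] by (simp add: algebra_simps)
  qed auto
qed

lemma adml_cmult:
  assumes "adml m e v"
  shows "adml m (\<lambda>r. c * e r) (\<lambda>r. c * v r)"
  unfolding adml_def
proof (intro conjI allI)
  note [measurable] = adml_measurable[OF assms(1)]
  show "ac (\<lambda>r. c * e r) (\<lambda>r. c * v r)" by (rule ac_bounded_linear[OF bounded_linear_mult_right adml_ac[OF assms]])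
  show "(\<lambda>r. c * e r) \<in> bm" "(\<lambda>r. c * v r) \<in> bm" by measurable
  fix R
  have "si {0<..<R} (\<lambda>r. nsq c * (nsq (v r) * r))"
    by (intro set_integrable_mult_right adml_si(1)[OF assms])
  then show "si {0<..<R} (\<lambda>r. nsq (c * v r) * r)"
    by (simp add: norm_mult power_mult_distrib mult_ac)
  have "si {0<..<R} (\<lambda>r. nsq c * (wt m r * nsq (e r)))"
    by (intro set_integrable_mult_right adml_si(2)[OF assms])
  then show "si {0<..<R} (\<lambda>r. wt m r * nsq (c * e r))"
    by (simp add: norm_mult power_mult_distrib mult_ac)
qed

lemma
  assumes a: "adml m e v" and M: "1 \<le> M" "R \<le> M"
  shows si_e_sq: "si {0<..<R} (\<lambda>r. nsq (e r))"
    and li_e_sq: "(LBINT r:{0<..<R}. nsq (e r)) \<le> 5 * M * (LBINT r:{0<..<R}. wt m r * nsq (e r))"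
proof -
  note [measurable] = adml_measurable[OF a]
  have le: "nsq (e r) \<le> 5 * M * (wt m r * nsq (e r))" if "r \<in> {0<..<R}" for r
  proof -
    have "1 * nsq (e r) \<le> (5 * M * wt m r) * nsq (e r)"
      using that M by (intro mult_right_mono wt_lower) auto
    then show ?thesis by (simp add: mult.assoc)
  qed
  have i: "si {0<..<R} (\<lambda>r. 5 * M * (wt m r * nsq (e r)))"
    by (intro set_integrable_mult_right adml_si(2)[OF a])
  show s: "si {0<..<R} (\<lambda>r. nsq (e r))"
    by (rule si_bound[OF i]) (use le in auto)
  show "(LBINT r:{0<..<R}. nsq (e r)) \<le> 5 * M * (LBINT r:{0<..<R}. wt m r * nsq (e r))"
    unfolding set_integral_mult_right[symmetric] by (rule set_integral_mono[OF s i le])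
qed

text \<open>Minus the first variation of \<open>A_theta\<close> at \<open>Q\<close>.\<close>
definition yf :: "nat \<Rightarrow> (real \<Rightarrow> complex) \<Rightarrow> real \<Rightarrow> real" where
  "yf m e r = (LBINT s:{0<..<r}. (q m s * s) * Re (e s))"

text \<open>The linearization at \<open>Q\<close> of the expression \<open>D_u u\<close>, applied to
  \<open>e\<close>.\<close>

definition hf :: "nat \<Rightarrow> (real \<Rightarrow> complex) \<Rightarrow> (real \<Rightarrow> complex) \<Rightarrow> real \<Rightarrow> complex" where
  "hf m e v r = v r - of_real (kq m r / r) * e r + of_real (q m r * yf m e r / r)"

lemma
  fixes f :: "real \<Rightarrow> real"
  assumes "\<And>R. si {0<..<R} f"
  shows ac_primitive: "ac (\<lambda>r. LBINT s:{0<..<r}. f s) f"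
proof -
  have l: "si {a..b} f" if "0 < a" for a b
    by (rule set_integrable_subset[OF assms[of "b + 1"]]) (use that in auto)
  have sm: "set_borel_measurable lborel A f" if "si A f" for A
    using that unfolding set_integrable_def set_borel_measurable_def by (rule borel_measurable_integrable)
  show ?thesis
    unfolding ac_def locint_def
  proof (intro conjI allI impI l)
    fix a b :: real assume ab: "0 < a" "a \<le> b"
    have "(LBINT s:{0<..<b}. f s) = (LBINT s:{0<..<a}. f s) + (LBINT s:{a..<b}. f s)"
    proof -
      have eq: "{0<..<b} = {0<..<a} \<union> {a..<b}" using ab by auto
      show ?thesis
        unfolding eq by (rule li_split) (use assms[of b] in \<open>auto simp: eq\<close>)
    qed
    also have "(LBINT s:{a..<b}. f s) = (LBINT s:{a..b}. f s)"
    proof (rule set_integral_cong_set)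
      show "set_borel_measurable lborel {a..b} f" "set_borel_measurable lborel {a..<b} f"
        by (rule sm, rule l[OF ab(1)], rule sm, rule set_integrable_subset[OF l[OF ab(1), of b]]) auto
      show "AE x in lborel. (x \<in> {a..b}) = (x \<in> {a..<b})"
        using AE_lborel_singleton[of b] by eventually_elim auto
    qed
    finally show "(LBINT s:{0<..<b}. f s) - (LBINT s:{0<..<a}. f s) = (LBINT s:{a..b}. f s)" by simp
  qed
qed

lemma borel_measurable_primitive [measurable]:
  fixes f :: "real \<Rightarrow> real"
  assumes [measurable]: "f \<in> bm"
  shows "(\<lambda>r. LBINT s:{0<..<r}. f s) \<in> bm"
  unfolding set_lebesgue_integral_def greaterThanLessThan_def indicator_inter_arith
  by (simp add: indicator_def greaterThan_def lessThan_def)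

lemma qs_sq_le: "s \<in> {0<..<r} \<Longrightarrow> \<bar>(q m s * s)^2\<bar> \<le> (qmax m)^2 * r^2"
proof -
  assume s: "s \<in> {0<..<r}"
  have "q m s * s \<le> qmax m * r"
    using s q_le_qmax[of s m] qmax_pos[of m] by (intro mult_mono) auto
  moreover have "0 \<le> q m s * s" using s q_pos[of s m] by simp
  ultimately have "(q m s * s)^2 \<le> (qmax m * r)^2" by (intro power_mono) auto
  then show ?thesis by (simp add: power_mult_distrib)
qed

lemma
  assumes a: "adml m e v"
  shows si_yf: "si {0<..<r} (\<lambda>s. (q m s * s) * Re (e s))"
    and yf_sq_le: "0 < r \<Longrightarrow> (yf m e r)^2 \<le> (qmax m)^2 * r ^ 3 * (LBINT s:{0<..<r}. nsq (e s))"
proof -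
  note [measurable] = adml_measurable[OF a]
  have e2: "si {0<..<r} (\<lambda>s. nsq (e s))"
    by (rule si_e_sq[OF a, of "max 1 r"]) auto
  have re: "(Re z)^2 \<le> nsq z" for z by (simp add: cmod_power2)
  have re2: "si {0<..<r} (\<lambda>s. (Re (e s))^2)"
    by (rule si_bound[OF e2]) (use re in auto)
  have qs: "si {0<..<r} (\<lambda>s. (q m s * s)^2)"
    by (rule si_bounded_interval[OF _ qs_sq_le]) auto
  show "si {0<..<r} (\<lambda>s. (q m s * s) * Re (e s))"
    by (rule si_mult[OF _ _ _ qs re2]) auto
  assume r: "0 < r"
  have "(yf m e r)^2 \<le> (LBINT s:{0<..<r}. (q m s * s)^2) * (LBINT s:{0<..<r}. (Re (e s))^2)"
    unfolding yf_def by (rule li_Cauchy_Schwarz[OF _ _ _ qs re2]) auto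
  also have "\<dots> \<le> ((qmax m)^2 * r^2 * (r - 0)) * (LBINT s:{0<..<r}. nsq (e s))"
  proof (intro mult_mono)
    show "(LBINT s:{0<..<r}. (q m s * s)^2) \<le> (qmax m)^2 * r^2 * (r - 0)"
      by (rule li_bounded_interval[OF _ qs_sq_le]) (use r in auto)
    show "(LBINT s:{0<..<r}. (Re (e s))^2) \<le> (LBINT s:{0<..<r}. nsq (e s))"
      by (rule set_integral_mono[OF re2 e2]) (rule re)
    show "0 \<le> (LBINT s:{0<..<r}. (Re (e s))^2)" by (rule li_nonneg) simp
  qed (use r in auto)
  finally show "(yf m e r)^2 \<le> (qmax m)^2 * r ^ 3 * (LBINT s:{0<..<r}. nsq (e s))"
    by (simp add: power2_eq_square power3_eq_cube mult.assoc)
qed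

lemma yf_ac: "adml m e v \<Longrightarrow> ac (yf m e) (\<lambda>s. (q m s * s) * Re (e s))"
  unfolding yf_def[abs_def] by (rule ac_primitive) (rule si_yf)

lemma yf_measurable: "e \<in> bm \<Longrightarrow> yf m e \<in> bm"
  unfolding yf_def[abs_def] by (rule borel_measurable_primitive) measurable

lemma hf_measurable: "adml m e v \<Longrightarrow> hf m e v \<in> bm"
  using adml_measurable[of m e v] yf_measurable[of e m] unfolding hf_def[abs_def] by measurable

lemma kq_sq_wt: "0 < r \<Longrightarrow> (kq m r)^2 / r \<le> (2 + 40 * (real m + 1)^2) * wt m r"
proof -
  assume r: "0 < r"
  have "(kq m r)^2 \<le> 2 * (real m)^2 + 2 * (real m - kq m r)^2"
    using zero_le_power2[of "2 * real m - kq m r"] by (simp add: power2_eq_square algebra_simps)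
  then have "(kq m r)^2 / r \<le> (2 * (real m)^2 + 2 * (real m - kq m r)^2) / r"
    using r by (intro divide_right_mono) auto
  also have "\<dots> = 2 * ((real m)^2 / r) + 2 * ((real m - kq m r)^2 / r)" by (simp add: add_divide_distrib)
  also have "\<dots> \<le> 2 * wt m r + 2 * (20 * (real m + 1)^2 * wt m r)"
    by (intro add_mono mult_left_mono wt_ge_m kq_diff_wt r) auto
  finally show ?thesis by (simp add: algebra_simps)
qed

lemma yterm_le:
  assumes a: "adml m e v" and r: "0 < r" "r < R"
  shows "(q m r * yf m e r / r)^2 * r \<le> (qmax m) ^ 4 * r^2 * (LBINT s:{0<..<R}. nsq (e s))"
proof -
  have e2: "si {0<..<R} (\<lambda>s. nsq (e s))"
    by (rule si_e_sq[OF a, of "max 1 R"]) auto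
  have "(LBINT s:{0<..<r}. nsq (e s)) \<le> (LBINT s:{0<..<R}. nsq (e s))"
    by (rule li_mono_set[OF e2]) (use r in auto)
  then have y: "(yf m e r)^2 \<le> (qmax m)^2 * r ^ 3 * (LBINT s:{0<..<R}. nsq (e s))"
    using r by (intro order_trans[OF yf_sq_le[OF a r(1)]] mult_left_mono) auto
  have "(q m r)^2 \<le> (qmax m)^2" using q_le_qmax[OF r(1)] q_pos[OF r(1), of m] by (intro power_mono) auto
  then have "(q m r)^2 * (yf m e r)^2 \<le> (qmax m)^2 * ((qmax m)^2 * r ^ 3 * (LBINT s:{0<..<R}. nsq (e s)))"
    by (intro mult_mono y) auto
  then have "(q m r)^2 * (yf m e r)^2 / r \<le> (qmax m)^2 * ((qmax m)^2 * r ^ 3 * (LBINT s:{0<..<R}. nsq (e s))) / r"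
    using r by (intro divide_right_mono) auto
  moreover have "(q m r * yf m e r / r)^2 * r = (q m r)^2 * (yf m e r)^2 / r"
    using r by (simp add: power_mult_distrib power_divide power2_eq_square)
  moreover have "(qmax m)^2 * ((qmax m)^2 * r ^ 3 * (LBINT s:{0<..<R}. nsq (e s))) / r =
      (qmax m) ^ 4 * r^2 * (LBINT s:{0<..<R}. nsq (e s))"
    using r by (simp add: power2_eq_square power3_eq_cube power4_eq_xxxx)
  ultimately show ?thesis by simp
qed

lemma si_hf:
  assumes a: "adml m e v"
  shows "si {0<..<R} (\<lambda>r. nsq (hf m e v r) * r)"
proof -
  note [measurable] = adml_measurable[OF a] hf_measurable[OF a] yf_measurable[OF adml_measurable(1)[OF a]]
  have c: "si {0<..<R} (\<lambda>r. (qmax m) ^ 4 * r^2 * (LBINT s:{0<..<R}. nsq (e s)))"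
    by (rule set_integrable_subset[OF borel_integrable_atLeastAtMost'[of 0 R]])
      (auto intro!: continuous_intros)
  show ?thesis
  proof (rule si_bound[OF set_integral_add(1)[OF set_integral_add(1)[OF
        set_integrable_mult_right[OF adml_si(1)[OF a], where a = 3]
        set_integrable_mult_right[OF set_integrable_mult_right[OF adml_si(2)[OF a], where a = "2 + 40 * (real m + 1)^2"], where a = 3]]
        set_integrable_mult_right[OF c, where a = 3]]])
    fix r assume r: "r \<in> {0<..<R}"
    then have r0: "0 < r" "r < R" by auto
    have "nsq (hf m e v r) \<le> 3 * nsq (v r) + 3 * nsq (- (of_real (kq m r / r) * e r)) + 3 * nsq (of_real (q m r * yf m e r / r))"
      using cmod_add3_sq_le[of "v r" "- (of_real (kq m r / r) * e r)" "of_real (q m r * yf m e r / r)"]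
      by (simp add: hf_def)
    then have "nsq (hf m e v r) \<le> 3 * nsq (v r) + 3 * ((kq m r / r)^2 * nsq (e r)) + 3 * (q m r * yf m e r / r)^2"
      unfolding norm_minus_cancel norm_mult norm_of_real power_mult_distrib power2_abs .
    then have "nsq (hf m e v r) * r \<le> (3 * nsq (v r) + 3 * ((kq m r / r)^2 * nsq (e r)) + 3 * (q m r * yf m e r / r)^2) * r"
      using r0 by (intro mult_right_mono) auto
    also have "\<dots> = 3 * (nsq (v r) * r) + 3 * ((kq m r)^2 / r * nsq (e r)) + 3 * ((q m r * yf m e r / r)^2 * r)"
      using r0 by (simp add: distrib_right power_divide power2_eq_square)
    also have "\<dots> \<le> 3 * (nsq (v r) * r) + 3 * (((2 + 40 * (real m + 1)^2) * wt m r) * nsq (e r))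
        + 3 * ((qmax m) ^ 4 * r^2 * (LBINT s:{0<..<R}. nsq (e s)))"
      by (intro add_mono mult_left_mono mult_right_mono order_refl kq_sq_wt yterm_le[OF a]) (use r0 in auto)
    finally show "\<bar>nsq (hf m e v r) * r\<bar> \<le> 3 * (nsq (v r) * r) + 3 * ((2 + 40 * (real m + 1)^2) * (wt m r * nsq (e r)))
        + 3 * ((qmax m) ^ 4 * r^2 * (LBINT s:{0<..<R}. nsq (e s)))"
      using r0 by (simp add: mult.assoc)
  qed auto
qed

definition vnorm :: "(real \<Rightarrow> complex) \<Rightarrow> real \<Rightarrow> real" where
  "vnorm v R = (LBINT r:{0<..<R}. nsq (v r) * r)"

definition enorm :: "nat \<Rightarrow> (real \<Rightarrow> complex) \<Rightarrow> real \<Rightarrow> real" where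
  "enorm m e R = (LBINT r:{0<..<R}. wt m r * nsq (e r))"

lemma vnorm_nonneg: "0 \<le> vnorm v R"
  unfolding vnorm_def by (rule li_nonneg) auto

lemma enorm_nonneg: "0 \<le> enorm m e R"
  unfolding enorm_def by (rule li_nonneg) (auto intro!: mult_nonneg_nonneg wt_nonneg)

text \<open>The operator is compared with its leading part \<open>g = v - (m/r) e\<close>. Expanding
  \<open>|g|^2 r\<close>, the cross term is the exact derivative \<open>- m (|e|^2)'\<close>, whose
  boundary contributions are zero at \<open>r0\<close> and of the right sign at the inner end; so
  \<open>g\<close> controls \<open>v\<close> and \<open>m e / r\<close>. Hardy's inequality supplies
  the logarithmic part, and the remaining terms of \<open>hf\<close> gain a factor
  \<open>r0\<close>.\<close>

lemma near_origin:
  obtains r0 C where "0 < r0" "r0 < 1" "0 < C"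
    "\<forall>e v. adml m e v \<longrightarrow> e r0 = 0 \<longrightarrow> vnorm v r0 + enorm m e r0 \<le> C * vnorm (hf m e v) r0"
proof -
  define B where "B = 60 * (real m + 1)^2 + 15 * (qmax m) ^ 4"
  have B: "0 < B" unfolding B_def by (intro add_pos_nonneg) auto
  \<comment> \<open>\<open>B\<close> collects the errors from \<open>kq - m\<close> and from the
    nonlocal term. The chain \<open>D + W \<le> 9 * G\<close> and
    \<open>G \<le> 3 * H + B * r0 * W\<close> has to close, so \<open>9 * B * r0 \<le> 1/2\<close>
    is arranged; the final constant is then \<open>2 * 9 * 3 = 54\<close>.\<close>
  define r0 where "r0 = min (1/2) (1 / (18 * B))"
  have r0: "0 < r0" "r0 < 1" "9 * B * r0 \<le> 1/2"
  proof -
    show "0 < r0" "r0 < 1" using B by (auto simp: r0_def)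
    have "9 * B * r0 \<le> 9 * B * (1 / (18 * B))" using B by (intro mult_left_mono) (auto simp: r0_def)
    then show "9 * B * r0 \<le> 1/2" using B by simp
  qed
  have main: "vnorm v r0 + enorm m e r0 \<le> 54 * vnorm (hf m e v) r0"
    if a: "adml m e v" and e0: "e r0 = 0" for e v
  proof -
    let ?I = "{0<..<r0}"
    note [measurable] = adml_measurable[OF a] hf_measurable[OF a] yf_measurable[OF adml_measurable(1)[OF a]]
    define D where "D = (LBINT r:?I. nsq (v r) * r)"
    define W where "W = (LBINT r:?I. wt m r * nsq (e r))"
    define H where "H = (LBINT r:?I. nsq (hf m e v r) * r)"
    define g where "g r = v r - of_real (real m / r) * e r" for r
    have [measurable]: "g \<in> bm" unfolding g_def by measurable
    have W0: "0 \<le> W" unfolding W_def by (rule li_nonneg) (auto intro!: mult_nonneg_nonneg wt_nonneg)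
    have D0: "0 \<le> D" unfolding D_def by (rule li_nonneg) auto
    have E5: "(LBINT s:?I. nsq (e s)) \<le> 5 * W"
      using li_e_sq[OF a, of 1 r0] r0 unfolding W_def by simp
    have gle: "nsq (g r) * r \<le> 3 * (nsq (hf m e v r) * r) + 60 * (real m + 1)^2 * r0 * (wt m r * nsq (e r))
        + 15 * (qmax m) ^ 4 * r^2 * W" if r: "r \<in> ?I" for r
    proof -
      have rp: "0 < r" "r < r0" "r \<le> 1" using r r0 by auto
      have geq: "g r = hf m e v r + of_real ((kq m r - real m) / r) * e r + (- of_real (q m r * yf m e r / r))"
        by (simp add: g_def hf_def diff_divide_distrib algebra_simps)
      have "nsq (g r) \<le> 3 * nsq (hf m e v r) + 3 * (((kq m r - real m) / r)^2 * nsq (e r)) + 3 * (q m r * yf m e r / r)^2"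
        using cmod_add3_sq_le[of "hf m e v r" "of_real ((kq m r - real m) / r) * e r" "- of_real (q m r * yf m e r / r)"]
        unfolding geq norm_minus_cancel norm_mult norm_of_real power_mult_distrib power2_abs .
      then have "nsq (g r) * r \<le> (3 * nsq (hf m e v r) + 3 * (((kq m r - real m) / r)^2 * nsq (e r)) + 3 * (q m r * yf m e r / r)^2) * r"
        using rp by (intro mult_right_mono) auto
      also have "\<dots> = 3 * (nsq (hf m e v r) * r) + 3 * ((kq m r - real m)^2 / r * nsq (e r)) + 3 * ((q m r * yf m e r / r)^2 * r)"
        using rp by (simp add: distrib_right power_divide power2_eq_square)
      also have "\<dots> \<le> 3 * (nsq (hf m e v r) * r) + 3 * ((20 * (real m + 1)^2 * r0 * wt m r) * nsq (e r))
          + 3 * ((qmax m) ^ 4 * r^2 * (5 * W))"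
      proof (intro add_mono mult_left_mono mult_right_mono order_refl)
        have "(kq m r - real m)^2 \<le> (2 * (real m + 1) * r^2)^2"
          using kq_diff_nonneg[OF rp(1), of m] kq_diff_le_sq[OF rp(1,3), of m]
          by (subst power2_commute) (intro power_mono)
        also have "\<dots> = 4 * (real m + 1)^2 * (r * (r * r)) * r" by (simp add: power2_eq_square algebra_simps)
        finally have "(kq m r - real m)^2 / r \<le> 4 * (real m + 1)^2 * (r * (r * r))" using rp by (simp add: divide_le_eq)
        also have "\<dots> \<le> 4 * (real m + 1)^2 * (r0 * (5 * wt m r))"
        proof (rule mult_left_mono, rule mult_mono)
          have "r * r \<le> 1 * 1" using rp by (intro mult_mono) auto
          then show "r * r \<le> 5 * wt m r" using wt_ge_1_5[OF rp(1,3), of m] by simp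
        qed (use rp r0 in auto)
        finally show "(kq m r - real m)^2 / r \<le> 20 * (real m + 1)^2 * r0 * wt m r" by (simp add: mult_ac)
        have "(q m r * yf m e r / r)^2 * r \<le> (qmax m) ^ 4 * r^2 * (LBINT s:?I. nsq (e s))"
          by (rule yterm_le[OF a rp(1,2)])
        also have "\<dots> \<le> (qmax m) ^ 4 * r^2 * (5 * W)" by (intro mult_left_mono E5) auto
        finally show "(q m r * yf m e r / r)^2 * r \<le> (qmax m) ^ 4 * r^2 * (5 * W)" .
      qed auto
      finally show ?thesis by (simp add: mult_ac)
    qed
    have hi: "si ?I (\<lambda>r. nsq (hf m e v r) * r)" by (rule si_hf[OF a])
    have wi: "si ?I (\<lambda>r. wt m r * nsq (e r))" by (rule adml_si(2)[OF a])
    have vi: "si ?I (\<lambda>r. nsq (v r) * r)" by (rule adml_si(1)[OF a])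
    have r2: "(\<lambda>r::real. 15 * (qmax m) ^ 4 * r^2 * W) \<in> bm" by measurable
    have r2b: "\<bar>15 * (qmax m) ^ 4 * r^2 * W\<bar> \<le> 15 * (qmax m) ^ 4 * W" if "r \<in> ?I" for r
    proof -
      have "r^2 \<le> 1" using that r0 by (intro power_le_one) auto
      then have "(15 * (qmax m) ^ 4 * W) * r^2 \<le> (15 * (qmax m) ^ 4 * W) * 1" using W0 by (intro mult_left_mono) auto
      then show ?thesis using W0 by (simp add: mult_ac)
    qed
    have ci: "si ?I (\<lambda>r. 15 * (qmax m) ^ 4 * r^2 * W)"
      by (rule si_bounded_interval[OF r2 r2b])
    have gsum: "si ?I (\<lambda>r. 3 * (nsq (hf m e v r) * r) + 60 * (real m + 1)^2 * r0 * (wt m r * nsq (e r)))"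
      by (intro set_integral_add(1) set_integrable_mult_right hi wi)
    have gi: "si ?I (\<lambda>r. nsq (g r) * r)"
    proof (rule si_bound[OF set_integral_add(1)[OF gsum ci]])
      show "\<bar>nsq (g r) * r\<bar> \<le> 3 * (nsq (hf m e v r) * r) + 60 * (real m + 1)^2 * r0 * (wt m r * nsq (e r))
        + 15 * (qmax m) ^ 4 * r^2 * W" if "r \<in> ?I" for r
        using gle[OF that] that by simp
    qed auto
    define G where "G = (LBINT r:?I. nsq (g r) * r)"
    have G: "G \<le> 3 * H + B * r0 * W"
    proof -
      have "G \<le> (LBINT r:?I. (3 * (nsq (hf m e v r) * r) + 60 * (real m + 1)^2 * r0 * (wt m r * nsq (e r)))
        + 15 * (qmax m) ^ 4 * r^2 * W)"
        unfolding G_def by (rule set_integral_mono[OF gi set_integral_add(1)[OF gsum ci] gle])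
      also have "\<dots> = (LBINT r:?I. 3 * (nsq (hf m e v r) * r) + 60 * (real m + 1)^2 * r0 * (wt m r * nsq (e r)))
        + (LBINT r:?I. 15 * (qmax m) ^ 4 * r^2 * W)"
        by (rule set_integral_add(2)[OF gsum ci])
      also have "(LBINT r:?I. 3 * (nsq (hf m e v r) * r) + 60 * (real m + 1)^2 * r0 * (wt m r * nsq (e r))) =
          3 * H + 60 * (real m + 1)^2 * r0 * W"
        unfolding H_def W_def set_integral_mult_right[symmetric]
        by (rule set_integral_add(2)[OF set_integrable_mult_right[OF hi] set_integrable_mult_right[OF wi]])
      also have "(LBINT r:?I. 15 * (qmax m) ^ 4 * r^2 * W) \<le> 15 * (qmax m) ^ 4 * W * (r0 - 0)"
        by (rule li_bounded_interval[OF r2 r2b]) (use r0 in auto)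
      finally show ?thesis unfolding B_def by (simp add: algebra_simps)
    qed
    have ac2: "ac (\<lambda>r. nsq (e r)) (\<lambda>r. 2 * Re (cnj (e r) * v r))" by (rule ac_cmod_sq[OF adml_ac[OF a]])
    define f where "f r = nsq (v r) * r + (real m)^2 / r * nsq (e r)" for r
    have [measurable]: "f \<in> bm" unfolding f_def by measurable
    have mi: "si ?I (\<lambda>r. (real m)^2 / r * nsq (e r))"
    proof (rule si_bound[OF wi])
      show "\<bar>(real m)^2 / r * nsq (e r)\<bar> \<le> wt m r * nsq (e r)" if "r \<in> ?I" for r
      proof -
        have "(real m)^2 / r * nsq (e r) \<le> wt m r * nsq (e r)"
          using that by (intro mult_right_mono wt_ge_m) auto
        moreover have "0 \<le> (real m)^2 / r * nsq (e r)"
          using that by (intro mult_nonneg_nonneg divide_nonneg_nonneg) auto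
        ultimately show ?thesis by (simp only: abs_of_nonneg)
      qed
    qed auto
    have fi: "si ?I f"
      unfolding f_def[abs_def] by (rule set_integral_add(1)[OF vi mi])
    \<comment> \<open>Integration starts at \<open>d > 0\<close> since \<open>|e|^2\<close> need not
      have a limit at the origin. The boundary term \<open>m |e(d)|^2\<close> has the sign that
      allows it to be dropped, so the bound is uniform in \<open>d\<close>.\<close>
    have fG: "si {d..<r0} f \<and> (LBINT r:{d..<r0}. f r) \<le> G" if d: "0 < d" "d < r0" for d
    proof -
      have sub: "{d..<r0} \<subseteq> ?I" using d by auto
      have fd: "si {d..<r0} f" by (rule set_integrable_subset[OF fi]) (use sub in auto)
      have cross: "si {d..r0} (\<lambda>r. 2 * Re (cnj (e r) * v r))"
        by (rule ac_integrable[OF ac2 d(1)])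
      have crossv: "(LBINT r:{d..<r0}. 2 * Re (cnj (e r) * v r)) = nsq (e r0) - nsq (e d)"
      proof -
        have "(LBINT r:{d..<r0}. 2 * Re (cnj (e r) * v r)) = (LBINT r:{d..r0}. 2 * Re (cnj (e r) * v r))"
        proof (rule set_integral_cong_set)
          show "AE x in lborel. (x \<in> {d..r0}) = (x \<in> {d..<r0})"
            using AE_lborel_singleton[of r0] by eventually_elim auto
        qed (auto simp: set_borel_measurable_def)
        with ac_diff_eq[OF ac2 d(1), of r0] d show ?thesis by simp
      qed
      have crossd: "si {d..<r0} (\<lambda>r. 2 * Re (cnj (e r) * v r))"
        by (rule set_integrable_subset[OF cross]) auto
      have geq: "nsq (g r) * r = f r - real m * (2 * Re (cnj (e r) * v r))" if "r \<in> {d..<r0}" for r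
      proof -
        have "r > 0" using that d by auto
        have "nsq (g r) = nsq (v r) + (real m / r)^2 * nsq (e r) - 2 * (real m / r) * Re (cnj (e r) * v r)"
          unfolding g_def cmod_power2 by (simp add: power2_eq_square algebra_simps)
        moreover have "(A + k^2 * E - 2 * k * X) * r = A * r + (k^2 * r) * E - (k * r) * (2 * X)" for A k E X :: real
          by (simp add: algebra_simps)
        moreover have "(real m / r)^2 * r = (real m)^2 / r" "real m / r * r = real m"
          using \<open>r > 0\<close> by (simp_all add: power2_eq_square)
        ultimately show ?thesis by (simp only: f_def)
      qed
      have "(LBINT r:{d..<r0}. nsq (g r) * r) = (LBINT r:{d..<r0}. f r - real m * (2 * Re (cnj (e r) * v r)))"
        by (rule set_lebesgue_integral_cong) (use geq in auto)
      also have "\<dots> = (LBINT r:{d..<r0}. f r) - (LBINT r:{d..<r0}. real m * (2 * Re (cnj (e r) * v r)))"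
        by (rule set_integral_diff(2)[OF fd set_integrable_mult_right[OF crossd]])
      also have "(LBINT r:{d..<r0}. real m * (2 * Re (cnj (e r) * v r))) = - (real m * nsq (e d))"
        by (subst set_integral_mult_right) (simp only: crossv e0, simp)
      finally have "(LBINT r:{d..<r0}. f r) \<le> (LBINT r:{d..<r0}. nsq (g r) * r)" by simp
      also have "\<dots> \<le> G" unfolding G_def by (rule li_mono_set[OF gi sub]) auto
      finally show ?thesis using fd by simp
    qed
    have G0: "0 \<le> G" unfolding G_def by (rule li_nonneg) auto
    have "(LBINT r:?I. f r) \<le> G"
      by (rule li_at_0[OF \<open>f \<in> bm\<close> _ fG G0]) (auto simp: f_def)
    moreover have "(LBINT r:?I. f r) = D + (LBINT r:?I. (real m)^2 / r * nsq (e r))"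
      unfolding D_def f_def by (rule set_integral_add(2)[OF vi mi])
    moreover have "W \<le> (LBINT r:?I. (real m)^2 / r * nsq (e r)) + 8 * D"
    proof -
      have phi: "si ?I (\<lambda>r. (hardy_P r)^2 / r * nsq (e r))"
        by (rule si_hardy[OF adml_ac[OF a] adml_measurable[OF a] _ _ vi]) (use r0 in auto)
      have "(LBINT r:?I. (hardy_P r)^2 / r * nsq (e r)) \<le> 4 * D"
        using li_hardy[OF adml_ac[OF a] adml_measurable[OF a] _ _ vi] r0 e0 unfolding D_def by simp
      moreover have "W \<le> (LBINT r:?I. (real m)^2 / r * nsq (e r) + 2 * ((hardy_P r)^2 / r * nsq (e r)))"
        unfolding W_def
      proof (rule set_integral_mono[OF wi set_integral_add(1)[OF mi set_integrable_mult_right[OF phi]]])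
        fix r assume r: "r \<in> ?I"
        have "wt m r * nsq (e r) \<le> ((real m)^2 / r + 2 * ((hardy_P r)^2 / r)) * nsq (e r)"
          by (intro mult_right_mono wt_le_hardy) (use r r0 in auto)
        then show "wt m r * nsq (e r) \<le> (real m)^2 / r * nsq (e r) + 2 * ((hardy_P r)^2 / r * nsq (e r))"
          by (simp add: distrib_right)
      qed
      moreover have "(LBINT r:?I. (real m)^2 / r * nsq (e r) + 2 * ((hardy_P r)^2 / r * nsq (e r))) =
        (LBINT r:?I. (real m)^2 / r * nsq (e r)) + 2 * (LBINT r:?I. (hardy_P r)^2 / r * nsq (e r))"
        unfolding set_integral_mult_right[symmetric]
        by (rule set_integral_add(2)[OF mi set_integrable_mult_right[OF phi]])
      ultimately show ?thesis by linarith
    qed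
    moreover have "0 \<le> (LBINT r:?I. (real m)^2 / r * nsq (e r))" by (rule li_nonneg) auto
    ultimately have S: "D + W \<le> 9 * G" using D0 by linarith
    have "9 * (B * r0 * W) \<le> (1/2) * W"
    proof -
      have "(9 * B * r0) * W \<le> (1/2) * W" using W0 r0(3) by (intro mult_right_mono) auto
      then show ?thesis by (simp add: mult_ac)
    qed
    with S G D0 W0 have "D + W \<le> 54 * H" by linarith
    then show ?thesis unfolding D_def W_def H_def vnorm_def enorm_def .
  qed
  show ?thesis by (rule that[OF r0(1,2), of 54]) (use main in auto)
qed

section \<open>The linearized operator on bounded intervals\<close>

lemma ac_cong: "ac F f \<Longrightarrow> (\<And>x. 0 < x \<Longrightarrow> F x = G x) \<Longrightarrow> (\<And>x. 0 < x \<Longrightarrow> f x = g x) \<Longrightarrow> ac G g"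
  for F f G g :: "real \<Rightarrow> 'a::euclidean_space"
proof -
  assume F: "ac F f" and FG: "\<And>x. 0 < x \<Longrightarrow> F x = G x" and fg: "\<And>x. 0 < x \<Longrightarrow> f x = g x"
  have eq: "si {a..b} f \<longleftrightarrow> si {a..b} g"
    "(LBINT x:{a..b}. f x) = (LBINT x:{a..b}. g x)" if "0 < a" for a b
    by (rule set_integrable_cong) (use fg that in auto, rule set_lebesgue_integral_cong, use fg that in auto)
  show "ac G g"
    unfolding ac_def locint_def
  proof (intro conjI allI impI)
    fix a b :: real assume ab: "0 < a" "a \<le> b"
    show "si {a..b} g" using ac_integrable[OF F ab(1)] eq(1)[OF ab(1)] by blast
    show "G b - G a = (LBINT x:{a..b}. g x)"
      using ac_diff_eq[OF F ab] eq(2)[OF ab(1)] FG[of a] FG[of b] ab by simp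
  qed
qed

lemma kq_abs_le: "0 < r \<Longrightarrow> \<bar>kq m r\<bar> \<le> real m + 2"
  using kq_diff_nonneg[of r m] kq_diff_le[of r m] by (simp add: abs_le_iff)

text \<open>Taking \<open>y = yf m e\<close> as a second unknown makes the nonlocal operator a
  system of two ordinary differential equations, with bounded coefficients away from the origin. The
  quantity \<open>|e|^2 + y^2\<close> then satisfies a Gronwall inequality, starting from
  \<open>y(r0)^2\<close> alone because \<open>e\<close> vanishes at \<open>r0\<close>.\<close>

lemma middle_region:
  assumes r0: "0 < r0" "r0 < R"
  obtains C where "0 < C"
    "\<forall>e v r. adml m e v \<longrightarrow> e r0 = 0 \<longrightarrow> r \<in> {r0..R} \<longrightarrow>
      nsq (e r) + (yf m e r)^2 \<le> C * ((yf m e r0)^2 + (LBINT s:{r0..R}. nsq (hf m e v s)))"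
proof -
  \<comment> \<open>The summands bound, in this order, the contributions of the cross term with
    \<open>h\<close>, of \<open>kq / s\<close>, of the nonlocal term \<open>q y / s\<close>, and of
    the derivative of \<open>y^2\<close>.\<close>
  define K where "K = 1 + 2 * (real m + 2) / r0 + qmax m / r0 + qmax m * R"
  have K: "0 \<le> K" unfolding K_def using r0 qmax_pos[of m] by (intro add_nonneg_nonneg mult_nonneg_nonneg divide_nonneg_nonneg) auto
  define C where "C = exp (K * (R - r0))"
  have main: "nsq (e r) + (yf m e r)^2 \<le> C * ((yf m e r0)^2 + (LBINT s:{r0..R}. nsq (hf m e v s)))"
    if a: "adml m e v" and e0: "e r0 = 0" and r: "r \<in> {r0..R}" for e v r
  proof -
    note [measurable] = adml_measurable[OF a] hf_measurable[OF a] yf_measurable[OF adml_measurable(1)[OF a]]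
    define y where "y = yf m e"
    have [measurable]: "y \<in> bm" by (simp add: y_def)
    define h where "h = hf m e v"
    have [measurable]: "h \<in> bm" by (simp add: h_def)
    define \<phi> where "\<phi> s = nsq (e s) + y s * y s" for s
    define d where "d s = 2 * Re (cnj (e s) * v s) + (y s * ((q m s * s) * Re (e s)) + y s * ((q m s * s) * Re (e s)))" for s
    have acy: "ac y (\<lambda>s. (q m s * s) * Re (e s))" unfolding y_def by (rule yf_ac[OF a])
    have ac: "ac \<phi> d"
      unfolding \<phi>_def[abs_def] d_def[abs_def]
      by (rule ac_add[OF ac_cmod_sq[OF adml_ac[OF a]] ac_mult[OF acy acy]])
    have hi: "si {r0..R} (\<lambda>s. nsq (h s))"
    proof (rule si_bound[OF set_integrable_mult_right[OF set_integrable_subset[OF si_hf[OF a, of "R + 1"]], where a = "1 / r0"]])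
      show "\<bar>nsq (h s)\<bar> \<le> 1 / r0 * (nsq (hf m e v s) * s)" if "s \<in> {r0..R}" for s
      proof -
        have "nsq (h s) * 1 \<le> nsq (h s) * (s / r0)"
          using that r0 by (intro mult_left_mono) auto
        then show ?thesis by (simp add: h_def)
      qed
    qed (use r0 in auto)
    have d_le: "d s \<le> nsq (h s) + K * \<phi> s" if s: "s \<in> {r0..R}" for s
    proof -
      have sp: "0 < s" "r0 \<le> s" "s \<le> R" using s r0 by auto
      let ?E = "cmod (e s)"
      have v: "v s = h s + of_real (kq m s / s) * e s - of_real (q m s * y s / s)"
        by (simp add: h_def y_def hf_def)
      have "Re (cnj (e s) * v s) = Re (cnj (e s) * h s) + kq m s / s * ?E^2 - q m s / s * (y s * Re (e s))"
      proof -
        have *: "Re (cnj x * (w + of_real k * x - of_real j)) = Re (cnj x * w) + k * nsq x - j * Re x" for x w and k j :: real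
          unfolding cmod_power2 by (simp add: algebra_simps power2_eq_square)
        show ?thesis unfolding v * by simp
      qed
      moreover have "2 * Re (cnj (e s) * h s) \<le> ?E^2 + nsq (h s)"
      proof -
        have "Re (cnj (e s) * h s) \<le> ?E * cmod (h s)"
          using complex_Re_le_cmod[of "cnj (e s) * h s"] by (simp add: norm_mult)
        then show ?thesis using sum_squares_bound[of ?E "cmod (h s)"] by linarith
      qed
      moreover have "kq m s / s * ?E^2 \<le> (real m + 2) / r0 * ?E^2"
      proof (intro mult_right_mono)
        have "kq m s / s \<le> (real m + 2) / s" using kq_abs_le[OF sp(1), of m] sp by (intro divide_right_mono) auto
        also have "\<dots> \<le> (real m + 2) / r0" using sp r0 by (intro divide_left_mono) auto
        finally show "kq m s / s \<le> (real m + 2) / r0" .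
      qed simp
      moreover have yre: "2 * \<bar>y s * Re (e s)\<bar> \<le> \<phi> s"
      proof -
        have "\<bar>y s * Re (e s)\<bar> \<le> \<bar>y s\<bar> * ?E" unfolding abs_mult by (intro mult_left_mono abs_Re_le_cmod) auto
        then show ?thesis using sum_squares_bound[of "\<bar>y s\<bar>" ?E] by (simp add: \<phi>_def power2_eq_square)
      qed
      moreover have "- (2 * (q m s / s * (y s * Re (e s)))) \<le> qmax m / r0 * \<phi> s"
      proof -
        have "- (2 * (q m s / s * (y s * Re (e s)))) = q m s / s * (- (2 * (y s * Re (e s))))" by simp
        also have "\<dots> \<le> q m s / s * \<phi> s"
          using yre q_pos[OF sp(1), of m] sp by (intro mult_left_mono) auto
        also have "\<dots> \<le> qmax m / r0 * \<phi> s"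
          using q_le_qmax[OF sp(1), of m] q_pos[OF sp(1), of m] sp r0
          by (intro mult_right_mono frac_le) (auto simp: \<phi>_def)
        finally show ?thesis .
      qed
      moreover have "2 * (y s * ((q m s * s) * Re (e s))) \<le> qmax m * R * \<phi> s"
      proof -
        have "2 * (y s * ((q m s * s) * Re (e s))) = (q m s * s) * (2 * (y s * Re (e s)))" by simp
        also have "\<dots> \<le> (q m s * s) * \<phi> s"
          using yre q_pos[OF sp(1), of m] sp by (intro mult_left_mono) auto
        also have "\<dots> \<le> qmax m * R * \<phi> s"
          using q_le_qmax[OF sp(1), of m] q_pos[OF sp(1), of m] sp qmax_pos[of m]
          by (intro mult_right_mono mult_mono) (auto simp: \<phi>_def)
        finally show ?thesis .
      qed
      moreover have "?E^2 \<le> \<phi> s" by (simp add: \<phi>_def)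
      moreover have "2 * ((real m + 2) / r0 * ?E^2) \<le> 2 * (real m + 2) / r0 * \<phi> s"
      proof -
        have "2 * (real m + 2) / r0 * ?E^2 \<le> 2 * (real m + 2) / r0 * \<phi> s"
          using r0 by (intro mult_left_mono) (auto simp: \<phi>_def)
        then show ?thesis by (simp add: algebra_simps)
      qed
      moreover have "K * \<phi> s = \<phi> s + 2 * (real m + 2) / r0 * \<phi> s + qmax m / r0 * \<phi> s + qmax m * R * \<phi> s"
        by (simp add: K_def algebra_simps)
      ultimately show ?thesis unfolding d_def by linarith
    qed
    define A where "A = (y r0)^2 + (LBINT s:{r0..R}. nsq (h s))"
    have c\<phi>: "continuous_on {r0..R} \<phi>"
      by (rule continuous_on_subset[OF ac_continuous[OF ac]]) (use r0 in auto)
    have "\<phi> r \<le> A * exp (K * (r - r0))"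
    proof (rule gronwall[OF c\<phi> K _ r])
      fix t assume t: "t \<in> {r0..R}"
      have hit: "si {r0..t} (\<lambda>s. nsq (h s))"
        by (rule set_integrable_subset[OF hi]) (use t in auto)
      have \<phi>it: "si {r0..t} \<phi>"
        by (rule borel_integrable_atLeastAtMost', rule continuous_on_subset[OF c\<phi>]) (use t in auto)
      have "\<phi> t - \<phi> r0 = (LBINT s:{r0..t}. d s)" using ac_diff_eq[OF ac r0(1)] t by simp
      also have "\<dots> \<le> (LBINT s:{r0..t}. nsq (h s) + K * \<phi> s)"
      proof (rule set_integral_mono[OF ac_integrable[OF ac r0(1)] set_integral_add(1)[OF hit set_integrable_mult_right[OF \<phi>it]]])
        show "d s \<le> nsq (h s) + K * \<phi> s" if "s \<in> {r0..t}" for s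
          using d_le[of s] that t by simp
      qed
      also have "\<dots> = (LBINT s:{r0..t}. nsq (h s)) + K * (LBINT s:{r0..t}. \<phi> s)"
        unfolding set_integral_mult_right[symmetric] by (rule set_integral_add(2)[OF hit set_integrable_mult_right[OF \<phi>it]])
      also have "(LBINT s:{r0..t}. nsq (h s)) \<le> (LBINT s:{r0..R}. nsq (h s))"
        by (rule li_mono_set[OF hi]) (use t in auto)
      finally show "\<phi> t \<le> A + K * (LBINT s:{r0..t}. \<phi> s)"
        unfolding A_def by (simp add: \<phi>_def e0 power2_eq_square)
    qed
    also have "\<dots> \<le> A * C"
    proof (intro mult_left_mono)
      show "exp (K * (r - r0)) \<le> C" unfolding C_def using r K by (auto intro!: mult_left_mono)
      show "0 \<le> A" unfolding A_def by (intro add_nonneg_nonneg li_nonneg) auto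
    qed
    finally show ?thesis unfolding A_def \<phi>_def h_def y_def by (simp add: power2_eq_square mult.commute)
  qed
  show ?thesis by (rule that[of C]) (use main in \<open>auto simp: C_def\<close>)
qed

text \<open>The estimate near the origin also controls \<open>yf m e r0\<close>, which is the
  initial value needed to continue to \<open>R\<close>. The point \<open>r0\<close> comes before
  \<open>R\<close> because the argument at the origin does not see \<open>R\<close>; the right-hand
  side reaches to \<open>R + 1\<close> so that the closed interval \<open>{r0..R}\<close> lies
  inside the open one.\<close>

lemma bounded_interval_linear:
  obtains r0 where "0 < r0" "r0 < 1"
    "\<And>R. 1 \<le> R \<Longrightarrow> \<exists>C>0. \<forall>e v. adml m e v \<longrightarrow> e r0 = 0 \<longrightarrow>
      vnorm v R + enorm m e R + nsq (e R) + (yf m e R)^2 \<le> C * vnorm (hf m e v) (R + 1)"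
proof -
  obtain r0 C0 where r0: "0 < r0" "r0 < 1" and C0: "0 < C0"
    "\<forall>e v. adml m e v \<longrightarrow> e r0 = 0 \<longrightarrow> vnorm v r0 + enorm m e r0 \<le> C0 * vnorm (hf m e v) r0"
    by (rule near_origin[of m]) (rule that)
  have "\<exists>C>0. \<forall>e v. adml m e v \<longrightarrow> e r0 = 0 \<longrightarrow>
      vnorm v R + enorm m e R + nsq (e R) + (yf m e R)^2 \<le> C * vnorm (hf m e v) (R + 1)" if R: "1 \<le> R" for R
  proof -
    have r0R: "r0 < R" using r0 R by simp
    obtain C1 where C1: "0 < C1" "\<forall>e v r. adml m e v \<longrightarrow> e r0 = 0 \<longrightarrow> r \<in> {r0..R} \<longrightarrow>
      nsq (e r) + (yf m e r)^2 \<le> C1 * ((yf m e r0)^2 + (LBINT s:{r0..R}. nsq (hf m e v s)))"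
      by (rule middle_region[OF r0(1) r0R, of m]) (rule that)
    \<comment> \<open>\<open>C2\<close> bounds \<open>|e|^2 + y^2\<close> pointwise on
      \<open>{r0..R}\<close>. Then \<open>C3\<close> adds the core estimate, these pointwise bounds
      integrated over a length of at most \<open>R\<close>, and the values at
      \<open>R\<close>.\<close>
    define C2 where "C2 = C1 * (5 * (qmax m)^2 * C0 + 1 / r0)"
    have C2: "0 \<le> C2" unfolding C2_def using C1 C0 r0 by (intro mult_nonneg_nonneg add_nonneg_nonneg) auto
    define C3 where "C3 = C0 + 3 * R / r0 + (3 * (real m + 2)^2 / r0 + 3 * (qmax m)^2 / r0 + ((real m)^2 + 1) / r0) * C2 * R + C2 + 1"
    have t1: "0 \<le> 3 * R / r0" "0 \<le> (3 * (real m + 2)^2 / r0 + 3 * (qmax m)^2 / r0 + ((real m)^2 + 1) / r0) * C2 * R"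
      using R r0 C2 by (auto intro!: mult_nonneg_nonneg add_nonneg_nonneg divide_nonneg_nonneg)
    have C3: "0 < C3" unfolding C3_def using t1 C0 C2 by linarith
    have "vnorm v R + enorm m e R + nsq (e R) + (yf m e R)^2 \<le> C3 * vnorm (hf m e v) (R + 1)"
      if a: "adml m e v" and e0: "e r0 = 0" for e v
    proof -
      note [measurable] = adml_measurable[OF a] hf_measurable[OF a] yf_measurable[OF adml_measurable(1)[OF a]]
      define H where "H = vnorm (hf m e v) (R + 1)"
      have hi: "si {0<..<R+1} (\<lambda>r. nsq (hf m e v r) * r)" by (rule si_hf[OF a])
      have Hr0: "vnorm (hf m e v) r0 \<le> H"
        unfolding H_def vnorm_def by (rule li_mono_set[OF hi]) (use r0 R in auto)
      have H0: "0 \<le> H" unfolding H_def by (rule vnorm_nonneg)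
      have N0: "vnorm v r0 + enorm m e r0 \<le> C0 * H"
        using C0(2)[rule_format, OF a e0] mult_left_mono[OF Hr0, of C0] C0(1) by linarith
      have him: "si {r0..R} (\<lambda>r. nsq (hf m e v r) * r)"
        by (rule set_integrable_subset[OF hi]) (use r0 in auto)
      have hm: "(LBINT r:{r0..R}. nsq (hf m e v r) * r) \<le> H"
        unfolding H_def vnorm_def by (rule li_mono_set[OF hi]) (use r0 in auto)
      have hn: "(LBINT s:{r0..R}. nsq (hf m e v s)) \<le> 1 / r0 * H"
      proof -
        have "\<bar>LBINT s:{r0..R}. nsq (hf m e v s)\<bar> \<le> (LBINT s:{r0..R}. 1 / r0 * (nsq (hf m e v s) * s))"
        proof (rule li_abs_le[OF set_integrable_mult_right[OF him]])
          show "\<bar>nsq (hf m e v s)\<bar> \<le> 1 / r0 * (nsq (hf m e v s) * s)" if "s \<in> {r0..R}" for s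
          proof -
            have "nsq (hf m e v s) * 1 \<le> nsq (hf m e v s) * (s / r0)"
              using that r0 by (intro mult_left_mono) auto
            then show ?thesis by simp
          qed
        qed auto
        also have "\<dots> = 1 / r0 * (LBINT s:{r0..R}. nsq (hf m e v s) * s)" by (rule set_integral_mult_right)
        also have "\<dots> \<le> 1 / r0 * H" using hm r0 by (intro mult_left_mono) auto
        finally show ?thesis by linarith
      qed
      have y0: "(yf m e r0)^2 \<le> 5 * (qmax m)^2 * C0 * H"
      proof -
        have "(LBINT s:{0<..<r0}. nsq (e s)) \<le> 5 * enorm m e r0"
          using li_e_sq[OF a, of 1 r0] r0 unfolding enorm_def by simp
        also have "\<dots> \<le> 5 * (C0 * H)" using N0 vnorm_nonneg[of v r0] by linarith
        finally have E: "(LBINT s:{0<..<r0}. nsq (e s)) \<le> 5 * (C0 * H)" .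
        have "r0 ^ 3 \<le> 1" using r0 by (intro power_le_one) auto
        then have Q: "(qmax m)^2 * r0 ^ 3 \<le> (qmax m)^2 * 1" by (intro mult_left_mono) auto
        have "(qmax m)^2 * r0 ^ 3 * (LBINT s:{0<..<r0}. nsq (e s)) \<le> (qmax m)^2 * 1 * (5 * (C0 * H))"
          by (rule mult_mono[OF Q E]) (auto intro: li_nonneg)
        with yf_sq_le[OF a r0(1)] show ?thesis by (simp add: mult_ac)
      qed
      have \<phi>: "nsq (e r) + (yf m e r)^2 \<le> C2 * H" if "r \<in> {r0..R}" for r
      proof -
        have "nsq (e r) + (yf m e r)^2 \<le> C1 * ((yf m e r0)^2 + (LBINT s:{r0..R}. nsq (hf m e v s)))"
          by (rule C1(2)[rule_format, OF a e0 that])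
        also have "\<dots> \<le> C1 * (5 * (qmax m)^2 * C0 * H + 1 / r0 * H)"
          using C1(1) y0 hn by (intro mult_left_mono add_mono) auto
        finally show ?thesis by (simp add: C2_def algebra_simps)
      qed
      have eb: "nsq (e r) \<le> C2 * H" and yb: "(yf m e r)^2 \<le> C2 * H" if "r \<in> {r0..R}" for r
        using \<phi>[OF that] zero_le_power2[of "yf m e r"] zero_le_power2[of "cmod (e r)"] by linarith+
      have vle: "nsq (v r) * r \<le> 3 * (nsq (hf m e v r) * r) + (3 * (real m + 2)^2 / r0 + 3 * (qmax m)^2 / r0) * (C2 * H)"
        if r: "r \<in> {r0..R}" for r
      proof -
        have rp: "0 < r" "r0 \<le> r" using r r0 by auto
        have veq: "v r = hf m e v r + of_real (kq m r / r) * e r + (- of_real (q m r * yf m e r / r))"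
          by (simp add: hf_def)
        have "nsq (v r) \<le> 3 * nsq (hf m e v r) + 3 * ((kq m r / r)^2 * nsq (e r)) + 3 * (q m r * yf m e r / r)^2"
          using cmod_add3_sq_le[of "hf m e v r" "of_real (kq m r / r) * e r" "- of_real (q m r * yf m e r / r)"]
          unfolding veq[symmetric] norm_minus_cancel norm_mult norm_of_real power_mult_distrib power2_abs .
        then have "nsq (v r) * r \<le> (3 * nsq (hf m e v r) + 3 * ((kq m r / r)^2 * nsq (e r)) + 3 * (q m r * yf m e r / r)^2) * r"
          using rp by (intro mult_right_mono) auto
        also have "\<dots> = 3 * (nsq (hf m e v r) * r) + 3 * ((kq m r)^2 / r * nsq (e r)) + 3 * ((q m r)^2 / r * (yf m e r)^2)"
          using rp by (simp add: distrib_right power_divide power_mult_distrib power2_eq_square)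
        also have "\<dots> \<le> 3 * (nsq (hf m e v r) * r) + 3 * ((real m + 2)^2 / r0 * (C2 * H)) + 3 * ((qmax m)^2 / r0 * (C2 * H))"
        proof -
          have "(kq m r)^2 \<le> (real m + 2)^2" using kq_abs_le[OF rp(1), of m] by (simp add: abs_le_square_iff[symmetric])
          then have "(kq m r)^2 / r \<le> (real m + 2)^2 / r0" using rp r0 by (intro frac_le) auto
          then have 1: "(kq m r)^2 / r * nsq (e r) \<le> (real m + 2)^2 / r0 * (C2 * H)"
            using r0 by (intro mult_mono eb r) auto
          have "(q m r)^2 \<le> (qmax m)^2" using q_le_qmax[OF rp(1), of m] q_pos[OF rp(1), of m] by (intro power_mono) auto
          then have "(q m r)^2 / r \<le> (qmax m)^2 / r0" using rp r0 by (intro frac_le) auto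
          then have 2: "(q m r)^2 / r * (yf m e r)^2 \<le> (qmax m)^2 / r0 * (C2 * H)"
            using r0 by (intro mult_mono yb r) auto
          show ?thesis using 1 2 by linarith
        qed
        finally show ?thesis by (simp add: algebra_simps)
      qed
      have ci: "si {r0..R} (\<lambda>r. c :: real)" for c
        by (rule borel_integrable_atLeastAtMost'[OF continuous_on_const])
      have cv: "(LBINT r:{r0..R}. c) \<le> c * R" if "0 \<le> c" for c :: real
      proof -
        have "(LBINT r:{r0..R}. c) = c * (R - r0)"
          using r0R by (simp add: set_lebesgue_integral_def)
        also have "\<dots> \<le> c * R" using r0 that by (intro mult_left_mono) auto
        finally show ?thesis .
      qed
      have Rsub: "{0<..<R} = {0<..<r0} \<union> {r0..<R}" "{0<..<r0} \<inter> {r0..<R} = {}" using r0R r0 by auto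
      have vi: "si {r0..R} (\<lambda>r. nsq (v r) * r)"
        by (rule set_integrable_subset[OF adml_si(1)[OF a, of "R+1"]]) (use r0 in auto)
      have wi: "si {r0..R} (\<lambda>r. wt m r * nsq (e r))"
        by (rule set_integrable_subset[OF adml_si(2)[OF a, of "R+1"]]) (use r0 in auto)
      have V: "vnorm v R \<le> vnorm v r0 + 3 * H + (3 * (real m + 2)^2 / r0 + 3 * (qmax m)^2 / r0) * (C2 * H) * R"
      proof -
        have "vnorm v R = vnorm v r0 + (LBINT r:{r0..<R}. nsq (v r) * r)"
          unfolding vnorm_def Rsub(1) by (rule li_split) (use adml_si(1)[OF a, of R] Rsub in auto)
        also have "(LBINT r:{r0..<R}. nsq (v r) * r) \<le> (LBINT r:{r0..R}. nsq (v r) * r)"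
          by (rule li_mono_set[OF vi]) (use r0 in auto)
        also have "\<dots> \<le> (LBINT r:{r0..R}. 3 * (nsq (hf m e v r) * r) + (3 * (real m + 2)^2 / r0 + 3 * (qmax m)^2 / r0) * (C2 * H))"
          by (rule set_integral_mono[OF vi set_integral_add(1)[OF set_integrable_mult_right[OF him] ci] vle])
        also have "\<dots> = (LBINT r:{r0..R}. 3 * (nsq (hf m e v r) * r)) + (LBINT r:{r0..R}. (3 * (real m + 2)^2 / r0 + 3 * (qmax m)^2 / r0) * (C2 * H))"
          by (rule set_integral_add(2)[OF set_integrable_mult_right[OF him] ci])
        also have "(LBINT r:{r0..R}. 3 * (nsq (hf m e v r) * r)) \<le> 3 * H"
          unfolding set_integral_mult_right using hm by simp
        also have "(LBINT r:{r0..R}. (3 * (real m + 2)^2 / r0 + 3 * (qmax m)^2 / r0) * (C2 * H)) \<le> (3 * (real m + 2)^2 / r0 + 3 * (qmax m)^2 / r0) * (C2 * H) * R"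
          using r0 C2 H0 by (intro cv mult_nonneg_nonneg add_nonneg_nonneg divide_nonneg_nonneg) auto
        finally show ?thesis by simp
      qed
      have E: "enorm m e R \<le> enorm m e r0 + ((real m)^2 + 1) / r0 * (C2 * H) * R"
      proof -
        have "enorm m e R = enorm m e r0 + (LBINT r:{r0..<R}. wt m r * nsq (e r))"
          unfolding enorm_def Rsub(1) by (rule li_split) (use adml_si(2)[OF a, of R] Rsub in auto)
        also have "(LBINT r:{r0..<R}. wt m r * nsq (e r)) \<le> (LBINT r:{r0..R}. wt m r * nsq (e r))"
          by (rule li_mono_set[OF wi]) (use r0 wt_nonneg in \<open>auto intro!: mult_nonneg_nonneg\<close>)
        also have "\<dots> \<le> (LBINT r:{r0..R}. ((real m)^2 + 1) / r0 * (C2 * H))"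
        proof (rule set_integral_mono[OF wi ci])
          fix r assume r: "r \<in> {r0..R}"
          have "wt m r \<le> ((real m)^2 + 1) / r" using r r0 by (intro wt_le) auto
          also have "\<dots> \<le> ((real m)^2 + 1) / r0" using r r0 by (intro divide_left_mono) auto
          finally show "wt m r * nsq (e r) \<le> ((real m)^2 + 1) / r0 * (C2 * H)"
            using r0 by (intro mult_mono eb r) auto
        qed
        also have "\<dots> \<le> ((real m)^2 + 1) / r0 * (C2 * H) * R"
          using r0 C2 H0 by (intro cv mult_nonneg_nonneg divide_nonneg_nonneg) auto
        finally show ?thesis by simp
      qed
      have "3 * H \<le> 3 * R / r0 * H"
      proof -
        have "1 \<le> R / r0" using r0 R by simp
        then have "3 * H * 1 \<le> 3 * H * (R / r0)" using H0 by (intro mult_left_mono) auto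
        then show ?thesis by (simp add: mult_ac)
      qed
      moreover have "nsq (e R) + (yf m e R)^2 \<le> C2 * H" by (rule \<phi>) (use r0R in auto)
      moreover have "C3 * H = C0 * H + 3 * R / r0 * H + (3 * (real m + 2)^2 / r0 + 3 * (qmax m)^2 / r0) * (C2 * H) * R
          + ((real m)^2 + 1) / r0 * (C2 * H) * R + C2 * H + H"
        unfolding C3_def by (simp add: algebra_simps)
      ultimately have "vnorm v R + enorm m e R + nsq (e R) + (yf m e R)^2 \<le> C3 * H"
        using V E N0 H0 by linarith
      then show ?thesis unfolding H_def .
    qed
    with C3 show ?thesis by blast
  qed
  with r0 that show ?thesis by blast
qed

lemma add_sq_le: "(x + y)^2 \<le> 2 * x^2 + 2 * y^2" for x y :: real
  using zero_le_power2[of "x - y"] by (simp add: power2_sum power2_diff)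

section \<open>The kernel of the linearized operator\<close>

text \<open>The real profile of \<open>Lambda Q\<close>: by the self-duality equation,
  \<open>r q' + q = (kq + 1) q\<close>.\<close>

definition lq :: "nat \<Rightarrow> real \<Rightarrow> real" where
  "lq m r = (kq m r + 1) * q m r"

definition dlq :: "nat \<Rightarrow> real \<Rightarrow> real" where
  "dlq m r = - ((q m r)^2 * r / 2) * q m r + (kq m r / r * q m r) * (kq m r + 1)"

lemma [measurable]: "lq m \<in> bm" "dlq m \<in> bm"
  unfolding lq_def[abs_def] dlq_def[abs_def] by measurable

lemma lq_deriv: "0 < r \<Longrightarrow> (lq m has_real_derivative dlq m r) (at r)"
proof -
  assume r: "0 < r"
  have "((\<lambda>r. kq m r + 1) has_real_derivative - ((q m r)^2 * r / 2) + 0) (at r)"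
    by (rule DERIV_add[OF kq_deriv[OF r] DERIV_const])
  from DERIV_mult[OF this q_deriv[OF r, of m]] show ?thesis
    unfolding lq_def[abs_def] dlq_def by simp
qed

lemma continuous_on_q: "continuous_on {0<..} (q m)" and continuous_on_kq: "continuous_on {0<..} (kq m)"
  by (rule continuous_at_imp_continuous_on, use q_deriv kq_deriv DERIV_isCont in blast)+

lemma adml_real:
  assumes d: "\<And>r. 0 < r \<Longrightarrow> (f has_real_derivative g r) (at r)" and c: "continuous_on {0<..} g"
    and [measurable]: "f \<in> bm" "g \<in> bm"
    and b: "\<And>R. \<exists>B. \<forall>r. 0 < r \<longrightarrow> r < R \<longrightarrow> (g r)^2 * r \<le> B"
    and b2: "\<exists>B. \<forall>r. 0 < r \<longrightarrow> r < 1 \<longrightarrow> (real m)^2 / r * (f r)^2 \<le> B"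
  shows "adml m (\<lambda>r. of_real (f r)) (\<lambda>r. of_real (g r))"
proof (rule admlI)
  have "ac f g"
    by (rule ac_C1[OF _ c]) (use d in \<open>simp add: has_real_derivative_iff_has_vector_derivative\<close>)
  from ac_bounded_linear[OF bounded_linear_of_real this]
  show "ac (\<lambda>r. complex_of_real (f r)) (\<lambda>r. of_real (g r))" .
  show "(\<lambda>r. complex_of_real (f r)) \<in> bm" "(\<lambda>r. complex_of_real (g r)) \<in> bm"
    by measurable
  show "si {0<..<R} (\<lambda>r. nsq (complex_of_real (g r)) * r)" for R
  proof -
    obtain B where "\<forall>r. 0 < r \<longrightarrow> r < R \<longrightarrow> (g r)^2 * r \<le> B" using b[of R] by blast
    then show ?thesis by (intro si_bounded_interval[where B = B]) auto
  qed
  obtain B where "\<forall>r. 0 < r \<longrightarrow> r < 1 \<longrightarrow> (real m)^2 / r * (f r)^2 \<le> B" using b2 by blast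
  then show "si {0<..<1} (\<lambda>r. (real m)^2 / r * nsq (complex_of_real (f r)))"
    by (intro si_bounded_interval[where B = B]) auto
qed

text \<open>Near the origin \<open>kq * q\<close> is of order \<open>r\<close> for two different
  reasons: when \<open>m > 0\<close> because \<open>q\<close> vanishes there, and when
  \<open>m = 0\<close> because \<open>kq\<close> does.\<close>

lemma kq_q_sq_le: "0 < r \<Longrightarrow> (kq m r / r * q m r)^2 * r \<le> (qmax m * (3 * real m + 2))^2"
proof -
  assume r: "0 < r"
  have eq: "(kq m r / r * q m r)^2 * r = (\<bar>kq m r\<bar> * q m r)^2 / r"
    using r by (simp add: power_mult_distrib power_divide power2_eq_square)
  show ?thesis
  proof (cases "r \<le> 1")
    case True
    have "\<bar>kq m r\<bar> \<le> real m + 2 * (real m + 1) * r^2"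
      using kq_diff_nonneg[OF r, of m] kq_diff_le_sq[OF r True, of m] by (simp add: abs_le_iff)
    then have "\<bar>kq m r\<bar> * q m r \<le> (real m + 2 * (real m + 1) * r^2) * q m r"
      using q_pos[OF r, of m] by (intro mult_right_mono) auto
    also have "\<dots> = real m * q m r + 2 * (real m + 1) * r^2 * q m r" by (simp add: distrib_right)
    also have "\<dots> \<le> real m * (qmax m * r) + 2 * (real m + 1) * r * qmax m"
    proof (intro add_mono)
      show "real m * q m r \<le> real m * (qmax m * r)"
      proof (cases m)
        case (Suc k)
        have "r ^ m \<le> r ^ 1" using r True Suc by (intro power_decreasing) auto
        then have "qmax m * r ^ m \<le> qmax m * r" using qmax_pos[of m] by simp
        then show ?thesis using q_le_power[OF r, of m] by (intro mult_left_mono) auto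
      qed simp
      have "r^2 \<le> r" using r True by (simp add: power2_eq_square mult_left_le)
      then show "2 * (real m + 1) * r^2 * q m r \<le> 2 * (real m + 1) * r * qmax m"
        using q_le_qmax[OF r, of m] q_pos[OF r, of m] r by (intro mult_mono mult_left_mono) auto
    qed
    also have "\<dots> = qmax m * (3 * real m + 2) * r" by (simp add: algebra_simps)
    finally have "(\<bar>kq m r\<bar> * q m r)^2 \<le> (qmax m * (3 * real m + 2) * r)^2"
      using q_pos[OF r, of m] by (intro power_mono) auto
    also have "\<dots> = (qmax m * (3 * real m + 2))^2 * r * r" by (simp add: power2_eq_square)
    finally have "(\<bar>kq m r\<bar> * q m r)^2 / r \<le> (qmax m * (3 * real m + 2))^2 * r" using r by (simp add: divide_le_eq)
    also have "\<dots> \<le> (qmax m * (3 * real m + 2))^2 * 1" using True by (intro mult_left_mono) auto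
    finally show ?thesis unfolding eq by simp
  next
    case False
    have "\<bar>kq m r\<bar> * q m r \<le> (3 * real m + 2) * qmax m"
      using kq_abs_le[OF r, of m] q_le_qmax[OF r, of m] q_pos[OF r, of m] by (intro mult_mono) auto
    then have "(\<bar>kq m r\<bar> * q m r)^2 \<le> ((3 * real m + 2) * qmax m)^2"
      using q_pos[OF r, of m] by (intro power_mono) auto
    then have "(\<bar>kq m r\<bar> * q m r)^2 / r \<le> ((3 * real m + 2) * qmax m)^2 / 1"
      using False by (intro frac_le) auto
    then show ?thesis unfolding eq by (simp add: mult.commute)
  qed
qed

lemma m_q_sq_le: "0 < r \<Longrightarrow> r < 1 \<Longrightarrow> (real m)^2 / r * (q m r)^2 \<le> (real m)^2 * (qmax m)^2"
proof (cases m)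
  case (Suc k)
  assume r: "0 < r" "r < 1"
  have "r ^ m \<le> r ^ 1" using r Suc by (intro power_decreasing) auto
  then have "qmax m * r ^ m \<le> qmax m * r" using qmax_pos[of m] by simp
  then have "q m r \<le> qmax m * r" using q_le_power[OF r(1), of m] by linarith
  then have "(q m r)^2 \<le> (qmax m * r)^2" using q_pos[OF r(1), of m] by (intro power_mono) auto
  also have "\<dots> = (qmax m)^2 * r * r" by (simp add: power2_eq_square)
  finally have "(q m r)^2 / r \<le> (qmax m)^2 * r" using r by (simp add: divide_le_eq)
  also have "\<dots> \<le> (qmax m)^2 * 1" using r by (intro mult_left_mono) auto
  finally have "(real m)^2 * ((q m r)^2 / r) \<le> (real m)^2 * ((qmax m)^2 * 1)" by (intro mult_left_mono) auto
  then show ?thesis by simp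
qed simp

lemma adml_q: "adml m (\<lambda>r. of_real (q m r)) (\<lambda>r. of_real (kq m r / r * q m r))"
proof (rule adml_real)
  show "continuous_on {0<..} (\<lambda>r. kq m r / r * q m r)"
    by (intro continuous_intros continuous_on_q continuous_on_kq) auto
  show "\<exists>B. \<forall>r. 0 < r \<longrightarrow> r < R \<longrightarrow> (kq m r / r * q m r)^2 * r \<le> B" for R
    using kq_q_sq_le by blast
  show "\<exists>B. \<forall>r. 0 < r \<longrightarrow> r < 1 \<longrightarrow> (real m)^2 / r * (q m r)^2 \<le> B"
    using m_q_sq_le by blast
qed (use q_deriv in auto)

lemma lq_abs_le: "0 < r \<Longrightarrow> \<bar>lq m r\<bar> \<le> (real m + 3) * q m r"
  unfolding lq_def abs_mult using kq_abs_le[of r m] q_pos[of r m]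
  by (intro mult_mono) auto

lemma adml_lq: "adml m (\<lambda>r. of_real (lq m r)) (\<lambda>r. of_real (dlq m r))"
proof (rule adml_real)
  show "continuous_on {0<..} (dlq m)"
    unfolding dlq_def[abs_def] by (intro continuous_intros continuous_on_q continuous_on_kq) auto
  show "\<exists>B. \<forall>r. 0 < r \<longrightarrow> r < R \<longrightarrow> (dlq m r)^2 * r \<le> B" for R
  proof (intro exI allI impI)
    fix r assume r: "0 < r" "r < R"
    let ?a = "- ((q m r)^2 * r / 2) * q m r" and ?b = "(kq m r / r * q m r) * (kq m r + 1)"
    have "(dlq m r)^2 \<le> 2 * ?a^2 + 2 * ?b^2"
      unfolding dlq_def by (rule add_sq_le)
    then have "(dlq m r)^2 * r \<le> (2 * ?a^2 + 2 * ?b^2) * r" using r by (intro mult_right_mono) auto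
    also have "\<dots> = 2 * (?a^2 * r) + 2 * ((kq m r + 1)^2 * ((kq m r / r * q m r)^2 * r))"
      by (simp only: power_mult_distrib) (simp only: algebra_simps)
    also have "\<dots> \<le> 2 * ((qmax m * qmax m * R * qmax m)^2 * R) + 2 * ((real m + 3)^2 * (qmax m * (3 * real m + 2))^2)"
    proof (intro add_mono mult_left_mono)
      have "\<bar>?a\<bar> \<le> qmax m * qmax m * R * qmax m"
      proof -
        have "\<bar>?a\<bar> = q m r * q m r * (r / 2) * q m r"
          using r q_pos[OF r(1), of m] by (simp add: abs_mult power2_eq_square)
        also have "\<dots> \<le> qmax m * qmax m * R * qmax m"
          using r q_pos[OF r(1), of m] q_le_qmax[OF r(1), of m] qmax_pos[of m] by (intro mult_mono mult_nonneg_nonneg) auto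
        finally show ?thesis .
      qed
      then have "?a^2 \<le> (qmax m * qmax m * R * qmax m)^2"
        by (metis abs_ge_zero power2_abs power_mono)
      then show "?a^2 * r \<le> (qmax m * qmax m * R * qmax m)^2 * R" using r by (intro mult_mono) auto
      have "(kq m r + 1)^2 \<le> (real m + 3)^2"
        using kq_abs_le[OF r(1), of m] by (intro power2_le_iff_abs_le[THEN iffD2]) auto
      then show "(kq m r + 1)^2 * ((kq m r / r * q m r)^2 * r) \<le> (real m + 3)^2 * (qmax m * (3 * real m + 2))^2"
        using r by (intro mult_mono kq_q_sq_le) auto
    qed auto
    finally show "(dlq m r)^2 * r \<le> 2 * ((qmax m * qmax m * R * qmax m)^2 * R) + 2 * ((real m + 3)^2 * (qmax m * (3 * real m + 2))^2)" .
  qed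
  show "\<exists>B. \<forall>r. 0 < r \<longrightarrow> r < 1 \<longrightarrow> (real m)^2 / r * (lq m r)^2 \<le> B"
  proof (intro exI allI impI)
    fix r :: real assume r: "0 < r" "r < 1"
    have "(lq m r)^2 \<le> ((real m + 3) * q m r)^2"
      using power_mono[OF lq_abs_le[OF r(1), of m], of 2] by simp
    then have "(real m)^2 / r * (lq m r)^2 \<le> (real m)^2 / r * ((real m + 3) * q m r)^2"
      using r by (intro mult_left_mono) auto
    also have "\<dots> = (real m + 3)^2 * ((real m)^2 / r * (q m r)^2)" by (simp only: power_mult_distrib) (simp only: mult_ac)
    also have "\<dots> \<le> (real m + 3)^2 * ((real m)^2 * (qmax m)^2)" by (intro mult_left_mono m_q_sq_le r) auto
    finally show "(real m)^2 / r * (lq m r)^2 \<le> (real m + 3)^2 * ((real m)^2 * (qmax m)^2)" .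
  qed
qed (use lq_deriv in auto)

lemma yf_add:
  assumes "adml m e v" "adml m f w"
  shows "yf m (\<lambda>r. e r + f r) r = yf m e r + yf m f r"
  unfolding yf_def using set_integral_add(2)[OF si_yf[OF assms(1)] si_yf[OF assms(2)], of r]
  by (simp add: distrib_left)

lemma yf_cmult: "yf m (\<lambda>r. of_real c * e r) r = c * yf m e r"
proof -
  have "yf m (\<lambda>r. of_real c * e r) r = (LBINT s:{0<..<r}. c * ((q m s * s) * Re (e s)))"
    unfolding yf_def by (intro set_lebesgue_integral_cong) (auto simp: mult_ac)
  then show ?thesis unfolding yf_def by (simp only: set_integral_mult_right)
qed

lemma hf_add:
  assumes "adml m e v" "adml m f w"
  shows "hf m (\<lambda>r. e r + f r) (\<lambda>r. v r + w r) r = hf m e v r + hf m f w r"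
  unfolding hf_def yf_add[OF assms] by (simp add: algebra_simps add_divide_distrib)

lemma hf_cmult: "hf m (\<lambda>r. of_real c * e r) (\<lambda>r. of_real c * v r) r = of_real c * hf m e v r"
  unfolding hf_def yf_cmult by (simp add: algebra_simps)

lemma adml_iq: "adml m (\<lambda>r. \<i> * of_real (q m r)) (\<lambda>r. \<i> * of_real (kq m r / r * q m r))"
  by (rule adml_cmult[OF adml_q])

lemma yf_iq: "yf m (\<lambda>r. \<i> * of_real (q m r)) r = 0"
  by (simp add: yf_def)

text \<open>The kernel element generated by phase rotation. It is purely imaginary, so the nonlocal
  term does not see it, and self-duality cancels the rest.\<close>

lemma hf_iq: "hf m (\<lambda>r. \<i> * of_real (q m r)) (\<lambda>r. \<i> * of_real (kq m r / r * q m r)) r = 0"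
  unfolding hf_def yf_iq by simp

text \<open>Since \<open>lq\<close> is the derivative of \<open>r q\<close>, both sides are
  primitives of the same function and differ by a constant. The square of that constant is at most
  \<open>K * a\<close> for arbitrarily small \<open>a\<close>, because both sides vanish at the
  origin.\<close>

lemma yf_lq:
  assumes b: "0 < b"
  shows "yf m (\<lambda>r. of_real (lq m r)) b = b^2 * (q m b)^2 / 2"
proof -
  let ?L = "\<lambda>r. complex_of_real (lq m r)"
  define D where "D r = yf m ?L r - r^2 * (q m r)^2 / 2" for r
  have 1: "ac (\<lambda>r. r^2 * (q m r)^2 / 2) (\<lambda>s. (q m s * s) * lq m s)"
  proof (rule ac_C1)
    fix r :: real assume r: "0 < r"
    have d: "((\<lambda>r. r * q m r) has_real_derivative lq m r) (at r)"
      using DERIV_mult[OF DERIV_ident q_deriv[OF r, of m]] r by (simp add: lq_def algebra_simps)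
    have "((\<lambda>r. r^2 * (q m r)^2 / 2) has_real_derivative (q m r * r) * lq m r) (at r)"
      using DERIV_cdivide[OF DERIV_mult[OF d d], of 2] by (simp add: power2_eq_square mult_ac)
    then show "((\<lambda>r. r^2 * (q m r)^2 / 2) has_vector_derivative (q m r * r) * lq m r) (at r)"
      by (simp add: has_real_derivative_iff_has_vector_derivative)
  next
    show "continuous_on {0<..} (\<lambda>s. (q m s * s) * lq m s)"
      unfolding lq_def by (intro continuous_intros continuous_on_q continuous_on_kq)
  qed
  have acD: "ac D (\<lambda>s. (q m s * s) * Re (?L s) - (q m s * s) * lq m s)"
    unfolding D_def[abs_def] by (rule ac_diff[OF yf_ac[OF adml_lq] 1])
  have const: "D b = D a" if "0 < a" "a \<le> b" for a
    using ac_diff_eq[OF acD that] by (simp add: set_lebesgue_integral_def)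
  define K where "K = 2 * (qmax m)^2 * (LBINT s:{0<..<1}. nsq (?L s)) + (qmax m) ^ 4"
  have "(D b)^2 \<le> K * a" if a: "0 < a" "a \<le> b" "a < 1" for a
  proof -
    have e2: "si {0<..<1} (\<lambda>s. nsq (?L s))"
      by (rule si_e_sq[OF adml_lq, of 1]) auto
    have "(yf m ?L a)^2 \<le> (qmax m)^2 * a ^ 3 * (LBINT s:{0<..<a}. nsq (?L s))"
      by (rule yf_sq_le[OF adml_lq a(1)])
    also have "\<dots> \<le> (qmax m)^2 * a * (LBINT s:{0<..<1}. nsq (?L s))"
    proof (rule mult_mono, rule mult_left_mono)
      show "a ^ 3 \<le> a" using power_decreasing[of 1 3 a] a by simp
      show "(LBINT s:{0<..<a}. nsq (?L s)) \<le> (LBINT s:{0<..<1}. nsq (?L s))"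
        by (rule li_mono_set[OF e2]) (use a in auto)
    qed (use a in \<open>auto intro: li_nonneg\<close>)
    finally have 1: "(yf m ?L a)^2 \<le> (qmax m)^2 * a * (LBINT s:{0<..<1}. nsq (?L s))" .
    have "a^2 * (q m a)^2 / 2 \<le> 1 * (qmax m)^2 * a / 2"
    proof -
      have "a^2 * (q m a)^2 \<le> a * (qmax m)^2"
        using a q_le_qmax[OF a(1), of m] q_pos[OF a(1), of m]
        by (intro mult_mono power_mono) (auto simp: power2_eq_square mult_left_le)
      then show ?thesis by (simp add: mult.commute)
    qed
    then have "(a^2 * (q m a)^2 / 2)^2 \<le> (1 * (qmax m)^2 * a / 2)^2" by (intro power_mono) auto
    also have "\<dots> = (qmax m) ^ 4 * (a * a) / 4" by (simp add: power2_eq_square power4_eq_xxxx)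
    also have "\<dots> \<le> (qmax m) ^ 4 * (a * 1) / 4" using a by (intro divide_right_mono mult_left_mono) auto
    finally have 2: "(a^2 * (q m a)^2 / 2)^2 \<le> (qmax m) ^ 4 * a / 4" by simp
    have "(D a)^2 \<le> 2 * (yf m ?L a)^2 + 2 * (a^2 * (q m a)^2 / 2)^2"
    proof -
      have "(x - y)^2 \<le> 2 * x^2 + 2 * y^2" for x y :: real
        using zero_le_power2[of "x + y"] by (simp add: power2_sum power2_diff)
      then show ?thesis unfolding D_def .
    qed
    also have "\<dots> \<le> 2 * ((qmax m)^2 * a * (LBINT s:{0<..<1}. nsq (?L s))) + 2 * ((qmax m) ^ 4 * a / 4)"
      using 1 2 by linarith
    also have "\<dots> \<le> K * a"
    proof -
      have "0 \<le> (qmax m) ^ 4 * a" using a by simp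
      then show ?thesis unfolding K_def by (simp add: algebra_simps)
    qed
    finally show ?thesis using const[OF a(1,2)] by simp
  qed
  note * = this
  have "(D b)^2 \<le> 0"
  proof (rule ccontr)
    assume "\<not> (D b)^2 \<le> 0"
    then have pos: "0 < (D b)^2" by simp
    \<comment> \<open>Small enough that \<open>K * a\<close> is at most half of the positive number
      \<open>(D b)^2\<close>; the \<open>1\<close> added to the modulus of \<open>K\<close> keeps
      the denominator positive.\<close>
    define a where "a = min (min b (1/2)) ((D b)^2 / (2 * (\<bar>K\<bar> + 1)))"
    have a: "0 < a" "a \<le> b" "a < 1" using pos b by (auto simp: a_def)
    have "K * a \<le> (\<bar>K\<bar> + 1) * a" using a by (intro mult_right_mono) auto
    also have "\<dots> \<le> (\<bar>K\<bar> + 1) * ((D b)^2 / (2 * (\<bar>K\<bar> + 1)))" by (intro mult_left_mono) (auto simp: a_def)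
    also have "\<dots> = (D b)^2 / 2" by (simp add: field_simps)
    finally show False using *[OF a] pos by simp
  qed
  then show ?thesis by (simp add: D_def)
qed

text \<open>The kernel element generated by scaling. The term from differentiating \<open>kq\<close>
  is cancelled by the nonlocal term, whose value \<open>yf_lq\<close> provides.\<close>

lemma hf_lq:
  assumes r: "0 < r"
  shows "hf m (\<lambda>r. of_real (lq m r)) (\<lambda>r. of_real (dlq m r)) r = 0"
proof -
  have "dlq m r - kq m r / r * lq m r + q m r * (r^2 * (q m r)^2 / 2) / r = 0"
    using r unfolding dlq_def lq_def by (simp add: field_simps power2_eq_square)
  then have "complex_of_real (dlq m r - kq m r / r * lq m r + q m r * (r^2 * (q m r)^2 / 2) / r) = of_real 0"
    by (simp only:)
  then show ?thesis
    unfolding hf_def yf_lq[OF r] by simp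
qed

section \<open>Orthogonality conditions\<close>

definition ip :: "(real \<Rightarrow> complex) \<Rightarrow> (real \<Rightarrow> complex) \<Rightarrow> real" where
  "ip f Z = (LBINT r:{0<..}. Re (cnj (f r) * Z r) * r)"

lemma
  assumes a: "adml m e v" and Z[measurable]: "Z \<in> bm" and B: "\<And>r. cmod (Z r) \<le> B"
    and supp: "\<And>r. R \<le> r \<Longrightarrow> Z r = 0" and R: "1 \<le> R"
  shows si_ip: "si {0<..} (\<lambda>r. Re (cnj (e r) * Z r) * r)"
    and ip_sq_le: "(ip e Z)^2 \<le> B^2 * R ^ 3 * (5 * R * enorm m e R)"
proof -
  note [measurable] = adml_measurable[OF a]
  have B0: "0 \<le> B" using B[of 0] norm_ge_zero[of "Z 0"] by linarith
  have e2: "si {0<..<R} (\<lambda>r. nsq (e r))"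
    by (rule si_e_sq[OF a R]) simp
  have br: "\<bar>(B * r)^2\<bar> \<le> B^2 * R^2" if "r \<in> {0<..<R}" for r
  proof -
    have "(B * r)^2 \<le> (B * R)^2" using that B0 by (intro power_mono mult_left_mono) auto
    then show ?thesis by (simp add: power_mult_distrib)
  qed
  have b2: "si {0<..<R} (\<lambda>r. (B * r)^2)"
    by (rule si_bounded_interval[OF _ br]) auto
  have prod: "si {0<..<R} (\<lambda>r. cmod (e r) * (B * r))"
    by (rule si_mult[OF _ _ _ e2 b2]) auto
  have le: "\<bar>Re (cnj (e r) * Z r) * r\<bar> \<le> cmod (e r) * (B * r)" if "r \<in> {0<..<R}" for r
  proof -
    have "\<bar>Re (cnj (e r) * Z r)\<bar> \<le> cmod (e r) * cmod (Z r)"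
      using abs_Re_le_cmod[of "cnj (e r) * Z r"] by (simp add: norm_mult)
    also have "\<dots> \<le> cmod (e r) * B" by (intro mult_left_mono B) auto
    finally have "\<bar>Re (cnj (e r) * Z r)\<bar> * r \<le> cmod (e r) * B * r" using that by (intro mult_right_mono) auto
    then show ?thesis using that by (simp add: abs_mult mult.assoc)
  qed
  have i: "si {0<..<R} (\<lambda>r. Re (cnj (e r) * Z r) * r)"
    by (rule si_bound[OF prod _ _ le]) auto
  have zero: "Re (cnj (e r) * Z r) * r = 0" if "r \<in> {0<..}" "r \<notin> {0<..<R}" for r
    using that supp[of r] by auto
  show "si {0<..} (\<lambda>r. Re (cnj (e r) * Z r) * r)"
    by (subst set_integrable_support[where A = "{0<..<R}"]) (use i zero in auto)
  have "ip e Z = (LBINT r:{0<..<R}. Re (cnj (e r) * Z r) * r)"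
    unfolding ip_def by (rule set_lebesgue_integral_support) (use zero in auto)
  then have "\<bar>ip e Z\<bar> \<le> (LBINT r:{0<..<R}. cmod (e r) * (B * r))"
    using li_abs_le[OF prod _ _ le] by simp
  then have "(ip e Z)^2 \<le> (LBINT r:{0<..<R}. cmod (e r) * (B * r))^2"
    by (metis abs_ge_zero power2_abs power_mono)
  also have "\<dots> \<le> (LBINT r:{0<..<R}. nsq (e r)) * (LBINT r:{0<..<R}. (B * r)^2)"
    by (rule li_Cauchy_Schwarz[OF _ _ _ e2 b2]) auto
  also have "\<dots> \<le> (5 * R * enorm m e R) * (B^2 * R^2 * (R - 0))"
  proof (intro mult_mono)
    show "(LBINT r:{0<..<R}. nsq (e r)) \<le> 5 * R * enorm m e R"
      unfolding enorm_def by (rule li_e_sq[OF a R]) simp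
    show "(LBINT r:{0<..<R}. (B * r)^2) \<le> B^2 * R^2 * (R - 0)"
      by (rule li_bounded_interval[OF _ br]) (use R in auto)
    show "0 \<le> (LBINT r:{0<..<R}. (B * r)^2)" by (rule li_nonneg) simp
  qed (use R enorm_nonneg[of m e R] in auto)
  finally show "(ip e Z)^2 \<le> B^2 * R ^ 3 * (5 * R * enorm m e R)"
    by (simp add: power2_eq_square power3_eq_cube mult_ac)
qed

lemma vnorm_add:
  assumes "adml m e v" "adml m f w"
  shows "vnorm (\<lambda>r. v r + w r) R \<le> 2 * vnorm v R + 2 * vnorm w R"
proof -
  have "vnorm (\<lambda>r. v r + w r) R \<le> (LBINT r:{0<..<R}. 2 * (nsq (v r) * r) + 2 * (nsq (w r) * r))"
    unfolding vnorm_def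
  proof (rule set_integral_mono[OF adml_si(1)[OF adml_add[OF assms]]
        set_integral_add(1)[OF set_integrable_mult_right[OF adml_si(1)[OF assms(1)]] set_integrable_mult_right[OF adml_si(1)[OF assms(2)]]]])
    fix r :: real assume r: "r \<in> {0<..<R}"
    have "nsq (v r + w r) * r \<le> (2 * nsq (v r) + 2 * nsq (w r)) * r"
      using r by (intro mult_right_mono cmod_add_sq_le) auto
    then show "nsq (v r + w r) * r \<le> 2 * (nsq (v r) * r) + 2 * (nsq (w r) * r)"
      by (simp add: algebra_simps)
  qed
  also have "\<dots> = 2 * vnorm v R + 2 * vnorm w R"
    unfolding vnorm_def set_integral_mult_right[symmetric]
    by (rule set_integral_add(2)[OF set_integrable_mult_right[OF adml_si(1)[OF assms(1)]] set_integrable_mult_right[OF adml_si(1)[OF assms(2)]]])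
  finally show ?thesis .
qed

lemma enorm_add:
  assumes "adml m e v" "adml m f w"
  shows "enorm m (\<lambda>r. e r + f r) R \<le> 2 * enorm m e R + 2 * enorm m f R"
proof -
  have "enorm m (\<lambda>r. e r + f r) R \<le> (LBINT r:{0<..<R}. 2 * (wt m r * nsq (e r)) + 2 * (wt m r * nsq (f r)))"
    unfolding enorm_def
  proof (rule set_integral_mono[OF adml_si(2)[OF adml_add[OF assms]]
        set_integral_add(1)[OF set_integrable_mult_right[OF adml_si(2)[OF assms(1)]] set_integrable_mult_right[OF adml_si(2)[OF assms(2)]]]])
    fix r :: real assume r: "r \<in> {0<..<R}"
    have "wt m r * nsq (e r + f r) \<le> wt m r * (2 * nsq (e r) + 2 * nsq (f r))"
      using r wt_nonneg[of r m] by (intro mult_left_mono cmod_add_sq_le) auto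
    then show "wt m r * nsq (e r + f r) \<le> 2 * (wt m r * nsq (e r)) + 2 * (wt m r * nsq (f r))"
      by (simp add: algebra_simps)
  qed
  also have "\<dots> = 2 * enorm m e R + 2 * enorm m f R"
    unfolding enorm_def set_integral_mult_right[symmetric]
    by (rule set_integral_add(2)[OF set_integrable_mult_right[OF adml_si(2)[OF assms(1)]] set_integrable_mult_right[OF adml_si(2)[OF assms(2)]]])
  finally show ?thesis .
qed

lemma vnorm_cmult: "vnorm (\<lambda>r. of_real c * v r) R = c^2 * vnorm v R"
  unfolding vnorm_def norm_mult norm_of_real power_mult_distrib power2_abs mult.assoc set_integral_mult_right ..

lemma enorm_cmult: "enorm m (\<lambda>r. of_real c * e r) R = c^2 * enorm m e R"
proof -
  have "wt m r * nsq (of_real c * e r) = c^2 * (wt m r * nsq (e r))" for r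
    unfolding norm_mult norm_of_real power_mult_distrib power2_abs by simp
  then show ?thesis unfolding enorm_def by (simp only: set_integral_mult_right)
qed

text \<open>Besides the norm on \<open>{0<..<R}\<close> this contains the boundary values of
  \<open>e\<close> and \<open>yf\<close> at \<open>R\<close>, which are the data that the exterior
  region has to be started from.\<close>

definition bnorm :: "nat \<Rightarrow> (real \<Rightarrow> complex) \<Rightarrow> (real \<Rightarrow> complex) \<Rightarrow> real \<Rightarrow> real" where
  "bnorm m e v R = vnorm v R + enorm m e R + nsq (e R) + (yf m e R)^2"

lemma bnorm_nonneg: "0 \<le> bnorm m e v R"
  unfolding bnorm_def using vnorm_nonneg[of v R] enorm_nonneg[of m e R] by simp

lemma bnorm_add:
  assumes "adml m e v" "adml m f w"
  shows "bnorm m (\<lambda>r. e r + f r) (\<lambda>r. v r + w r) R \<le> 2 * bnorm m e v R + 2 * bnorm m f w R"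
proof -
  have "(yf m (\<lambda>r. e r + f r) R)^2 \<le> 2 * (yf m e R)^2 + 2 * (yf m f R)^2"
    unfolding yf_add[OF assms] by (rule add_sq_le)
  then show ?thesis
    unfolding bnorm_def
    by (rule order_trans[OF add_mono[OF add_mono[OF add_mono[OF vnorm_add[OF assms] enorm_add[OF assms]] cmod_add_sq_le]]])
      (simp add: algebra_simps)
qed

lemma bnorm_cmult: "bnorm m (\<lambda>r. of_real c * e r) (\<lambda>r. of_real c * v r) R = c^2 * bnorm m e v R"
  unfolding bnorm_def vnorm_cmult enorm_cmult yf_cmult norm_mult norm_of_real power_mult_distrib power2_abs
  by (simp add: algebra_simps)

text \<open>
  Subtracting multiples of the two kernel elements makes \<open>e\<close> vanish at \<open>r0\<close>; the orthogonality
  conditions and the determinant then control these multiples.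
\<close>
lemma orthogonal_linear:
  assumes Z: "Z1 \<in> bm" "Z2 \<in> bm"
    and B: "\<And>r. cmod (Z1 r) \<le> B" "\<And>r. cmod (Z2 r) \<le> B"
    and supp: "\<And>r. R \<le> r \<Longrightarrow> Z1 r = 0" "\<And>r. R \<le> r \<Longrightarrow> Z2 r = 0" and R: "1 \<le> R"
    and det: "ip (\<lambda>r. of_real (lq m r)) Z1 * ip (\<lambda>r. \<i> * of_real (q m r)) Z2 -
      ip (\<lambda>r. of_real (lq m r)) Z2 * ip (\<lambda>r. \<i> * of_real (q m r)) Z1 \<noteq> 0"
  shows "\<exists>C>0. \<forall>e v. adml m e v \<longrightarrow> ip e Z1 = 0 \<longrightarrow> ip e Z2 = 0 \<longrightarrow>
    bnorm m e v R \<le> C * vnorm (hf m e v) (R + 1)"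
proof -
  let ?L = "\<lambda>r. complex_of_real (lq m r)" and ?dL = "\<lambda>r. complex_of_real (dlq m r)"
  let ?Q = "\<lambda>r. \<i> * complex_of_real (q m r)" and ?dQ = "\<lambda>r. \<i> * complex_of_real (kq m r / r * q m r)"
  define p1 p2 q1 q2 where "p1 = ip ?L Z1" "p2 = ip ?L Z2" "q1 = ip ?Q Z1" "q2 = ip ?Q Z2"
  note pq = this
  define d where "d = p1 * q2 - p2 * q1"
  have d: "d \<noteq> 0" using det by (simp add: d_def pq)
  obtain r0 where r0: "0 < r0" "r0 < 1" and L: "\<And>R. 1 \<le> R \<Longrightarrow> \<exists>C>0. \<forall>e v. adml m e v \<longrightarrow> e r0 = 0 \<longrightarrow>
      vnorm v R + enorm m e R + nsq (e R) + (yf m e R)^2 \<le> C * vnorm (hf m e v) (R + 1)"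
    using bounded_interval_linear[of m] by blast
  obtain C1 where C1: "0 < C1" "\<forall>e v. adml m e v \<longrightarrow> e r0 = 0 \<longrightarrow> bnorm m e v R \<le> C1 * vnorm (hf m e v) (R + 1)"
    using L[OF R] unfolding bnorm_def by blast
  \<comment> \<open>The profile of \<open>Lambda Q\<close> changes sign at \<open>r = 1\<close>,
    where \<open>kq = - 1\<close>; this is where \<open>r0 < 1\<close> is needed.\<close>
  have lq0: "lq m r0 \<noteq> 0" and q0: "q m r0 \<noteq> 0"
  proof -
    have p: "0 < q m r0" by (rule q_pos[OF r0(1)])
    have "r0 ^ (2 * m + 2) < 1" using r0 by (intro power_less_one_iff[THEN iffD2]) auto
    then have "r0 ^ (2 * m + 2) / (1 + r0 ^ (2 * m + 2)) < 1 / 2"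
      using one_plus_pow_pos[of r0 m] by (simp add: field_simps)
    then have "2 * (real m + 1) * (r0 ^ (2 * m + 2) / (1 + r0 ^ (2 * m + 2))) < 2 * (real m + 1) * (1 / 2)"
      by (intro mult_strict_left_mono) auto
    then have "0 < kq m r0 + 1" by (simp add: kq_def)
    with p show "lq m r0 \<noteq> 0" "q m r0 \<noteq> 0" by (auto simp: lq_def)
  qed
  define K where "K = B^2 * R ^ 3 * (5 * R)"
  have K: "0 \<le> K" unfolding K_def using R by simp
  \<comment> \<open>The bound for \<open>\<alpha>^2\<close> and \<open>\<beta>^2\<close>, relative
    to the right-hand side \<open>H\<close>, that Cramer's rule will give: the entries of the matrix
    over its determinant, times the bound \<open>K * C1\<close> for the squared inner products of
    \<open>e'\<close>.\<close>
  define A where "A = 2 * (q1^2 + q2^2 + p1^2 + p2^2) * (K * C1) / d^2"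
  have A: "0 \<le> A" unfolding A_def using K C1 by (intro divide_nonneg_nonneg mult_nonneg_nonneg) auto
  define C where "C = 2 * C1 + 4 * (A * bnorm m ?L ?dL R + A * bnorm m ?Q ?dQ R) + 1"
  have C: "0 < C" unfolding C_def using C1 A bnorm_nonneg[of m ?L ?dL R] bnorm_nonneg[of m ?Q ?dQ R]
    by (intro add_nonneg_pos add_nonneg_nonneg mult_nonneg_nonneg) auto
  have "bnorm m e v R \<le> C * vnorm (hf m e v) (R + 1)"
    if a: "adml m e v" and o: "ip e Z1 = 0" "ip e Z2 = 0" for e v
  proof -
    define H where "H = vnorm (hf m e v) (R + 1)"
    have H: "0 \<le> H" unfolding H_def by (rule vnorm_nonneg)
    \<comment> \<open>One kernel element is real and the other purely imaginary, so the real and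
      imaginary parts of \<open>e r0\<close> determine the two coefficients separately.\<close>
    define \<alpha> where "\<alpha> = Re (e r0) / lq m r0"
    define \<beta> where "\<beta> = Im (e r0) / q m r0"
    define kk where "kk r = of_real \<alpha> * ?L r + of_real \<beta> * ?Q r" for r
    define dk where "dk r = of_real \<alpha> * ?dL r + of_real \<beta> * ?dQ r" for r
    have aL: "adml m (\<lambda>r. of_real \<alpha> * ?L r) (\<lambda>r. of_real \<alpha> * ?dL r)" by (rule adml_cmult[OF adml_lq])
    have aQ: "adml m (\<lambda>r. of_real \<beta> * ?Q r) (\<lambda>r. of_real \<beta> * ?dQ r)" by (rule adml_cmult[OF adml_iq])
    have ak: "adml m kk dk" unfolding kk_def[abs_def] dk_def[abs_def] by (rule adml_add[OF aL aQ])
    define e' where "e' r = e r + of_real (- 1) * kk r" for r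
    define v' where "v' r = v r + of_real (- 1) * dk r" for r
    have amk: "adml m (\<lambda>r. of_real (- 1) * kk r) (\<lambda>r. of_real (- 1) * dk r)" by (rule adml_cmult[OF ak])
    have a': "adml m e' v'" unfolding e'_def[abs_def] v'_def[abs_def] by (rule adml_add[OF a amk])
    have e'0: "e' r0 = 0"
      using lq0 q0 by (simp add: e'_def kk_def \<alpha>_def \<beta>_def complex_eq_iff)
    have hk: "hf m kk dk r = 0" if "0 < r" for r
      unfolding kk_def[abs_def] dk_def[abs_def] hf_add[OF aL aQ] hf_cmult hf_lq[OF that] hf_iq by simp
    have "hf m e' v' r = hf m e v r" if "0 < r" for r
      unfolding e'_def[abs_def] v'_def[abs_def] hf_add[OF a amk] hf_cmult hk[OF that] by simp
    then have "vnorm (hf m e' v') (R + 1) = H"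
      unfolding H_def vnorm_def by (intro set_lebesgue_integral_cong) auto
    then have S: "bnorm m e' v' R \<le> C1 * H" using C1(2) a' e'0 by metis
    have ipk: "ip e' Z = ip e Z - (\<alpha> * ip ?L Z + \<beta> * ip ?Q Z)" and ip': "(ip e' Z)^2 \<le> K * (C1 * H)"
      if Z: "Z \<in> bm" "\<And>r. cmod (Z r) \<le> B" "\<And>r. R \<le> r \<Longrightarrow> Z r = 0" for Z
    proof -
      note si = si_ip[OF _ Z R]
      have "ip e' Z = (LBINT r:{0<..}. Re (cnj (e r) * Z r) * r - (\<alpha> * (Re (cnj (?L r) * Z r) * r) + \<beta> * (Re (cnj (?Q r) * Z r) * r)))"
        unfolding ip_def e'_def kk_def by (rule arg_cong[where f = "set_lebesgue_integral lborel {0<..}"]) (auto simp: fun_eq_iff algebra_simps)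
      also have "\<dots> = ip e Z - (LBINT r:{0<..}. \<alpha> * (Re (cnj (?L r) * Z r) * r) + \<beta> * (Re (cnj (?Q r) * Z r) * r))"
        unfolding ip_def by (rule set_integral_diff(2)[OF si[OF a] set_integral_add(1)[OF set_integrable_mult_right[OF si[OF adml_lq]] set_integrable_mult_right[OF si[OF adml_iq]]]])
      also have "(LBINT r:{0<..}. \<alpha> * (Re (cnj (?L r) * Z r) * r) + \<beta> * (Re (cnj (?Q r) * Z r) * r)) = \<alpha> * ip ?L Z + \<beta> * ip ?Q Z"
        unfolding ip_def set_integral_mult_right[symmetric]
        by (rule set_integral_add(2)[OF set_integrable_mult_right[OF si[OF adml_lq]] set_integrable_mult_right[OF si[OF adml_iq]]])
      finally show "ip e' Z = ip e Z - (\<alpha> * ip ?L Z + \<beta> * ip ?Q Z)" .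
      have "(ip e' Z)^2 \<le> K * enorm m e' R"
        using ip_sq_le[OF a' Z R] by (simp add: K_def mult.assoc)
      also have "\<dots> \<le> K * (C1 * H)"
      proof (intro mult_left_mono K)
        show "enorm m e' R \<le> C1 * H" using S vnorm_nonneg[of v' R] unfolding bnorm_def
          by (smt (verit) zero_le_power2)
      qed
      finally show "(ip e' Z)^2 \<le> K * (C1 * H)" .
    qed
    define s1 where "s1 = \<alpha> * p1 + \<beta> * q1"
    define s2 where "s2 = \<alpha> * p2 + \<beta> * q2"
    have "ip e' Z1 = - s1" "ip e' Z2 = - s2"
      using ipk[OF Z(1) B(1) supp(1)] ipk[OF Z(2) B(2) supp(2)] o by (simp_all add: s1_def s2_def pq)
    then have s: "s1^2 \<le> K * (C1 * H)" "s2^2 \<le> K * (C1 * H)"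
      using ip'[OF Z(1) B(1) supp(1)] ip'[OF Z(2) B(2) supp(2)] by simp_all
    have sq: "(x * y - z * w)^2 \<le> 2 * (x^2 * y^2) + 2 * (z^2 * w^2)" for x y z w :: real
      using add_sq_le[of "x * y" "- (z * w)"] by (simp add: power_mult_distrib)
    have bound: "2 * (s1^2 * y^2) + 2 * (s2^2 * w^2) \<le> A * H * d^2" if "y^2 + w^2 \<le> q1^2 + q2^2 + p1^2 + p2^2" for y w
    proof -
      have "2 * (s1^2 * y^2) + 2 * (s2^2 * w^2) \<le> 2 * (K * (C1 * H) * y^2) + 2 * (K * (C1 * H) * w^2)"
        by (intro add_mono mult_left_mono mult_right_mono s) auto
      also have "\<dots> = 2 * (K * (C1 * H)) * (y^2 + w^2)" by (simp add: algebra_simps)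
      also have "\<dots> \<le> 2 * (K * (C1 * H)) * (q1^2 + q2^2 + p1^2 + p2^2)"
        using K C1 H by (intro mult_left_mono that) auto
      also have "\<dots> = A * H * d^2" using d by (simp add: A_def)
      finally show ?thesis .
    qed
    \<comment> \<open>Cramer's rule. As \<open>e\<close> is orthogonal to \<open>Z1\<close> and
      \<open>Z2\<close>, the numbers \<open>s1\<close> and \<open>s2\<close> are, up to sign, the
      inner products of \<open>e'\<close>, which are already under control.\<close>
    have "\<alpha> * d = s1 * q2 - s2 * q1" by (simp add: s1_def s2_def d_def algebra_simps)
    then have "\<alpha>^2 * d^2 \<le> A * H * d^2"
      using sq[of s1 q2 s2 q1] bound[of q2 q1] by (simp add: power_mult_distrib[symmetric])
    then have al: "\<alpha>^2 \<le> A * H" using d by simp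
    have "\<beta> * d = s2 * p1 - s1 * p2" by (simp add: s1_def s2_def d_def algebra_simps)
    then have "\<beta>^2 * d^2 \<le> A * H * d^2"
      using sq[of s2 p1 s1 p2] bound[of p2 p1] by (simp add: power_mult_distrib[symmetric])
    then have be: "\<beta>^2 \<le> A * H" using d by simp
    have ek: "(\<lambda>r. e' r + kk r) = e" "(\<lambda>r. v' r + dk r) = v" by (auto simp: e'_def v'_def)
    have "bnorm m e v R \<le> 2 * bnorm m e' v' R + 2 * bnorm m kk dk R"
      using bnorm_add[OF a' ak, of R] unfolding ek .
    moreover have "bnorm m kk dk R \<le> 2 * (\<alpha>^2 * bnorm m ?L ?dL R) + 2 * (\<beta>^2 * bnorm m ?Q ?dQ R)"
      using bnorm_add[OF aL aQ, of R] unfolding bnorm_cmult kk_def[symmetric] dk_def[symmetric] .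
    moreover have "\<alpha>^2 * bnorm m ?L ?dL R \<le> A * H * bnorm m ?L ?dL R" by (intro mult_right_mono al bnorm_nonneg)
    moreover have "\<beta>^2 * bnorm m ?Q ?dQ R \<le> A * H * bnorm m ?Q ?dQ R" by (intro mult_right_mono be bnorm_nonneg)
    moreover have "C * H = 2 * (C1 * H) + 4 * (A * H * bnorm m ?L ?dL R) + 4 * (A * H * bnorm m ?Q ?dQ R) + H"
      by (simp add: C_def algebra_simps)
    ultimately have "bnorm m e v R \<le> C * H" using S H by linarith
    then show ?thesis unfolding H_def .
  qed
  with C show ?thesis by blast
qed

section \<open>The nonlinear operator\<close>

text \<open>The quadratic part of \<open>A_theta Q - A_theta (Q + e)\<close>. It is never negative,
  which is the sign that the exterior estimate exploits.\<close>

definition zf :: "(real \<Rightarrow> complex) \<Rightarrow> real \<Rightarrow> real" where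
  "zf e r = (1/2) * (LBINT s:{0<..<r}. nsq (e s) * s)"

text \<open>The difference \<open>A_theta Q - A_theta (Q + e)\<close>.\<close>
definition bf :: "nat \<Rightarrow> (real \<Rightarrow> complex) \<Rightarrow> real \<Rightarrow> real" where
  "bf m e r = yf m e r + zf e r"

text \<open>The covariant derivative \<open>D_u u\<close> for \<open>u = Q + e\<close>, simplified by \<open>D_Q Q = 0\<close>.\<close>
definition ff :: "nat \<Rightarrow> (real \<Rightarrow> complex) \<Rightarrow> (real \<Rightarrow> complex) \<Rightarrow> real \<Rightarrow> complex" where
  "ff m e v r = v r - of_real ((kq m r - bf m e r) / r) * e r + of_real (q m r * bf m e r / r)"

definition adm :: "nat \<Rightarrow> (real \<Rightarrow> complex) \<Rightarrow> (real \<Rightarrow> complex) \<Rightarrow> bool" where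
  "adm m e v \<longleftrightarrow> adml m e v \<and> si {0<..} (\<lambda>r. nsq (v r) * r) \<and>
    si {0<..} (\<lambda>r. wt m r * nsq (e r)) \<and>
    si {0<..} (\<lambda>r. nsq (e r) * r)"

definition mass :: "(real \<Rightarrow> complex) \<Rightarrow> real" where
  "mass e = (LBINT r:{0<..}. nsq (e r) * r)"

text \<open>Equivalent to the square of the calligraphic norm, with constants between
  \<open>pi\<close> and \<open>4 * pi\<close>.\<close>

definition tot :: "nat \<Rightarrow> (real \<Rightarrow> complex) \<Rightarrow> (real \<Rightarrow> complex) \<Rightarrow> real" where
  "tot m e v = (LBINT r:{0<..}. nsq (v r) * r) + (LBINT r:{0<..}. wt m r * nsq (e r))"

text \<open>By the Bogomolny identity this is the energy of \<open>Q + e\<close> divided by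
  \<open>pi\<close>.\<close>

definition defect :: "nat \<Rightarrow> (real \<Rightarrow> complex) \<Rightarrow> (real \<Rightarrow> complex) \<Rightarrow> real" where
  "defect m e v = (LBINT r:{0<..}. nsq (ff m e v r) * r)"

lemma adm_adml: "adm m e v \<Longrightarrow> adml m e v"
  and adm_si: "adm m e v \<Longrightarrow> si {0<..} (\<lambda>r. nsq (v r) * r)"
    "adm m e v \<Longrightarrow> si {0<..} (\<lambda>r. wt m r * nsq (e r))"
    "adm m e v \<Longrightarrow> si {0<..} (\<lambda>r. nsq (e r) * r)"
  by (simp_all add: adm_def)

lemma mass_nonneg: "0 \<le> mass e"
  unfolding mass_def by (rule li_nonneg) auto

lemma etot_nonneg: "0 \<le> (LBINT r:{0<..}. wt m r * nsq (e r))"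
  by (rule li_nonneg) (auto intro!: mult_nonneg_nonneg wt_nonneg)

lemma vtot_nonneg: "0 \<le> (LBINT r:{0<..}. nsq (v r) * r)"
  by (rule li_nonneg) auto

lemma tot_nonneg: "0 \<le> tot m e v"
  unfolding tot_def using etot_nonneg[of m e] vtot_nonneg[of v] by simp

lemma defect_nonneg: "0 \<le> defect m e v"
  unfolding defect_def by (rule li_nonneg) auto

lemma enorm_le_tot: "adm m e v \<Longrightarrow> enorm m e R \<le> tot m e v"
proof -
  assume a: "adm m e v"
  have "enorm m e R \<le> (LBINT r:{0<..}. wt m r * nsq (e r))"
    unfolding enorm_def by (rule li_mono_set[OF adm_si(2)[OF a]]) (auto intro!: mult_nonneg_nonneg wt_nonneg)
  then show ?thesis unfolding tot_def using vtot_nonneg[of v] by linarith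
qed

lemma zf_nonneg: "0 \<le> zf e r"
  unfolding zf_def by (intro mult_nonneg_nonneg li_nonneg) auto

lemma zf_measurable:
  assumes [measurable]: "e \<in> bm"
  shows "zf e \<in> bm"
proof -
  have [measurable]: "(\<lambda>r. LBINT s:{0<..<r}. nsq (e s) * s) \<in> bm"
    by (rule borel_measurable_primitive) measurable
  show ?thesis unfolding zf_def[abs_def] by measurable
qed

lemma bf_measurable: "e \<in> bm \<Longrightarrow> bf m e \<in> bm"
  unfolding bf_def[abs_def] by (intro borel_measurable_add yf_measurable zf_measurable)

lemma ff_measurable:
  assumes a: "adml m e v"
  shows "ff m e v \<in> bm"
proof -
  note [measurable] = adml_measurable[OF a] bf_measurable[OF adml_measurable(1)[OF a]]
  show ?thesis unfolding ff_def[abs_def] by measurable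
qed

lemma si_zf:
  assumes a: "adml m e v"
  shows "si {0<..<R} (\<lambda>s. nsq (e s) * s)"
proof -
  note [measurable] = adml_measurable[OF a]
  have e2: "si {0<..<R} (\<lambda>s. nsq (e s))"
    by (rule si_e_sq[OF a, of "max 1 R"]) auto
  show ?thesis
  proof (rule si_bound[OF set_integrable_mult_right[OF e2, where a = R]])
    fix s :: real assume s: "s \<in> {0<..<R}"
    then show "\<bar>nsq (e s) * s\<bar> \<le> R * nsq (e s)"
      by (auto simp: mult.commute[of _ s] intro!: mult_right_mono)
  qed auto
qed

lemma zf_le:
  assumes a: "adml m e v" and r: "0 < r" "r \<le> R" "1 \<le> R"
  shows "zf e r \<le> 5/2 * R * r * enorm m e R"
proof -
  note [measurable] = adml_measurable[OF a]
  have e2: "si {0<..<R} (\<lambda>s. nsq (e s))"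
    by (rule si_e_sq[OF a r(3)]) simp
  have e2r: "si {0<..<r} (\<lambda>s. nsq (e s))"
    by (rule set_integrable_subset[OF e2]) (use r in auto)
  have "(LBINT s:{0<..<r}. nsq (e s) * s) \<le> (LBINT s:{0<..<r}. r * nsq (e s))"
    by (rule set_integral_mono[OF si_zf[OF a] set_integrable_mult_right[OF e2r]]) (auto simp: mult.commute[of r] intro!: mult_left_mono)
  also have "\<dots> = r * (LBINT s:{0<..<r}. nsq (e s))" by (rule set_integral_mult_right)
  also have "\<dots> \<le> r * (LBINT s:{0<..<R}. nsq (e s))"
    using r by (intro mult_left_mono li_mono_set[OF e2]) auto
  also have "\<dots> \<le> r * (5 * R * enorm m e R)"
    using r li_e_sq[OF a r(3) order_refl] unfolding enorm_def by (intro mult_left_mono) auto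
  finally show ?thesis unfolding zf_def by (simp add: mult_ac)
qed

lemma yf_le:
  assumes a: "adml m e v" and r: "0 < r" "r \<le> R" "1 \<le> R"
  shows "(yf m e r)^2 \<le> 5 * (qmax m)^2 * R^2 * r^2 * enorm m e R"
proof -
  have e2: "si {0<..<R} (\<lambda>s. nsq (e s))"
    by (rule si_e_sq[OF a r(3)]) simp
  have "(yf m e r)^2 \<le> (qmax m)^2 * r ^ 3 * (LBINT s:{0<..<r}. nsq (e s))" by (rule yf_sq_le[OF a r(1)])
  also have "\<dots> \<le> (qmax m)^2 * (R * r^2) * (5 * R * enorm m e R)"
  proof (rule mult_mono, rule mult_left_mono)
    show "r ^ 3 \<le> R * r^2" using r by (simp add: power3_eq_cube power2_eq_square mult_right_mono)
    have "(LBINT s:{0<..<r}. nsq (e s)) \<le> (LBINT s:{0<..<R}. nsq (e s))"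
      by (rule li_mono_set[OF e2]) (use r in auto)
    then show "(LBINT s:{0<..<r}. nsq (e s)) \<le> 5 * R * enorm m e R"
      using li_e_sq[OF a r(3) order_refl] unfolding enorm_def by linarith
  qed (use r in \<open>auto intro: li_nonneg\<close>)
  finally show ?thesis by (simp add: power2_eq_square mult_ac)
qed

text \<open>The factor \<open>r^2\<close> is the point: it compensates the division by
  \<open>r\<close> in \<open>ff\<close>, so that the coefficient produced by \<open>bf\<close> stays
  bounded at the origin.\<close>

lemma bf_sq_le:
  assumes a: "adml m e v" and r: "0 < r" "r \<le> R" "1 \<le> R"
  shows "(bf m e r)^2 \<le> r^2 * (R^2 * (10 * (qmax m)^2 + 13 * enorm m e R) * enorm m e R)"
proof -
  let ?W = "enorm m e R"
  have W: "0 \<le> ?W" by (rule enorm_nonneg)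
  have "(zf e r)^2 \<le> (5/2 * R * r * ?W)^2" by (intro power_mono zf_le[OF a r] zf_nonneg)
  also have "\<dots> = (25/4 * (R^2 * r^2 * ?W^2))" by (simp add: power_mult_distrib power2_eq_square)
  finally have z: "(zf e r)^2 \<le> 25/4 * (R^2 * r^2 * ?W^2)" .
  have "0 \<le> R^2 * r^2 * ?W^2" by simp
  with z yf_le[OF a r] add_sq_le[of "yf m e r" "zf e r"]
  have "(bf m e r)^2 \<le> 10 * ((qmax m)^2 * R^2 * r^2 * ?W) + 13 * (R^2 * r^2 * ?W^2)"
    unfolding bf_def by linarith
  then show ?thesis by (simp add: power2_eq_square algebra_simps)
qed

lemma ff_hf: "ff m e v r = hf m e v r + (of_real (q m r * zf e r / r) + of_real (bf m e r / r) * e r)"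
  unfolding ff_def hf_def bf_def by (simp add: algebra_simps add_divide_distrib diff_divide_distrib)

definition rem :: "nat \<Rightarrow> (real \<Rightarrow> complex) \<Rightarrow> real \<Rightarrow> complex" where
  "rem m e r = of_real (q m r * zf e r / r) + of_real (bf m e r / r) * e r"

lemma rem_measurable:
  assumes [measurable]: "e \<in> bm"
  shows "rem m e \<in> bm"
proof -
  note [measurable] = zf_measurable[OF assms] bf_measurable[OF assms]
  show ?thesis unfolding rem_def[abs_def] by measurable
qed

text \<open>In \<open>rem\<close> the density of \<open>zf\<close> is quadratic in \<open>e\<close>,
  and \<open>bf\<close> is at least linear and multiplies \<open>e\<close> once more. The bound is
  therefore quadratic in \<open>enorm\<close>, and smallness can absorb it. The powers of
  \<open>R\<close> are harmless, as \<open>R\<close> is fixed before \<open>\<eta>\<close>.\<close>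

lemma
  assumes a: "adml m e v" and R: "1 \<le> R"
  shows si_rem: "si {0<..<R} (\<lambda>r. nsq (rem m e r) * r)"
    and vnorm_rem_le: "vnorm (rem m e) R \<le> (13 * (qmax m)^2 * R ^ 4 + 10 * R ^ 4 * (10 * (qmax m)^2 + 13 * enorm m e R)) * (enorm m e R)^2"
proof -
  note [measurable] = adml_measurable[OF a] rem_measurable[OF adml_measurable(1)[OF a]]
  let ?W = "enorm m e R"
  define c where "c = R^2 * (10 * (qmax m)^2 + 13 * ?W) * ?W"
  have W: "0 \<le> ?W" by (rule enorm_nonneg)
  have c: "0 \<le> c" unfolding c_def using W by (intro mult_nonneg_nonneg add_nonneg_nonneg) auto
  have e2: "si {0<..<R} (\<lambda>s. nsq (e s))"
    by (rule si_e_sq[OF a R]) simp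
  have le: "nsq (rem m e r) * r \<le> 13 * (qmax m)^2 * R ^ 3 * ?W^2 + 2 * c * R * nsq (e r)"
    if r: "r \<in> {0<..<R}" for r
  proof -
    have rp: "0 < r" "r \<le> R" using r by auto
    have "nsq (rem m e r) \<le> 2 * (q m r * zf e r / r)^2 + 2 * ((bf m e r / r)^2 * nsq (e r))"
      using cmod_add_sq_le[of "of_real (q m r * zf e r / r)" "of_real (bf m e r / r) * e r"]
      unfolding rem_def[symmetric] norm_mult norm_of_real power_mult_distrib power2_abs .
    then have "nsq (rem m e r) * r \<le> (2 * (q m r * zf e r / r)^2 + 2 * ((bf m e r / r)^2 * nsq (e r))) * r"
      using rp by (intro mult_right_mono) auto
    also have "\<dots> = 2 * ((q m r)^2 * (zf e r)^2 / r) + 2 * ((bf m e r)^2 / r * nsq (e r))"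
      using rp by (simp add: distrib_right power_divide power_mult_distrib power2_eq_square)
    also have "\<dots> \<le> 2 * ((qmax m)^2 * (25/4 * R ^ 3 * ?W^2)) + 2 * (c * R * nsq (e r))"
    proof (intro add_mono mult_left_mono)
      have "(zf e r)^2 \<le> (5/2 * R * r * ?W)^2" by (intro power_mono zf_le[OF a rp R] zf_nonneg)
      also have "\<dots> = 25/4 * R^2 * ?W^2 * r * r" by (simp add: power_mult_distrib power2_eq_square)
      finally have "(zf e r)^2 / r \<le> 25/4 * R^2 * ?W^2 * r" using rp by (simp add: divide_le_eq)
      also have "\<dots> \<le> 25/4 * R^2 * ?W^2 * R" using rp R by (intro mult_left_mono) auto
      finally have z: "(zf e r)^2 / r \<le> 25/4 * R ^ 3 * ?W^2" by (simp add: power2_eq_square power3_eq_cube mult_ac)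
      have "(q m r)^2 \<le> (qmax m)^2" using q_le_qmax[OF rp(1), of m] q_pos[OF rp(1), of m] by (intro power_mono) auto
      then have "(q m r)^2 * ((zf e r)^2 / r) \<le> (qmax m)^2 * (25/4 * R ^ 3 * ?W^2)"
        using rp by (intro mult_mono z) auto
      then show "(q m r)^2 * (zf e r)^2 / r \<le> (qmax m)^2 * (25/4 * R ^ 3 * ?W^2)" by simp
      have "(bf m e r)^2 \<le> c * r * r" using bf_sq_le[OF a rp R] unfolding c_def by (simp add: power2_eq_square mult_ac)
      then have "(bf m e r)^2 / r \<le> c * r" using rp by (simp add: divide_le_eq)
      also have "\<dots> \<le> c * R" using rp c by (intro mult_left_mono) auto
      finally show "(bf m e r)^2 / r * nsq (e r) \<le> c * R * nsq (e r)" by (intro mult_right_mono) auto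
    qed auto
    also have "\<dots> \<le> 13 * (qmax m)^2 * R ^ 3 * ?W^2 + 2 * c * R * nsq (e r)"
    proof -
      have "0 \<le> (qmax m)^2 * (R ^ 3 * ?W^2)" using R by simp
      then show ?thesis by (simp add: mult_ac)
    qed
    finally show ?thesis .
  qed
  have ci: "si {0<..<R} (\<lambda>r. 13 * (qmax m)^2 * R ^ 3 * ?W^2)"
    by (rule si_bounded_interval[OF _ order_refl]) simp
  have sum: "si {0<..<R} (\<lambda>r. 13 * (qmax m)^2 * R ^ 3 * ?W^2 + 2 * c * R * nsq (e r))"
    by (rule set_integral_add(1)[OF ci set_integrable_mult_right[OF e2]])
  show i: "si {0<..<R} (\<lambda>r. nsq (rem m e r) * r)"
    by (rule si_bound[OF sum]) (use le in auto)
  have "vnorm (rem m e) R \<le> (LBINT r:{0<..<R}. 13 * (qmax m)^2 * R ^ 3 * ?W^2 + 2 * c * R * nsq (e r))"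
    unfolding vnorm_def by (rule set_integral_mono[OF i sum le])
  also have "\<dots> = (LBINT r:{0<..<R}. 13 * (qmax m)^2 * R ^ 3 * ?W^2) + (LBINT r:{0<..<R}. 2 * c * R * nsq (e r))"
    by (rule set_integral_add(2)[OF ci set_integrable_mult_right[OF e2]])
  also have "(LBINT r:{0<..<R}. 2 * c * R * nsq (e r)) = 2 * c * R * (LBINT r:{0<..<R}. nsq (e r))"
    by (rule set_integral_mult_right)
  also have "(LBINT r:{0<..<R}. 13 * (qmax m)^2 * R ^ 3 * ?W^2) \<le> 13 * (qmax m)^2 * R ^ 3 * ?W^2 * (R - 0)"
    by (rule li_bounded_interval) (use R in auto)
  also have "2 * c * R * (LBINT r:{0<..<R}. nsq (e r)) \<le> 2 * c * R * (5 * R * ?W)"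
    using c R li_e_sq[OF a R order_refl] unfolding enorm_def by (intro mult_left_mono) auto
  finally show "vnorm (rem m e) R \<le> (13 * (qmax m)^2 * R ^ 4 + 10 * R ^ 4 * (10 * (qmax m)^2 + 13 * ?W)) * ?W^2"
    unfolding c_def by (simp add: power2_eq_square power4_eq_xxxx power3_eq_cube algebra_simps)
qed

section \<open>Integrable majorants\<close>

lemma
  fixes R :: real
  assumes R: "0 < R"
  shows si_inverse_sq: "si {R..} (\<lambda>r. 1 / r^2)"
    and li_inverse_sq: "(LBINT r:{R..}. 1 / r^2) \<le> 1 / R"
proof -
  have main: "si {R..b} (\<lambda>r. 1 / r^2) \<and> (LBINT r:{R..b}. 1 / r^2) \<le> 1 / R" if b: "R \<le> b" for b
  proof
    have c: "continuous_on {R..b} (\<lambda>r. 1 / r^2)" by (rule continuous_on_divide) (use R in \<open>auto intro: continuous_on_power continuous_on_id\<close>)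
    then show "si {R..b} (\<lambda>r. 1 / r^2)" by (rule borel_integrable_atLeastAtMost')
    have "(LBINT r:{R..b}. 1 / r^2) = - (1 / b) - (- (1 / R))"
      unfolding set_lebesgue_integral_def
    proof (rule integral_FTC_atLeastAtMost[OF b _ c])
      fix x assume x: "R \<le> x" "x \<le> b"
      have "((\<lambda>r. - (1 / r)) has_real_derivative 1 / x^2) (at x within {R..b})"
        using x R by (auto intro!: derivative_eq_intros simp: power2_eq_square)
      then show "((\<lambda>r. - (1 / r)) has_vector_derivative 1 / x^2) (at x within {R..b})"
        by (simp add: has_real_derivative_iff_has_vector_derivative)
    qed
    then show "(LBINT r:{R..b}. 1 / r^2) \<le> 1 / R" using R b by simp
  qed
  show "si {R..} (\<lambda>r. 1 / r^2)" by (rule si_at_infinity[OF _ _ main]) auto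
  show "(LBINT r:{R..}. 1 / r^2) \<le> 1 / R" by (rule li_at_infinity[OF _ _ main]) auto
qed

text \<open>One integrable majorant, up to constants, for the quadratic densities built from
  \<open>Q\<close> and \<open>Q'\<close>. The slowest decay is that of \<open>m = 0\<close>, where
  \<open>Q\<close> behaves like \<open>1 / r^2\<close>.\<close>

definition maj :: "real \<Rightarrow> real" where
  "maj r = (if r < 1 then 1 else 1 / r^2)"

lemma maj_measurable [measurable]: "maj \<in> bm"
  unfolding maj_def[abs_def] by measurable

lemma si_maj: "si {0<..} maj" and li_maj: "(LBINT r:{0<..}. maj r) \<le> 2"
proof -
  have eq: "{0<..} = {0<..<1} \<union> {1::real..}" by auto
  have 1: "si {0<..<1} maj"
    by (rule si_bounded_interval[where B = 1]) (auto simp: maj_def)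
  have 2: "si {1..} maj"
    by (rule set_integrable_cong[THEN iffD1, OF refl refl _ si_inverse_sq[OF zero_less_one]]) (auto simp: maj_def)
  have iu: "si ({0<..<1} \<union> {1::real..}) maj"
    by (rule set_integrable_Un[OF 1 2]) auto
  then show "si {0<..} maj" by (simp only: eq)
  have "(LBINT r:{0<..}. maj r) = (LBINT r:{0<..<1}. maj r) + (LBINT r:{1..}. maj r)"
    unfolding eq by (rule li_split[OF iu]) auto
  also have "(LBINT r:{0<..<1}. maj r) \<le> 1 * (1 - 0)"
    by (rule li_bounded_interval) (auto simp: maj_def)
  also have "(LBINT r:{1..}. maj r) = (LBINT r:{1..}. 1 / r^2)"
    by (rule set_lebesgue_integral_cong) (auto simp: maj_def)
  also have "\<dots> \<le> 1 / 1" by (rule li_inverse_sq) simp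
  finally show "(LBINT r:{0<..}. maj r) \<le> 2" by simp
qed

lemma q_sq_mult_le_maj: "0 < r \<Longrightarrow> (q m r)^2 * r \<le> (qmax m)^2 * maj r"
proof (cases "r < 1")
  case True
  assume r: "0 < r"
  have "(q m r)^2 * r \<le> (qmax m)^2 * 1"
    using q_le_qmax[OF r, of m] q_pos[OF r, of m] r True by (intro mult_mono power_mono) auto
  with True show ?thesis by (simp add: maj_def)
next
  case False
  then have r: "1 \<le> r" by simp
  have "(q m r)^2 \<le> (qmax m / r^2)^2"
    using q_decay[OF r, of m] q_pos[of r m] r by (intro power_mono) auto
  then have "(q m r)^2 * r \<le> (qmax m / r^2)^2 * r" using r by (intro mult_right_mono) auto
  also have "\<dots> = (qmax m)^2 * (1 / r^2) * (1 / r)" using r by (simp add: power2_eq_square)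
  also have "\<dots> \<le> (qmax m)^2 * (1 / r^2) * 1" using r by (intro mult_left_mono) auto
  finally show ?thesis using False by (simp add: maj_def)
qed

lemma q_sq_decay: "1 \<le> r \<Longrightarrow> (q m r)^2 \<le> (qmax m)^2 / r ^ 4"
proof -
  assume r: "1 \<le> r"
  have "(q m r)^2 \<le> (qmax m / r^2)^2"
    using q_decay[OF r, of m] q_pos[of r m] r by (intro power_mono) auto
  then show ?thesis by (simp add: power_divide flip: power_mult)
qed

text \<open>Cauchy-Schwarz with two different weights. Paired with the mass, the decay of
  \<open>Q\<close> gains \<open>1/R\<close>, which is small although \<open>e\<close> need not be.
  Paired with the integral of \<open>|e|^2 / s\<close>, the increment of \<open>bf\<close> is
  bounded by the very quantity that the exterior estimate produces, so it can be absorbed.\<close>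

lemma
  assumes a: "adm m e v" and R: "1 \<le> R" "R \<le> r"
  shows yf_diff_mass: "(yf m e r - yf m e R)^2 \<le> (qmax m)^2 / R * mass e"
    and bf_diff_tail: "(bf m e r - bf m e R)^2 \<le> (2 * (qmax m)^2 + mass e) * r^2 * (LBINT s:{R..r}. nsq (e s) / s)"
    and si_tail: "si {R..r} (\<lambda>s. nsq (e s) / s)"
proof -
  note al = adm_adml[OF a]
  note [measurable] = adml_measurable[OF al]
  have R0: "0 < R" using R by simp
  let ?S = "{R..r}"
  let ?T = "LBINT s:?S. nsq (e s) / s"
  have ce: "continuous_on ?S e" by (rule continuous_on_subset[OF ac_continuous[OF adml_ac[OF al]]]) (use R0 in auto)
  have cq: "continuous_on ?S (q m)" by (rule continuous_on_subset[OF continuous_on_q]) (use R0 in auto)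
  have int: "si ?S f" if "continuous_on ?S f" for f :: "real \<Rightarrow> real"
    using that by (rule borel_integrable_atLeastAtMost')
  show Ti: "si ?S (\<lambda>s. nsq (e s) / s)"
    by (intro int continuous_intros ce) (use R0 in auto)
  have T0: "0 \<le> ?T" by (rule li_nonneg) (use R0 in auto)
  have M: "(LBINT s:?S. nsq (e s) * s) \<le> mass e"
    unfolding mass_def by (rule li_mono_set[OF adm_si(3)[OF a]]) (use R0 in auto)
  have dy: "yf m e r - yf m e R = (LBINT s:?S. (q m s * s) * Re (e s))"
    by (rule ac_diff_eq[OF yf_ac[OF al] R0 R(2)])
  have dz: "zf e r - zf e R = (1/2) * (LBINT s:?S. nsq (e s) * s)"
    unfolding zf_def using ac_diff_eq[OF ac_primitive[OF si_zf[OF al]] R0 R(2)] by simp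
  show "(yf m e r - yf m e R)^2 \<le> (qmax m)^2 / R * mass e"
  proof -
    let ?f = "\<lambda>s. q m s * sqrt s" and ?g = "\<lambda>s. sqrt s * Re (e s)"
    have "(yf m e r - yf m e R)^2 = (LBINT s:?S. ?f s * ?g s)^2"
      unfolding dy by (intro arg_cong[where f = "\<lambda>x. x^2"] set_lebesgue_integral_cong) (use R0 in \<open>auto simp: mult_ac\<close>)
    also have "\<dots> \<le> (LBINT s:?S. (?f s)^2) * (LBINT s:?S. (?g s)^2)"
      by (rule li_Cauchy_Schwarz) (auto intro!: int continuous_intros ce cq)
    also have "\<dots> \<le> ((qmax m)^2 * (1 / R)) * mass e"
    proof (rule mult_mono)
      have "(LBINT s:?S. (?f s)^2) \<le> (LBINT s:?S. (qmax m)^2 * (1 / s^2))"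
      proof (rule set_integral_mono)
        show "si ?S (\<lambda>s. (?f s)^2)" by (intro int continuous_intros cq)
        show "si ?S (\<lambda>s. (qmax m)^2 * (1 / s^2))" by (intro int continuous_intros) (use R0 in auto)
        show "(?f s)^2 \<le> (qmax m)^2 * (1 / s^2)" if "s \<in> ?S" for s
          using q_sq_mult_le_maj[of s m] that R by (simp add: power_mult_distrib maj_def)
      qed
      also have "\<dots> = (qmax m)^2 * (LBINT s:?S. 1 / s^2)" by (rule set_integral_mult_right)
      also have "\<dots> \<le> (qmax m)^2 * (1 / R)"
      proof (rule mult_left_mono)
        have "(LBINT s:?S. 1 / s^2) \<le> (LBINT s:{R..}. 1 / s^2)"
          by (rule li_mono_set[OF si_inverse_sq[OF R0]]) auto
        then show "(LBINT s:?S. 1 / s^2) \<le> 1 / R" using li_inverse_sq[OF R0] by linarith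
      qed simp
      finally show "(LBINT s:?S. (?f s)^2) \<le> (qmax m)^2 * (1 / R)" .
      have "(LBINT s:?S. (?g s)^2) \<le> (LBINT s:?S. nsq (e s) * s)"
      proof (rule set_integral_mono)
        show "si ?S (\<lambda>s. (?g s)^2)" "si ?S (\<lambda>s. nsq (e s) * s)"
          by (intro int continuous_intros ce)+
        show "(?g s)^2 \<le> nsq (e s) * s" if "s \<in> ?S" for s
        proof -
          have "s * (Re (e s))^2 \<le> s * nsq (e s)" using that R0 by (intro mult_left_mono) (auto simp: cmod_power2)
          then show ?thesis using that R0 by (simp add: power_mult_distrib mult.commute)
        qed
      qed
      with M show "(LBINT s:?S. (?g s)^2) \<le> mass e" by linarith
    qed (use R0 in \<open>auto intro: li_nonneg\<close>)
    finally show ?thesis by simp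
  qed
  have Y: "(yf m e r - yf m e R)^2 \<le> (qmax m)^2 * r^2 * ?T"
  proof -
    let ?f = "\<lambda>s. q m s * s * sqrt s" and ?g = "\<lambda>s. Re (e s) / sqrt s"
    have "(yf m e r - yf m e R)^2 = (LBINT s:?S. ?f s * ?g s)^2"
      unfolding dy by (intro arg_cong[where f = "\<lambda>x. x^2"] set_lebesgue_integral_cong) (use R0 in auto)
    also have "\<dots> \<le> (LBINT s:?S. (?f s)^2) * (LBINT s:?S. (?g s)^2)"
      by (rule li_Cauchy_Schwarz) (use R0 in \<open>auto intro!: int continuous_intros ce cq\<close>)
    also have "\<dots> \<le> ((qmax m)^2 * r^2) * ?T"
    proof (rule mult_mono)
      have "(LBINT s:?S. (?f s)^2) \<le> (LBINT s:?S. (qmax m)^2)"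
      proof (rule set_integral_mono)
        show "si ?S (\<lambda>s. (?f s)^2)" by (intro int continuous_intros cq)
        show "si ?S (\<lambda>s. (qmax m)^2)" by (intro int continuous_intros)
        fix s assume s: "s \<in> ?S"
        then have s1: "1 \<le> s" using R by simp
        have "(?f s)^2 = (q m s)^2 * s ^ 3" using s1 by (simp add: power_mult_distrib power3_eq_cube power2_eq_square)
        also have "\<dots> \<le> (qmax m)^2 / s ^ 4 * s ^ 3" using s1 by (intro mult_right_mono q_sq_decay) auto
        also have "\<dots> = (qmax m)^2 * (1 / s)" using s1 by (simp add: power4_eq_xxxx power3_eq_cube)
        also have "\<dots> \<le> (qmax m)^2 * 1" using s1 by (intro mult_left_mono) auto
        finally show "(?f s)^2 \<le> (qmax m)^2" by simp
      qed
      also have "\<dots> = (qmax m)^2 * (r - R)" using R by (simp add: set_lebesgue_integral_def)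
      also have "\<dots> \<le> (qmax m)^2 * r^2"
      proof (rule mult_left_mono)
        have "r \<le> r * r" using mult_left_mono[of 1 r r] R by simp
        then show "r - R \<le> r^2" unfolding power2_eq_square using R by linarith
      qed simp
      finally show "(LBINT s:?S. (?f s)^2) \<le> (qmax m)^2 * r^2" .
      show "(LBINT s:?S. (?g s)^2) \<le> ?T"
      proof (rule set_integral_mono[OF _ Ti])
        show "si ?S (\<lambda>s. (?g s)^2)"
          by (intro int continuous_intros ce) (use R0 in auto)
        show "(?g s)^2 \<le> nsq (e s) / s" if "s \<in> ?S" for s
          using that R0 by (auto simp: power_divide cmod_power2 intro!: divide_right_mono)
      qed
    qed (auto intro: li_nonneg)
    finally show ?thesis .
  qed
  have Z: "(zf e r - zf e R)^2 \<le> (1/4) * (mass e * (r^2 * ?T))"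
  proof -
    let ?A = "LBINT s:?S. nsq (e s) * s"
    have A0: "0 \<le> ?A" by (rule li_nonneg) (use R0 in auto)
    have "?A \<le> (LBINT s:?S. r^2 * (nsq (e s) / s))"
    proof (rule set_integral_mono)
      show "si ?S (\<lambda>s. nsq (e s) * s)" by (intro int continuous_intros ce)
      show "si ?S (\<lambda>s. r^2 * (nsq (e s) / s))" by (rule set_integrable_mult_right[OF Ti])
      fix s assume s: "s \<in> ?S"
      then have "s * s \<le> r^2" using R0 by (auto simp: power2_eq_square intro!: mult_mono)
      then have "nsq (e s) / s * (s * s) \<le> nsq (e s) / s * r^2" using s R0 by (intro mult_left_mono) auto
      then show "nsq (e s) * s \<le> r^2 * (nsq (e s) / s)" using s R0 by (simp add: mult.commute)
    qed
    also have "\<dots> = r^2 * ?T" by (rule set_integral_mult_right)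
    \<comment> \<open>One factor is bounded by the mass and the other by the tail integral, which
      keeps the estimate linear in the tail.\<close>
    finally have "?A * ?A \<le> mass e * (r^2 * ?T)" using M A0 mass_nonneg[of e] by (intro mult_mono) auto
    moreover have "(zf e r - zf e R)^2 = (1/4) * (?A * ?A)" unfolding dz by (simp add: power2_eq_square)
    ultimately show ?thesis by linarith
  qed
  have "bf m e r - bf m e R = (yf m e r - yf m e R) + (zf e r - zf e R)" by (simp add: bf_def)
  then have "(bf m e r - bf m e R)^2 \<le> 2 * (yf m e r - yf m e R)^2 + 2 * (zf e r - zf e R)^2"
    by (simp only: add_sq_le)
  moreover have "0 \<le> mass e * (r^2 * ?T)" using mass_nonneg[of e] T0 by simp
  ultimately have "(bf m e r - bf m e R)^2 \<le> 2 * ((qmax m)^2 * r^2 * ?T) + mass e * (r^2 * ?T)"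
    using Y Z by linarith
  then show "(bf m e r - bf m e R)^2 \<le> (2 * (qmax m)^2 + mass e) * r^2 * ?T" by (simp add: algebra_simps)
qed

lemma bf_bounded:
  assumes a: "adm m e v" and r: "0 < r"
  shows "(bf m e r)^2 \<le> 4 * (qmax m)^2 * mass e + (mass e)^2"
proof -
  note al = adm_adml[OF a]
  note [measurable] = adml_measurable[OF al]
  let ?S = "{0<..<r}"
  have ei: "si ?S (\<lambda>s. nsq (e s) * s)" by (rule si_zf[OF al])
  have M: "(LBINT s:?S. nsq (e s) * s) \<le> mass e"
    unfolding mass_def by (rule li_mono_set[OF adm_si(3)[OF a]]) auto
  have mi: "si ?S maj" by (rule set_integrable_subset[OF si_maj]) auto
  let ?f = "\<lambda>s. q m s * sqrt s" and ?g = "\<lambda>s. sqrt s * Re (e s)"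
  have fle: "\<bar>(?f s)^2\<bar> \<le> (qmax m)^2 * maj s" if "s \<in> ?S" for s
    using q_sq_mult_le_maj[of s m] that by (simp add: power_mult_distrib)
  have fi: "si ?S (\<lambda>s. (?f s)^2)"
    by (rule si_bound[OF set_integrable_mult_right[OF mi] _ _ fle]) auto
  have gle: "\<bar>(?g s)^2\<bar> \<le> nsq (e s) * s" if "s \<in> ?S" for s
  proof -
    have "s * (Re (e s))^2 \<le> s * nsq (e s)" using that by (intro mult_left_mono) (auto simp: cmod_power2)
    then show ?thesis using that by (simp add: power_mult_distrib mult.commute)
  qed
  have gi: "si ?S (\<lambda>s. (?g s)^2)"
    by (rule si_bound[OF ei _ _ gle]) auto
  have "(yf m e r)^2 = (LBINT s:?S. ?f s * ?g s)^2"
    unfolding yf_def by (intro arg_cong[where f = "\<lambda>x. x^2"] set_lebesgue_integral_cong) (auto simp: mult_ac)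
  also have "\<dots> \<le> (LBINT s:?S. (?f s)^2) * (LBINT s:?S. (?g s)^2)"
    by (rule li_Cauchy_Schwarz[OF _ _ _ fi gi]) auto
  also have "\<dots> \<le> ((qmax m)^2 * 2) * mass e"
  proof (rule mult_mono)
    have "(LBINT s:?S. (?f s)^2) \<le> (LBINT s:?S. (qmax m)^2 * maj s)"
      by (rule set_integral_mono[OF fi set_integrable_mult_right[OF mi]]) (use fle in fastforce)
    also have "\<dots> = (qmax m)^2 * (LBINT s:?S. maj s)" by (rule set_integral_mult_right)
    also have "\<dots> \<le> (qmax m)^2 * 2"
    proof (rule mult_left_mono)
      have "(LBINT s:?S. maj s) \<le> (LBINT s:{0<..}. maj s)"
        by (rule li_mono_set[OF si_maj]) (auto simp: maj_def)
      then show "(LBINT s:?S. maj s) \<le> 2" using li_maj by linarith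
    qed simp
    finally show "(LBINT s:?S. (?f s)^2) \<le> (qmax m)^2 * 2" .
    have "(LBINT s:?S. (?g s)^2) \<le> (LBINT s:?S. nsq (e s) * s)"
      by (rule set_integral_mono[OF gi ei]) (use gle in fastforce)
    with M show "(LBINT s:?S. (?g s)^2) \<le> mass e" by linarith
  qed (auto intro: li_nonneg)
  finally have y: "(yf m e r)^2 \<le> 2 * ((qmax m)^2 * mass e)" by simp
  have "zf e r \<le> mass e / 2" using M unfolding zf_def by simp
  then have "(zf e r)^2 \<le> (mass e / 2)^2" by (intro power_mono zf_nonneg)
  then have z: "(zf e r)^2 \<le> (mass e)^2 / 4" by (simp add: power_divide)
  have "0 \<le> (mass e)^2" by simp
  with y z add_sq_le[of "yf m e r" "zf e r"]
  have "(bf m e r)^2 \<le> 4 * ((qmax m)^2 * mass e) + (mass e)^2" unfolding bf_def by linarith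
  then show ?thesis by simp
qed

section \<open>The upper bound\<close>

lemma cmod_add4_sq_le: "nsq (a + b + c + d) \<le> 4 * nsq a + 4 * nsq b + 4 * nsq c + 4 * nsq d"
  using cmod_add_sq_le[of "a + b" "c + d"] cmod_add_sq_le[of a b] cmod_add_sq_le[of c d] by (simp add: add.assoc)

lemma tail_le_etot:
  assumes a: "adm m e v" and R: "1 \<le> R" "R \<le> r"
  shows "(LBINT s:{R..r}. nsq (e s) / s) \<le> tot m e v"
proof -
  have wi: "si {R..r} (\<lambda>r. wt m r * nsq (e r))"
    by (rule set_integrable_subset[OF adm_si(2)[OF a]]) (use R in auto)
  have "(LBINT s:{R..r}. nsq (e s) / s) \<le> (LBINT s:{R..r}. wt m s * nsq (e s))"
  proof (rule set_integral_mono[OF si_tail[OF a R] wi])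
    fix s assume "s \<in> {R..r}"
    then have "1 / s * nsq (e s) \<le> wt m s * nsq (e s)"
      using R by (intro mult_right_mono wt_ge_inverse) auto
    then show "nsq (e s) / s \<le> wt m s * nsq (e s)" by simp
  qed
  also have "\<dots> \<le> (LBINT s:{0<..}. wt m s * nsq (e s))"
    by (rule li_mono_set[OF adm_si(2)[OF a]]) (use R in \<open>auto intro!: mult_nonneg_nonneg wt_nonneg\<close>)
  finally show ?thesis unfolding tot_def using vtot_nonneg[of v] by linarith
qed

text \<open>Up to radius \<open>1\<close> this is the local bound \<open>bf_sq_le\<close>; beyond it
  the increment from \<open>1\<close> is bounded through the tail integral. The bound
  \<open>M\<close> enters only the prefactor, so the estimate stays linear in
  \<open>tot\<close>.\<close>

lemma bf_sq_le_tot: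
  assumes a: "adm m e v" and M: "mass e \<le> M" "tot m e v \<le> M" and r: "0 < r"
  shows "(bf m e r)^2 \<le> (24 * (qmax m)^2 + 28 * M) * r^2 * tot m e v"
proof -
  let ?N = "tot m e v"
  have N: "0 \<le> ?N" by (rule tot_nonneg)
  then have M0: "0 \<le> M" using M by linarith
  have near: "(bf m e s)^2 \<le> (10 * (qmax m)^2 + 13 * M) * s^2 * ?N" if s: "0 < s" "s \<le> 1" for s
  proof -
    have "(bf m e s)^2 \<le> s^2 * ((10 * (qmax m)^2 + 13 * enorm m e 1) * enorm m e 1)"
      using bf_sq_le[OF adm_adml[OF a] s order_refl] by simp
    also have "\<dots> \<le> s^2 * ((10 * (qmax m)^2 + 13 * M) * ?N)"
      using enorm_le_tot[OF a, of 1] M(2) M0 by (intro mult_left_mono mult_mono) (auto intro: enorm_nonneg)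
    finally show ?thesis by (simp add: mult_ac)
  qed
  show ?thesis
  proof (cases "r \<le> 1")
    case True
    have "(10 * (qmax m)^2 + 13 * M) * (r^2 * ?N) \<le> (24 * (qmax m)^2 + 28 * M) * (r^2 * ?N)"
      using N M0 by (intro mult_right_mono) auto
    with near[OF r True] show ?thesis by (simp add: mult_ac)
  next
    case False
    then have r1: "1 \<le> r" by simp
    have "(bf m e r)^2 \<le> 2 * (bf m e 1)^2 + 2 * (bf m e r - bf m e 1)^2"
      using add_sq_le[of "bf m e 1" "bf m e r - bf m e 1"] by simp
    moreover have "(bf m e 1)^2 \<le> (10 * (qmax m)^2 + 13 * M) * r^2 * ?N"
    proof -
      have "(bf m e 1)^2 \<le> (10 * (qmax m)^2 + 13 * M) * 1 * ?N" using near[of 1] by simp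
      also have "\<dots> \<le> (10 * (qmax m)^2 + 13 * M) * r^2 * ?N"
        using N M0 r1 by (intro mult_right_mono mult_left_mono) (auto simp: one_le_power)
      finally show ?thesis .
    qed
    moreover have "(bf m e r - bf m e 1)^2 \<le> (2 * (qmax m)^2 + M) * r^2 * ?N"
    proof -
      have "(bf m e r - bf m e 1)^2 \<le> (2 * (qmax m)^2 + mass e) * r^2 * (LBINT s:{1..r}. nsq (e s) / s)"
        by (rule bf_diff_tail[OF a order_refl r1])
      also have "\<dots> \<le> (2 * (qmax m)^2 + M) * r^2 * ?N"
        using M M0 tail_le_etot[OF a order_refl r1] mass_nonneg[of e]
        by (intro mult_mono mult_right_mono) (auto intro!: li_nonneg)
      finally show ?thesis .
    qed
    ultimately have "(bf m e r)^2 \<le> 2 * ((10 * (qmax m)^2 + 13 * M) * r^2 * ?N) + 2 * ((2 * (qmax m)^2 + M) * r^2 * ?N)" by linarith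
    also have "\<dots> = (24 * (qmax m)^2 + 28 * M) * r^2 * ?N" by (simp add: algebra_simps)
    finally show ?thesis .
  qed
qed

text \<open>Near the origin \<open>bf\<close> is of order \<open>r\<close>, while the weight is
  bounded below; for \<open>r > 1\<close> the uniform bound on \<open>bf\<close> is used together
  with a weight that dominates \<open>1/r\<close>.\<close>

lemma potential_le:
  assumes a: "adm m e v" and M: "mass e \<le> M" "tot m e v \<le> M" and r: "0 < r"
  shows "(real m - kq m r + bf m e r)^2 / r \<le>
    (40 * (real m + 1)^2 + 10 * ((24 * (qmax m)^2 + 28 * M) * M) + 2 * (4 * (qmax m)^2 * M + M^2)) * wt m r"
proof -
  let ?N = "tot m e v" and ?D = "24 * (qmax m)^2 + 28 * M"
  have N: "0 \<le> ?N" by (rule tot_nonneg)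
  then have M0: "0 \<le> M" using M by linarith
  have D: "0 \<le> ?D" using M0 by simp
  have w: "0 \<le> wt m r" by (rule wt_nonneg[OF r])
  have b: "(bf m e r)^2 / r \<le> (5 * (?D * M) + (4 * (qmax m)^2 * M + M^2)) * wt m r"
  proof (cases "r \<le> 1")
    case True
    have "(bf m e r)^2 \<le> ?D * ?N * r * r" using bf_sq_le_tot[OF a M r] by (simp add: power2_eq_square mult_ac)
    then have "(bf m e r)^2 / r \<le> ?D * ?N * r" using r by (simp add: divide_le_eq)
    also have "\<dots> \<le> ?D * M * (5 * wt m r)"
      using D N M M0 r True wt_ge_1_5[OF r True, of m] by (intro mult_mono mult_left_mono) auto
    also have "\<dots> \<le> (5 * (?D * M) + (4 * (qmax m)^2 * M + M^2)) * wt m r"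
    proof -
      have "0 \<le> (4 * (qmax m)^2 * M + M^2) * wt m r" using w M0 by simp
      then show ?thesis by (simp add: algebra_simps)
    qed
    finally show ?thesis .
  next
    case False
    have "(bf m e r)^2 \<le> 4 * (qmax m)^2 * mass e + (mass e)^2" by (rule bf_bounded[OF a r])
    also have "\<dots> \<le> 4 * (qmax m)^2 * M + M^2"
      using M mass_nonneg[of e] by (intro add_mono mult_left_mono power_mono) auto
    finally have "(bf m e r)^2 / r \<le> (4 * (qmax m)^2 * M + M^2) / r" using r by (intro divide_right_mono) auto
    also have "\<dots> = (4 * (qmax m)^2 * M + M^2) * (1 / r)" by simp
    also have "\<dots> \<le> (4 * (qmax m)^2 * M + M^2) * wt m r"
      using False M0 by (intro mult_left_mono wt_ge_inverse) auto
    also have "\<dots> \<le> (5 * (?D * M) + (4 * (qmax m)^2 * M + M^2)) * wt m r"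
      using D M0 w by (intro mult_right_mono) auto
    finally show ?thesis .
  qed
  have "(real m - kq m r + bf m e r)^2 / r \<le> (2 * (real m - kq m r)^2 + 2 * (bf m e r)^2) / r"
    using r by (intro divide_right_mono add_sq_le) auto
  also have "\<dots> = 2 * ((real m - kq m r)^2 / r) + 2 * ((bf m e r)^2 / r)" by (simp add: add_divide_distrib)
  also have "\<dots> \<le> 2 * (20 * (real m + 1)^2 * wt m r) + 2 * ((5 * (?D * M) + (4 * (qmax m)^2 * M + M^2)) * wt m r)"
    using kq_diff_wt[OF r, of m] b by linarith
  also have "\<dots> = (40 * (real m + 1)^2 + 10 * (?D * M) + 2 * (4 * (qmax m)^2 * M + M^2)) * wt m r"
    by (simp add: algebra_simps)
  finally show ?thesis .
qed

text \<open>The singular coefficient \<open>m/r\<close> is split off first: the weight covers it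
  when \<open>m > 0\<close>, and it is absent when \<open>m = 0\<close>. What is left of the
  potential is controlled by \<open>wt\<close>, and the source term \<open>q bf / r\<close> by the
  integrable majorant of \<open>q^2 r\<close>.\<close>

lemma
  assumes a: "adm m e v" and M: "mass e \<le> M" "tot m e v \<le> M"
  shows si_ff_aux: "si {0<..} (\<lambda>r. nsq (ff m e v r) * r)"
    and defect_le: "defect m e v \<le> (4 * (1 + (40 * (real m + 1)^2 + 10 * ((24 * (qmax m)^2 + 28 * M) * M) + 2 * (4 * (qmax m)^2 * M + M^2)))
      + 8 * ((24 * (qmax m)^2 + 28 * M) * (qmax m)^2)) * tot m e v"
proof -
  note al = adm_adml[OF a]
  note [measurable] = adml_measurable[OF al] ff_measurable[OF al]
  let ?N = "tot m e v"
  define D where "D = 24 * (qmax m)^2 + 28 * M"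
  define C where "C = 40 * (real m + 1)^2 + 10 * (D * M) + 2 * (4 * (qmax m)^2 * M + M^2)"
  have N: "0 \<le> ?N" by (rule tot_nonneg)
  then have M0: "0 \<le> M" using M by linarith
  have D: "0 \<le> D" unfolding D_def using M0 by simp
  have C: "0 \<le> C" unfolding C_def using M0 D by simp
  have le: "nsq (ff m e v r) * r \<le> (4 * (nsq (v r) * r) + 4 * (1 + C) * (wt m r * nsq (e r))) + 4 * (D * ?N * (qmax m)^2) * maj r"
    if r: "r \<in> {0<..}" for r
  proof -
    have rp: "0 < r" using r by simp
    have eq: "ff m e v r = v r + - (of_real (real m / r) * e r) + of_real ((real m - kq m r + bf m e r) / r) * e r + of_real (q m r * bf m e r / r)"
      unfolding ff_def by (simp add: algebra_simps add_divide_distrib diff_divide_distrib)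
    have "nsq (ff m e v r) \<le> 4 * nsq (v r) + 4 * ((real m / r)^2 * nsq (e r))
        + 4 * (((real m - kq m r + bf m e r) / r)^2 * nsq (e r)) + 4 * (q m r * bf m e r / r)^2"
      using cmod_add4_sq_le[of "v r" "- (of_real (real m / r) * e r)" "of_real ((real m - kq m r + bf m e r) / r) * e r" "of_real (q m r * bf m e r / r)"]
      unfolding eq[symmetric] norm_minus_cancel norm_mult norm_of_real power_mult_distrib power2_abs .
    then have "nsq (ff m e v r) * r \<le> (4 * nsq (v r) + 4 * ((real m / r)^2 * nsq (e r))
        + 4 * (((real m - kq m r + bf m e r) / r)^2 * nsq (e r)) + 4 * (q m r * bf m e r / r)^2) * r"
      using rp by (intro mult_right_mono) auto
    also have "\<dots> = 4 * (nsq (v r) * r) + 4 * ((real m)^2 / r * nsq (e r))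
        + 4 * ((real m - kq m r + bf m e r)^2 / r * nsq (e r)) + 4 * ((q m r)^2 * ((bf m e r)^2 / r))"
    proof -
      have *: "(x / r)^2 * r = x^2 / r" for x :: real using rp by (simp add: power_divide power2_eq_square)
      have d: "(4 * A + 4 * (k * E) + 4 * (l * E) + 4 * X) * r = 4 * (A * r) + 4 * ((k * r) * E) + 4 * ((l * r) * E) + 4 * (X * r)" for A k l E X :: real
        by (simp add: algebra_simps)
      show ?thesis unfolding d * by (simp add: power_mult_distrib)
    qed
    also have "\<dots> \<le> 4 * (nsq (v r) * r) + 4 * (wt m r * nsq (e r))
        + 4 * (C * wt m r * nsq (e r)) + 4 * (D * ?N * (qmax m)^2 * maj r)"
    proof (intro add_mono mult_left_mono mult_right_mono order_refl wt_ge_m rp)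
      show "(real m - kq m r + bf m e r)^2 / r \<le> C * wt m r"
        unfolding C_def D_def by (rule potential_le[OF a M rp])
      have "(bf m e r)^2 \<le> D * ?N * r * r" using bf_sq_le_tot[OF a M rp] unfolding D_def by (simp add: power2_eq_square mult_ac)
      then have "(bf m e r)^2 / r \<le> D * ?N * r" using rp by (simp add: divide_le_eq)
      then have "(q m r)^2 * ((bf m e r)^2 / r) \<le> (q m r)^2 * (D * ?N * r)" by (intro mult_left_mono) auto
      also have "\<dots> = D * ?N * ((q m r)^2 * r)" by simp
      also have "\<dots> \<le> D * ?N * ((qmax m)^2 * maj r)" using D N by (intro mult_left_mono q_sq_mult_le_maj rp) auto
      finally show "(q m r)^2 * ((bf m e r)^2 / r) \<le> D * ?N * (qmax m)^2 * maj r" by (simp add: mult_ac)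
    qed auto
    finally show ?thesis by (simp add: algebra_simps)
  qed
  have s1: "si {0<..} (\<lambda>r. 4 * (nsq (v r) * r) + 4 * (1 + C) * (wt m r * nsq (e r)))"
    by (rule set_integral_add(1)[OF set_integrable_mult_right[OF adm_si(1)[OF a]] set_integrable_mult_right[OF adm_si(2)[OF a]]])
  have s2: "si {0<..} (\<lambda>r. 4 * (D * ?N * (qmax m)^2) * maj r)"
    by (rule set_integrable_mult_right[OF si_maj])
  show i: "si {0<..} (\<lambda>r. nsq (ff m e v r) * r)"
    by (rule si_bound[OF set_integral_add(1)[OF s1 s2]]) (use le in auto)
  have "defect m e v \<le> (LBINT r:{0<..}. (4 * (nsq (v r) * r) + 4 * (1 + C) * (wt m r * nsq (e r))) + 4 * (D * ?N * (qmax m)^2) * maj r)"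
    unfolding defect_def by (rule set_integral_mono[OF i set_integral_add(1)[OF s1 s2] le])
  also have "\<dots> = (LBINT r:{0<..}. 4 * (nsq (v r) * r) + 4 * (1 + C) * (wt m r * nsq (e r))) + (LBINT r:{0<..}. 4 * (D * ?N * (qmax m)^2) * maj r)"
    by (rule set_integral_add(2)[OF s1 s2])
  also have "(LBINT r:{0<..}. 4 * (nsq (v r) * r) + 4 * (1 + C) * (wt m r * nsq (e r))) =
      (LBINT r:{0<..}. 4 * (nsq (v r) * r)) + (LBINT r:{0<..}. 4 * (1 + C) * (wt m r * nsq (e r)))"
    by (rule set_integral_add(2)[OF set_integrable_mult_right[OF adm_si(1)[OF a]] set_integrable_mult_right[OF adm_si(2)[OF a]]])
  also have "(LBINT r:{0<..}. 4 * (nsq (v r) * r)) = 4 * (LBINT r:{0<..}. nsq (v r) * r)"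
    by (rule set_integral_mult_right)
  also have "(LBINT r:{0<..}. 4 * (1 + C) * (wt m r * nsq (e r))) = 4 * (1 + C) * (LBINT r:{0<..}. wt m r * nsq (e r))"
    by (rule set_integral_mult_right)
  also have "(LBINT r:{0<..}. 4 * (D * ?N * (qmax m)^2) * maj r) = 4 * (D * ?N * (qmax m)^2) * (LBINT r:{0<..}. maj r)"
    by (rule set_integral_mult_right)
  also have "\<dots> \<le> 4 * (D * ?N * (qmax m)^2) * 2"
    using D N by (intro mult_left_mono li_maj) auto
  also have "4 * (LBINT r:{0<..}. nsq (v r) * r) \<le> 4 * (1 + C) * (LBINT r:{0<..}. nsq (v r) * r)"
    using C vtot_nonneg[of v] by (intro mult_right_mono) auto
  finally have "defect m e v \<le> (4 * (1 + C) + 8 * (D * (qmax m)^2)) * ?N"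
    unfolding tot_def by (simp add: algebra_simps)
  then show "defect m e v \<le> (4 * (1 + (40 * (real m + 1)^2 + 10 * ((24 * (qmax m)^2 + 28 * M) * M) + 2 * (4 * (qmax m)^2 * M + M^2)))
      + 8 * ((24 * (qmax m)^2 + 28 * M) * (qmax m)^2)) * ?N"
    unfolding C_def D_def .
qed

lemma si_ff: "adm m e v \<Longrightarrow> si {0<..} (\<lambda>r. nsq (ff m e v r) * r)"
  by (rule si_ff_aux[where M = "max (mass e) (tot m e v)"]) auto

section \<open>The exterior region\<close>

text \<open>
  For large \<open>r\<close> the coefficient \<open>kq - bf\<close> is at most \<open>- 1\<close>; testing the equation against \<open>e / r\<close>
  gives a positive term there, and no smallness of the nonlinearity is needed.
\<close>
lemma exterior_region:
  assumes M: "0 \<le> M"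
  obtains R1 where "1 \<le> R1" "\<forall>R\<ge>R1. \<exists>C>0. \<exists>\<delta>>0. \<forall>e v. adm m e v \<longrightarrow> mass e \<le> M \<longrightarrow> enorm m e R \<le> \<delta> \<longrightarrow>
    (LBINT r:{R..}. nsq (v r) * r) + (LBINT r:{R..}. wt m r * nsq (e r)) \<le>
      C * (nsq (e R) + (bf m e R)^2 + defect m e v)"
proof -
  let ?K = "(qmax m)^2"
  define Cf where "Cf = 2 * ?K + M"
  \<comment> \<open>The three summands ensure, in this order, \<open>kq \<le> - (3/2)\<close>, an
    increment of \<open>yf\<close> of at most \<open>1/4\<close>, and the absorption of half of the
    tail \<open>T\<close>.\<close>
  define R1 where "R1 = 4 * (real m + 1) + 16 * ?K * M + 8 * ?K * Cf"
  have Cf: "0 \<le> Cf" unfolding Cf_def using M by simp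
  have R1: "1 \<le> R1" "4 * (real m + 1) \<le> R1" "16 * ?K * M \<le> R1" "8 * ?K * Cf \<le> R1"
    unfolding R1_def using M Cf by (auto intro: add_increasing)
  have "\<exists>C>0. \<exists>\<delta>>0. \<forall>e v. adm m e v \<longrightarrow> mass e \<le> M \<longrightarrow> enorm m e R \<le> \<delta> \<longrightarrow>
    (LBINT r:{R..}. nsq (v r) * r) + (LBINT r:{R..}. wt m r * nsq (e r)) \<le>
      C * (nsq (e R) + (bf m e R)^2 + defect m e v)" if RR: "R1 \<le> R" for R
  proof -
    have R: "1 \<le> R" "4 * (real m + 1) \<le> R" "16 * ?K * M \<le> R" "8 * ?K * Cf \<le> R" "0 < R" using R1 RR by auto
    define Ck where "Ck = 2 * (real m + 2)^2 + 2 * (4 * ?K * M + M^2)"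
    have Ck: "0 \<le> Ck" unfolding Ck_def using M by simp
    \<comment> \<open>Chosen so that \<open>5 * ?K * R ^ 4 * \<delta> \<le> (1/4)^2\<close>, which
      makes the value of \<open>yf\<close> at \<open>R\<close> at most \<open>1/4\<close> in
      modulus; the \<open>1\<close> in the denominator guarantees positivity and plays no part in
      the size.\<close>
    define \<delta> where "\<delta> = 1 / (80 * ?K * R ^ 4 + 1)"
    have \<delta>: "0 < \<delta>" "80 * ?K * R ^ 4 * \<delta> \<le> 1"
    proof -
      have p: "0 < 80 * ?K * R ^ 4 + 1" using R by (intro add_nonneg_pos mult_nonneg_nonneg) auto
      then show "0 < \<delta>" by (simp add: \<delta>_def)
      show "80 * ?K * R ^ 4 * \<delta> \<le> 1" using p by (simp add: \<delta>_def)
    qed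
    define C where "C = (2 * Ck + (real m)^2 + 1) * (6 + 8 * ?K) + 2 * (5 + 8 * ?K)"
    have C: "0 < C" unfolding C_def using Ck by (intro add_nonneg_pos mult_nonneg_nonneg add_nonneg_nonneg) (auto intro: add_pos_nonneg)
    have "(LBINT r:{R..}. nsq (v r) * r) + (LBINT r:{R..}. wt m r * nsq (e r)) \<le>
        C * (nsq (e R) + (bf m e R)^2 + defect m e v)"
      if a: "adm m e v" and ma: "mass e \<le> M" and en: "enorm m e R \<le> \<delta>" for e v
    proof -
      note al = adm_adml[OF a]
      note [measurable] = adml_measurable[OF al] ff_measurable[OF al] bf_measurable[OF adml_measurable(1)[OF al]]
      define F where "F = defect m e v"
      define X where "X = nsq (e R) + (bf m e R)^2 + F"
      have F0: "0 \<le> F" unfolding F_def by (rule defect_nonneg)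
      define ku where "ku r = kq m r - bf m e r" for r
      have ku: "ku r \<le> - 1" "(ku r)^2 \<le> Ck" if r: "R \<le> r" for r
      proof -
        have rp: "0 < r" using r R by simp
        have "(yf m e R)^2 \<le> 5 * ?K * R^2 * R^2 * enorm m e R"
          using yf_le[OF al R(5) order_refl R(1)] by simp
        also have "\<dots> \<le> 5 * ?K * R^2 * R^2 * \<delta>" using en R by (intro mult_left_mono) auto
        also have "\<dots> \<le> (1/4)^2" using \<delta>(2) by (simp add: power4_eq_xxxx power2_eq_square mult_ac)
        finally have y1: "\<bar>yf m e R\<bar> \<le> 1/4" by (simp add: abs_le_square_iff[symmetric])
        have "(yf m e r - yf m e R)^2 \<le> ?K / R * mass e" by (rule yf_diff_mass[OF a R(1) r])
        also have "\<dots> \<le> ?K / R * M" using ma R by (intro mult_left_mono) auto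
        also have "\<dots> \<le> (1/4)^2" using R by (simp add: divide_le_eq power2_eq_square)
        finally have y2: "\<bar>yf m e r - yf m e R\<bar> \<le> 1/4" by (simp add: abs_le_square_iff[symmetric])
        have "kq m r \<le> - (3/2)" using kq_tail[of m r] R r by simp
        then show "ku r \<le> - 1" unfolding ku_def bf_def using y1 y2 zf_nonneg[of e r] by linarith
        have "(kq m r)^2 \<le> (real m + 2)^2" using kq_abs_le[OF rp, of m] by (simp add: abs_le_square_iff[symmetric])
        moreover have "(bf m e r)^2 \<le> 4 * ?K * M + M^2"
        proof -
          have "(bf m e r)^2 \<le> 4 * ?K * mass e + (mass e)^2" by (rule bf_bounded[OF a rp])
          also have "\<dots> \<le> 4 * ?K * M + M^2"
            using ma mass_nonneg[of e] by (intro add_mono mult_left_mono power_mono) auto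
          finally show ?thesis .
        qed
        ultimately show "(ku r)^2 \<le> Ck"
          unfolding ku_def Ck_def using add_sq_le[of "kq m r" "- bf m e r"] by simp
      qed
      define g where "g r = ff m e v r - of_real (q m r * bf m e r / r)" for r
      have [measurable]: "g \<in> bm" "ku \<in> bm" unfolding g_def ku_def by measurable
      have v: "v r = of_real (ku r / r) * e r + g r" for r by (simp add: g_def ff_def ku_def)
      \<comment> \<open>The bound is uniform in \<open>b\<close>, so no decay of \<open>e\<close> at
        infinity has to be known in advance.\<close>
      have main: "(LBINT r:{R..b}. nsq (v r) * r) + (LBINT r:{R..b}. wt m r * nsq (e r)) \<le> C * X"
        if b: "R \<le> b" for b
      proof -
        let ?S = "{R..b}"
        define T where "T = (LBINT s:?S. nsq (e s) / s)"
        have Ti: "si ?S (\<lambda>s. nsq (e s) / s)" by (rule si_tail[OF a R(1) b])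
        have T0: "0 \<le> T" unfolding T_def by (rule li_nonneg) (use R in auto)
        have fi: "si ?S (\<lambda>r. nsq (ff m e v r) * r)"
          by (rule set_integrable_subset[OF si_ff[OF a]]) (use R in auto)
        have Ff: "(LBINT r:?S. nsq (ff m e v r) * r) \<le> F"
          unfolding F_def defect_def by (rule li_mono_set[OF si_ff[OF a]]) (use R in auto)
        have isq: "si ?S (\<lambda>r. 1 / r^2)"
          by (rule set_integrable_subset[OF si_inverse_sq[OF R(5)]]) auto
        have lsq: "(LBINT r:?S. 1 / r^2) \<le> 1 / R"
        proof -
          have "(LBINT r:?S. 1 / r^2) \<le> (LBINT r:{R..}. 1 / r^2)"
            by (rule li_mono_set[OF si_inverse_sq[OF R(5)]]) auto
          then show ?thesis using li_inverse_sq[OF R(5)] by linarith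
        qed
        \<comment> \<open>\<open>Y\<close> contains the unknown tail \<open>T\<close>, through the
          increment of \<open>bf\<close>. Integrating \<open>1 / r^2\<close> over
          \<open>{R..b}\<close> gains \<open>1 / R\<close>, and the choice of \<open>R1\<close>
          leaves at most \<open>T / 2\<close> on the right.\<close>
        define Y where "Y = 4 * (?K * (bf m e R)^2) + 4 * (?K * Cf * T)"
        have Y0: "0 \<le> Y" unfolding Y_def using T0 Cf by simp
        have gle: "nsq (g r) * r \<le> 2 * (nsq (ff m e v r) * r) + Y * (1 / r^2)" if r: "r \<in> ?S" for r
        proof -
          have rp: "0 < r" "1 \<le> r" "R \<le> r" using r R by auto
          have "nsq (g r) \<le> 2 * nsq (ff m e v r) + 2 * (q m r * bf m e r / r)^2"
            using cmod_add_sq_le[of "ff m e v r" "- of_real (q m r * bf m e r / r)"]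
            unfolding norm_minus_cancel norm_of_real power2_abs by (simp add: g_def)
          then have "nsq (g r) * r \<le> (2 * nsq (ff m e v r) + 2 * (q m r * bf m e r / r)^2) * r"
            using rp by (intro mult_right_mono) auto
          also have "\<dots> = 2 * (nsq (ff m e v r) * r) + 2 * ((q m r)^2 * (bf m e r)^2 * (1 / r))"
            using rp by (simp add: distrib_right power_divide power_mult_distrib power2_eq_square)
          also have "2 * ((q m r)^2 * (bf m e r)^2 * (1 / r)) \<le> Y * (1 / r^2)"
          proof -
            have T: "(LBINT s:{R..r}. nsq (e s) / s) \<le> T"
              unfolding T_def by (rule li_mono_set[OF Ti]) (use r R in auto)
            have "(bf m e r - bf m e R)^2 \<le> (2 * ?K + mass e) * r^2 * (LBINT s:{R..r}. nsq (e s) / s)"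
              by (rule bf_diff_tail[OF a R(1) rp(3)])
            also have "\<dots> \<le> Cf * r^2 * T"
              unfolding Cf_def using T ma M mass_nonneg[of e] R by (intro mult_mono mult_right_mono) (auto intro!: li_nonneg)
            finally have "(bf m e r)^2 \<le> 2 * (bf m e R)^2 + 2 * (Cf * r^2 * T)"
              using add_sq_le[of "bf m e R" "bf m e r - bf m e R"] by simp
            also have "2 * (bf m e R)^2 \<le> 2 * ((bf m e R)^2 * r^2)"
              using rp by (simp add: mult_le_cancel_left1 one_le_power)
            finally have b2: "(bf m e r)^2 \<le> (2 * (bf m e R)^2 + 2 * (Cf * T)) * r^2" by (simp add: algebra_simps)
            have "(q m r)^2 * (bf m e r)^2 \<le> ?K / r ^ 4 * ((2 * (bf m e R)^2 + 2 * (Cf * T)) * r^2)"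
              using rp by (intro mult_mono q_sq_decay b2) auto
            also have "\<dots> = ?K * (2 * (bf m e R)^2 + 2 * (Cf * T)) * (1 / r^2)"
              using rp by (simp add: power4_eq_xxxx power2_eq_square)
            finally have qb: "(q m r)^2 * (bf m e r)^2 \<le> ?K * (2 * (bf m e R)^2 + 2 * (Cf * T)) * (1 / r^2)" .
            have "(q m r)^2 * (bf m e r)^2 * (1 / r) \<le> ?K * (2 * (bf m e R)^2 + 2 * (Cf * T)) * (1 / r^2) * 1"
              by (rule mult_mono[OF qb]) (use rp Cf T0 in auto)
            then have "2 * ((q m r)^2 * (bf m e r)^2 * (1 / r)) \<le>
                2 * (?K * (2 * (bf m e R)^2 + 2 * (Cf * T)) * (1 / r^2) * 1)"
              by (rule mult_left_mono) simp
            also have "\<dots> = Y * (1 / r^2)" unfolding Y_def by (simp add: algebra_simps)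
            finally show ?thesis .
          qed
          finally show ?thesis by simp
        qed
        have gsum: "si ?S (\<lambda>r. 2 * (nsq (ff m e v r) * r) + Y * (1 / r^2))"
          by (rule set_integral_add(1)[OF set_integrable_mult_right[OF fi] set_integrable_mult_right[OF isq]])
        have gi: "si ?S (\<lambda>r. nsq (g r) * r)"
          by (rule si_bound[OF gsum]) (use gle R in auto)
        define G where "G = (LBINT r:?S. nsq (g r) * r)"
        have G: "G \<le> 2 * F + 4 * (?K * (bf m e R)^2) + T / 2"
        proof -
          have "G \<le> (LBINT r:?S. 2 * (nsq (ff m e v r) * r) + Y * (1 / r^2))"
            unfolding G_def by (rule set_integral_mono[OF gi gsum gle])
          also have "\<dots> = (LBINT r:?S. 2 * (nsq (ff m e v r) * r)) + (LBINT r:?S. Y * (1 / r^2))"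
            by (rule set_integral_add(2)[OF set_integrable_mult_right[OF fi] set_integrable_mult_right[OF isq]])
          also have "(LBINT r:?S. 2 * (nsq (ff m e v r) * r)) = 2 * (LBINT r:?S. nsq (ff m e v r) * r)"
            by (rule set_integral_mult_right)
          also have "(LBINT r:?S. Y * (1 / r^2)) = Y * (LBINT r:?S. 1 / r^2)"
            by (rule set_integral_mult_right)
          also have "\<dots> \<le> Y * (1 / R)" using Y0 by (intro mult_left_mono lsq) auto
          also have "\<dots> = 4 * (?K * (bf m e R)^2 * (1 / R)) + 4 * ?K * Cf / R * T"
            unfolding Y_def using R by (simp add: add_divide_distrib)
          also have "4 * (?K * (bf m e R)^2 * (1 / R)) \<le> 4 * (?K * (bf m e R)^2 * 1)"
            using R by (intro mult_left_mono) auto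
          also have "4 * ?K * Cf / R * T \<le> 1/2 * T"
          proof (rule mult_right_mono[OF _ T0])
            show "4 * ?K * Cf / R \<le> 1/2" using R(4,5) by (simp add: divide_le_eq)
          qed
          finally show ?thesis using Ff by simp
        qed
        have ac2: "ac (\<lambda>r. nsq (e r)) (\<lambda>r. 2 * Re (cnj (e r) * v r))" by (rule ac_cmod_sq[OF adml_ac[OF al]])
        have neg: "si ?S (\<lambda>r. nsq (g r) * r - nsq (e r) / r)"
          by (rule set_integral_diff(1)[OF gi Ti])
        \<comment> \<open>The tested equation: since \<open>ku \<le> - 1\<close>, the potential
          contributes \<open>- 2 |e|^2 / r\<close>, one half of which pays for the cross term with
          \<open>g\<close>. The outer boundary value \<open>|e(b)|^2\<close> has the favourable sign
          and is dropped.\<close>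
        have "nsq (e b) - nsq (e R) = (LBINT r:?S. 2 * Re (cnj (e r) * v r))"
          by (rule ac_diff_eq[OF ac2 R(5) b])
        also have "\<dots> \<le> (LBINT r:?S. nsq (g r) * r - nsq (e r) / r)"
        proof (rule set_integral_mono[OF ac_integrable[OF ac2 R(5)] neg])
          fix r assume r: "r \<in> ?S"
          then have rp: "0 < r" "R \<le> r" using R by auto
          have "Re (cnj (e r) * v r) = ku r / r * nsq (e r) + Re (cnj (e r) * g r)"
            unfolding v cmod_power2 by (simp add: algebra_simps add_divide_distrib power2_eq_square)
          moreover have "2 * Re (cnj (e r) * g r) \<le> nsq (e r) / r + nsq (g r) * r"
          proof -
            have "Re (cnj (e r) * g r) \<le> cmod (e r) * cmod (g r)"
              using complex_Re_le_cmod[of "cnj (e r) * g r"] by (simp add: norm_mult)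
            moreover have "0 \<le> (cmod (e r) - r * cmod (g r))^2 / r" using rp by simp
            moreover have "(cmod (e r) - r * cmod (g r))^2 / r = nsq (e r) / r + nsq (g r) * r - 2 * (cmod (e r) * cmod (g r))"
              using rp by (simp add: power2_eq_square field_simps)
            ultimately show ?thesis by linarith
          qed
          moreover have "ku r / r * nsq (e r) \<le> - (nsq (e r) / r)"
          proof -
            have "ku r * (nsq (e r) / r) \<le> (- 1) * (nsq (e r) / r)"
              using ku(1)[OF rp(2)] rp by (intro mult_right_mono) auto
            then show ?thesis by simp
          qed
          ultimately show "2 * Re (cnj (e r) * v r) \<le> nsq (g r) * r - nsq (e r) / r" by linarith
        qed
        also have "\<dots> = G - T" unfolding G_def T_def by (rule set_integral_diff(2)[OF gi Ti])
        finally have "T \<le> nsq (e R) + G" using zero_le_power2[of "cmod (e b)"] by linarith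
        with G have T: "T \<le> 2 * nsq (e R) + 4 * F + 8 * (?K * (bf m e R)^2)" by linarith
        with G have G': "G \<le> nsq (e R) + 4 * F + 8 * (?K * (bf m e R)^2)" by linarith
        have KX: "?K * (bf m e R)^2 \<le> ?K * X" unfolding X_def using F0 by (intro mult_left_mono) auto
        have eX: "nsq (e R) \<le> X" "F \<le> X" unfolding X_def using F0 by auto
        have TX: "T \<le> (6 + 8 * ?K) * X" using T KX eX by (simp add: distrib_right) 
        have GX: "G \<le> (5 + 8 * ?K) * X" using G' KX eX by (simp add: distrib_right)
        have vi: "si ?S (\<lambda>r. nsq (v r) * r)"
          by (rule set_integrable_subset[OF adm_si(1)[OF a]]) (use R in auto)
        have wi: "si ?S (\<lambda>r. wt m r * nsq (e r))"
          by (rule set_integrable_subset[OF adm_si(2)[OF a]]) (use R in auto)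
        have "(LBINT r:?S. nsq (v r) * r) \<le> (LBINT r:?S. 2 * Ck * (nsq (e r) / r) + 2 * (nsq (g r) * r))"
        proof (rule set_integral_mono[OF vi set_integral_add(1)[OF set_integrable_mult_right[OF Ti] set_integrable_mult_right[OF gi]]])
          fix r assume r: "r \<in> ?S"
          then have rp: "0 < r" "R \<le> r" using R by auto
          have "nsq (v r) \<le> 2 * ((ku r / r)^2 * nsq (e r)) + 2 * nsq (g r)"
            using cmod_add_sq_le[of "of_real (ku r / r) * e r" "g r"]
            unfolding v[symmetric] norm_mult norm_of_real power_mult_distrib power2_abs .
          then have "nsq (v r) * r \<le> (2 * ((ku r / r)^2 * nsq (e r)) + 2 * nsq (g r)) * r"
            using rp by (intro mult_right_mono) auto
          also have "\<dots> = 2 * ((ku r)^2 * (nsq (e r) / r)) + 2 * (nsq (g r) * r)"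
            using rp by (simp add: distrib_right power_divide power2_eq_square)
          also have "\<dots> \<le> 2 * (Ck * (nsq (e r) / r)) + 2 * (nsq (g r) * r)"
            using rp by (intro add_mono mult_left_mono mult_right_mono ku(2)) auto
          finally show "nsq (v r) * r \<le> 2 * Ck * (nsq (e r) / r) + 2 * (nsq (g r) * r)" by simp
        qed
        also have "\<dots> = 2 * Ck * T + 2 * G"
          unfolding T_def G_def set_integral_mult_right[symmetric]
          by (rule set_integral_add(2)[OF set_integrable_mult_right[OF Ti] set_integrable_mult_right[OF gi]])
        finally have V: "(LBINT r:?S. nsq (v r) * r) \<le> 2 * Ck * T + 2 * G" .
        have "(LBINT r:?S. wt m r * nsq (e r)) \<le> (LBINT r:?S. ((real m)^2 + 1) * (nsq (e r) / r))"
        proof (rule set_integral_mono[OF wi set_integrable_mult_right[OF Ti]])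
          fix r assume r: "r \<in> ?S"
          then have "wt m r * nsq (e r) \<le> ((real m)^2 + 1) / r * nsq (e r)"
            using R by (intro mult_right_mono wt_le) auto
          then show "wt m r * nsq (e r) \<le> ((real m)^2 + 1) * (nsq (e r) / r)" by simp
        qed
        also have "\<dots> = ((real m)^2 + 1) * T" unfolding T_def by (rule set_integral_mult_right)
        finally have "(LBINT r:?S. nsq (v r) * r) + (LBINT r:?S. wt m r * nsq (e r)) \<le>
            (2 * Ck + (real m)^2 + 1) * T + 2 * G" using V by (simp add: algebra_simps)
        also have "\<dots> \<le> (2 * Ck + (real m)^2 + 1) * ((6 + 8 * ?K) * X) + 2 * ((5 + 8 * ?K) * X)"
          using Ck by (intro add_mono mult_left_mono TX GX) auto
        also have "\<dots> = C * X" unfolding C_def by (simp add: algebra_simps)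
        finally show ?thesis .
      qed
      have sv: "si {R..} (\<lambda>r. nsq (v r) * r)"
        by (rule set_integrable_subset[OF adm_si(1)[OF a]]) (use R in auto)
      have sw: "si {R..} (\<lambda>r. wt m r * nsq (e r))"
        by (rule set_integrable_subset[OF adm_si(2)[OF a]]) (use R in auto)
      have "(LBINT r:{R..}. nsq (v r) * r + wt m r * nsq (e r)) \<le> C * X"
      proof (rule li_at_infinity)
        show "0 \<le> nsq (v r) * r + wt m r * nsq (e r)" if "R \<le> r" for r
          using that R wt_nonneg[of r m] by (intro add_nonneg_nonneg mult_nonneg_nonneg) auto
        fix b assume b: "R \<le> b"
        have svb: "si {R..b} (\<lambda>r. nsq (v r) * r)"
          by (rule set_integrable_subset[OF sv]) auto
        have swb: "si {R..b} (\<lambda>r. wt m r * nsq (e r))"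
          by (rule set_integrable_subset[OF sw]) auto
        show "si {R..b} (\<lambda>r. nsq (v r) * r + wt m r * nsq (e r)) \<and>
            (LBINT r:{R..b}. nsq (v r) * r + wt m r * nsq (e r)) \<le> C * X"
          using main[OF b] set_integral_add[OF svb swb] by simp
      qed measurable
      then show ?thesis
        unfolding X_def F_def set_integral_add(2)[OF sv sw] .
    qed
    with C \<delta> show ?thesis by blast
  qed
  with R1(1) that show ?thesis by blast
qed

section \<open>Coercivity of the covariant derivative\<close>

text \<open>The interior bound delivers the boundary data at \<open>R\<close>, the exterior bound
  turns them into control of the tail, and the sum reads
  \<open>tot \<le> C2 * (defect + tot^2)\<close>. Smallness of \<open>tot\<close> absorbs the last
  term. The dependence of the constants is consistent because \<open>R\<close> is determined by
  \<open>M\<close> and the supports alone.\<close>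

lemma nonlinear_coercivity:
  assumes Z: "Z1 \<in> bm" "Z2 \<in> bm"
    and B: "\<And>r. cmod (Z1 r) \<le> B" "\<And>r. cmod (Z2 r) \<le> B"
    and supp: "\<And>r. R0 \<le> r \<Longrightarrow> Z1 r = 0" "\<And>r. R0 \<le> r \<Longrightarrow> Z2 r = 0"
    and det: "ip (\<lambda>r. of_real (lq m r)) Z1 * ip (\<lambda>r. \<i> * of_real (q m r)) Z2 -
      ip (\<lambda>r. of_real (lq m r)) Z2 * ip (\<lambda>r. \<i> * of_real (q m r)) Z1 \<noteq> 0"
    and M: "0 \<le> M"
  shows "\<exists>\<eta>>0. \<exists>c>0. \<exists>C>0. \<forall>e v. adm m e v \<longrightarrow> mass e \<le> M \<longrightarrow> ip e Z1 = 0 \<longrightarrow> ip e Z2 = 0 \<longrightarrow> tot m e v \<le> \<eta> \<longrightarrow>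
    c * tot m e v \<le> defect m e v \<and> defect m e v \<le> C * tot m e v"
proof -
  let ?K = "(qmax m)^2"
  obtain R1 where R1: "1 \<le> R1" "\<forall>R\<ge>R1. \<exists>C>0. \<exists>\<delta>>0. \<forall>e v. adm m e v \<longrightarrow> mass e \<le> M \<longrightarrow> enorm m e R \<le> \<delta> \<longrightarrow>
    (LBINT r:{R..}. nsq (v r) * r) + (LBINT r:{R..}. wt m r * nsq (e r)) \<le>
      C * (nsq (e R) + (bf m e R)^2 + defect m e v)"
    by (rule exterior_region[OF M, of m]) (rule that)
  \<comment> \<open>Beyond the threshold of the exterior estimate, and beyond the supports of
    \<open>Z1\<close> and \<open>Z2\<close>, so that the orthogonality conditions only involve the
    interior.\<close>
  define R where "R = max R1 R0"
  have R: "1 \<le> R" "R1 \<le> R" "R0 \<le> R" using R1(1) by (auto simp: R_def)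
  obtain Ct \<delta> where Ct: "0 < Ct" and \<delta>: "0 < \<delta>" and tail: "\<forall>e v. adm m e v \<longrightarrow> mass e \<le> M \<longrightarrow> enorm m e R \<le> \<delta> \<longrightarrow>
    (LBINT r:{R..}. nsq (v r) * r) + (LBINT r:{R..}. wt m r * nsq (e r)) \<le>
      Ct * (nsq (e R) + (bf m e R)^2 + defect m e v)"
    using R1(2) R(2) by blast
  have "\<exists>C>0. \<forall>e v. adml m e v \<longrightarrow> ip e Z1 = 0 \<longrightarrow> ip e Z2 = 0 \<longrightarrow> bnorm m e v R \<le> C * vnorm (hf m e v) (R + 1)"
  proof (rule orthogonal_linear[OF Z B _ _ R(1) det])
    show "Z1 r = 0" "Z2 r = 0" if "R \<le> r" for r using supp[of r] that R(3) by auto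
  qed
  then obtain Cl where Cl: "0 < Cl" and lin: "\<forall>e v. adml m e v \<longrightarrow> ip e Z1 = 0 \<longrightarrow> ip e Z2 = 0 \<longrightarrow> bnorm m e v R \<le> Cl * vnorm (hf m e v) (R + 1)"
    by blast
  define Cr where "Cr = 13 * ?K * (R + 1) ^ 4 + 10 * (R + 1) ^ 4 * (10 * ?K + 13)"
  have Cr: "0 \<le> Cr" unfolding Cr_def using R by (intro add_nonneg_nonneg mult_nonneg_nonneg) auto
  define C1 where "C1 = Cl * (2 + 2 * Cr)"
  have C1: "0 < C1" unfolding C1_def using Cl Cr by simp
  define Cz where "Cz = 2 * (5/2 * R * R)^2"
  have Cz: "0 \<le> Cz" unfolding Cz_def by simp
  define C2 where "C2 = C1 + Ct * (2 * C1 + Cz + 1)"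
  have C2: "0 < C2" unfolding C2_def using C1 Ct Cz by (intro add_pos_nonneg mult_nonneg_nonneg add_nonneg_nonneg) auto
  \<comment> \<open>The bound \<open>1\<close> makes the constant of the remainder independent of
    \<open>e\<close>, \<open>\<delta>\<close> opens the exterior estimate, and
    \<open>1 / (2 * C2)\<close> absorbs the quadratic term.\<close>
  define \<eta> where "\<eta> = min 1 (min \<delta> (1 / (2 * C2)))"
  have \<eta>: "0 < \<eta>" "\<eta> \<le> 1" "\<eta> \<le> \<delta>" "C2 * \<eta> \<le> 1/2"
  proof -
    show "0 < \<eta>" "\<eta> \<le> 1" "\<eta> \<le> \<delta>" using \<delta> C2 by (auto simp: \<eta>_def)
    have "C2 * \<eta> \<le> C2 * (1 / (2 * C2))" using C2 by (intro mult_left_mono) (auto simp: \<eta>_def)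
    then show "C2 * \<eta> \<le> 1/2" using C2 by simp
  qed
  define c where "c = 1 / (2 * C2)"
  have c: "0 < c" using C2 by (simp add: c_def)
  \<comment> \<open>The upper bound asks for one number dominating both the mass, at most
    \<open>M\<close>, and \<open>tot\<close>, at most \<open>1\<close>.\<close>
  define M1 where "M1 = M + 1"
  define C where "C = 4 * (1 + (40 * (real m + 1)^2 + 10 * ((24 * ?K + 28 * M1) * M1) + 2 * (4 * ?K * M1 + M1^2)))
      + 8 * ((24 * ?K + 28 * M1) * ?K)"
  have C: "0 < C" unfolding C_def M1_def using M by (intro add_pos_nonneg mult_nonneg_nonneg mult_pos_pos add_nonneg_nonneg) auto
  have "c * tot m e v \<le> defect m e v \<and> defect m e v \<le> C * tot m e v"
    if a: "adm m e v" and ma: "mass e \<le> M" and o: "ip e Z1 = 0" "ip e Z2 = 0" and t: "tot m e v \<le> \<eta>" for e v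
  proof
    note al = adm_adml[OF a]
    note [measurable] = adml_measurable[OF al] ff_measurable[OF al] hf_measurable[OF al] rem_measurable[OF adml_measurable(1)[OF al]]
    let ?N = "tot m e v" and ?F = "defect m e v"
    have N: "0 \<le> ?N" "?N \<le> 1" using tot_nonneg[of m e v] t \<eta> by auto
    have F0: "0 \<le> ?F" by (rule defect_nonneg)
    show "?F \<le> C * ?N"
      unfolding C_def by (rule defect_le[OF a]) (use ma N M in \<open>auto simp: M1_def\<close>)
    have R1': "1 \<le> R + 1" using R by simp
    have ffi: "si {0<..<R+1} (\<lambda>r. nsq (ff m e v r) * r)"
      by (rule set_integrable_subset[OF si_ff[OF a]]) auto
    have ri: "si {0<..<R+1} (\<lambda>r. nsq (rem m e r) * r)" by (rule si_rem[OF al R1'])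
    have "vnorm (hf m e v) (R + 1) \<le> (LBINT r:{0<..<R+1}. 2 * (nsq (ff m e v r) * r) + 2 * (nsq (rem m e r) * r))"
      unfolding vnorm_def
    proof (rule set_integral_mono[OF si_hf[OF al] set_integral_add(1)[OF set_integrable_mult_right[OF ffi] set_integrable_mult_right[OF ri]]])
      fix r assume r: "r \<in> {0<..<R+1}"
      have "hf m e v r = ff m e v r + - rem m e r" by (simp add: ff_hf rem_def)
      then have "nsq (hf m e v r) \<le> 2 * nsq (ff m e v r) + 2 * nsq (rem m e r)"
        using cmod_add_sq_le[of "ff m e v r" "- rem m e r"] by simp
      then have "nsq (hf m e v r) * r \<le> (2 * nsq (ff m e v r) + 2 * nsq (rem m e r)) * r"
        using r by (intro mult_right_mono) auto
      then show "nsq (hf m e v r) * r \<le> 2 * (nsq (ff m e v r) * r) + 2 * (nsq (rem m e r) * r)"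
        by (simp add: algebra_simps)
    qed
    also have "\<dots> = 2 * vnorm (ff m e v) (R + 1) + 2 * vnorm (rem m e) (R + 1)"
      unfolding vnorm_def set_integral_mult_right[symmetric]
      by (rule set_integral_add(2)[OF set_integrable_mult_right[OF ffi] set_integrable_mult_right[OF ri]])
    also have "vnorm (ff m e v) (R + 1) \<le> ?F"
      unfolding vnorm_def defect_def by (rule li_mono_set[OF si_ff[OF a]]) auto
    also have "vnorm (rem m e) (R + 1) \<le> Cr * ?N^2"
    proof -
      have W: "0 \<le> enorm m e (R + 1)" "enorm m e (R + 1) \<le> ?N" by (rule enorm_nonneg, rule enorm_le_tot[OF a])
      have "vnorm (rem m e) (R + 1) \<le> (13 * ?K * (R + 1) ^ 4 + 10 * (R + 1) ^ 4 * (10 * ?K + 13 * enorm m e (R + 1))) * (enorm m e (R + 1))^2"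
        by (rule vnorm_rem_le[OF al R1'])
      also have "\<dots> \<le> Cr * ?N^2"
        unfolding Cr_def using W N R qmax_pos[of m] by (intro mult_mono add_mono mult_left_mono power_mono) auto
      finally show ?thesis .
    qed
    finally have H: "vnorm (hf m e v) (R + 1) \<le> 2 * ?F + 2 * (Cr * ?N^2)" by simp
    have "bnorm m e v R \<le> Cl * vnorm (hf m e v) (R + 1)" using lin al o by blast
    also have "\<dots> \<le> Cl * (2 * ?F + 2 * (Cr * ?N^2))" using Cl H by (intro mult_left_mono) auto
    also have "\<dots> \<le> C1 * (?F + ?N^2)"
    proof -
      have "0 \<le> Cl * Cr * ?F" "0 \<le> Cl * ?N^2" using Cl Cr F0 by simp_all
      then show ?thesis unfolding C1_def by (simp add: algebra_simps)
    qed
    finally have b: "bnorm m e v R \<le> C1 * (?F + ?N^2)" .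
    define X where "X = ?F + ?N^2"
    have X: "0 \<le> X" "?F \<le> X" "?N^2 \<le> X" unfolding X_def using F0 by auto
    have parts: "vnorm v R + enorm m e R \<le> C1 * X" "nsq (e R) + (yf m e R)^2 \<le> C1 * X"
      using b vnorm_nonneg[of v R] enorm_nonneg[of m e R] zero_le_power2[of "cmod (e R)"] zero_le_power2[of "yf m e R"]
      unfolding bnorm_def X_def by linarith+
    have "(zf e R)^2 \<le> (5/2 * R * R * ?N)^2"
    proof (intro power_mono zf_nonneg)
      have "zf e R \<le> 5/2 * R * R * enorm m e R" by (rule zf_le[OF al _ order_refl R(1)]) (use R in simp)
      also have "\<dots> \<le> 5/2 * R * R * ?N" using R by (intro mult_left_mono enorm_le_tot[OF a]) auto
      finally show "zf e R \<le> 5/2 * R * R * ?N" .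
    qed
    also have "\<dots> = (5/2 * R * R)^2 * ?N^2" by (rule power_mult_distrib)
    also have "\<dots> \<le> (5/2 * R * R)^2 * X" using X by (intro mult_left_mono) auto
    finally have "2 * (zf e R)^2 \<le> Cz * X" unfolding Cz_def by simp
    then have "nsq (e R) + (bf m e R)^2 \<le> (2 * C1 + Cz) * X"
      using parts(2) add_sq_le[of "yf m e R" "zf e R"] zero_le_power2[of "cmod (e R)"]
      unfolding bf_def distrib_right mult.assoc by linarith
    then have "nsq (e R) + (bf m e R)^2 + ?F \<le> (2 * C1 + Cz + 1) * X" using X by (simp add: distrib_right)
    then have "Ct * (nsq (e R) + (bf m e R)^2 + ?F) \<le> Ct * ((2 * C1 + Cz + 1) * X)"
      using Ct by (intro mult_left_mono) auto
    moreover have "enorm m e R \<le> \<delta>" using enorm_le_tot[OF a, of R] t \<eta>(3) by linarith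
    then have "(LBINT r:{R..}. nsq (v r) * r) + (LBINT r:{R..}. wt m r * nsq (e r)) \<le>
      Ct * (nsq (e R) + (bf m e R)^2 + ?F)" using tail a ma by blast
    moreover have "?N = vnorm v R + enorm m e R + ((LBINT r:{R..}. nsq (v r) * r) + (LBINT r:{R..}. wt m r * nsq (e r)))"
    proof -
      have eq: "{0<..} = {0<..<R} \<union> {R..}" "{0<..<R} \<inter> {R..} = {}" using R by auto
      have "(LBINT r:{0<..}. f r) = (LBINT r:{0<..<R}. f r) + (LBINT r:{R..}. f r)"
        if "si {0<..} f" for f :: "real \<Rightarrow> real"
        using li_split[of "{0<..<R}" "{R..}" f] that unfolding eq(1)[symmetric] eq(2) by simp
      from this[OF adm_si(1)[OF a]] this[OF adm_si(2)[OF a]] show ?thesis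
        unfolding tot_def vnorm_def enorm_def by simp
    qed
    ultimately have "?N \<le> C1 * X + Ct * ((2 * C1 + Cz + 1) * X)" using parts(1) by linarith
    also have "\<dots> = C2 * ?F + C2 * ?N^2" unfolding C2_def X_def by (simp add: algebra_simps)
    also have "C2 * ?N^2 \<le> 1/2 * ?N"
    proof -
      have "C2 * ?N \<le> C2 * \<eta>" using C2 t by (intro mult_left_mono) auto
      then have "(C2 * ?N) * ?N \<le> 1/2 * ?N" using \<eta>(4) N by (intro mult_right_mono) auto
      then show ?thesis by (simp add: power2_eq_square)
    qed
    finally have "?N \<le> 2 * (C2 * ?F)" by linarith
    then show "c * ?N \<le> ?F" using C2 by (simp add: c_def divide_le_eq mult_ac)
  qed
  with \<eta>(1) c C show ?thesis by blast
qed

section \<open>The Bogomolny identity\<close>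

text \<open>If \<open>P\<close> stayed above \<open>d\<close> in modulus, its integral against
  \<open>1/r\<close> over the interval would be at least \<open>d * ln (b / a)\<close>. The left
  endpoint is chosen so that this equals the total integral plus one.\<close>

lemma small_value_if_integrable_over_r:
  fixes P :: "real \<Rightarrow> real"
  assumes c: "continuous_on {0<..} P" and i: "si {0<..} (\<lambda>r. \<bar>P r\<bar> / r)"
    and d: "0 < d" and b: "0 < b"
  shows "\<exists>r\<in>{b * exp (- ((LBINT r:{0<..}. \<bar>P r\<bar> / r) + 1) / d)..b}. \<bar>P r\<bar> < d"
proof (rule ccontr)
  define G where "G = (LBINT r:{0<..}. \<bar>P r\<bar> / r)"
  define a where "a = b * exp (- (G + 1) / d)"
  have G: "0 \<le> G" unfolding G_def by (rule li_nonneg) auto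
  have neg: "- (G + 1) / d \<le> 0" using G d by (intro divide_nonpos_pos) auto
  have a: "0 < a" "a \<le> b"
    unfolding a_def using b mult_left_mono[of "exp (- (G + 1) / d)" 1 b] neg by (simp_all only: exp_le_one_iff mult_1_right exp_gt_zero mult_pos_pos less_imp_le)
  assume "\<not> ?thesis"
  then have le: "d \<le> \<bar>P r\<bar>" if "r \<in> {a..b}" for r using that unfolding a_def G_def by (meson not_le)
  have "((ln :: real \<Rightarrow> real) has_vector_derivative 1 / x) (at x)" if "0 < x" for x :: real
    using DERIV_ln_divide[OF that] by (simp add: has_real_derivative_iff_has_vector_derivative)
  then have ac: "ac ln (\<lambda>r. 1 / r)" by (rule ac_C1) (auto intro!: continuous_intros)
  have "d * (ln b - ln a) = (LBINT r:{a..b}. d * (1 / r))"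
    unfolding ac_diff_eq[OF ac a] by (rule set_integral_mult_right[symmetric])
  also have "\<dots> \<le> (LBINT r:{a..b}. \<bar>P r\<bar> / r)"
  proof (rule set_integral_mono)
    show "si {a..b} (\<lambda>r. d * (1 / r))"
      by (rule set_integrable_mult_right[OF ac_integrable[OF ac a(1)]])
    show "si {a..b} (\<lambda>r. \<bar>P r\<bar> / r)"
      by (rule set_integrable_subset[OF i]) (use a in auto)
    show "d * (1 / r) \<le> \<bar>P r\<bar> / r" if "r \<in> {a..b}" for r
      using le[OF that] that a by (auto simp: divide_right_mono)
  qed
  also have "\<dots> \<le> G" unfolding G_def by (rule li_mono_set[OF i]) (use a in auto)
  also have "d * (ln b - ln a) = G + 1"
    unfolding a_def using b d by (simp add: ln_mult)
  finally show False by simp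
qed

text \<open>Since \<open>1 / r\<close> is not integrable at either end, \<open>P\<close> tends to \<open>0\<close> along sequences to \<open>0\<close> and \<open>\<infinity>\<close>.\<close>
lemma ac_total_integral:
  fixes P p A B :: "real \<Rightarrow> real"
  assumes ac: "ac P p" and p: "\<And>r. 0 < r \<Longrightarrow> p r = A r - B r"
    and A: "si {0<..} A"
    and B[measurable]: "B \<in> bm" and B0: "\<And>r. 0 < r \<Longrightarrow> 0 \<le> B r"
    and i: "si {0<..} (\<lambda>r. \<bar>P r\<bar> / r)"
  shows "si {0<..} B" and "(LBINT r:{0<..}. A r - B r) = 0"
proof -
  define G where "G = (LBINT r:{0<..}. \<bar>P r\<bar> / r)"
  note small = small_value_if_integrable_over_r[OF ac_continuous[OF ac] i, folded G_def]
  have "\<exists>a b. 0 < a \<and> a \<le> 1 / real (Suc n) \<and> real (Suc n) \<le> b \<and> \<bar>P a\<bar> < 1 / real (Suc n) \<and> \<bar>P b\<bar> < 1 / real (Suc n)" for n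
  proof -
    let ?d = "1 / real (Suc n)"
    have d: "0 < ?d" by simp
    obtain a where a: "a \<in> {?d * exp (- (G + 1) / ?d)..?d}" "\<bar>P a\<bar> < ?d" using small[OF d d] by blast
    \<comment> \<open>The right endpoint is scaled up so that the interval in which the small value
      is found starts at \<open>n + 1\<close>.\<close>
    define b' where "b' = real (Suc n) * exp ((G + 1) / ?d)"
    have b': "0 < b'" "b' * exp (- (G + 1) / ?d) = real (Suc n)"
      unfolding b'_def mult.assoc exp_add[symmetric] minus_divide_left[symmetric] by simp_all
    obtain b where b: "b \<in> {real (Suc n)..b'}" "\<bar>P b\<bar> < ?d" using small[OF d b'(1)] unfolding b'(2) by blast
    have "0 < ?d * exp (- (G + 1) / ?d)" by simp
    then have "0 < a" using a(1) by (meson atLeastAtMost_iff less_le_trans)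
    then show ?thesis using a b by auto
  qed
  then obtain a b where ab: "\<And>n. 0 < a n" "\<And>n. a n \<le> 1 / real (Suc n)" "\<And>n. real (Suc n) \<le> b n"
    "\<And>n. \<bar>P (a n)\<bar> < 1 / real (Suc n)" "\<And>n. \<bar>P (b n)\<bar> < 1 / real (Suc n)" by metis
  have one: "1 / real (Suc n) \<le> 1" "1 \<le> real (Suc n)" for n by simp_all
  have le: "a n \<le> b n" for n using ab(2,3)[of n] one[of n] by linarith
  have Ai: "si {x..y} A" if "0 < x" for x y
    by (rule set_integrable_subset[OF A]) (use that in auto)
  have Bi: "si {x..y} B" if "0 < x" for x y
  proof -
    have "si {x..y} (\<lambda>r. A r - p r)"
      by (rule set_integral_diff(1)[OF Ai[OF that] ac_integrable[OF ac that]])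
    moreover have "A r - p r = B r" if "r \<in> {x..y}" for r using p[of r] that \<open>0 < x\<close> by auto
    ultimately show ?thesis using set_integrable_cong[OF refl refl, of "{x..y}" "\<lambda>r. A r - p r" B lborel] by blast
  qed
  have diff: "P (b n) - P (a n) = (LBINT r:{a n..b n}. A r - B r)" for n
    unfolding ac_diff_eq[OF ac ab(1) le]
    by (rule set_lebesgue_integral_cong) (use ab(1)[of n] p in \<open>auto intro: less_le_trans\<close>)
  \<comment> \<open>Only \<open>A\<close> is assumed integrable. As \<open>B\<close> is nonnegative,
    bounding its integrals by those of \<open>|A|\<close> and the boundary values of
    \<open>P\<close> proves its integrability along the way; in the application this is the quartic
    term of the energy.\<close>
  have Ub: "(LBINT r:{a n..b n}. B r) \<le> (LBINT r:{0<..}. \<bar>A r\<bar>) + 2" for n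
  proof -
    have "(LBINT r:{a n..b n}. B r) = (LBINT r:{a n..b n}. A r) - (P (b n) - P (a n))"
      unfolding diff set_integral_diff(2)[OF Ai[OF ab(1)] Bi[OF ab(1)]] by simp
    also have "(LBINT r:{a n..b n}. A r) \<le> (LBINT r:{a n..b n}. \<bar>A r\<bar>)"
      by (rule set_integral_mono[OF Ai[OF ab(1)] set_integrable_abs[OF Ai[OF ab(1)]]]) simp
    also have "\<dots> \<le> (LBINT r:{0<..}. \<bar>A r\<bar>)"
      by (rule li_mono_set[OF set_integrable_abs[OF A]]) (use ab(1)[of n] in auto)
    finally show ?thesis using ab(4,5)[of n] one(1)[of n] by linarith
  qed
  show Bint: "si {0<..} B"
  proof (rule si_incseq[where A = "\<lambda>n. {1 / real (Suc n)..real (Suc n)}" and K = "(LBINT r:{0<..}. \<bar>A r\<bar>) + 2"])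
    show "incseq (\<lambda>n. {1 / real (Suc n)..real (Suc n)})"
      by (rule incseq_SucI) (auto simp: frac_le intro: order_trans[rotated])
    show "(\<Union>n. {1 / real (Suc n)..real (Suc n)}) = {0<..}"
    proof (intro equalityI subsetI)
      fix x :: real assume "x \<in> {0<..}"
      then have x: "0 < x" by simp
      obtain n where n: "max x (1 / x) \<le> real n" using real_arch_simple by blast
      then have "1 / real (Suc n) \<le> x" "x \<le> real (Suc n)" using x by (auto simp: field_simps)
      then show "x \<in> (\<Union>n. {1 / real (Suc n)..real (Suc n)})" by auto
    next
      fix x :: real assume "x \<in> (\<Union>n. {1 / real (Suc n)..real (Suc n)})"
      then obtain n where "1 / real (Suc n) \<le> x" by auto
      moreover have "0 < 1 / real (Suc n)" by simp
      ultimately show "x \<in> {0<..}" by (metis greaterThan_iff less_le_trans)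
    qed
    show "si {1 / real (Suc n)..real (Suc n)} B" for n by (rule Bi) simp
    show "(LBINT x:{1 / real (Suc n)..real (Suc n)}. B x) \<le> (LBINT r:{0<..}. \<bar>A r\<bar>) + 2" for n
    proof -
      have "(LBINT x:{1 / real (Suc n)..real (Suc n)}. B x) \<le> (LBINT x:{a n..b n}. B x)"
        by (rule li_mono_set[OF Bi[OF ab(1)]]) (use ab(1)[of n] ab(2,3)[of n] in \<open>auto intro!: B0 intro: less_le_trans\<close>)
      then show ?thesis using Ub[of n] by linarith
    qed
  qed (auto intro: B0)
  have AB: "si {0<..} (\<lambda>r. A r - B r)" by (rule set_integral_diff(1)[OF A Bint])
  have "(\<lambda>n. LBINT r:{a n..b n}. A r - B r) \<longlonglongrightarrow> (LBINT r:{0<..}. A r - B r)"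
    unfolding set_lebesgue_integral_def
  proof (rule integral_dominated_convergence[where w = "\<lambda>r. norm (indicat_real {0<..} r *\<^sub>R (A r - B r))"])
    show "(\<lambda>r. indicat_real {0<..} r *\<^sub>R (A r - B r)) \<in> borel_measurable lborel"
      using AB unfolding set_integrable_def by (rule borel_measurable_integrable)
    show "(\<lambda>r. indicat_real {a n..b n} r *\<^sub>R (A r - B r)) \<in> borel_measurable lborel" for n
      using set_integral_diff(1)[OF Ai[OF ab(1)] Bi[OF ab(1)]] unfolding set_integrable_def by (rule borel_measurable_integrable)
    show "integrable lborel (\<lambda>r. norm (indicat_real {0<..} r *\<^sub>R (A r - B r)))"
      using AB unfolding set_integrable_def by (rule integrable_norm)
    show "AE r in lborel. (\<lambda>n. indicat_real {a n..b n} r *\<^sub>R (A r - B r)) \<longlonglongrightarrow> indicat_real {0<..} r *\<^sub>R (A r - B r)"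
    proof (rule AE_I2)
      fix r :: real
      show "(\<lambda>n. indicat_real {a n..b n} r *\<^sub>R (A r - B r)) \<longlonglongrightarrow> indicat_real {0<..} r *\<^sub>R (A r - B r)"
      proof (cases "0 < r")
        case True
        obtain N where N: "max r (1 / r) \<le> real N" using real_arch_simple by blast
        have "r \<in> {a n..b n}" if "N \<le> n" for n
        proof -
          have n: "real N \<le> real (Suc n)" using that by simp
          then have "1 / r \<le> real (Suc n)" "r \<le> real (Suc n)" using N by linarith+
          then have "1 / real (Suc n) \<le> r" "r \<le> real (Suc n)" using True by (auto simp: field_simps)
          then show ?thesis using ab(2,3)[of n] by auto
        qed
        then have "\<forall>\<^sub>F n in sequentially. indicat_real {a n..b n} r *\<^sub>R (A r - B r) = indicat_real {0<..} r *\<^sub>R (A r - B r)"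
          using True by (intro eventually_sequentiallyI[of N]) auto
        then show ?thesis by (rule tendsto_eventually)
      next
        case False
        then have "r \<notin> {a n..b n}" for n using ab(1)[of n] by auto
        then show ?thesis using False by simp
      qed
    qed
    show "AE r in lborel. norm (indicat_real {a n..b n} r *\<^sub>R (A r - B r)) \<le> norm (indicat_real {0<..} r *\<^sub>R (A r - B r))" for n
    proof (rule AE_I2)
      fix r
      have "0 < r" if "r \<in> {a n..b n}" using that ab(1)[of n] by auto
      then show "norm (indicat_real {a n..b n} r *\<^sub>R (A r - B r)) \<le> norm (indicat_real {0<..} r *\<^sub>R (A r - B r))"
        by (auto simp: indicator_def)
    qed
  qed
  moreover have "(\<lambda>n. P (b n) - P (a n)) \<longlonglongrightarrow> 0"
  proof (rule tendsto_0_le[where K = 2])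
    show "(\<lambda>n. 1 / real (Suc n)) \<longlonglongrightarrow> 0" by (rule LIMSEQ_Suc[OF lim_1_over_n])
    show "\<forall>\<^sub>F n in sequentially. norm (P (b n) - P (a n)) \<le> norm (1 / real (Suc n)) * 2"
    proof (rule always_eventually, rule allI)
      fix n
      have "norm (1 / real (Suc n)) = 1 / real (Suc n)" by simp
      then show "norm (P (b n) - P (a n)) \<le> norm (1 / real (Suc n)) * 2"
        using ab(4,5)[of n] unfolding real_norm_def by linarith
    qed
  qed
  ultimately show "(LBINT r:{0<..}. A r - B r) = 0"
    unfolding diff by (metis LIMSEQ_unique)
qed

definition uf :: "nat \<Rightarrow> (real \<Rightarrow> complex) \<Rightarrow> real \<Rightarrow> complex" where
  "uf m e r = of_real (q m r) + e r"

definition duf :: "nat \<Rightarrow> (real \<Rightarrow> complex) \<Rightarrow> real \<Rightarrow> complex" where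
  "duf m v r = of_real (kq m r / r * q m r) + v r"

lemma adml_uf: "adml m e v \<Longrightarrow> adml m (uf m e) (duf m v)"
  unfolding uf_def[abs_def] duf_def[abs_def] by (rule adml_add[OF adml_q])

lemma ff_eq: "ff m e v r = duf m v r - of_real ((kq m r - bf m e r) / r) * uf m e r"
  unfolding ff_def duf_def uf_def by (simp add: diff_divide_distrib add_divide_distrib algebra_simps)

lemma cmod_uf_sq: "nsq (uf m e r) = (q m r)^2 + 2 * (q m r * Re (e r)) + nsq (e r)"
  unfolding uf_def cmod_power2 by (simp add: power2_eq_square algebra_simps)

lemma
  assumes a: "adm m e v"
  shows si_uf: "si {0<..} (\<lambda>r. nsq (uf m e r) * r)"
    and si_duf: "si {0<..} (\<lambda>r. nsq (duf m v r) * r)"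
proof -
  note [measurable] = adml_measurable[OF adm_adml[OF a]] adml_measurable[OF adml_uf[OF adm_adml[OF a]]]
  have i1: "si {0<..} (\<lambda>r. 2 * ((qmax m)^2 * maj r) + 2 * (nsq (e r) * r))"
    by (intro set_integral_add(1) set_integrable_mult_right si_maj adm_si(3)[OF a])
  show "si {0<..} (\<lambda>r. nsq (uf m e r) * r)"
  proof (rule si_bound[OF i1])
    fix r :: real assume "r \<in> {0<..}"
    then have r: "0 < r" by simp
    have "nsq (uf m e r) * r \<le> (2 * (q m r)^2 + 2 * nsq (e r)) * r"
      using cmod_add_sq_le[of "of_real (q m r)" "e r"] r unfolding uf_def by (intro mult_right_mono) auto
    also have "\<dots> \<le> 2 * ((qmax m)^2 * maj r) + 2 * (nsq (e r) * r)"
      using q_sq_mult_le_maj[OF r, of m] by (simp add: algebra_simps)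
    finally show "\<bar>nsq (uf m e r) * r\<bar> \<le> 2 * ((qmax m)^2 * maj r) + 2 * (nsq (e r) * r)" using r by simp
  qed auto
  define K where "K = (qmax m * (3 * real m + 2))^2 + (real m + 2)^2 * (qmax m)^2"
  have i2: "si {0<..} (\<lambda>r. 2 * (K * maj r) + 2 * (nsq (v r) * r))"
    by (intro set_integral_add(1) set_integrable_mult_right si_maj adm_si(1)[OF a])
  have dq: "(kq m r / r * q m r)^2 * r \<le> K * maj r" if r: "0 < r" for r
  proof (cases "r < 1")
    case True
    have "(kq m r / r * q m r)^2 * r \<le> K"
      using kq_q_sq_le[OF r, of m] unfolding K_def by (smt (verit) zero_le_mult_iff zero_le_power2)
    then show ?thesis using True by (simp add: maj_def)
  next
    case False
    have "\<bar>kq m r / r\<bar> \<le> real m + 2"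
      using kq_abs_le[OF r, of m] False r by (simp add: divide_le_eq mult_le_cancel_left1 order_trans)
    then have "(kq m r / r)^2 \<le> (real m + 2)^2" by (rule power2_le_iff_abs_le[THEN iffD2, rotated]) simp
    then have "(kq m r / r * q m r)^2 * r \<le> (real m + 2)^2 * ((q m r)^2 * r)"
      unfolding power_mult_distrib[of "kq m r / r"] mult.assoc using r by (intro mult_right_mono) auto
    also have "\<dots> \<le> (real m + 2)^2 * ((qmax m)^2 * maj r)"
      by (intro mult_left_mono q_sq_mult_le_maj r) simp
    also have "\<dots> \<le> K * maj r"
      unfolding K_def mult.assoc[symmetric] by (intro mult_right_mono) (use False in \<open>auto simp: maj_def\<close>)
    finally show ?thesis .
  qed
  show "si {0<..} (\<lambda>r. nsq (duf m v r) * r)"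
  proof (rule si_bound[OF i2])
    fix r :: real assume "r \<in> {0<..}"
    then have r: "0 < r" by simp
    have "nsq (duf m v r) \<le> 2 * (kq m r / r * q m r)^2 + 2 * nsq (v r)"
      using cmod_add_sq_le[of "of_real (kq m r / r * q m r)" "v r"] unfolding duf_def norm_of_real power2_abs .
    then have "nsq (duf m v r) * r \<le> (2 * (kq m r / r * q m r)^2 + 2 * nsq (v r)) * r"
      using r by (intro mult_right_mono) auto
    also have "\<dots> = 2 * ((kq m r / r * q m r)^2 * r) + 2 * (nsq (v r) * r)" by (simp only: distrib_right mult.assoc)
    also have "\<dots> \<le> 2 * (K * maj r) + 2 * (nsq (v r) * r)" using dq[OF r] by simp
    finally show "\<bar>nsq (duf m v r) * r\<bar> \<le> 2 * (K * maj r) + 2 * (nsq (v r) * r)" using r by simp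
  qed auto
qed

lemma ac_kq: "ac (kq m) (\<lambda>r. - ((q m r)^2 * r / 2))"
  by (rule ac_C1) (auto intro!: continuous_intros continuous_on_q simp: kq_deriv simp flip: has_real_derivative_iff_has_vector_derivative)

lemma ac_covariant:
  assumes a: "adml m e v"
  shows "ac (\<lambda>r. kq m r - bf m e r) (\<lambda>r. - (nsq (uf m e r) * r / 2))"
proof -
  have "ac (zf e) (\<lambda>s. (1/2) * (nsq (e s) * s))"
    unfolding zf_def[abs_def] by (rule ac_bounded_linear[OF bounded_linear_mult_right[of "1/2"] ac_primitive[OF si_zf[OF a]]])
  from ac_diff[OF ac_kq ac_add[OF yf_ac[OF a] this]] show ?thesis
    by (rule ac_cong) (auto simp: bf_def cmod_uf_sq field_simps)
qed

text \<open>The difference of the two sides has derivative zero, so it is constant. Letting the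
  radius tend to \<open>0\<close>, where \<open>kq\<close> tends to \<open>m\<close> and both
  \<open>bf\<close> and the mass integral vanish, shows that the constant is zero.\<close>

lemma A_theta_uf:
  assumes a: "adml m e v" and r: "0 < r"
  shows "real m + A_theta (uf m e) r = kq m r - bf m e r"
proof -
  let ?k = "\<lambda>r. kq m r - bf m e r" and ?z = "\<lambda>r. (1/2) * (LBINT s:{0<..<r}. nsq (uf m e s) * s)"
  have l: "ac (\<lambda>r. ?k r + ?z r) (\<lambda>r. 0)"
    by (rule ac_cong[OF ac_add[OF ac_covariant[OF a] ac_bounded_linear[OF bounded_linear_mult_right[of "1/2"] ac_primitive[OF si_zf[OF adml_uf[OF a]]]]]]) auto
  have eq: "?k s + ?z s = ?k r + ?z r" if "0 < s" "s \<le> r" for s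
    using ac_diff_eq[OF l that] by simp
  have lim: "((\<lambda>s. ?k s + ?z s) \<longlongrightarrow> real m) (at_right 0)"
  proof -
    define D where "D = 1 * (10 * (qmax m)^2 + 13 * enorm m e 1) * enorm m e 1"
    have D: "0 \<le> D" unfolding D_def using enorm_nonneg[of m e 1] by simp
    define L where "L = 2 * (real m + 1) + sqrt D + 5/2 * enorm m (uf m e) 1"
    have "\<forall>\<^sub>F s in at_right 0. norm (?k s + ?z s - real m) \<le> norm s * L"
    proof (rule eventually_at_rightI[of 0 1])
      fix s :: real assume "s \<in> {0<..<1}"
      then have s: "0 < s" "s \<le> 1" by auto
      have "real m - kq m s \<le> 2 * (real m + 1) * s^2" by (rule kq_diff_le_sq[OF s])
      also have "\<dots> \<le> 2 * (real m + 1) * s" using s by (intro mult_left_mono) (auto simp: power2_eq_square mult_le_cancel_left1)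
      finally have 1: "\<bar>kq m s - real m\<bar> \<le> 2 * (real m + 1) * s" using kq_diff_nonneg[OF s(1), of m] by simp
      have "(bf m e s)^2 \<le> s^2 * D" using bf_sq_le[OF a s order_refl] unfolding D_def by simp
      then have 2: "\<bar>bf m e s\<bar> \<le> s * sqrt D"
        using s D by (metis abs_of_pos real_sqrt_abs real_sqrt_le_iff real_sqrt_mult)
      have 3: "\<bar>?z s\<bar> \<le> 5/2 * s * enorm m (uf m e) 1"
        using zf_le[OF adml_uf[OF a] s order_refl] zf_nonneg[of "uf m e" s] unfolding zf_def by simp
      show "norm (?k s + ?z s - real m) \<le> norm s * L"
        using 1 2 3 s unfolding L_def by (simp add: algebra_simps)
    qed simp
    moreover have "((\<lambda>s::real. s) \<longlongrightarrow> 0) (at_right 0)" by (rule tendsto_ident_at)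
    ultimately have "((\<lambda>s. ?k s + ?z s - real m) \<longlongrightarrow> 0) (at_right 0)" by (rule tendsto_0_le[rotated])
    then show ?thesis by (rule LIM_zero_cancel)
  qed
  have "\<forall>\<^sub>F s in at_right 0. ?k s + ?z s = ?k r + ?z r"
    by (rule eventually_at_rightI[OF _ r]) (rule eq, auto)
  then have "((\<lambda>s. ?k s + ?z s) \<longlongrightarrow> ?k r + ?z r) (at_right 0)" by (rule tendsto_eventually)
  then have "?k r + ?z r = real m" by (rule tendsto_unique[OF trivial_limit_at_right_real _ lim])
  then show ?thesis unfolding A_theta_def by simp
qed

text \<open>Expanding \<open>|D_u u|^2\<close> leaves the cross term
  \<open>A = 2 k Re (cnj u u')\<close>, with \<open>k = m + A_theta u\<close>. Since
  \<open>k' = - |u|^2 r / 2\<close>, the derivative of \<open>P = k |u|^2\<close> is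
  \<open>A - B\<close>, where \<open>B\<close> is the quartic density. So the energy density and
  half of \<open>|D_u u|^2 r\<close> differ by half of a total derivative, whose integral is
  zero.\<close>

lemma bogomolny:
  assumes a: "adm m e v"
  shows "(LBINT r:{0<..}. (1/2 * nsq (duf m v r)
      + 1/2 * ((real m + A_theta (uf m e) r) / r)^2 * nsq (uf m e r) - 1/4 * cmod (uf m e r) ^ 4) * r) =
    1/2 * defect m e v"
proof -
  note al = adm_adml[OF a] and au = adml_uf[OF adm_adml[OF a]]
  note [measurable] = adml_measurable[OF al] adml_measurable[OF au] bf_measurable[OF adml_measurable(1)[OF al]] ff_measurable[OF al]
  let ?u = "uf m e" and ?w = "duf m v"
  define k where "k r = kq m r - bf m e r" for r
  have [measurable]: "k \<in> bm" unfolding k_def[abs_def] by measurable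
  have ff: "ff m e v r = ?w r - of_real (k r / r) * ?u r" for r unfolding k_def by (rule ff_eq)
  define A where "A r = 2 * k r * Re (cnj (?u r) * ?w r)" for r
  define B where "B r = (cmod (?u r)) ^ 4 * r / 2" for r
  define P where "P r = k r * nsq (?u r)" for r
  have ac: "ac P (\<lambda>r. A r - B r)"
    unfolding P_def[abs_def] A_def[abs_def] B_def[abs_def]
    by (rule ac_cong[OF ac_mult[OF ac_covariant[OF al, folded k_def] ac_cmod_sq[OF adml_ac[OF au]]]])
      (auto simp: power2_eq_square power4_eq_xxxx algebra_simps)
  have id: "nsq (ff m e v r) * r = nsq (?w r) * r + (k r / r)^2 * nsq (?u r) * r - A r" if r: "0 < r" for r
    unfolding ff A_def cmod_power2 using r by (simp add: power2_eq_square field_simps)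
  note wi = si_duf[OF a] and ui = si_uf[OF a] and fi = si_ff[OF a]
  \<comment> \<open>The term \<open>(k/r) u\<close> is the difference of the derivative of
    \<open>u\<close> and \<open>D_u u\<close>, both already known to be square integrable; no direct
    estimate is needed.\<close>
  have ki: "si {0<..} (\<lambda>r. (k r / r)^2 * nsq (?u r) * r)"
  proof (rule si_bound)
    show "si {0<..} (\<lambda>r. 2 * (nsq (?w r) * r) + 2 * (nsq (ff m e v r) * r))"
      by (intro set_integral_add(1) set_integrable_mult_right wi fi)
    fix r :: real assume "r \<in> {0<..}"
    then have r: "0 < r" by simp
    have "(k r / r)^2 * nsq (?u r) = nsq (?w r + (- ff m e v r))"
      unfolding ff by (simp add: norm_mult power_mult_distrib norm_divide power_divide)
    also have "\<dots> \<le> 2 * nsq (?w r) + 2 * nsq (ff m e v r)"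
      using cmod_add_sq_le[of "?w r" "- ff m e v r"] by simp
    finally have "(k r / r)^2 * nsq (?u r) * r \<le> (2 * nsq (?w r) + 2 * nsq (ff m e v r)) * r"
      using r by (intro mult_right_mono) auto
    then show "\<bar>(k r / r)^2 * nsq (?u r) * r\<bar> \<le> 2 * (nsq (?w r) * r) + 2 * (nsq (ff m e v r) * r)"
      using r by (simp add: algebra_simps)
  qed auto
  have Ai: "si {0<..} A"
  proof -
    have "si {0<..} (\<lambda>r. nsq (?w r) * r + (k r / r)^2 * nsq (?u r) * r - nsq (ff m e v r) * r)"
      by (intro set_integral_diff(1) set_integral_add(1) wi ki fi)
    moreover have "nsq (?w r) * r + (k r / r)^2 * nsq (?u r) * r - nsq (ff m e v r) * r = A r" if "r \<in> {0<..}" for r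
      using id[of r] that by simp
    ultimately show ?thesis
      using set_integrable_cong[OF refl refl, of "{0<..}" "\<lambda>r. nsq (?w r) * r + (k r / r)^2 * nsq (?u r) * r - nsq (ff m e v r) * r" A lborel] by blast
  qed
  \<comment> \<open>Near the origin \<open>|k|\<close> exceeds \<open>m\<close> by at most a
    multiple of \<open>r\<close>, so \<open>|k| / r\<close> is bounded by the weight even if
    \<open>m = 0\<close>. Beyond \<open>1\<close> the boundedness of \<open>k\<close> and the mass
    of \<open>u\<close> suffice.\<close>
  have Pi: "si {0<..} (\<lambda>r. \<bar>P r\<bar> / r)"
  proof -
    define D where "D = 1 * (10 * (qmax m)^2 + 13 * enorm m e 1) * enorm m e 1"
    have D: "0 \<le> D" unfolding D_def using enorm_nonneg[of m e 1] by simp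
    define L where "L = 1 + 5 * (2 * (real m + 1) + sqrt D)"
    define S where "S = real m + 2 + sqrt (4 * (qmax m)^2 * mass e + (mass e)^2)"
    have M: "\<bar>P r\<bar> / r = \<bar>k r\<bar> / r * nsq (?u r)" if "0 < r" for r unfolding P_def by (simp add: abs_mult)
    have "si {0<..<1} (\<lambda>r. \<bar>P r\<bar> / r)"
    proof (rule si_bound)
      show "si {0<..<1} (\<lambda>r. L * (wt m r * nsq (?u r)))"
        by (intro set_integrable_mult_right adml_si(2)[OF au])
      fix r :: real assume "r \<in> {0<..<1}"
      then have r: "0 < r" "r \<le> 1" by auto
      have "real m - kq m r \<le> 2 * (real m + 1) * r^2" by (rule kq_diff_le_sq[OF r])
      also have "\<dots> \<le> 2 * (real m + 1) * r" using r by (intro mult_left_mono) (auto simp: power2_eq_square mult_le_cancel_left1)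
      finally have 1: "\<bar>kq m r - real m\<bar> \<le> 2 * (real m + 1) * r" using kq_diff_nonneg[OF r(1), of m] by simp
      have "(bf m e r)^2 \<le> r^2 * D" using bf_sq_le[OF al r order_refl] unfolding D_def by simp
      then have 2: "\<bar>bf m e r\<bar> \<le> r * sqrt D"
        using r D by (metis abs_of_pos real_sqrt_abs real_sqrt_le_iff real_sqrt_mult)
      have "\<bar>k r\<bar> \<le> real m + (2 * (real m + 1) + sqrt D) * r"
        using 1 2 unfolding k_def by (simp add: algebra_simps)
      then have "\<bar>k r\<bar> / r \<le> (real m + (2 * (real m + 1) + sqrt D) * r) / r" using r by (intro divide_right_mono) auto
      also have "\<dots> = real m / r + (2 * (real m + 1) + sqrt D) * 1" using r by (simp add: field_simps)
      also have "\<dots> \<le> wt m r + (2 * (real m + 1) + sqrt D) * (5 * wt m r)"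
      proof (intro add_mono mult_left_mono)
        have "real m \<le> (real m)^2" by (cases m) (auto simp: power2_eq_square)
        then show "real m / r \<le> wt m r" using wt_ge_m[OF r(1), of m] divide_right_mono[of "real m" "(real m)^2" r] r by linarith
        show "1 \<le> 5 * wt m r" using wt_ge_1_5[OF r, of m] by simp
      qed (use D in auto)
      also have "\<dots> = L * wt m r" unfolding L_def by (simp add: algebra_simps)
      finally have "\<bar>k r\<bar> / r * nsq (?u r) \<le> L * wt m r * nsq (?u r)" by (rule mult_right_mono) simp
      then show "\<bar>\<bar>P r\<bar> / r\<bar> \<le> L * (wt m r * nsq (?u r))" using M[OF r(1)] r by (simp add: mult.assoc)
    qed (auto simp: P_def)
    moreover have "si {1..} (\<lambda>r. \<bar>P r\<bar> / r)"
    proof (rule si_bound)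
      show "si {1..} (\<lambda>r. S * (nsq (?u r) * r))"
        by (intro set_integrable_mult_right set_integrable_subset[OF ui]) auto
      fix r :: real assume "r \<in> {1..}"
      then have r: "0 < r" "1 \<le> r" by auto
      have "\<bar>bf m e r\<bar> \<le> sqrt (4 * (qmax m)^2 * mass e + (mass e)^2)"
        using bf_bounded[OF a r(1)] by (simp add: real_le_rsqrt)
      then have k: "\<bar>k r\<bar> \<le> S" using kq_abs_le[OF r(1), of m] unfolding k_def S_def by linarith
      have "\<bar>k r\<bar> / r \<le> \<bar>k r\<bar> * r" using r by (simp add: divide_le_eq mult.assoc mult_le_cancel_left1 mult_ge1_I)
      also have "\<dots> \<le> S * r" using k r by (intro mult_right_mono) auto
      finally have "\<bar>k r\<bar> / r * nsq (?u r) \<le> S * r * nsq (?u r)" by (rule mult_right_mono) simp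
      then show "\<bar>\<bar>P r\<bar> / r\<bar> \<le> S * (nsq (?u r) * r)" using M[OF r(1)] r by (simp add: mult_ac)
    qed (auto simp: P_def)
    moreover have "{0<..} = {0<..<1} \<union> {1::real..}" by auto
    ultimately show ?thesis by (simp only:) (intro set_integrable_Un; simp)
  qed
  have Bm: "B \<in> bm" unfolding B_def[abs_def] by measurable
  have B0: "0 \<le> B r" if "0 < r" for r unfolding B_def using that by simp
  have Bi: "si {0<..} B" by (rule ac_total_integral(1)[OF ac _ Ai Bm B0 Pi]) auto
  have zero: "(LBINT r:{0<..}. A r - B r) = 0" by (rule ac_total_integral(2)[OF ac _ Ai Bm B0 Pi]) auto
  have "(LBINT r:{0<..}. (1/2 * nsq (?w r)
      + 1/2 * ((real m + A_theta ?u r) / r)^2 * nsq (?u r) - 1/4 * cmod (?u r) ^ 4) * r) =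
    (LBINT r:{0<..}. 1/2 * (nsq (ff m e v r) * r) + 1/2 * (A r - B r))"
  proof (rule set_lebesgue_integral_cong)
    show "\<forall>r. r \<in> {0<..} \<longrightarrow> (1/2 * nsq (?w r) + 1/2 * ((real m + A_theta ?u r) / r)^2 * nsq (?u r) - 1/4 * cmod (?u r) ^ 4) * r
      = 1/2 * (nsq (ff m e v r) * r) + 1/2 * (A r - B r)"
    proof (intro allI impI)
      fix r :: real assume "r \<in> {0<..}"
      then have r: "0 < r" by simp
      show "(1/2 * nsq (?w r) + 1/2 * ((real m + A_theta ?u r) / r)^2 * nsq (?u r) - 1/4 * cmod (?u r) ^ 4) * r
        = 1/2 * (nsq (ff m e v r) * r) + 1/2 * (A r - B r)"
        unfolding A_theta_uf[OF al r] k_def[symmetric] id[OF r] B_def by (simp add: algebra_simps)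
    qed
  qed simp
  also have "\<dots> = (LBINT r:{0<..}. 1/2 * (nsq (ff m e v r) * r)) + (LBINT r:{0<..}. 1/2 * (A r - B r))"
    by (intro set_integral_add(2) set_integrable_mult_right fi set_integral_diff(1) Ai Bi)
  also have "\<dots> = 1/2 * defect m e v"
    unfolding set_integral_mult_right zero defect_def by simp
  finally show ?thesis .
qed

section \<open>Energy, norms and inner products in terms of the representatives\<close>

text \<open>Integrands formed from \<open>\<epsilon>\<close> and \<open>d_r\<close> carry no
  measurability on negative radii. Cutting the functions off there makes them Borel measurable, and
  then almost everywhere equal functions may be exchanged.\<close>

lemma li_cong_AE:
  fixes f1 f2 g1 g2 :: "real \<Rightarrow> complex" and h :: "real \<Rightarrow> complex \<Rightarrow> complex \<Rightarrow> real"
  assumes f: "locint f1" "locint f2" and g: "g1 \<in> bm" "g2 \<in> bm"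
    and eq: "AE r in lborel. 0 < r \<longrightarrow> f1 r = g1 r" "AE r in lborel. 0 < r \<longrightarrow> f2 r = g2 r"
    and h: "\<And>F G. F \<in> bm \<Longrightarrow> G \<in> bm \<Longrightarrow> (\<lambda>r. h r (F r) (G r)) \<in> bm"
    and A: "A \<in> sets borel" "A \<subseteq> {0<..}"
  shows "(LBINT r:A. h r (f1 r) (f2 r)) = (LBINT r:A. h r (g1 r) (g2 r))"
proof -
  let ?F1 = "\<lambda>r. indicat_real {0<..} r *\<^sub>R f1 r" and ?F2 = "\<lambda>r. indicat_real {0<..} r *\<^sub>R f2 r"
  have [measurable]: "(\<lambda>r. h r (?F1 r) (?F2 r)) \<in> bm" "(\<lambda>r. h r (g1 r) (g2 r)) \<in> bm"
    by (rule h[OF locint_measurable[OF f(1)] locint_measurable[OF f(2)]], rule h[OF g])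
  have "(LBINT r:A. h r (f1 r) (f2 r)) = (LBINT r:A. h r (?F1 r) (?F2 r))"
    by (rule set_lebesgue_integral_cong) (use A in auto)
  also have "\<dots> = (LBINT r:A. h r (g1 r) (g2 r))"
  proof (rule set_lebesgue_integral_cong_AE)
    show "AE r\<in>A in lborel. h r (?F1 r) (?F2 r) = h r (g1 r) (g2 r)"
      using eq by eventually_elim (use A(2) in auto)
  qed (use A(1) in auto)
  finally show ?thesis .
qed

lemma has_weak_derivative_add_half_line:
  fixes u v f g :: "real \<Rightarrow> complex"
  assumes u: "has_weak_derivative u v 1 {0<..}" and f: "has_weak_derivative f g 1 {0<..}"
  shows "has_weak_derivative (\<lambda>r. u r + f r) (\<lambda>r. v r + g r) 1 {0<..}"
proof -
  have l: "locint u" "locint v" "locint f" "locint g"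
    using u f unfolding has_weak_derivative_half_line by auto
  show ?thesis
    unfolding has_weak_derivative_half_line
  proof (intro conjI locint_add l allI impI)
    fix \<xi> \<xi>' :: "real \<Rightarrow> real"
    assume t: "test_fun \<xi>" "test_fun \<xi>'" and d: "\<forall>x. (\<xi> has_real_derivative \<xi>' x) (at x)"
    have "(LBINT x:{0<..}. \<xi>' x *\<^sub>R (u x + f x)) = (LBINT x:{0<..}. \<xi>' x *\<^sub>R u x) + (LBINT x:{0<..}. \<xi>' x *\<^sub>R f x)"
      unfolding scaleR_add_right by (rule set_integral_add(2)[OF test_fun_integrable[OF t(2) l(1)] test_fun_integrable[OF t(2) l(3)]])
    also have "\<dots> = - ((LBINT x:{0<..}. \<xi> x *\<^sub>R v x) + (LBINT x:{0<..}. \<xi> x *\<^sub>R g x))"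
      using weak_derivative_test[OF u t] weak_derivative_test[OF f t] d by simp
    also have "(LBINT x:{0<..}. \<xi> x *\<^sub>R v x) + (LBINT x:{0<..}. \<xi> x *\<^sub>R g x) = (LBINT x:{0<..}. \<xi> x *\<^sub>R (v x + g x))"
      unfolding scaleR_add_right by (rule set_integral_add(2)[symmetric, OF test_fun_integrable[OF t(1) l(2)] test_fun_integrable[OF t(1) l(4)]])
    finally show "(LBINT x:{0<..}. \<xi>' x *\<^sub>R (u x + f x)) = - (LBINT x:{0<..}. \<xi> x *\<^sub>R (v x + g x))" .
  qed
qed

lemma
  assumes "has_weak_derivative u v 1 {0<..}"
  shows d_r_AE: "AE r in lborel. 0 < r \<longrightarrow> d_r u r = v r" and locint_d_r: "locint (d_r u)" and locint_weak: "locint u"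
proof -
  have d: "has_weak_derivative u (d_r u) 1 {0<..}" unfolding d_r_def by (rule someI[of "\<lambda>v. has_weak_derivative u v 1 {0<..}", OF assms])
  show "AE r in lborel. 0 < r \<longrightarrow> d_r u r = v r" by (rule has_weak_derivative_unique[OF d assms])
  show "locint (d_r u)" "locint u" using d unfolding has_weak_derivative_half_line by auto
qed

lemma weak_derivative_Q: "has_weak_derivative (Q m) (\<lambda>r. of_real (kq m r / r * q m r)) 1 {0<..}"
proof -
  have eq: "Q m = (\<lambda>r. of_real (q m r))" by (rule ext) (rule Q_eq_q)
  show ?thesis unfolding eq by (rule has_weak_derivative_ac[OF adml_ac[OF adml_q]]) auto
qed

text \<open>Near the origin the logarithmic weight is integrated by Hardy's inequality, through
  \<open>admlI\<close>. Beyond \<open>1\<close> the logarithm vanishes and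
  \<open>1/r \<le> r\<close> lets the mass take over.\<close>

lemma H1m_adm:
  assumes "\<epsilon> \<in> H1m m"
  obtains e v where "adm m e v" "AE r in lborel. 0 < r \<longrightarrow> \<epsilon> r = e r" "has_weak_derivative \<epsilon> v 1 {0<..}"
proof -
  obtain e v where ev: "ac e v" "e \<in> bm" "v \<in> bm"
    and eq: "AE r in lborel. 0 < r \<longrightarrow> \<epsilon> r = e r" and w: "has_weak_derivative \<epsilon> v 1 {0<..}"
    and i: "si {0<..} (\<lambda>r. nsq (v r) * r)"
    "si {0<..} (\<lambda>r. nsq (e r) * r)"
    "si {0<..} (\<lambda>r. (real m)^2 * nsq (e r) / r)"
    by (rule H1m_radial[OF assms])
  note [measurable] = ev(2,3)
  have m: "si {0<..<1} (\<lambda>r. (real m)^2 / r * nsq (e r))"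
    using set_integrable_subset[OF i(3), of "{0<..<1}"] by (simp add: subset_iff)
  have a: "adml m e v"
    by (rule admlI[OF ev _ m]) (rule set_integrable_subset[OF i(1)], auto)
  have "si {1..} (\<lambda>r. wt m r * nsq (e r))"
  proof (rule si_bound)
    show "si {1..} (\<lambda>r. (real m)^2 * nsq (e r) / r + nsq (e r) * r)"
      by (rule set_integrable_subset[OF set_integral_add(1)[OF i(3,2)]]) auto
    fix r :: real assume "r \<in> {1..}"
    then have r: "1 \<le> r" by simp
    then have "log_minus r = 0" unfolding log_minus_def by simp
    moreover have "1 / r \<le> r" using r by (simp add: divide_le_eq mult_ge1_I)
    ultimately have "wt m r \<le> (real m)^2 / r + r" unfolding wt_def by simp
    then have "wt m r * nsq (e r) \<le> ((real m)^2 / r + r) * nsq (e r)" by (rule mult_right_mono) simp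
    then show "\<bar>wt m r * nsq (e r)\<bar> \<le> (real m)^2 * nsq (e r) / r + nsq (e r) * r"
      using wt_nonneg[of r m] r by (simp add: algebra_simps)
  qed auto
  then have "si ({0<..<1} \<union> {1..}) (\<lambda>r. wt m r * nsq (e r))"
    by (intro set_integrable_Un adml_si(2)[OF a]) auto
  moreover have "{0<..<1} \<union> {1..} = {0::real<..}" by auto
  ultimately have "adm m e v" unfolding adm_def using a i by simp
  then show thesis using eq w by (rule that)
qed

text \<open>The bridge between the statement and the analysis: here every quantity of the theorem is
  rewritten for the representative \<open>e\<close> and its derivative \<open>v\<close>.\<close>

locale H1m_pair =
  fixes m \<epsilon> e v
  assumes adm: "adm m e v" and eps: "AE r in lborel. 0 < r \<longrightarrow> \<epsilon> r = e r"
    and weak: "has_weak_derivative \<epsilon> v 1 {0<..}"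
begin

lemma measurables [measurable]: "e \<in> bm" "v \<in> bm"
  by (rule adml_measurable[OF adm_adml[OF adm]])+

lemma L2_norm_eps: "(L2_norm \<epsilon>)^2 = 2 * pi * mass e"
proof -
  have "(LBINT r:{0<..}. nsq (\<epsilon> r) * r) = mass e"
    unfolding mass_def
    by (rule li_cong_AE[OF locint_weak[OF weak] locint_weak[OF weak] measurables(1) measurables(1) eps eps, where h = "\<lambda>r z w. nsq z * r"]) auto
  then show ?thesis unfolding L2_norm_def rint_def using mass_nonneg[of e] by simp
qed

lemma L2_norm_d_r: "(L2_norm (d_r \<epsilon>))^2 = 2 * pi * (LBINT r:{0<..}. nsq (v r) * r)"
proof -
  have "(LBINT r:{0<..}. nsq (d_r \<epsilon> r) * r) = (LBINT r:{0<..}. nsq (v r) * r)"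
    by (rule li_cong_AE[OF locint_d_r[OF weak] locint_d_r[OF weak] measurables(2) measurables(2) d_r_AE[OF weak] d_r_AE[OF weak], where h = "\<lambda>r z w. nsq z * r"]) auto
  then show ?thesis unfolding L2_norm_def rint_def using vtot_nonneg[of v] by simp
qed

lemma L2_norm_weighted:
  assumes [measurable]: "w \<in> bm" and W: "\<And>r. 0 < r \<Longrightarrow> W r = 1 / ((w r)^2 * r)"
  shows "(L2_norm (\<lambda>r. \<epsilon> r / of_real (w r * r)))^2 = 2 * pi * (LBINT r:{0<..}. W r * nsq (e r))"
proof -
  have "(LBINT r:{0<..}. nsq (\<epsilon> r / of_real (w r * r)) * r) = (LBINT r:{0<..}. nsq (e r / of_real (w r * r)) * r)"
    by (rule li_cong_AE[OF locint_weak[OF weak] locint_weak[OF weak] measurables(1) measurables(1) eps eps, where h = "\<lambda>r z u. nsq (z / of_real (w r * r)) * r"]) auto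
  also have "\<dots> = (LBINT r:{0<..}. W r * nsq (e r))"
    by (rule set_lebesgue_integral_cong)
      (auto simp: W norm_divide norm_mult power_divide power_mult_distrib power2_eq_square[of "_ :: real"] field_simps)
  finally show ?thesis
    unfolding L2_norm_def rint_def
    using li_nonneg[of "{0<..}" "\<lambda>r. nsq (\<epsilon> r / of_real (w r * r)) * r"] by simp
qed

text \<open>For \<open>m = 0\<close> the norm is a sum of two terms, whose square lies between the
  sum of the squares and twice that sum. For \<open>m > 0\<close> the weight lies between
  \<open>m^2 / r\<close> and \<open>2 m^2 / r\<close>. The factor \<open>2 * pi\<close> of the
  planar measure turns these factors of two into \<open>pi\<close> and
  \<open>4 * pi\<close>.\<close>

lemma calHdot1m_norm_tot:
  "pi * tot m e v \<le> (calHdot1m_norm m \<epsilon>)^2" "(calHdot1m_norm m \<epsilon>)^2 \<le> 4 * pi * tot m e v"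
proof -
  define V where "V = (LBINT r:{0<..}. nsq (v r) * r)"
  define W where "W = (LBINT r:{0<..}. wt m r * nsq (e r))"
  have VW: "0 \<le> V" "0 \<le> W" "tot m e v = V + W" unfolding V_def W_def tot_def by (rule vtot_nonneg, rule etot_nonneg, rule refl)
  have "pi * tot m e v \<le> (calHdot1m_norm m \<epsilon>)^2 \<and> (calHdot1m_norm m \<epsilon>)^2 \<le> 4 * pi * tot m e v"
  proof (cases "m = 0")
    case True
    define x where "x = L2_norm (d_r \<epsilon>)"
    define y where "y = L2_norm (\<lambda>r. \<epsilon> r / of_real (jbracket (log_minus r) * r))"
    have x: "0 \<le> x" "x^2 = 2 * pi * V"
      unfolding x_def V_def L2_norm_d_r by (auto simp: L2_norm_def rint_def intro!: mult_nonneg_nonneg li_nonneg)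
    have [measurable]: "(\<lambda>r. jbracket (log_minus r)) \<in> bm"
      unfolding jbracket_def log_minus_def by measurable
    have "wt m r = 1 / ((jbracket (log_minus r))^2 * r)" for r
      unfolding wt_def jbracket_def True by (simp add: real_sqrt_pow2 mult.commute)
    then have y: "y^2 = 2 * pi * W"
      unfolding y_def W_def by (intro L2_norm_weighted) auto
    have y0: "0 \<le> y"
      unfolding y_def by (auto simp: L2_norm_def rint_def intro!: mult_nonneg_nonneg li_nonneg)
    have "(calHdot1m_norm m \<epsilon>)^2 = x^2 + y^2 + 2 * (x * y)"
      unfolding calHdot1m_norm_def x_def y_def using True by (simp add: power2_eq_square algebra_simps)
    moreover have "2 * (x * y) \<le> x^2 + y^2" using sum_squares_bound[of x y] by simp
    moreover have "0 \<le> x * y" using x y0 by simp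
    ultimately show ?thesis using x y VW by (simp add: distrib_left)
  next
    case False
    define y where "y = (L2_norm (\<lambda>r. \<epsilon> r / of_real r))^2"
    define Y where "Y = (LBINT r:{0<..}. 1 / r * nsq (e r))"
    have y: "y = 2 * pi * Y"
      using L2_norm_weighted[of "\<lambda>_. 1" "\<lambda>r. 1 / r"] unfolding y_def Y_def by simp
    have m1: "1 \<le> (real m)^2" using False by (simp add: one_le_power)
    have Yi: "si {0<..} (\<lambda>r. 1 / r * nsq (e r))"
    proof (rule si_bound[OF adm_si(2)[OF adm]])
      fix r :: real assume r: "r \<in> {0<..}"
      have "1 / r \<le> (real m)^2 / r" using m1 r by (intro divide_right_mono) auto
      also have "\<dots> \<le> wt m r" using r by (intro wt_ge_m) auto
      finally show "\<bar>1 / r * nsq (e r)\<bar> \<le> wt m r * nsq (e r)"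
        using mult_right_mono[of "1 / r" "wt m r" "nsq (e r)"] r by simp
    qed auto
    have "(real m)^2 * Y \<le> W"
      unfolding W_def Y_def set_integral_mult_right[symmetric]
    proof (rule set_integral_mono[OF set_integrable_mult_right[OF Yi] adm_si(2)[OF adm]])
      fix r :: real assume r: "r \<in> {0<..}"
      have "(real m)^2 / r * nsq (e r) \<le> wt m r * nsq (e r)" using r by (intro mult_right_mono wt_ge_m) auto
      then show "(real m)^2 * (1 / r * nsq (e r)) \<le> wt m r * nsq (e r)" by simp
    qed
    moreover have "W \<le> 2 * (real m)^2 * Y"
      unfolding W_def Y_def set_integral_mult_right[symmetric]
    proof (rule set_integral_mono[OF adm_si(2)[OF adm] set_integrable_mult_right[OF Yi]])
      fix r :: real assume r: "r \<in> {0<..}"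
      have "wt m r \<le> ((real m)^2 + 1) / r" using r by (intro wt_le) auto
      also have "\<dots> \<le> 2 * (real m)^2 / r" using m1 r by (intro divide_right_mono) auto
      finally have "wt m r * nsq (e r) \<le> 2 * (real m)^2 / r * nsq (e r)" by (rule mult_right_mono) simp
      then show "wt m r * nsq (e r) \<le> 2 * (real m)^2 * (1 / r * nsq (e r))" by simp
    qed
    ultimately have mY: "pi * ((real m)^2 * Y) \<le> pi * W" "pi * W \<le> pi * (2 * (real m)^2 * Y)"
      by (auto intro!: mult_left_mono)
    have "(calHdot1m_norm m \<epsilon>)^2 = 2 * pi * V + (real m)^2 * y"
      unfolding calHdot1m_norm_def Hdot1m_norm_def y_def L2_norm_d_r V_def[symmetric] using False VW(1) by simp
    moreover define X where "X = pi * ((real m)^2 * Y)"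
    moreover have "(real m)^2 * y = 2 * X" "pi * (2 * (real m)^2 * Y) = 2 * X" unfolding y X_def by simp_all
    moreover have "0 \<le> pi * V" "0 \<le> pi * W" using VW by simp_all
    ultimately show ?thesis using mY unfolding VW(3) distrib_left mult.assoc by linarith
  qed
  then show "pi * tot m e v \<le> (calHdot1m_norm m \<epsilon>)^2" "(calHdot1m_norm m \<epsilon>)^2 \<le> 4 * pi * tot m e v" by auto
qed

lemma A_theta_eps: "A_theta (\<lambda>r. Q m r + \<epsilon> r) = A_theta (uf m e)"
proof (rule ext)
  fix R
  have "(LBINT r:{0<..<R}. nsq (Q m r + \<epsilon> r) * r) = (LBINT r:{0<..<R}. nsq (uf m e r) * r)"
    unfolding Q_eq_q uf_def
    by (rule li_cong_AE[OF locint_weak[OF weak] locint_weak[OF weak] measurables(1) measurables(1) eps eps, where h = "\<lambda>r z w. nsq (of_real (q m r) + z) * r"]) auto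
  then show "A_theta (\<lambda>r. Q m r + \<epsilon> r) R = A_theta (uf m e) R" unfolding A_theta_def by simp
qed

lemma energy_eps: "energy m (\<lambda>r. Q m r + \<epsilon> r) = pi * defect m e v"
proof -
  let ?u = "\<lambda>r. Q m r + \<epsilon> r"
  note w = has_weak_derivative_add_half_line[OF weak_derivative_Q[of m] weak, folded duf_def]
  note [measurable] = adml_measurable[OF adml_uf[OF adm_adml[OF adm]]]
  have [measurable]: "A_theta (uf m e) \<in> bm" unfolding A_theta_def[abs_def] by measurable
  have u: "AE r in lborel. 0 < r \<longrightarrow> ?u r = uf m e r" using eps by eventually_elim (simp add: uf_def Q_eq_q)
  have "(LBINT r:{0<..}. (1/2 * nsq (d_r ?u r)
      + 1/2 * ((real m + A_theta (uf m e) r) / r)^2 * nsq (?u r) - 1/4 * cmod (?u r) ^ 4) * r) =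
    (LBINT r:{0<..}. (1/2 * nsq (duf m v r)
      + 1/2 * ((real m + A_theta (uf m e) r) / r)^2 * nsq (uf m e r) - 1/4 * cmod (uf m e r) ^ 4) * r)"
    by (rule li_cong_AE[OF locint_d_r[OF w] locint_weak[OF w] _ _ d_r_AE[OF w] u, where h = "\<lambda>r z1 z2. (1/2 * nsq z1
      + 1/2 * ((real m + A_theta (uf m e) r) / r)^2 * nsq z2 - 1/4 * cmod z2 ^ 4) * r"]) auto
  then show ?thesis unfolding energy_def rint_def A_theta_eps bogomolny[OF adm] by simp
qed

lemma inner_r_eps:
  assumes [measurable]: "Zt \<in> bm" and Z: "\<And>r. 0 < r \<Longrightarrow> Z r = Zt r"
  shows "inner_r \<epsilon> Z = 2 * pi * ip e Zt"
proof -
  have "(LBINT r:{0<..}. Re (cnj (\<epsilon> r) * Z r) * r) = (LBINT r:{0<..}. Re (cnj (\<epsilon> r) * Zt r) * r)"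
    by (rule set_lebesgue_integral_cong) (auto simp: Z)
  also have "\<dots> = ip e Zt"
    unfolding ip_def
    by (rule li_cong_AE[OF locint_weak[OF weak] locint_weak[OF weak] measurables(1) measurables(1) eps eps, where h = "\<lambda>r z w. Re (cnj z * Zt r) * r"]) auto
  finally show ?thesis unfolding inner_r_def rint_def by simp
qed

end

lemma inner_r_Lambda_Q:
  assumes [measurable]: "Zt \<in> bm" and Z: "\<And>r. 0 < r \<Longrightarrow> Z r = Zt r"
  shows "inner_r (Lambda (Q m)) Z = 2 * pi * ip (\<lambda>r. of_real (lq m r)) Zt"
proof -
  note w = weak_derivative_Q[of m]
  have "(LBINT r:{0<..}. Re (cnj (Lambda (Q m) r) * Z r) * r) = (LBINT r:{0<..}. Re (cnj (of_real r * d_r (Q m) r + of_real (q m r)) * Zt r) * r)"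
    by (rule set_lebesgue_integral_cong) (auto simp: Z Lambda_def Q_eq_q)
  also have "\<dots> = (LBINT r:{0<..}. Re (cnj (of_real r * of_real (kq m r / r * q m r) + of_real (q m r)) * Zt r) * r)"
    by (rule li_cong_AE[OF locint_d_r[OF w] locint_d_r[OF w] _ _ d_r_AE[OF w] d_r_AE[OF w],
      where h = "\<lambda>r z w. Re (cnj (of_real r * z + of_real (q m r)) * Zt r) * r"]) auto
  also have "\<dots> = ip (\<lambda>r. of_real (lq m r)) Zt"
    unfolding ip_def
  proof (rule set_lebesgue_integral_cong)
    have "of_real r * of_real (kq m r / r * q m r) + of_real (q m r) = complex_of_real (lq m r)" if "0 < r" for r
      using that unfolding lq_def by (simp add: algebra_simps)
    then show "\<forall>r. r \<in> {0<..} \<longrightarrow> Re (cnj (of_real r * of_real (kq m r / r * q m r) + of_real (q m r)) * Zt r) * r = Re (cnj (of_real (lq m r)) * Zt r) * r"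
      by simp
  qed simp
  finally show ?thesis unfolding inner_r_def rint_def by simp
qed

lemma inner_r_iQ:
  assumes Z: "\<And>r. 0 < r \<Longrightarrow> Z r = Zt r"
  shows "inner_r (\<lambda>r. \<i> * Q m r) Z = 2 * pi * ip (\<lambda>r. \<i> * of_real (q m r)) Zt"
proof -
  have "(LBINT r:{0<..}. Re (cnj (\<i> * Q m r) * Z r) * r) = ip (\<lambda>r. \<i> * of_real (q m r)) Zt"
    unfolding ip_def by (rule set_lebesgue_integral_cong) (auto simp: Z Q_eq_q)
  then show ?thesis unfolding inner_r_def rint_def by simp
qed

text \<open>\<open>Zt\<close> is the restriction of the planar function to the real axis, where the
  phase is \<open>1\<close> at positive points. It replaces \<open>Z\<close>, about which nothing is
  known at nonpositive radii.\<close>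

lemma Cc_infinity_mE:
  assumes "Z \<in> Cc_infinity_m m"
  obtains Zt B R where "Zt \<in> bm" "\<forall>r>0. Z r = Zt r" "\<forall>r. cmod (Zt r) \<le> B" "\<forall>r\<ge>R. Zt r = 0"
proof -
  obtain F where F: "F \<in> Cc_infinity UNIV" "\<forall>z. z \<noteq> 0 \<longrightarrow> F z = equivariant m Z z"
    using assms unfolding Cc_infinity_m_def by blast
  let ?S = "closure {z. F z \<noteq> 0}"
  have "Ck 0 F" and S: "compact ?S" using F(1) unfolding Cc_infinity_def by blast+
  then have c: "continuous_on UNIV F" by simp
  have out: "F z = 0" if "z \<notin> ?S" for z using that closure_subset[of "{z. F z \<noteq> 0}"] by blast
  have "bounded (F ` ?S)"
    by (rule compact_imp_bounded[OF compact_continuous_image[OF continuous_on_subset[OF c] S]]) simp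
  then obtain B where B: "\<forall>z\<in>?S. cmod (F z) \<le> B" unfolding bounded_iff by blast
  obtain R where R: "\<forall>z\<in>?S. cmod z \<le> R" using compact_imp_bounded[OF S] unfolding bounded_iff by blast
  define Zt where "Zt r = F (of_real r)" for r
  show thesis
  proof (rule that)
    have "continuous_on UNIV Zt"
      unfolding Zt_def[abs_def] by (rule continuous_on_compose2[OF c]) (auto intro: continuous_intros)
    then show "Zt \<in> bm" by (rule borel_measurable_continuous_onI)
    show "\<forall>r>0. Z r = Zt r"
      using F(2) equivariant_of_real[of _ m Z] unfolding Zt_def by simp
    show "\<forall>r. cmod (Zt r) \<le> max B 0"
    proof
      fix r show "cmod (Zt r) \<le> max B 0"
        using B out[of "of_real r"] unfolding Zt_def by (cases "of_real r \<in> ?S") auto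
    qed
    show "\<forall>r\<ge>max R 0 + 1. Zt r = 0"
    proof (intro allI impI)
      fix r assume r: "max R 0 + 1 \<le> r"
      have "complex_of_real r \<notin> ?S"
      proof
        assume "complex_of_real r \<in> ?S"
        then have "cmod (of_real r) \<le> R" using R by blast
        then show False using r by simp
      qed
      then show "Zt r = 0" unfolding Zt_def by (rule out)
    qed
  qed
qed

theorem lemma4p4:
  fixes m :: nat and Z1 Z2 :: "real \<Rightarrow> complex"
  assumes "Z1 \<in> Cc_infinity_m m" and "Z2 \<in> Cc_infinity_m m"
    and "det (vector [vector [inner_r (Lambda (Q m)) Z1, inner_r (\<lambda>r. \<i> * Q m r) Z1],
                      vector [inner_r (Lambda (Q m)) Z2, inner_r (\<lambda>r. \<i> * Q m r) Z2]]
              :: real^2^2) \<noteq> 0"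
  shows "\<forall>M>0. \<exists>\<eta>>0. \<exists>c>0. \<exists>C>0. \<forall>\<epsilon> \<in> H1m m.
           L2_norm \<epsilon> \<le> M \<and> inner_r \<epsilon> Z1 = 0 \<and> inner_r \<epsilon> Z2 = 0 \<and> calHdot1m_norm m \<epsilon> \<le> \<eta> \<longrightarrow>
             c * (calHdot1m_norm m \<epsilon>)\<^sup>2 \<le> energy m (\<lambda>r. Q m r + \<epsilon> r) \<and>
             energy m (\<lambda>r. Q m r + \<epsilon> r) \<le> C * (calHdot1m_norm m \<epsilon>)\<^sup>2"
proof (intro allI impI)
  fix M :: real assume M: "0 < M"
  obtain Y1 B1 R1 where Y1: "Y1 \<in> bm" "\<forall>r>0. Z1 r = Y1 r" "\<forall>r. cmod (Y1 r) \<le> B1" "\<forall>r\<ge>R1. Y1 r = 0"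
    by (rule Cc_infinity_mE[OF assms(1)])
  obtain Y2 B2 R2 where Y2: "Y2 \<in> bm" "\<forall>r>0. Z2 r = Y2 r" "\<forall>r. cmod (Y2 r) \<le> B2" "\<forall>r\<ge>R2. Y2 r = 0"
    by (rule Cc_infinity_mE[OF assms(2)])
  have Z1: "Z1 r = Y1 r" and Z2: "Z2 r = Y2 r" if "0 < r" for r using Y1(2) Y2(2) that by auto
  have det: "ip (\<lambda>r. of_real (lq m r)) Y1 * ip (\<lambda>r. \<i> * of_real (q m r)) Y2 -
      ip (\<lambda>r. of_real (lq m r)) Y2 * ip (\<lambda>r. \<i> * of_real (q m r)) Y1 \<noteq> 0"
    using assms(3) inner_r_Lambda_Q[OF Y1(1) Z1, of m] inner_r_Lambda_Q[OF Y2(1) Z2, of m]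
      inner_r_iQ[of Z1 Y1 m, OF Z1] inner_r_iQ[of Z2 Y2 m, OF Z2] by (auto simp: det_2 algebra_simps)
  have B: "cmod (Y1 r) \<le> max B1 B2" "cmod (Y2 r) \<le> max B1 B2" for r
    using Y1(3) Y2(3) by (auto simp: max.coboundedI1 max.coboundedI2)
  have supp: "Y1 r = 0" "Y2 r = 0" if "max R1 R2 \<le> r" for r using Y1(4) Y2(4) that by auto
  \<comment> \<open>The square of the \<open>L^2\<close> norm is \<open>2 * pi * mass\<close>, so
    this is the mass bound that corresponds to \<open>M\<close>.\<close>
  have M0: "0 \<le> M^2 / (2 * pi)" by simp
  obtain \<eta> c C where pos: "0 < \<eta>" "0 < c" "0 < C"
    and main: "\<forall>e v. adm m e v \<longrightarrow> mass e \<le> M^2 / (2 * pi) \<longrightarrow> ip e Y1 = 0 \<longrightarrow> ip e Y2 = 0 \<longrightarrow> tot m e v \<le> \<eta> \<longrightarrow>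
      c * tot m e v \<le> defect m e v \<and> defect m e v \<le> C * tot m e v"
    using nonlinear_coercivity[OF Y1(1) Y2(1) B supp det M0] by blast
  show "\<exists>\<eta>>0. \<exists>c>0. \<exists>C>0. \<forall>\<epsilon> \<in> H1m m.
           L2_norm \<epsilon> \<le> M \<and> inner_r \<epsilon> Z1 = 0 \<and> inner_r \<epsilon> Z2 = 0 \<and> calHdot1m_norm m \<epsilon> \<le> \<eta> \<longrightarrow>
             c * (calHdot1m_norm m \<epsilon>)^2 \<le> energy m (\<lambda>r. Q m r + \<epsilon> r) \<and>
             energy m (\<lambda>r. Q m r + \<epsilon> r) \<le> C * (calHdot1m_norm m \<epsilon>)^2"
  \<comment> \<open>The witnesses translate between the two scales: \<open>pi * tot\<close> is at
    most the squared norm, which gives the square root and keeps \<open>C\<close> unchanged; the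
    squared norm is at most \<open>4 * pi * tot\<close>, which costs the factor \<open>4\<close> in
    \<open>c / 4\<close>. The \<open>pi\<close> in the energy cancels.\<close>
  proof (rule exI[of _ "sqrt (pi * \<eta>)"], rule conjI, use pos in simp, rule exI[of _ "c / 4"], rule conjI, use pos in simp,
      rule exI[of _ C], rule conjI, rule pos(3), intro ballI impI, elim conjE)
    fix \<epsilon> assume \<epsilon>: "\<epsilon> \<in> H1m m" and L: "L2_norm \<epsilon> \<le> M" and o: "inner_r \<epsilon> Z1 = 0" "inner_r \<epsilon> Z2 = 0"
      and small: "calHdot1m_norm m \<epsilon> \<le> sqrt (pi * \<eta>)"
    obtain e v where ev: "adm m e v" "AE r in lborel. 0 < r \<longrightarrow> \<epsilon> r = e r" "has_weak_derivative \<epsilon> v 1 {0<..}"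
      by (rule H1m_adm[OF \<epsilon>])
    interpret H1m_pair m \<epsilon> e v by (unfold_locales) (rule ev)+
    have "0 \<le> L2_norm \<epsilon>" unfolding L2_norm_def rint_def by (auto intro!: mult_nonneg_nonneg li_nonneg)
    then have "2 * pi * mass e \<le> M^2" unfolding L2_norm_eps[symmetric] using L by (intro power_mono)
    then have ma: "mass e \<le> M^2 / (2 * pi)" by (simp add: field_simps)
    have o': "ip e Y1 = 0" "ip e Y2 = 0" using o inner_r_eps[OF Y1(1) Z1] inner_r_eps[OF Y2(1) Z2] by simp_all
    define N where "N = (calHdot1m_norm m \<epsilon>)^2"
    note N = calHdot1m_norm_tot[folded N_def]
    have "0 \<le> calHdot1m_norm m \<epsilon>"
      unfolding calHdot1m_norm_def Hdot1m_norm_def L2_norm_def rint_def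
      by (auto intro!: mult_nonneg_nonneg li_nonneg add_nonneg_nonneg)
    then have "N \<le> (sqrt (pi * \<eta>))^2" unfolding N_def using small by (intro power_mono)
    then have "N \<le> pi * \<eta>" using pos(1) by simp
    then have "pi * tot m e v \<le> pi * \<eta>" using N(1) by linarith
    then have "tot m e v \<le> \<eta>" by (rule mult_left_le_imp_le) (rule pi_gt_zero)
    then have cd: "c * tot m e v \<le> defect m e v" "defect m e v \<le> C * tot m e v"
      using main ev(1) ma o' by blast+
    have "c / 4 * N \<le> c / 4 * (4 * pi * tot m e v)" using N(2) pos(2) by (intro mult_left_mono) auto
    also have "\<dots> = pi * (c * tot m e v)" by simp
    also have "\<dots> \<le> pi * defect m e v" by (intro mult_left_mono cd) simp
    finally have 1: "c / 4 * N \<le> energy m (\<lambda>r. Q m r + \<epsilon> r)" unfolding energy_eps .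
    have "pi * defect m e v \<le> pi * (C * tot m e v)" by (intro mult_left_mono cd) simp
    also have "\<dots> = C * (pi * tot m e v)" by simp
    also have "\<dots> \<le> C * N" using N(1) pos(3) by (intro mult_left_mono) auto
    finally have 2: "energy m (\<lambda>r. Q m r + \<epsilon> r) \<le> C * N" unfolding energy_eps .
    show "c / 4 * (calHdot1m_norm m \<epsilon>)^2 \<le> energy m (\<lambda>r. Q m r + \<epsilon> r) \<and>
      energy m (\<lambda>r. Q m r + \<epsilon> r) \<le> C * (calHdot1m_norm m \<epsilon>)^2"
      using 1 2 unfolding N_def by blast
  qed
qed

end
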